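(* Let $(A,\mathfrak m,k)$ be a noetherian local ring containing $k$. Let $K$ and $J$ be ideals of $A$ of height $\ell$ that are monomial with respect to a regular sequence $\underline{x}=x_1,\ldots,x_\ell$ of $A$ of length $\ell>1$. Then $$\operatorname{r}(A/KJ)\geq 2\operatorname{r}(A).$$ In particular, $A/KJ$ is not Gorenstein.
   Context: $k=A/\mathfrak m$ is the residue field, and "$A$ contains $k$" means that $A$ contains a field mapping isomorphically onto $A/\mathfrak m$. A proper ideal of $A$ is monomial with respect to $\underline{x}$ if it is generated by monomials $x_1^{i_1}\cdots x_\ell^{i_\ell}$ in $x_1,\dots,x_\ell$. For a local ring $B$ with residue field $k$ and depth $t$, $\operatorname{r}(B)=\dim_k\operatorname{Ext}^t_B(k,B)$ is the type of $B$. *)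

theory Defs
  imports "HOL-Algebra.Algebra" "HOL-Library.Extended_Nat"
begin

section \<open>Local rings, height, regular sequences, monomial ideals\<close>

definition local_ring :: "('a, 'b) ring_scheme \<Rightarrow> bool" where
  "local_ring R \<longleftrightarrow> cring R \<and> (\<exists>!m. maximalideal m R)"

definition max_ideal :: "('a, 'b) ring_scheme \<Rightarrow> 'a set" where
  "max_ideal R = (THE m. maximalideal m R)"

definition residue_field :: "('a, 'b) ring_scheme \<Rightarrow> 'a set ring" where
  "residue_field R = R Quot (max_ideal R)"

definition contains_residue_field :: "('a, 'b) ring_scheme \<Rightarrow> bool" where
  "contains_residue_field R \<longleftrightarrow>
     (\<exists>F. subfield F R \<and>
          (\<lambda>a. max_ideal R +>\<^bsub>R\<^esub> a) \<in> ring_iso (R\<lparr>carrier := F\<rparr>) (residue_field R))"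

definition prime_height :: "('a, 'b) ring_scheme \<Rightarrow> 'a set \<Rightarrow> enat" where
  "prime_height R P =
     (SUP n \<in> {n. \<exists>c. (\<forall>i\<le>n. primeideal (c i) R) \<and> (\<forall>i<n. c i \<subset> c (Suc i)) \<and> c n = P}. enat n)"

definition height :: "('a, 'b) ring_scheme \<Rightarrow> 'a set \<Rightarrow> enat" where
  "height R I = (INF P \<in> {P. primeideal P R \<and> I \<subseteq> P}. prime_height R P)"

definition regular_sequence :: "('a, 'b) ring_scheme \<Rightarrow> 'a list \<Rightarrow> bool" where
  "regular_sequence R xs \<longleftrightarrow>
     set xs \<subseteq> carrier R \<and> Idl\<^bsub>R\<^esub> (set xs) \<noteq> carrier R \<and>
     (\<forall>i<length xs. \<forall>a\<in>carrier R.
        xs ! i \<otimes>\<^bsub>R\<^esub> a \<in> Idl\<^bsub>R\<^esub> (set (take i xs)) \<longrightarrow> a \<in> Idl\<^bsub>R\<^esub> (set (take i xs)))"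

text \<open>Over a local ring the entries of a regular sequence automatically lie in the maximal
  ideal. Over a noetherian local ring the lengths are bounded, so the supremum is a maximum.\<close>

definition depth :: "('a, 'b) ring_scheme \<Rightarrow> nat" where
  "depth R = Sup {length xs | xs. regular_sequence R xs}"

definition monomial :: "('a, 'b) ring_scheme \<Rightarrow> 'a list \<Rightarrow> (nat \<Rightarrow> nat) \<Rightarrow> 'a" where
  "monomial R xs e = (\<Otimes>\<^bsub>R\<^esub>i\<in>{..<length xs}. (xs ! i) [^]\<^bsub>R\<^esub> e i)"

definition monomial_ideal :: "('a, 'b) ring_scheme \<Rightarrow> 'a list \<Rightarrow> 'a set \<Rightarrow> bool" where
  "monomial_ideal R xs I \<longleftrightarrow> I \<noteq> carrier R \<and> (\<exists>E. I = Idl\<^bsub>R\<^esub> (monomial R xs ` E))"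

section \<open>Modules\<close>

text \<open>The fields \<open>mult\<close> and \<open>one\<close> of a module record carry no meaning. Homomorphisms are
  extensional, so that equality of functions is equality of homomorphisms.\<close>

definition module_hom ::
    "('a, 'r) ring_scheme \<Rightarrow> ('a, 'b, 'm) module_scheme \<Rightarrow> ('a, 'c, 'n) module_scheme \<Rightarrow> ('b \<Rightarrow> 'c) set"
  where
  "module_hom R M N =
     {f \<in> carrier M \<rightarrow>\<^sub>E carrier N.
        (\<forall>x\<in>carrier M. \<forall>y\<in>carrier M. f (x \<oplus>\<^bsub>M\<^esub> y) = f x \<oplus>\<^bsub>N\<^esub> f y) \<and>
        (\<forall>r\<in>carrier R. \<forall>x\<in>carrier M. f (r \<odot>\<^bsub>M\<^esub> x) = r \<odot>\<^bsub>N\<^esub> f x)}"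

definition hom_module ::
    "('a, 'r) ring_scheme \<Rightarrow> ('a, 'b, 'm) module_scheme \<Rightarrow> ('a, 'c, 'n) module_scheme
      \<Rightarrow> ('a, 'b \<Rightarrow> 'c) module"
  where
  "hom_module R M N =
     \<lparr>carrier = module_hom R M N, monoid.mult = undefined, one = undefined,
      ring.zero = (\<lambda>x\<in>carrier M. \<zero>\<^bsub>N\<^esub>),
      ring.add = (\<lambda>f g. \<lambda>x\<in>carrier M. f x \<oplus>\<^bsub>N\<^esub> g x),
      smult = (\<lambda>r f. \<lambda>x\<in>carrier M. r \<odot>\<^bsub>N\<^esub> f x)\<rparr>"

definition quotient_module ::
    "('a, 'b, 'm) module_scheme \<Rightarrow> 'b set \<Rightarrow> ('a, 'b set) module" where
  "quotient_module M S =
     \<lparr>carrier = a_rcosets\<^bsub>M\<^esub> S, monoid.mult = undefined, one = undefined,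
      ring.zero = S, ring.add = set_add M,
      smult = (\<lambda>r C. \<Union>x\<in>C. S +>\<^bsub>M\<^esub> (r \<odot>\<^bsub>M\<^esub> x))\<rparr>"

definition self_module :: "('a, 'r) ring_scheme \<Rightarrow> ('a, 'a) module" where
  "self_module R =
     \<lparr>carrier = carrier R, monoid.mult = monoid.mult R, one = one R,
      ring.zero = ring.zero R, ring.add = ring.add R,
      smult = monoid.mult R\<rparr>"

definition residue_module :: "('a, 'r) ring_scheme \<Rightarrow> ('a, 'a set) module" where
  "residue_module R = quotient_module (self_module R) (max_ideal R)"

definition free_module :: "('a, 'r) ring_scheme \<Rightarrow> nat \<Rightarrow> ('a, nat \<Rightarrow> 'a) module" where
  "free_module R n =
     \<lparr>carrier = {..<n} \<rightarrow>\<^sub>E carrier R, monoid.mult = undefined, one = undefined,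
      ring.zero = (\<lambda>i\<in>{..<n}. \<zero>\<^bsub>R\<^esub>),
      ring.add = (\<lambda>v w. \<lambda>i\<in>{..<n}. v i \<oplus>\<^bsub>R\<^esub> w i),
      smult = (\<lambda>r v. \<lambda>i\<in>{..<n}. r \<otimes>\<^bsub>R\<^esub> v i)\<rparr>"

text \<open>Dimension of a vector space \<open>V\<close> over a field \<open>K\<close> (both as records).\<close>

definition is_basis :: "('k, 'r) ring_scheme \<Rightarrow> ('k, 'v, 'm) module_scheme \<Rightarrow> 'v set \<Rightarrow> bool" where
  "is_basis K V S \<longleftrightarrow>
     S \<subseteq> carrier V \<and>
     (\<forall>T c. finite T \<and> T \<subseteq> S \<and> c \<in> T \<rightarrow> carrier K \<and> (\<Oplus>\<^bsub>V\<^esub>v\<in>T. c v \<odot>\<^bsub>V\<^esub> v) = \<zero>\<^bsub>V\<^esub>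
        \<longrightarrow> (\<forall>v\<in>T. c v = \<zero>\<^bsub>K\<^esub>)) \<and>
     (\<forall>x\<in>carrier V. \<exists>T c. finite T \<and> T \<subseteq> S \<and> c \<in> T \<rightarrow> carrier K \<and>
        x = (\<Oplus>\<^bsub>V\<^esub>v\<in>T. c v \<odot>\<^bsub>V\<^esub> v))"

definition vdim :: "('k, 'r) ring_scheme \<Rightarrow> ('k, 'v, 'm) module_scheme \<Rightarrow> nat" where
  "vdim K V = card (SOME S. is_basis K V S)"

text \<open>An \<open>R\<close>-module killed by the maximal ideal, as a vector space over the residue field:
  a residue class acts through any of its representatives.\<close>

definition residue_space :: "('a, 'b, 'm) module_scheme \<Rightarrow> ('a set, 'b) module" where
  "residue_space M =
     \<lparr>carrier = carrier M, monoid.mult = monoid.mult M, one = one M,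
      ring.zero = ring.zero M, ring.add = ring.add M,
      smult = (\<lambda>C v. (SOME r. r \<in> C) \<odot>\<^bsub>M\<^esub> v)\<rparr>"

section \<open>Ext and the type of a local ring\<close>

text \<open>A resolution of \<open>M\<close> whose \<open>i\<close>-th term is the free module of rank \<open>n i\<close>, with
  differentials \<open>d i\<close> from term \<open>i + 1\<close> to term \<open>i\<close> and augmentation \<open>e\<close>. Such a resolution by free modules of finite rank exists for every
  finitely generated module over a noetherian ring.\<close>

definition free_resolution ::
    "('a, 'r) ring_scheme \<Rightarrow> ('a, 'b, 'm) module_scheme \<Rightarrow> (nat \<Rightarrow> nat)
      \<Rightarrow> (nat \<Rightarrow> (nat \<Rightarrow> 'a) \<Rightarrow> (nat \<Rightarrow> 'a)) \<Rightarrow> ((nat \<Rightarrow> 'a) \<Rightarrow> 'b) \<Rightarrow> bool"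
  where
  "free_resolution R M n d e \<longleftrightarrow>
     e \<in> module_hom R (free_module R (n 0)) M \<and>
     e ` carrier (free_module R (n 0)) = carrier M \<and>
     (\<forall>i. d i \<in> module_hom R (free_module R (n (Suc i))) (free_module R (n i))) \<and>
     d 0 ` carrier (free_module R (n 1))
       = {v \<in> carrier (free_module R (n 0)). e v = \<zero>\<^bsub>M\<^esub>} \<and>
     (\<forall>i. d (Suc i) ` carrier (free_module R (n (Suc (Suc i))))
       = {v \<in> carrier (free_module R (n (Suc i))). d i v = \<zero>\<^bsub>free_module R (n i)\<^esub>})"

text \<open>Cohomology in degree \<open>i\<close> of the complex obtained by applying \<open>Hom(-, N)\<close> to the
  resolution with its augmentation removed.\<close>

definition cocycles ::
    "('a, 'r) ring_scheme \<Rightarrow> ('a, 'c, 'm) module_scheme \<Rightarrow> (nat \<Rightarrow> nat)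
      \<Rightarrow> (nat \<Rightarrow> (nat \<Rightarrow> 'a) \<Rightarrow> (nat \<Rightarrow> 'a)) \<Rightarrow> nat \<Rightarrow> ((nat \<Rightarrow> 'a) \<Rightarrow> 'c) set"
  where
  "cocycles R N n d i =
     {f \<in> module_hom R (free_module R (n i)) N.
        \<forall>v\<in>carrier (free_module R (n (Suc i))). f (d i v) = \<zero>\<^bsub>N\<^esub>}"

fun coboundaries ::
    "('a, 'r) ring_scheme \<Rightarrow> ('a, 'c, 'm) module_scheme \<Rightarrow> (nat \<Rightarrow> nat)
      \<Rightarrow> (nat \<Rightarrow> (nat \<Rightarrow> 'a) \<Rightarrow> (nat \<Rightarrow> 'a)) \<Rightarrow> nat \<Rightarrow> ((nat \<Rightarrow> 'a) \<Rightarrow> 'c) set"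
  where
  "coboundaries R N n d 0 = {\<zero>\<^bsub>hom_module R (free_module R (n 0)) N\<^esub>}"
| "coboundaries R N n d (Suc i) =
     (\<lambda>g. \<lambda>v\<in>carrier (free_module R (n (Suc i))). g (d i v)) ` module_hom R (free_module R (n i)) N"

definition cohomology ::
    "('a, 'r) ring_scheme \<Rightarrow> ('a, 'c, 'm) module_scheme \<Rightarrow> (nat \<Rightarrow> nat)
      \<Rightarrow> (nat \<Rightarrow> (nat \<Rightarrow> 'a) \<Rightarrow> (nat \<Rightarrow> 'a)) \<Rightarrow> nat \<Rightarrow> ('a, ((nat \<Rightarrow> 'a) \<Rightarrow> 'c) set) module"
  where
  "cohomology R N n d i =
     quotient_module
       ((hom_module R (free_module R (n i)) N)\<lparr>carrier := cocycles R N n d i\<rparr>)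
       (coboundaries R N n d i)"

text \<open>Used only for finitely generated \<open>M\<close> over noetherian \<open>R\<close>; any two resolutions
  give isomorphic modules, and one of them is chosen.\<close>

definition Ext ::
    "('a, 'r) ring_scheme \<Rightarrow> nat \<Rightarrow> ('a, 'b, 'm) module_scheme \<Rightarrow> ('a, 'c, 'n) module_scheme
      \<Rightarrow> ('a, ((nat \<Rightarrow> 'a) \<Rightarrow> 'c) set) module"
  where
  "Ext R i M N =
     (let (n, d) = (SOME (n, d). \<exists>e. free_resolution R M n d e) in cohomology R N n d i)"

definition cm_type :: "('a, 'r) ring_scheme \<Rightarrow> nat" where
  "cm_type R =
     vdim (residue_field R) (residue_space (Ext R (depth R) (residue_module R) (self_module R)))"

section \<open>Gorenstein local rings\<close>

text \<open>The test modules have carriers in \<open>(nat \<Rightarrow> 'a) set\<close>. All finitely generated modules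
  and their submodules, in particular \<open>R\<close> and its ideals, occur there up to isomorphism, so by
  Baer's criterion this is injectivity with respect to all modules.\<close>

definition injective_module ::
    "('a, 'r) ring_scheme \<Rightarrow> ('a, 'c, 'm) module_scheme \<Rightarrow> bool" where
  "injective_module R I \<longleftrightarrow>
     module R I \<and>
     (\<forall>(M :: ('a, (nat \<Rightarrow> 'a) set) module) (N :: ('a, (nat \<Rightarrow> 'a) set) module) j f.
        module R M \<and> module R N \<and> j \<in> module_hom R M N \<and> inj_on j (carrier M) \<and>
        f \<in> module_hom R M I \<longrightarrow>
        (\<exists>g\<in>module_hom R N I. \<forall>x\<in>carrier M. g (j x) = f x))"

text \<open>\<open>0 \<rightarrow> M \<rightarrow> I 0 \<rightarrow> I 1 \<rightarrow> \<dots>\<close> exact, with augmentation \<open>h\<close> and differentials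
  \<open>\<delta> i : I i \<rightarrow> I (i + 1)\<close>.\<close>

definition injective_resolution ::
    "('a, 'r) ring_scheme \<Rightarrow> ('a, 'b, 'm) module_scheme \<Rightarrow> (nat \<Rightarrow> ('a, 'c) module)
      \<Rightarrow> (nat \<Rightarrow> 'c \<Rightarrow> 'c) \<Rightarrow> ('b \<Rightarrow> 'c) \<Rightarrow> bool"
  where
  "injective_resolution R M I \<delta> h \<longleftrightarrow>
     (\<forall>i. injective_module R (I i)) \<and>
     h \<in> module_hom R M (I 0) \<and> inj_on h (carrier M) \<and>
     (\<forall>i. \<delta> i \<in> module_hom R (I i) (I (Suc i))) \<and>
     h ` carrier M = {x \<in> carrier (I 0). \<delta> 0 x = \<zero>\<^bsub>I 1\<^esub>} \<and>
     (\<forall>i. \<delta> i ` carrier (I i) = {x \<in> carrier (I (Suc i)). \<delta> (Suc i) x = \<zero>\<^bsub>I (Suc (Suc i))\<^esub>})"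

text \<open>A noetherian local ring is Gorenstein if it has finite injective dimension as a module
  over itself. HOL cannot quantify over carrier types inside a definition, so the type \<open>'c\<close>
  carrying the resolution is a parameter: \<open>R\<close> is Gorenstein iff \<open>gorenstein TYPE('c) R\<close>
  for some \<open>'c\<close>, and it fails to be Gorenstein iff \<open>\<not> gorenstein TYPE('c) R\<close> for every \<open>'c\<close>.\<close>

definition gorenstein :: "'c itself \<Rightarrow> ('a, 'r) ring_scheme \<Rightarrow> bool" where
  "gorenstein T R \<longleftrightarrow>
     noetherian_ring R \<and> local_ring R \<and>
     (\<exists>(I :: nat \<Rightarrow> ('a, 'c) module) \<delta> h n.
        injective_resolution R (self_module R) I \<delta> h \<and> (\<forall>i>n. carrier (I i) = {\<zero>\<^bsub>I i\<^esub>}))"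

end

theory Submission
  imports Defs
begin

text \<open>Let \<open>E\<close> be the set of exponents of generators of \<open>KJ\<close>. By Krull's height theorem \<open>K\<close> and \<open>J\<close> contain powers of all
  \<open>x\<^sub>i\<close>, so only finitely many exponents lie outside the up-set of \<open>E\<close>, and since \<open>l > 1\<close> at least two of these, \<open>w\<close>
  and \<open>w'\<close>, are maximal. Extend \<open>x\<close> by \<open>y\<close> to a maximal regular sequence of \<open>A\<close>. By dimension shifting the type of
  \<open>A\<close> is the dimension of the socle of \<open>A/(x, y)\<close>, and \<open>y\<close> is also a maximal regular sequence on \<open>B = A/KJ\<close>, so the
  type of \<open>B\<close> is the dimension of the socle of \<open>B/yB\<close>. For monomial ideals in a regular sequence colons are computed on
  exponents, as for variables of a polynomial ring; hence multiplication by \<open>x\<^sup>w\<close> and by \<open>x\<^sup>w\<^sup>'\<close> embeds two independent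
  copies of the first socle into the second one.

  The inequality alone excludes a Gorenstein \<open>B\<close> only together with the theorem that finite self-injective dimension means
  type one. Instead, let \<open>C = (x)B\<close>, the annihilator of both \<open>x\<^sup>w\<close> and \<open>x\<^sup>w\<^sup>'\<close>. Monomial ideals of \<open>B\<close> have quotients filtered by copies
  of \<open>B/C\<close>, and \<open>B/C\<close> is isomorphic to the submodule \<open>x\<^sup>wB\<close>. With finite self-injective dimension, descending
  induction on the degree shows that \<open>Ext\<^sup>i(B/C, B)\<close> vanishes for \<open>i > 0\<close>. So the homomorphism \<open>(x\<^sup>w, x\<^sup>w\<^sup>') \<rightarrow> B\<close> that fixes \<open>x\<^sup>w\<close>
  and kills \<open>x\<^sup>w\<^sup>'\<close> would be multiplication by some \<open>r\<close>. Then \<open>1 - r\<close> and \<open>r\<close> both lie in \<open>C\<close>, which is absurd.\<close>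

section \<open>Monomials in a regular sequence\<close>

text \<open>The sequence \<open>y\<close> is regular only after \<open>x\<close>, while it has to be
  regular modulo monomials in \<open>x\<close>. Permuting the sequence is avoided: the quotient by a
  monomial ideal is built from copies of the quotient by (x), one for each exponent outside the
  up-set, so that an element regular modulo (x) is regular modulo the monomial ideal. Identifying
  these copies takes the colon formula, and carrying the colon formula to the next element takes the
  regularity just obtained, so both facts are proved in alternation. Dimensions of Ext and of socles
  are compared through the property of having \<open>p\<close> independent members, which is
  transported by linear maps out of free modules. Isomorphisms between Ext modules, and between
  vector spaces over different residue fields, never have to be formed; a lower bound over A becomes
  one over B by pushing coefficient vectors along the quotient map. The homomorphism used against
  the Gorenstein property is well defined because a relation between \<open>x^w\<close> and
  \<open>x^w'\<close> in B has both terms zero; here again the colon formula is the reason.\<close>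

context cring
begin

lemmas ring_norm = r_minus l_minus r_distr l_distr a_minus_def a_ac m_ac r_neg r_neg1 r_neg2 minus_add

lemma Idl_carr: "S \<subseteq> carrier R \<Longrightarrow> Idl S \<subseteq> carrier R"
  by (rule subsetI) (rule ideal.Icarr[OF genideal_ideal])

lemma Idl_mono: "S \<subseteq> T \<Longrightarrow> T \<subseteq> carrier R \<Longrightarrow> Idl S \<subseteq> Idl T"
  by (rule subset_Idl_subset)

lemma Idl_leI: "S \<subseteq> carrier R \<Longrightarrow> T \<subseteq> carrier R \<Longrightarrow> S \<subseteq> Idl T \<Longrightarrow> Idl S \<subseteq> Idl T"
  by (simp add: genideal_ideal genideal_minimal)

lemma Idl_ideal: "ideal I R \<Longrightarrow> Idl I = I"
  by (meson genideal_minimal genideal_self ideal.Icarr subset_antisym subset_iff)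

lemma Idl_memI: "S \<subseteq> carrier R \<Longrightarrow> x \<in> S \<Longrightarrow> x \<in> Idl S"
  using genideal_self by blast

lemma Idl_add: "S \<subseteq> carrier R \<Longrightarrow> x \<in> Idl S \<Longrightarrow> y \<in> Idl S \<Longrightarrow> x \<oplus> y \<in> Idl S"
  by (simp add: genideal_ideal additive_subgroup.a_closed ideal.axioms(1))

lemma Idl_minus: "S \<subseteq> carrier R \<Longrightarrow> x \<in> Idl S \<Longrightarrow> y \<in> Idl S \<Longrightarrow> x \<ominus> y \<in> Idl S"
  using Idl_add[of S x "\<ominus> y"] genideal_ideal[of S]
  by (simp add: a_minus_def additive_subgroup.a_inv_closed ideal.axioms(1))

lemma Idl_uminus: "S \<subseteq> carrier R \<Longrightarrow> x \<in> Idl S \<Longrightarrow> \<ominus> x \<in> Idl S"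
  by (simp add: additive_subgroup.a_inv_closed genideal_ideal ideal.axioms(1))

lemma Idl_lmult: "S \<subseteq> carrier R \<Longrightarrow> x \<in> Idl S \<Longrightarrow> r \<in> carrier R \<Longrightarrow> r \<otimes> x \<in> Idl S"
  by (simp add: genideal_ideal ideal.I_l_closed)

lemma Idl_zero: "S \<subseteq> carrier R \<Longrightarrow> \<zero> \<in> Idl S"
  by (simp add: additive_subgroup.zero_closed genideal_ideal ideal.axioms(1))

lemma Idl_Un_Idl: "S \<subseteq> carrier R \<Longrightarrow> T \<subseteq> carrier R \<Longrightarrow> Idl (Idl S \<union> T) = Idl (S \<union> T)"
proof -
  assume S: "S \<subseteq> carrier R" and T: "T \<subseteq> carrier R"
  have a: "Idl S \<subseteq> Idl (S \<union> T)" using S T by (simp add: Idl_mono)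
  show "Idl (Idl S \<union> T) = Idl (S \<union> T)"
  proof
    show "Idl (Idl S \<union> T) \<subseteq> Idl (S \<union> T)"
      using S T a Idl_carr genideal_self[of "S \<union> T"] by (intro Idl_leI) auto
    show "Idl (S \<union> T) \<subseteq> Idl (Idl S \<union> T)"
      using S T Idl_carr genideal_self[of S] by (intro Idl_mono) auto
  qed
qed

lemma Idl_insert_mem:
  assumes S: "S \<subseteq> carrier R" and y: "y \<in> carrier R"
  shows "x \<in> Idl (insert y S) \<longleftrightarrow> (\<exists>q\<in>Idl S. \<exists>r\<in>carrier R. x = q \<oplus> r \<otimes> y)"
proof -
  have "Idl (insert y S) = Idl (S \<union> {y})" by simp
  also have "\<dots> = Idl (Idl S \<union> {y})" using S y Idl_Un_Idl[of S "{y}"] by simp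
  also have "\<dots> = Idl ({y} \<union> Idl S)" by (simp add: Un_commute)
  also have "\<dots> = Idl (Idl {y} \<union> Idl S)" using S y Idl_Un_Idl[of "{y}" "Idl S"] Idl_carr by simp
  also have "\<dots> = Idl {y} <+> Idl S" using S y by (simp add: union_genideal genideal_ideal)
  also have "\<dots> = Idl S <+> Idl {y}" using S y Idl_carr by (intro set_add_comm) auto
  finally show ?thesis
    using y unfolding set_add_defs cgenideal_eq_genideal[OF y, symmetric] cgenideal_def by auto
qed

lemma Idl_empty: "Idl {} = {\<zero>}"
  using genideal_zero genideal_minimal[OF zeroideal, of "{}"] Idl_zero[of "{}"] by auto

text \<open>The parameter is a set of generators instead of an ideal, so that passing to a further
  quotient is a union of sets. The quotient may be zero; the condition is then vacuous, which serves
  as the base case of inductions.\<close>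

definition nzd :: "'a set \<Rightarrow> 'a \<Rightarrow> bool" where
  "nzd S y \<longleftrightarrow> (\<forall>a\<in>carrier R. y \<otimes> a \<in> Idl S \<longrightarrow> a \<in> Idl S)"

lemma nzd_pow:
  assumes "nzd S y" "y \<in> carrier R" "a \<in> carrier R" "y [^] (n::nat) \<otimes> a \<in> Idl S"
  shows "a \<in> Idl S"
  using assms(4)
proof (induction n)
  case (Suc n)
  have "y [^] Suc n \<otimes> a = y \<otimes> (y [^] n \<otimes> a)"
    using assms(2,3) m_assoc[of y "y [^] n" a] by (simp add: m_comm)
  then have "y [^] n \<otimes> a \<in> Idl S" using Suc.prems assms(1-3) unfolding nzd_def by simp
  then show ?case by (rule Suc.IH)
qed (use assms in auto)

lemma nth_carr [simp]: "set xs \<subseteq> carrier R \<Longrightarrow> i < length xs \<Longrightarrow> xs ! i \<in> carrier R"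
  using nth_mem by blast

lemma monomial_closed [simp]: "set xs \<subseteq> carrier R \<Longrightarrow> monomial R xs e \<in> carrier R"
  unfolding monomial_def by (intro finprod_closed) auto

lemma monomial_Nil [simp]: "monomial R [] e = \<one>"
  by (simp add: monomial_def)

lemma monomial_snoc:
  assumes "set xs \<subseteq> carrier R" "y \<in> carrier R"
  shows "monomial R (xs @ [y]) e = monomial R xs e \<otimes> y [^] e (length xs)"
proof -
  have "monomial R (xs @ [y]) e = y [^] e (length xs) \<otimes> (\<Otimes>i\<in>{..<length xs}. ((xs @ [y]) ! i) [^] e i)"
    unfolding monomial_def length_append_singleton lessThan_Suc using assms
    by (subst finprod_insert) (auto simp: nth_append)
  also have "(\<Otimes>i\<in>{..<length xs}. ((xs @ [y]) ! i) [^] e i) = monomial R xs e"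
    unfolding monomial_def using assms by (intro finprod_cong') (auto simp: nth_append)
  finally show ?thesis using assms by (simp add: m_comm)
qed

lemma monomial_cong: "set xs \<subseteq> carrier R \<Longrightarrow> (\<And>i. i < length xs \<Longrightarrow> e i = f i) \<Longrightarrow> monomial R xs e = monomial R xs f"
  unfolding monomial_def by (intro finprod_cong') auto

lemma monomial_add: "set xs \<subseteq> carrier R \<Longrightarrow> monomial R xs (\<lambda>i. e i + f i) = monomial R xs e \<otimes> monomial R xs f"
  unfolding monomial_def
proof -
  assume xs: "set xs \<subseteq> carrier R"
  have "(\<Otimes>i\<in>{..<length xs}. (xs ! i) [^] (e i + f i)) = (\<Otimes>i\<in>{..<length xs}. (xs ! i) [^] e i \<otimes> (xs ! i) [^] f i)"
    using xs by (intro finprod_cong') (auto simp: nat_pow_mult)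
  then show "(\<Otimes>i\<in>{..<length xs}. (xs ! i) [^] (e i + f i)) =
      (\<Otimes>i\<in>{..<length xs}. (xs ! i) [^] e i) \<otimes> (\<Otimes>i\<in>{..<length xs}. (xs ! i) [^] f i)"
    using xs by (simp add: finprod_multf)
qed

lemma monomial_le:
  assumes "set xs \<subseteq> carrier R" "\<And>i. i < length xs \<Longrightarrow> e i \<le> f i"
  shows "monomial R xs f = monomial R xs (\<lambda>i. f i - e i) \<otimes> monomial R xs e"
proof -
  have "monomial R xs f = monomial R xs (\<lambda>i. (f i - e i) + e i)"
    using assms by (intro monomial_cong) auto
  then show ?thesis using monomial_add[OF assms(1)] by simp
qed

lemma monomial_zero: "set xs \<subseteq> carrier R \<Longrightarrow> (\<And>i. i < length xs \<Longrightarrow> e i = 0) \<Longrightarrow> monomial R xs e = \<one>"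
  unfolding monomial_def by (intro finprod_one_eqI) auto

lemma monomial_single:
  assumes "set xs \<subseteq> carrier R" "i < length xs" "\<And>j. j < length xs \<Longrightarrow> j \<noteq> i \<Longrightarrow> e j = 0"
  shows "monomial R xs e = (xs ! i) [^] e i"
proof -
  have "monomial R xs e = (\<Otimes>j\<in>{..<length xs}. if i = j then (xs ! j) [^] e j else \<one>)"
    unfolding monomial_def using assms by (intro finprod_cong') auto
  also have "\<dots> = (xs ! i) [^] e i"
    using assms by (subst finprod_singleton) auto
  finally show ?thesis .
qed

end

section \<open>Exponents outside an up-set\<close>

definition below :: "nat \<Rightarrow> (nat \<Rightarrow> nat) set \<Rightarrow> (nat \<Rightarrow> nat) set" where
  "below l E = {v. (\<forall>i\<ge>l. v i = 0) \<and> \<not> (\<exists>e\<in>E. \<forall>i<l. e i \<le> v i)}"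

lemma finite_exponents: "finite {v :: nat \<Rightarrow> nat. (\<forall>i\<ge>l. v i = 0) \<and> (\<forall>i<l. v i < a i)}"
proof (rule finite_subset)
  show "{v :: nat \<Rightarrow> nat. (\<forall>i\<ge>l. v i = 0) \<and> (\<forall>i<l. v i < a i)}
     \<subseteq> {v. \<forall>i. (i \<in> {..<l} \<longrightarrow> v i \<in> {..<Max (insert 0 (a ` {..<l}))}) \<and> (i \<notin> {..<l} \<longrightarrow> v i = 0)}"
    by (auto intro: less_le_trans Max_ge)
  show "finite {v. \<forall>i. (i \<in> {..<l} \<longrightarrow> v i \<in> {..<Max (insert 0 (a ` {..<l}))}) \<and> (i \<notin> {..<l} \<longrightarrow> v i = (0::nat))}"
    by (rule finite_set_of_finite_funs) auto
qed

text \<open>A vector outside the up-set cannot dominate the pure exponent \<open>f i\<close>, hence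
  \<open>v i < f i i\<close>, and \<open>v\<close> lies in a box. The zero tail imposed by
  \<open>below\<close> is what makes this box a finite set of functions.\<close>

lemma finite_below:
  assumes "\<And>i. i < l \<Longrightarrow> \<exists>e\<in>E. \<forall>j<l. j \<noteq> i \<longrightarrow> e j = 0"
  shows "finite (below l E)"
proof -
  obtain f where f: "\<And>i. i < l \<Longrightarrow> f i \<in> E \<and> (\<forall>j<l. j \<noteq> i \<longrightarrow> f i j = 0)" using assms by metis
  have "below l E \<subseteq> {v. (\<forall>i\<ge>l. v i = 0) \<and> (\<forall>i<l. v i < f i i)}"
  proof (rule subsetI, rule CollectI, intro conjI allI impI)
    fix v i assume v: "v \<in> below l E" and i: "i < l"
    show "v i < f i i"
    proof (rule ccontr)
      assume "\<not> v i < f i i"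
      then have "\<forall>j<l. f i j \<le> v j" using f[OF i] by (metis le0 not_less)
      then have "\<exists>e\<in>E. \<forall>j<l. e j \<le> v j" using f[OF i] by (intro bexI[of _ "f i"]) auto
      moreover have "\<not> (\<exists>e\<in>E. \<forall>j<l. e j \<le> v j)" using v unfolding below_def mem_Collect_eq by (rule conjunct2)
      ultimately show False by contradiction
    qed
  qed (simp add: below_def)
  then show ?thesis by (rule finite_subset) (rule finite_exponents)
qed

text \<open>A maximal exponent \<open>w\<close> outside the up-set is adjoined to \<open>E\<close>,
  which removes just \<open>w\<close> from \<open>below\<close>. On quotients this kills a monomial
  that every variable already sends to zero, so a property of the ring modulo \<open>E\<close> has
  to be carried across one copy of the ring modulo the variables at a time.\<close>

lemma below_induct [consumes 1, case_names full step]: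
  assumes fin: "finite (below l E)"
    and full: "\<And>E. below l E = {} \<Longrightarrow> P E"
    and step: "\<And>E w. finite (below l E) \<Longrightarrow> w \<in> below l E \<Longrightarrow> (\<And>i. i < l \<Longrightarrow> w(i := Suc (w i)) \<notin> below l E)
       \<Longrightarrow> P (insert w E) \<Longrightarrow> P E"
  shows "P E"
  using fin
proof (induction "card (below l E)" arbitrary: E rule: less_induct)
  case less
  show ?case
  proof (cases "below l E = {}")
    case True then show ?thesis by (rule full)
  next
    case False
    let ?s = "\<lambda>v::nat \<Rightarrow> nat. \<Sum>i<l. v i"
    \<comment> \<open>A vector of largest degree is chosen: raising a coordinate raises the degree,
      so the result has left \<open>below\<close>.\<close>
    obtain w where w: "w \<in> below l E" and mx: "\<And>v. v \<in> below l E \<Longrightarrow> ?s v \<le> ?s w"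
    proof -
      have "Max (?s ` below l E) \<in> ?s ` below l E" using False less.prems by (intro Max_in) auto
      then obtain w where "w \<in> below l E" "?s w = Max (?s ` below l E)" by auto
      then show ?thesis using that less.prems by (metis Max_ge finite_imageI imageI)
    qed
    have sub: "below l (insert w E) \<subset> below l E"
      using w unfolding below_def by auto
    show ?thesis
    proof (rule step)
      fix i assume i: "i < l"
      have "?s (w(i := Suc (w i))) > ?s w"
        using i by (intro sum_strict_mono_ex1) auto
      then show "w(i := Suc (w i)) \<notin> below l E" using mx by fastforce
    next
      show "P (insert w E)"
        using sub less.prems by (intro less.hyps psubset_card_mono) (auto intro: finite_subset)
    qed (use w less.prems in auto)
  qed
qed

text \<open>The pure powers just beyond \<open>w\<close>. In the first \<open>l\<close> coordinates,
  the up-set that they generate consists of exactly the exponents that are not below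
  \<open>w\<close>.\<close>

definition pow_exps :: "nat \<Rightarrow> (nat \<Rightarrow> nat) \<Rightarrow> (nat \<Rightarrow> nat) set" where
  "pow_exps l w = (\<lambda>i j. if j = i then Suc (w i) else 0) ` {..<l}"

lemma pow_exps_less: "e \<in> pow_exps l w \<Longrightarrow> \<exists>i<l. w i < e i"
  by (auto simp: pow_exps_def)

lemma finite_below_pow: "finite (below l (pow_exps l w))"
  by (rule finite_below) (auto simp: pow_exps_def)

lemma finite_below_mono: "finite (below l E) \<Longrightarrow> E \<subseteq> F \<Longrightarrow> finite (below l F)"
  by (erule rev_finite_subset) (auto simp: below_def)

section \<open>Colons and nonzerodivisors modulo monomial ideals\<close>

context cring
begin

text \<open>Modulo \<open>S\<close>, the colon ideal of \<open>(x\<^sub>i\<^sup>w\<^sup>(\<^sup>i\<^sup>)\<^sup>+\<^sup>1)\<^sub>i\<close> at \<open>x\<^sup>w\<close> is \<open>(x)\<close>.\<close>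

definition col :: "'a set \<Rightarrow> 'a list \<Rightarrow> bool" where
  "col S xs \<longleftrightarrow> (\<forall>w. \<forall>a\<in>carrier R.
     monomial R xs w \<otimes> a \<in> Idl (S \<union> (\<lambda>i. (xs ! i) [^] Suc (w i)) ` {..<length xs}) \<longrightarrow> a \<in> Idl (S \<union> set xs))"

lemma mon_image_carr: "set xs \<subseteq> carrier R \<Longrightarrow> monomial R xs ` E \<subseteq> carrier R"
  by auto

text \<open>An exponent that exceeds \<open>w\<close> in coordinate \<open>i\<close> is a multiple
  of the power \<open>w i + 1\<close> of the variable \<open>i\<close>. So the ideal of pure powers
  in \<open>col\<close> contains every monomial ideal whose exponents are not below
  \<open>w\<close>, and the colon at \<open>x^w\<close> is controlled by that single case.\<close>

lemma col_ideal:
  assumes "col S xs" "S \<subseteq> carrier R" "set xs \<subseteq> carrier R" "a \<in> carrier R"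
    and w: "\<And>e. e \<in> E \<Longrightarrow> \<exists>i<length xs. w i < e i"
    and mem: "monomial R xs w \<otimes> a \<in> Idl (S \<union> monomial R xs ` E)"
  shows "a \<in> Idl (S \<union> set xs)"
proof -
  let ?T = "(\<lambda>i. (xs ! i) [^] Suc (w i)) ` {..<length xs}"
  have T: "?T \<subseteq> carrier R" using assms(3) by auto
  have "monomial R xs e \<in> Idl (S \<union> ?T)" if "e \<in> E" for e
  proof -
    obtain i where i: "i < length xs" "w i < e i" using w[OF \<open>e \<in> E\<close>] by blast
    have "monomial R xs e = monomial R xs (\<lambda>j. e j - (if j = i then Suc (w i) else 0)) \<otimes>
       monomial R xs (\<lambda>j. if j = i then Suc (w i) else 0)"
      using assms(3) i by (intro monomial_le) auto
    also have "monomial R xs (\<lambda>j. if j = i then Suc (w i) else 0) = (xs ! i) [^] Suc (w i)"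
      using assms(3) i by (subst monomial_single[of _ i]) auto
    finally have "monomial R xs e = monomial R xs (\<lambda>j. e j - (if j = i then Suc (w i) else 0)) \<otimes> (xs ! i) [^] Suc (w i)" .
    moreover have "(xs ! i) [^] Suc (w i) \<in> Idl (S \<union> ?T)"
      using i assms(2) T by (intro Idl_memI) auto
    ultimately show ?thesis using Idl_lmult[of "S \<union> ?T"] assms(2,3) T by auto
  qed
  then have "Idl (S \<union> monomial R xs ` E) \<subseteq> Idl (S \<union> ?T)"
    using assms(2,3) T by (intro Idl_leI) (auto intro: Idl_memI)
  then show ?thesis using assms(1,4) mem unfolding col_def by blast
qed

lemma mon_mem:
  assumes "set xs \<subseteq> carrier R" "S \<subseteq> carrier R" "e \<in> E" "\<And>i. i < length xs \<Longrightarrow> e i \<le> v i"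
  shows "monomial R xs v \<in> Idl (S \<union> monomial R xs ` E)"
proof -
  have "S \<union> monomial R xs ` E \<subseteq> carrier R" using assms by auto
  then have "monomial R xs (\<lambda>i. v i - e i) \<otimes> monomial R xs e \<in> Idl (S \<union> monomial R xs ` E)"
    using assms by (intro Idl_lmult Idl_memI) auto
  then show ?thesis using monomial_le[OF assms(1,4)] by simp
qed

lemma mon_ideal_full:
  assumes "set xs \<subseteq> carrier R" "S \<subseteq> carrier R" "below (length xs) E = {}"
  shows "Idl (S \<union> monomial R xs ` E) = carrier R"
proof -
  have "(\<lambda>i. 0) \<notin> below (length xs) E" using assms(3) by simp
  then obtain e where e: "e \<in> E" "\<forall>i<length xs. e i \<le> 0" unfolding below_def by auto
  have "\<one> \<in> Idl (S \<union> monomial R xs ` E)"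
    using mon_mem[OF assms(1,2) e(1), of "\<lambda>i. 0"] e(2) assms(1) by (auto simp: monomial_zero)
  then show ?thesis using assms by (intro ideal.one_imp_carrier genideal_ideal) auto
qed

text \<open>The inclusion opposite to \<open>col_ideal\<close>, for a maximal \<open>w\<close>:
  every product of \<open>x^w\<close> with a variable is a monomial of the ideal. Together the two
  identify the colon at \<open>x^w\<close> with the ideal of \<open>S\<close> and the
  variables.\<close>

lemma mon_times_var_mem:
  assumes xs: "set xs \<subseteq> carrier R" and S: "S \<subseteq> carrier R"
    and mx: "\<And>i. i < length xs \<Longrightarrow> w(i := Suc (w i)) \<notin> below (length xs) E"
    and w: "w \<in> below (length xs) E"
    and b: "b \<in> Idl (S \<union> set xs)"
  shows "monomial R xs w \<otimes> b \<in> Idl (S \<union> monomial R xs ` E)"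
proof -
  let ?T = "S \<union> monomial R xs ` E"
  have T: "?T \<subseteq> carrier R" using xs S by auto
  let ?I = "{b \<in> carrier R. monomial R xs w \<otimes> b \<in> Idl ?T}"
  have "ideal ?I R"
  proof (intro idealI ring_axioms)
    show "subgroup ?I (add_monoid R)"
      using xs T by unfold_locales
        (auto simp: r_distr Idl_add Idl_zero r_minus a_inv_def[symmetric]
          additive_subgroup.a_inv_closed genideal_ideal ideal.axioms(1))
    show "x \<otimes> a \<in> ?I" if "a \<in> ?I" "x \<in> carrier R" for a x
      using that xs T Idl_lmult[OF T, of "monomial R xs w \<otimes> a" x] by (auto simp: m_lcomm)
    show "a \<otimes> x \<in> ?I" if "a \<in> ?I" "x \<in> carrier R" for a x
      using that xs T Idl_lmult[OF T, of "monomial R xs w \<otimes> a" x] by (auto simp: m_ac)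
  qed
  moreover have "S \<union> set xs \<subseteq> ?I"
  proof
    fix s assume s: "s \<in> S \<union> set xs"
    show "s \<in> ?I"
    proof (cases "s \<in> S")
      case True
      then show ?thesis using S xs Idl_lmult[OF T Idl_memI[OF T], of s "monomial R xs w"] by auto
    next
      case False
      then obtain i where i: "i < length xs" "s = xs ! i" using s by (auto simp: in_set_conv_nth)
      let ?v = "w(i := Suc (w i))"
      have "\<forall>j\<ge>length xs. ?v j = 0" using w i unfolding below_def by auto
      then obtain e where e: "e \<in> E" "\<forall>j<length xs. e j \<le> ?v j"
        using mx[OF i(1)] unfolding below_def by auto
      have "monomial R xs ?v \<in> Idl ?T" using mon_mem[OF xs S e(1)] e(2) by blast
      moreover have "monomial R xs ?v = monomial R xs w \<otimes> xs ! i"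
      proof -
        have "monomial R xs ?v = monomial R xs (\<lambda>j. w j + (if j = i then 1 else 0))"
          using xs by (intro monomial_cong) auto
        also have "\<dots> = monomial R xs w \<otimes> xs ! i"
          using xs i monomial_single[OF xs i(1), of "\<lambda>j. if j = i then 1 else 0"]
          by (subst monomial_add) auto
        finally show ?thesis .
      qed
      ultimately show ?thesis using i xs by (auto simp: subset_iff)
    qed
  qed
  ultimately have "Idl (S \<union> set xs) \<subseteq> ?I" by (rule genideal_minimal)
  then show ?thesis using b by blast
qed

text \<open>Adjoining \<open>x^w\<close> to the ideal changes the quotient by a copy of the ring
  modulo \<open>S\<close> and the variables, by the two colon inclusions. As \<open>y\<close> is
  regular on each copy, it is regular on the module filtered by them.\<close>

lemma nzd_mon:
  assumes col: "col S xs" and S: "S \<subseteq> carrier R" and xs: "set xs \<subseteq> carrier R" and y: "y \<in> carrier R"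
    and nzd: "nzd (S \<union> set xs) y" and fin: "finite (below (length xs) E)"
  shows "nzd (S \<union> monomial R xs ` E) y"
  using fin
proof (induction rule: below_induct)
  case (full E)
  then show ?case unfolding nzd_def using mon_ideal_full xs S by auto
next
  case (step E w)
  let ?T = "S \<union> monomial R xs ` E" let ?x = "monomial R xs w"
  have T: "?T \<subseteq> carrier R" using xs S by auto
  have ins: "S \<union> monomial R xs ` insert w E = insert ?x ?T" by auto
  show ?case unfolding nzd_def
  proof (intro ballI impI)
    fix a assume a: "a \<in> carrier R" and ya: "y \<otimes> a \<in> Idl ?T"
    have "Idl ?T \<subseteq> Idl (insert ?x ?T)" using T xs by (intro Idl_mono) auto
    then have "a \<in> Idl (insert ?x ?T)" using step.IH a ya unfolding nzd_def ins by blast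
    then obtain q b where q: "q \<in> Idl ?T" and b: "b \<in> carrier R" and aq: "a = q \<oplus> b \<otimes> ?x"
      using Idl_insert_mem[OF T, of ?x] xs by auto
    have qc: "q \<in> carrier R" using q Idl_carr[OF T] by blast
    \<comment> \<open>By induction \<open>a\<close> is a multiple \<open>b\<close> of
      \<open>x^w\<close> modulo the ideal. Then \<open>y \<otimes> b\<close> lies in the colon at
      \<open>x^w\<close>, where \<open>y\<close> may be cancelled.\<close>
    have "?x \<otimes> (y \<otimes> b) = y \<otimes> a \<ominus> y \<otimes> q" unfolding aq using qc b y monomial_closed[OF xs, of w] by algebra
    then have "?x \<otimes> (y \<otimes> b) \<in> Idl ?T" using ya q Idl_lmult[OF T q y] Idl_minus[OF T] by simp
    then have "y \<otimes> b \<in> Idl (S \<union> set xs)"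
      by (intro col_ideal[OF col S xs, of _ E w]) (use step.hyps b y in \<open>auto simp: below_def not_le\<close>)
    then have "b \<in> Idl (S \<union> set xs)" using nzd b unfolding nzd_def by blast
    then have "?x \<otimes> b \<in> Idl ?T" using mon_times_var_mem[OF xs S step.hyps(3,2)] by blast
    then show "a \<in> Idl ?T" unfolding aq using Idl_add[OF T q] b xs by (simp add: m_comm)
  qed
qed

lemma pow_exps_mon:
  assumes "set xs \<subseteq> carrier R"
  shows "monomial R xs ` pow_exps (length xs) w = (\<lambda>i. (xs ! i) [^] Suc (w i)) ` {..<length xs}"
  unfolding pow_exps_def image_image using assms monomial_single[OF assms]
  by (intro image_cong) (auto simp: monomial_single)

text \<open>The colon formula modulo \<open>y\<close>, for one \<open>w\<close>. The coefficient
  \<open>b\<close> of \<open>y\<close> is a multiple of \<open>x^w\<close> modulo the pure powers;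
  this rests on regularity of \<open>y\<close> modulo the pure powers together with
  \<open>x^w\<close>, which \<open>nzd_mon\<close> derives from regularity modulo the
  variables.\<close>

lemma col_step:
  assumes col: "col S xs" and S: "S \<subseteq> carrier R" and xs: "set xs \<subseteq> carrier R" and y: "y \<in> carrier R"
    and nzd: "nzd (S \<union> set xs) y" and a: "a \<in> carrier R"
    and mem: "monomial R xs w \<otimes> a \<in> Idl (insert y (S \<union> monomial R xs ` pow_exps (length xs) w))"
  shows "a \<in> Idl (insert y (S \<union> set xs))"
proof -
  let ?E = "pow_exps (length xs) w" let ?T = "S \<union> monomial R xs ` ?E" let ?x = "monomial R xs w"
  have T: "?T \<subseteq> carrier R" using xs S by auto
  obtain q b where q: "q \<in> Idl ?T" and b: "b \<in> carrier R" and eq: "?x \<otimes> a = q \<oplus> b \<otimes> y"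
    using mem Idl_insert_mem[OF T y] by auto
  have qc: "q \<in> carrier R" using q Idl_carr[OF T] by blast
  have "y \<otimes> b = (?x \<otimes> a) \<ominus> q" unfolding eq using qc b y by algebra
  also have "\<dots> = \<ominus> q \<oplus> a \<otimes> ?x" using a qc monomial_closed[OF xs, of w] by algebra
  also have "\<dots> \<in> Idl (insert ?x ?T)"
    unfolding Idl_insert_mem[OF T monomial_closed[OF xs]] using Idl_uminus[OF T q] a by blast
  finally have "y \<otimes> b \<in> Idl (S \<union> monomial R xs ` insert w ?E)" by simp
  then have "b \<in> Idl (S \<union> monomial R xs ` insert w ?E)"
    using nzd_mon[OF col S xs y nzd finite_below_mono[OF finite_below_pow]] b
    unfolding nzd_def by blast
  then obtain p c where p: "p \<in> Idl ?T" and c: "c \<in> carrier R" and bp: "b = p \<oplus> c \<otimes> ?x"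
    using Idl_insert_mem[OF T monomial_closed[OF xs]] by auto
  have pc: "p \<in> carrier R" using p Idl_carr[OF T] by blast
  \<comment> \<open>Subtracting the multiple \<open>c \<otimes> y\<close> from \<open>a\<close>
    brings the product with \<open>x^w\<close> back into the ideal without \<open>y\<close>, where
    the old colon formula applies.\<close>
  have "?x \<otimes> (a \<ominus> c \<otimes> y) = ?x \<otimes> a \<ominus> ?x \<otimes> (c \<otimes> y)" using a c y monomial_closed[OF xs, of w] by algebra
  also have "\<dots> = q \<oplus> y \<otimes> p" unfolding eq bp using qc pc c y monomial_closed[OF xs, of w] by algebra
  also have "\<dots> \<in> Idl ?T" using Idl_add[OF T q Idl_lmult[OF T p y]] .
  finally have "a \<ominus> c \<otimes> y \<in> Idl (S \<union> set xs)"
    using col_ideal[OF col S xs _ pow_exps_less, where a = "a \<ominus> c \<otimes> y" and w = w] a c y by simp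
  moreover have "a = (a \<ominus> c \<otimes> y) \<oplus> c \<otimes> y" using a c y by algebra
  ultimately show ?thesis using Idl_insert_mem[of "S \<union> set xs" y] S xs y c by auto
qed

lemma col_insert:
  assumes "col S xs" "S \<subseteq> carrier R" "set xs \<subseteq> carrier R" "y \<in> carrier R" "nzd (S \<union> set xs) y"
  shows "col (insert y S) xs"
  unfolding col_def using col_step[OF assms] assms(3) by (simp add: pow_exps_mon)

text \<open>With \<open>y\<close> as a new last variable the hypothesis reads
  \<open>x^w y^n a = q + b y^(n+1)\<close>. Since \<open>y\<close> is regular modulo the pure powers
  of the old variables, \<open>y^n\<close> cancels, and what remains is the situation of
  \<open>col_step\<close>.\<close>

lemma col_snoc:
  assumes col: "col S xs" and S: "S \<subseteq> carrier R" and xs: "set xs \<subseteq> carrier R" and y: "y \<in> carrier R"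
    and nzd: "nzd (S \<union> set xs) y"
  shows "col S (xs @ [y])"
  unfolding col_def
proof (intro allI ballI impI)
  fix w a assume a: "a \<in> carrier R"
    and mem: "monomial R (xs @ [y]) w \<otimes> a \<in> Idl (S \<union> (\<lambda>i. ((xs @ [y]) ! i) [^] Suc (w i)) ` {..<length (xs @ [y])})"
  let ?n = "w (length xs)" let ?T = "S \<union> monomial R xs ` pow_exps (length xs) w" let ?x = "monomial R xs w"
  have T: "?T \<subseteq> carrier R" using xs S by auto
  have "(\<lambda>i. ((xs @ [y]) ! i) [^] Suc (w i)) ` {..<length (xs @ [y])} =
     insert (y [^] Suc ?n) ((\<lambda>i. (xs ! i) [^] Suc (w i)) ` {..<length xs})"
    unfolding length_append_singleton lessThan_Suc image_insert
    by (intro arg_cong2[of _ _ _ _ insert] image_cong) (auto simp: nth_append)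
  then have "monomial R (xs @ [y]) w \<otimes> a \<in> Idl (insert (y [^] Suc ?n) ?T)"
    using mem xs by (simp add: pow_exps_mon)
  then obtain q b where q: "q \<in> Idl ?T" and b: "b \<in> carrier R"
    and eq: "?x \<otimes> y [^] ?n \<otimes> a = q \<oplus> b \<otimes> (y [^] ?n \<otimes> y)"
    using Idl_insert_mem[OF T, of "y [^] Suc ?n"] y xs by (auto simp: monomial_snoc)
  have qc: "q \<in> carrier R" using q Idl_carr[OF T] by blast
  define z where "z = y [^] ?n"
  have z: "z \<in> carrier R" unfolding z_def using y by simp
  have eq': "z \<otimes> (?x \<otimes> a \<ominus> b \<otimes> y) = q"
  proof -
    have "z \<otimes> (?x \<otimes> a \<ominus> b \<otimes> y) = ?x \<otimes> z \<otimes> a \<ominus> b \<otimes> (z \<otimes> y)" using a b y z monomial_closed[OF xs, of w] by algebra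
    also have "\<dots> = q" unfolding eq[folded z_def] using qc b z y by algebra
    finally show ?thesis .
  qed
  have "?x \<otimes> a \<ominus> b \<otimes> y \<in> Idl ?T"
    by (rule nzd_pow[OF nzd_mon[OF col S xs y nzd finite_below_pow] y _ eq'[unfolded z_def, THEN ssubst, of "\<lambda>u. u \<in> Idl ?T"]])
      (use a b y xs q in auto)
  moreover have "?x \<otimes> a = (?x \<otimes> a \<ominus> b \<otimes> y) \<oplus> b \<otimes> y" using a b y monomial_closed[OF xs, of w] by algebra
  ultimately have "?x \<otimes> a \<in> Idl (insert y ?T)" using Idl_insert_mem[OF T y] b by blast
  then show "a \<in> Idl (S \<union> set (xs @ [y]))" using col_step[OF col S xs y nzd a] by simp
qed

lemma col_Nil: "S \<subseteq> carrier R \<Longrightarrow> col S []"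
  unfolding col_def by simp

text \<open>A regular sequence modulo \<open>S\<close> without properness; over a local ring
  properness is carried separately, by membership of the entries in the maximal ideal.\<close>

definition reg :: "'a set \<Rightarrow> 'a list \<Rightarrow> bool" where
  "reg S xs \<longleftrightarrow> (\<forall>i<length xs. nzd (S \<union> set (take i xs)) (xs ! i))"

lemma reg_snoc: "reg S (xs @ [y]) \<longleftrightarrow> reg S xs \<and> nzd (S \<union> set xs) y"
  unfolding reg_def by (auto simp: less_Suc_eq nth_append)

lemma reg_append: "reg S (xs @ ys) \<longleftrightarrow> reg S xs \<and> reg (S \<union> set xs) ys"
proof (induction ys rule: rev_induct)
  case Nil then show ?case by (simp add: reg_def)
next
  case (snoc y ys)
  have "reg S (xs @ ys @ [y]) \<longleftrightarrow> reg S (xs @ ys) \<and> nzd (S \<union> set (xs @ ys)) y"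
    using reg_snoc[of S "xs @ ys" y] by simp
  then show ?case using snoc reg_snoc[of "S \<union> set xs" ys y] by (auto simp: Un_assoc)
qed

lemma reg_imp_col:
  assumes "reg S xs" "S \<subseteq> carrier R" "set xs \<subseteq> carrier R"
  shows "col S xs"
  using assms
proof (induction xs rule: rev_induct)
  case (snoc y xs)
  then show ?case using col_snoc[of S xs y] by (auto simp: reg_snoc)
qed (simp add: col_Nil)

text \<open>One induction on \<open>ys\<close> for both conclusions: regularity of the next
  \<open>y\<close> modulo the monomial ideal rests on the colon formula modulo the earlier entries
  of \<open>ys\<close>, and the formula then passes to the quotient by \<open>y\<close>. This takes
  the place of permuting \<open>xs\<close> and \<open>ys\<close>.\<close>

lemma reg_mod_mon:
  assumes "reg S (xs @ ys)" "S \<subseteq> carrier R" "set xs \<subseteq> carrier R" "set ys \<subseteq> carrier R"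
    and fin: "finite (below (length xs) E)"
  shows "col (S \<union> set ys) xs \<and> reg (S \<union> monomial R xs ` E) ys"
  using assms(1,4)
proof (induction ys rule: rev_induct)
  case Nil
  then show ?case using reg_imp_col assms(2,3) by (simp add: reg_def)
next
  case (snoc y ys)
  have r: "reg S (xs @ ys)" "nzd (S \<union> set ys \<union> set xs) y"
    using snoc.prems(1) reg_snoc[of S "xs @ ys" y] by (simp_all add: Un_ac)
  have IH: "col (S \<union> set ys) xs" "reg (S \<union> monomial R xs ` E) ys"
    using snoc.IH r(1) snoc.prems(2) by auto
  have c: "S \<union> set ys \<subseteq> carrier R" "y \<in> carrier R" using assms(2) snoc.prems(2) by auto
  have "nzd (S \<union> set ys \<union> monomial R xs ` E) y"
    by (rule nzd_mon[OF IH(1) c(1) assms(3) c(2) r(2) fin])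
  then show ?case using IH(2) col_insert[OF IH(1) c(1) assms(3) c(2) r(2)]
    by (simp add: reg_snoc Un_ac)
qed

end

section \<open>Krull's height theorem\<close>

definition prime_chain :: "('a, 'b) ring_scheme \<Rightarrow> nat \<Rightarrow> (nat \<Rightarrow> 'a set) \<Rightarrow> bool" where
  "prime_chain R n c \<longleftrightarrow> (\<forall>i\<le>n. primeideal (c i) R) \<and> (\<forall>i<n. c i \<subset> c (Suc i))"

context ring
begin

text \<open>In a noetherian ring the union of a nonempty chain of ideals is a member of the chain,
  so Zorn's lemma applies to an arbitrary predicate \<open>P\<close>.\<close>

lemma noetherian_maximal:
  assumes "noetherian_ring R" "ideal I R" "P I"
  obtains M where "ideal M R" "P M" "I \<subseteq> M" "\<And>N. ideal N R \<Longrightarrow> P N \<Longrightarrow> M \<subseteq> N \<Longrightarrow> N = M"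
proof -
  interpret N: noetherian_ring R by fact
  define A where "A = {J. ideal J R \<and> P J \<and> I \<subseteq> J}"
  have "\<exists>M\<in>A. \<forall>N\<in>A. M \<subseteq> N \<longrightarrow> N = M"
  proof (rule subset_Zorn_nonempty)
    show "A \<noteq> {}" using assms unfolding A_def by blast
    fix C assume C: "C \<noteq> {}" "subset.chain A C"
    have "subset.chain {I. ideal I R} C" using C(2) unfolding subset_chain_def A_def by blast
    then have "\<Union>C \<in> C" using N.ideal_chain_is_trivial[OF C(1)] by blast
    then show "\<Union>C \<in> A" using C(2) unfolding subset_chain_def A_def by blast
  qed
  then show ?thesis using that unfolding A_def by auto
qed

end

context cring
begin

lemma ideal_setI:
  assumes "I \<subseteq> carrier R" "\<zero> \<in> I" "\<And>x y. x \<in> I \<Longrightarrow> y \<in> I \<Longrightarrow> x \<oplus> y \<in> I"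
    "\<And>r x. r \<in> carrier R \<Longrightarrow> x \<in> I \<Longrightarrow> r \<otimes> x \<in> I"
  shows "ideal I R"
proof (rule idealI[OF ring_axioms])
  have inv: "\<ominus> x \<in> I" if "x \<in> I" for x
    using assms(4)[of "\<ominus> \<one>" x] that assms(1) by (auto simp: l_minus)
  show "subgroup I (add_monoid R)"
    using assms inv by unfold_locales (auto simp: a_inv_def[symmetric])
  show "x \<otimes> a \<in> I" if "a \<in> I" "x \<in> carrier R" for a x using assms(4) that by blast
  show "a \<otimes> x \<in> I" if "a \<in> I" "x \<in> carrier R" for a x
    using assms(1) assms(4)[OF that(2,1)] that m_comm[of a x] by auto
qed

lemma primeidealI':
  assumes "ideal I R" "\<one> \<notin> I" "\<And>a b. a \<in> carrier R \<Longrightarrow> b \<in> carrier R \<Longrightarrow> a \<otimes> b \<in> I \<Longrightarrow> a \<in> I \<or> b \<in> I"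
  shows "primeideal I R"
  using assms by (intro primeidealI is_cring) auto

lemma primeideal_one: "primeideal P R \<Longrightarrow> \<one> \<notin> P"
  using ideal.one_imp_carrier primeideal.I_notcarr primeideal.axioms(1) by metis

lemma ideal_insert_mem:
  assumes "ideal I R" "y \<in> carrier R"
  shows "x \<in> Idl (insert y I) \<longleftrightarrow> (\<exists>q\<in>I. \<exists>r\<in>carrier R. x = q \<oplus> r \<otimes> y)"
  using Idl_insert_mem[of I y x] Idl_ideal[OF assms(1)] assms ideal.Icarr[OF assms(1)] by auto

lemma ideal_insert_facts:
  assumes "ideal I R" "y \<in> carrier R"
  shows "ideal (Idl (insert y I)) R" "I \<subseteq> Idl (insert y I)" "y \<in> Idl (insert y I)"
proof -
  have c: "insert y I \<subseteq> carrier R" using assms ideal.Icarr by auto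
  show "ideal (Idl (insert y I)) R" by (rule genideal_ideal[OF c])
  show "I \<subseteq> Idl (insert y I)" "y \<in> Idl (insert y I)" using genideal_self[OF c] by auto
qed

lemma ideal_closed:
  assumes "ideal I R"
  shows "x \<in> I \<Longrightarrow> y \<in> I \<Longrightarrow> x \<oplus> y \<in> I" "x \<in> I \<Longrightarrow> y \<in> I \<Longrightarrow> x \<ominus> y \<in> I"
    "x \<in> I \<Longrightarrow> r \<in> carrier R \<Longrightarrow> r \<otimes> x \<in> I" "x \<in> I \<Longrightarrow> r \<in> carrier R \<Longrightarrow> x \<otimes> r \<in> I"
    "\<zero> \<in> I" "x \<in> I \<Longrightarrow> \<ominus> x \<in> I" "x \<in> I \<Longrightarrow> x \<in> carrier R" "I \<subseteq> carrier R"
proof -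
  interpret ideal I R by fact
  show "x \<in> I \<Longrightarrow> y \<in> I \<Longrightarrow> x \<oplus> y \<in> I" by (rule a_closed)
  show "x \<in> I \<Longrightarrow> y \<in> I \<Longrightarrow> x \<ominus> y \<in> I" using a_closed a_inv_closed by (simp add: a_minus_def)
  show "x \<in> I \<Longrightarrow> r \<in> carrier R \<Longrightarrow> r \<otimes> x \<in> I" by (rule I_l_closed)
  show "x \<in> I \<Longrightarrow> r \<in> carrier R \<Longrightarrow> x \<otimes> r \<in> I" by (rule I_r_closed)
  show "\<zero> \<in> I" by simp
  show "x \<in> I \<Longrightarrow> \<ominus> x \<in> I" by (rule a_inv_closed)
  show "x \<in> I \<Longrightarrow> x \<in> carrier R" by (rule Icarr)
  show "I \<subseteq> carrier R" by (rule a_subset)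
qed

lemma ideal_cancel:
  assumes "ideal I R" "x \<oplus> y \<in> I" "x \<in> I" "y \<in> carrier R"
  shows "y \<in> I"
proof -
  have "y = (x \<oplus> y) \<ominus> x" using assms ideal_closed(7)[OF assms(1,3)] by algebra
  then show ?thesis using ideal_closed(2)[OF assms(1,2,3)] by simp
qed

text \<open>An ideal \<open>T\<close> maximal among those disjoint from a multiplicative set is
  prime: if \<open>a\<close> and \<open>b\<close> were outside \<open>T\<close>, both enlargements
  would meet \<open>M\<close>, and for \<open>a \<otimes> b\<close> in \<open>T\<close> the product
  of the two elements found would lie in \<open>T\<close> and \<open>M\<close>.\<close>

lemma prime_avoiding:
  assumes N: "noetherian_ring R" and I: "ideal I R"
    and M: "\<one> \<in> M" "M \<subseteq> carrier R" "\<And>a b. a \<in> M \<Longrightarrow> b \<in> M \<Longrightarrow> a \<otimes> b \<in> M" and dis: "I \<inter> M = {}"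
  obtains T where "primeideal T R" "I \<subseteq> T" "T \<inter> M = {}"
proof -
  obtain T where T: "ideal T R" "T \<inter> M = {}" "I \<subseteq> T"
    and mx: "\<And>J. ideal J R \<Longrightarrow> J \<inter> M = {} \<Longrightarrow> T \<subseteq> J \<Longrightarrow> J = T"
    using noetherian_maximal[OF N I, of "\<lambda>J. J \<inter> M = {}", OF dis] by metis
  have hit: "\<exists>q\<in>T. \<exists>r\<in>carrier R. q \<oplus> r \<otimes> y \<in> M" if y: "y \<in> carrier R" "y \<notin> T" for y
  proof -
    have "Idl (insert y T) \<inter> M \<noteq> {}"
      using mx[of "Idl (insert y T)"] ideal_insert_facts[OF T(1) y(1)] y(2) by blast
    then obtain x where "x \<in> Idl (insert y T)" "x \<in> M" by blast
    then show ?thesis using ideal_insert_mem[OF T(1) y(1), of x] by auto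
  qed
  have "primeideal T R"
  proof (rule primeidealI'[OF T(1)])
    show "\<one> \<notin> T" using T(2) M(1) by blast
    fix a b assume ab: "a \<in> carrier R" "b \<in> carrier R" "a \<otimes> b \<in> T"
    show "a \<in> T \<or> b \<in> T"
    proof (rule ccontr)
      assume n: "\<not> (a \<in> T \<or> b \<in> T)"
      obtain p r where p: "p \<in> T" "r \<in> carrier R" "p \<oplus> r \<otimes> a \<in> M" using hit[of a] ab n by blast
      obtain q s where q: "q \<in> T" "s \<in> carrier R" "q \<oplus> s \<otimes> b \<in> M" using hit[of b] ab n by blast
      have c: "p \<in> carrier R" "q \<in> carrier R" using p q ideal_closed(7)[OF T(1)] by auto
      have "(p \<oplus> r \<otimes> a) \<otimes> (q \<oplus> s \<otimes> b) = (q \<oplus> s \<otimes> b) \<otimes> p \<oplus> ((r \<otimes> a) \<otimes> q \<oplus> (r \<otimes> s) \<otimes> (a \<otimes> b))"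
        using c p(2) q(2) ab by algebra
      also have "\<dots> \<in> T"
        using ideal_closed(3)[OF T(1) p(1), of "q \<oplus> s \<otimes> b"] ideal_closed(3)[OF T(1) q(1), of "r \<otimes> a"]
          ideal_closed(3)[OF T(1) ab(3), of "r \<otimes> s"] p(2) q(2) c ab(1,2)
        by (intro ideal_closed(1)[OF T(1)]) auto
      finally show False using M(3)[OF p(3) q(3)] T(2) by blast
    qed
  qed
  then show ?thesis using that T by blast
qed

section \<open>Colons and localization at a prime\<close>

definition colon :: "'a set \<Rightarrow> 'a \<Rightarrow> 'a set" where
  "colon I x = {r \<in> carrier R. r \<otimes> x \<in> I}"

lemma colon_ideal: "ideal I R \<Longrightarrow> x \<in> carrier R \<Longrightarrow> ideal (colon I x) R"
  by (intro ideal_setI) (auto simp: colon_def l_distr m_assoc ideal_closed)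

text \<open>The usual source of associated primes. If \<open>a \<otimes> b\<close> lies in a maximal
  colon at \<open>x\<close> and \<open>b \<otimes> x\<close> is not in \<open>I\<close>, then the
  colon at \<open>b \<otimes> x\<close> contains the one at \<open>x\<close>, hence equals it, and
  \<open>a\<close> lies in it.\<close>

lemma max_colon_prime:
  assumes N: "noetherian_ring R" and I: "ideal I R" and y: "y \<in> carrier R" "y \<notin> I"
  obtains x where "x \<in> carrier R" "x \<notin> I" "primeideal (colon I x) R" "colon I y \<subseteq> colon I x"
    "\<And>z. z \<in> carrier R \<Longrightarrow> z \<notin> I \<Longrightarrow> colon I x \<subseteq> colon I z \<Longrightarrow> colon I z = colon I x"
proof -
  obtain M where M: "ideal M R" "\<exists>x\<in>carrier R. x \<notin> I \<and> M = colon I x" "colon I y \<subseteq> M"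
    and mx: "\<And>J. ideal J R \<Longrightarrow> \<exists>x\<in>carrier R. x \<notin> I \<and> J = colon I x \<Longrightarrow> M \<subseteq> J \<Longrightarrow> J = M"
    using noetherian_maximal[OF N colon_ideal[OF I y(1)], of "\<lambda>M. \<exists>x\<in>carrier R. x \<notin> I \<and> M = colon I x"] y
    by (metis (no_types, lifting))
  then obtain x where x: "x \<in> carrier R" "x \<notin> I" "M = colon I x" by blast
  have mx': "colon I z = colon I x" if "z \<in> carrier R" "z \<notin> I" "colon I x \<subseteq> colon I z" for z
    using mx[OF colon_ideal[OF I that(1)]] that x by blast
  have "primeideal (colon I x) R"
  proof (rule primeidealI'[OF colon_ideal[OF I x(1)]])
    show "\<one> \<notin> colon I x" using x by (simp add: colon_def)
    fix a b assume ab: "a \<in> carrier R" "b \<in> carrier R" "a \<otimes> b \<in> colon I x"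
    show "a \<in> colon I x \<or> b \<in> colon I x"
    proof (rule disjCI)
      assume nb: "b \<notin> colon I x"
      then have bx: "b \<otimes> x \<in> carrier R" "b \<otimes> x \<notin> I" using ab x by (auto simp: colon_def)
      have "colon I x \<subseteq> colon I (b \<otimes> x)"
      proof
        fix r assume r: "r \<in> colon I x"
        then have "r \<otimes> (b \<otimes> x) = b \<otimes> (r \<otimes> x)" using ab x by (auto simp: colon_def m_lcomm)
        then show "r \<in> colon I (b \<otimes> x)" using r ideal_closed(3)[OF I] ab by (auto simp: colon_def)
      qed
      then have "colon I (b \<otimes> x) = colon I x" by (rule mx'[OF bx])
      moreover have "a \<in> colon I (b \<otimes> x)" using ab x by (auto simp: colon_def m_assoc)
      ultimately show "a \<in> colon I x" by blast
    qed
  qed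
  then show ?thesis using that x mx' M(3) by blast
qed

text \<open>For a prime \<open>P\<close>, the contraction to \<open>R\<close> of the localization of \<open>I\<close> at \<open>P\<close>.\<close>

definition sat :: "'a set \<Rightarrow> 'a set \<Rightarrow> 'a set" where
  "sat P I = {r \<in> carrier R. \<exists>s\<in>carrier R - P. s \<otimes> r \<in> I}"

lemma sat_ideal:
  assumes P: "primeideal P R" and I: "ideal I R"
  shows "ideal (sat P I) R" "I \<subseteq> sat P I" "sat P (sat P I) = sat P I"
proof -
  have mul: "s \<otimes> t \<in> carrier R - P" if "s \<in> carrier R - P" "t \<in> carrier R - P" for s t
    using primeideal.I_prime[OF P, of s t] that by auto
  have one: "\<one> \<in> carrier R - P" using primeideal_one[OF P] by simp
  show sub: "I \<subseteq> sat P I" using ideal_closed(7)[OF I] one by (auto simp: sat_def intro!: bexI[of _ \<one>])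
  show "ideal (sat P I) R"
  proof (rule ideal_setI)
    show "sat P I \<subseteq> carrier R" by (auto simp: sat_def)
    show "\<zero> \<in> sat P I" using sub ideal_closed(5)[OF I] by blast
  next
    fix x y assume "x \<in> sat P I" "y \<in> sat P I"
    then obtain s t where st: "s \<in> carrier R - P" "s \<otimes> x \<in> I" "t \<in> carrier R - P" "t \<otimes> y \<in> I"
      and xy: "x \<in> carrier R" "y \<in> carrier R" by (auto simp: sat_def)
    have "(s \<otimes> t) \<otimes> (x \<oplus> y) = t \<otimes> (s \<otimes> x) \<oplus> s \<otimes> (t \<otimes> y)" using st xy by (simp add: ring_norm)
    also have "\<dots> \<in> I" using st ideal_closed(1,3)[OF I] by blast
    finally show "x \<oplus> y \<in> sat P I" using mul[OF st(1,3)] xy unfolding sat_def by blast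
  next
    fix r x assume r: "r \<in> carrier R" and "x \<in> sat P I"
    then obtain s where s: "s \<in> carrier R - P" "s \<otimes> x \<in> I" "x \<in> carrier R" by (auto simp: sat_def)
    have "s \<otimes> (r \<otimes> x) = r \<otimes> (s \<otimes> x)" using s r by (simp add: m_lcomm)
    also have "\<dots> \<in> I" using s r ideal_closed(3)[OF I] by blast
    finally show "r \<otimes> x \<in> sat P I" using s r unfolding sat_def by blast
  qed
  show "sat P (sat P I) = sat P I"
  proof
    show "sat P (sat P I) \<subseteq> sat P I"
    proof
      fix x assume "x \<in> sat P (sat P I)"
      then obtain s t where st: "s \<in> carrier R - P" "t \<in> carrier R - P" "t \<otimes> (s \<otimes> x) \<in> I" "x \<in> carrier R"
        by (auto simp: sat_def)
      then have "(t \<otimes> s) \<otimes> x \<in> I" by (simp add: m_assoc)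
      then show "x \<in> sat P I" using mul[OF st(2,1)] st(4) unfolding sat_def by blast
    qed
  qed (use sub in \<open>auto simp: sat_def\<close>)
qed

lemma sat_mono: "I \<subseteq> J \<Longrightarrow> sat P I \<subseteq> sat P J"
  unfolding sat_def by blast

text \<open>Nakayama's lemma at \<open>P\<close> without a localized ring. Quantifying over all
  \<open>M\<close> that contain \<open>N'\<close> and the products of \<open>P\<close> and
  \<open>N\<close> replaces forming the ideal that they generate. A saturated ideal that contains
  \<open>N'\<close> and is maximal among those not containing \<open>N\<close> is shown to contain
  these products.\<close>

lemma nakayama:
  assumes N: "noetherian_ring R" and P: "primeideal P R" and N': "ideal N' R" and NC: "N \<subseteq> carrier R"
    and step: "\<And>M. ideal M R \<Longrightarrow> N' \<subseteq> M \<Longrightarrow> (\<And>p n. p \<in> P \<Longrightarrow> n \<in> N \<Longrightarrow> p \<otimes> n \<in> M) \<Longrightarrow> N \<subseteq> sat P M"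
  shows "N \<subseteq> sat P N'"
proof (rule ccontr)
  assume a: "\<not> N \<subseteq> sat P N'"
  have PI: "ideal P R" using P by (rule primeideal.axioms)
  obtain M where M: "ideal M R" "sat P M = M \<and> N' \<subseteq> M \<and> \<not> N \<subseteq> M"
    and mx: "\<And>J. ideal J R \<Longrightarrow> sat P J = J \<and> N' \<subseteq> J \<and> \<not> N \<subseteq> J \<Longrightarrow> M \<subseteq> J \<Longrightarrow> J = M"
    using noetherian_maximal[OF N sat_ideal(1)[OF P N'], of "\<lambda>M. sat P M = M \<and> N' \<subseteq> M \<and> \<not> N \<subseteq> M"]
      sat_ideal(2,3)[OF P N'] a by (metis (no_types, lifting))
  have "p \<otimes> n \<in> M" if pn: "p \<in> P" "n \<in> N" for p n
  proof (rule ccontr)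
    assume no: "p \<otimes> n \<notin> M"
    have c: "p \<in> carrier R" "n \<in> carrier R" using pn NC ideal_closed(7)[OF PI] by auto
    have c': "p \<otimes> n \<in> carrier R" using c by simp
    let ?J = "Idl (insert (p \<otimes> n) M)"
    note J = ideal_insert_facts[OF M(1) c'] and sJ = sat_ideal[OF P ideal_insert_facts(1)[OF M(1) c']]
    have "sat P ?J \<noteq> M" using no J sJ by blast
    then have "N \<subseteq> sat P ?J" using mx[OF sJ(1)] sJ M J by blast
    then obtain s where s: "s \<in> carrier R" "s \<notin> P" "s \<otimes> n \<in> ?J" using pn by (auto simp: sat_def)
    then obtain q r where q: "q \<in> M" "r \<in> carrier R" "s \<otimes> n = q \<oplus> r \<otimes> (p \<otimes> n)"
      using ideal_insert_mem[OF M(1) c'] by blast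
    have qc: "q \<in> carrier R" using q ideal_closed(7)[OF M(1)] by blast
    \<comment> \<open>The element \<open>s \<ominus> r \<otimes> p\<close> is outside
      \<open>P\<close>, a unit after localization; this is the determinant trick for one
      element.\<close>
    have "(s \<ominus> r \<otimes> p) \<otimes> n = s \<otimes> n \<ominus> r \<otimes> (p \<otimes> n)" using s(1) c q(2) by algebra
    also have "\<dots> = q" unfolding q(3) using c q(2) qc by algebra
    finally have "(s \<ominus> r \<otimes> p) \<otimes> n \<in> M" using q by simp
    moreover have "s \<ominus> r \<otimes> p \<notin> P"
    proof
      assume "s \<ominus> r \<otimes> p \<in> P"
      then have "(s \<ominus> r \<otimes> p) \<oplus> r \<otimes> p \<in> P" using ideal_closed(1,3)[OF PI] pn q by blast
      moreover have "(s \<ominus> r \<otimes> p) \<oplus> r \<otimes> p = s" using s(1) q(2) c by algebra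
      ultimately show False using s by simp
    qed
    ultimately have "n \<in> sat P M" using s c q by (auto simp: sat_def)
    then have "p \<otimes> n \<in> M" using M ideal_closed(3)[OF M(1)] c by blast
    then show False using no by simp
  qed
  then show False using step[OF M(1)] M(2) by blast
qed

lemma sum_ideal:
  assumes "ideal I R" "ideal J R"
  shows "ideal (I <+> J) R" "I \<subseteq> I <+> J" "J \<subseteq> I <+> J"
    "\<And>x. x \<in> I <+> J \<longleftrightarrow> (\<exists>a\<in>I. \<exists>b\<in>J. x = a \<oplus> b)"
proof -
  show m: "\<And>x. x \<in> I <+> J \<longleftrightarrow> (\<exists>a\<in>I. \<exists>b\<in>J. x = a \<oplus> b)" by (auto simp: set_add_defs)
  show "ideal (I <+> J) R" by (rule add_ideals[OF assms])
  show "I \<subseteq> I <+> J"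
    using m ideal_closed(5,7)[OF assms(2)] ideal_closed(7)[OF assms(1)] by (metis r_zero subsetI)
  show "J \<subseteq> I <+> J"
    using m ideal_closed(5,7)[OF assms(1)] ideal_closed(7)[OF assms(2)] by (metis l_zero subsetI)
qed

text \<open>Ideals \<open>L \<supseteq> I\<close> such that the localization of \<open>R / L\<close> at \<open>P\<close> has finite length, generated
  along a composition series.\<close>

inductive fin_len :: "'a set \<Rightarrow> 'a set \<Rightarrow> 'a set \<Rightarrow> bool" for P I where
  full: "fin_len P I (carrier R)"
| step: "fin_len P I L \<Longrightarrow> ideal L R \<Longrightarrow> ideal L' R \<Longrightarrow> I \<subseteq> L' \<Longrightarrow> L' \<subseteq> L \<Longrightarrow> x \<in> L \<Longrightarrow>
    (\<And>p. p \<in> P \<Longrightarrow> p \<otimes> x \<in> L') \<Longrightarrow> L \<subseteq> sat P (Idl (insert x L')) \<Longrightarrow> fin_len P I L'"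

text \<open>The hypothesis says that the elements of \<open>P\<close> are nilpotent modulo
  \<open>I\<close> after localization. A maximal counterexample \<open>J\<close> is proper and has a
  prime colon at some \<open>x\<close>. This colon contains \<open>P\<close>, since
  \<open>s \<otimes> p [^] k\<close> lies in it and \<open>s\<close> does not; so \<open>x\<close>
  spans one composition factor above \<open>J\<close>.\<close>

lemma fin_len_sat:
  assumes N: "noetherian_ring R" and P: "primeideal P R" and I: "ideal I R"
    and nil: "\<And>p. p \<in> P \<Longrightarrow> \<exists>s\<in>carrier R - P. \<exists>k::nat. s \<otimes> p [^] k \<in> I"
  shows "fin_len P I (sat P I)"
proof (rule ccontr)
  assume a: "\<not> fin_len P I (sat P I)"
  have PI: "ideal P R" using P by (rule primeideal.axioms)
  obtain J where J: "ideal J R" "sat P J = J \<and> I \<subseteq> J \<and> \<not> fin_len P I J"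
    and mx: "\<And>L. ideal L R \<Longrightarrow> sat P L = L \<and> I \<subseteq> L \<and> \<not> fin_len P I L \<Longrightarrow> J \<subseteq> L \<Longrightarrow> L = J"
    using noetherian_maximal[OF N sat_ideal(1)[OF P I], of "\<lambda>M. sat P M = M \<and> I \<subseteq> M \<and> \<not> fin_len P I M"]
      sat_ideal(2,3)[OF P I] a by (metis (no_types, lifting))
  have "J \<noteq> carrier R" using J(2) fin_len.full by metis
  then have "\<one> \<notin> J" using ideal.one_imp_carrier[OF J(1)] by blast
  then obtain x where x: "x \<in> carrier R" "x \<notin> J" "primeideal (colon J x) R"
    using max_colon_prime[OF N J(1) one_closed] by metis
  have Px: "p \<otimes> x \<in> J" if p: "p \<in> P" for p
  proof -
    have pc: "p \<in> carrier R" using ideal_closed(7)[OF PI p] .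
    obtain s and k :: nat where s: "s \<in> carrier R" "s \<notin> P" "s \<otimes> p [^] k \<in> I" using nil[OF p] by blast
    have "s \<otimes> p [^] k \<otimes> x \<in> J" using s J x ideal_closed(4)[OF J(1)] by blast
    then have "s \<otimes> p [^] k \<in> colon J x" using s pc by (auto simp: colon_def)
    moreover have "s \<notin> colon J x" using s x J(2) by (auto simp: colon_def sat_def)
    ultimately have "p [^] k \<in> colon J x"
      using primeideal.I_prime[OF x(3) s(1), of "p [^] k"] pc by auto
    then have "p \<in> colon J x"
    proof (induction k)
      case 0 then show ?case using primeideal_one[OF x(3)] by simp
    next
      case (Suc k) then show ?case using primeideal.I_prime[OF x(3), of "p [^] k" p] pc by auto
    qed
    then show ?thesis by (simp add: colon_def)
  qed
  let ?L = "Idl (insert x J)"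
  note L = ideal_insert_facts[OF J(1) x(1)] and sL = sat_ideal[OF P ideal_insert_facts(1)[OF J(1) x(1)]]
  have "sat P ?L \<noteq> J" using L(3) sL(2) x(2) by blast
  then have "fin_len P I (sat P ?L)" using mx[OF sL(1)] sL J L by blast
  then have "fin_len P I J"
    by (rule fin_len.step[of _ _ _ _ x]) (use sL L J Px in blast)+
  then show False using J(2) by blast
qed

text \<open>Modulo \<open>L\<close> the chain becomes stationary by induction. The additional factor
  is spanned by \<open>x\<close>: either \<open>x\<close> belongs to every term, and
  \<open>L'\<close> may be traded for \<open>L\<close>, or it drops out for good at some stage,
  after which this factor contributes nothing.\<close>

lemma fin_len_dcc:
  assumes L: "fin_len P I L" and P: "primeideal P R"
    and Nk: "\<And>k::nat. ideal (N k) R" "\<And>k. N (Suc k) \<subseteq> N k"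
  shows "\<exists>k0. \<forall>k\<ge>k0. sat P (N k <+> L) = sat P (N k0 <+> L)"
  using L
proof induction
  case full
  have "N k <+> carrier R = carrier R" for k
    using sum_ideal[OF Nk(1)[of k] oneideal] ideal_closed(8) by blast
  then show ?case by simp
next
  case (step L L' x)
  have dec: "N m \<subseteq> N k" if "k \<le> m" for k m
    using that Nk(2) by (rule lift_Suc_antimono_le[rotated])
  have mono: "N m <+>\<^bsub>R\<^esub> M \<subseteq> N k <+>\<^bsub>R\<^esub> M" if "k \<le> m" for k m and M :: "'a set"
    using dec[OF that] by (auto simp: set_add_defs)
  note LL = sum_ideal[OF Nk(1) step.hyps(2)] and LL' = sum_ideal[OF Nk(1) step.hyps(3)]
  obtain k0 where k0: "\<And>k. k \<ge> k0 \<Longrightarrow> sat P (N k <+> L) = sat P (N k0 <+> L)" using step.IH by blast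
  have sub: "N k <+>\<^bsub>R\<^esub> L' \<subseteq> N k <+>\<^bsub>R\<^esub> L" for k using step.hyps(5) by (auto simp: set_add_defs)
  have xc: "x \<in> carrier R" using ideal_closed(7) step.hyps(2,6) by blast
  show ?case
  proof (cases "\<forall>k. x \<in> sat P (N k <+> L')")
    case True
    have "sat P (N k <+> L') = sat P (N k <+> L)" for k
    proof
      show "sat P (N k <+> L') \<subseteq> sat P (N k <+> L)" by (rule sat_mono[OF sub])
      note s = sat_ideal[OF P LL'(1)[of k]]
      have "Idl (insert x L') \<subseteq> sat P (N k <+> L')"
        using s(2) LL'(3)[of k] True by (intro genideal_minimal s(1)) auto
      then have "L \<subseteq> sat P (N k <+> L')"
        using step.hyps(8) sat_mono[of _ "sat P (N k <+> L')" P] s(3) by blast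
      moreover have "N k \<subseteq> sat P (N k <+> L')" using s(2) LL'(2) by blast
      ultimately have "N k <+> L \<subseteq> sat P (N k <+> L')"
        using ideal_closed(1)[OF s(1)] by (auto simp: set_add_defs)
      then show "sat P (N k <+> L) \<subseteq> sat P (N k <+> L')"
        using sat_mono s(3) by metis
    qed
    then show ?thesis using k0 by metis
  next
    case False
    then obtain k1 where k1: "x \<notin> sat P (N k1 <+> L')" by blast
    let ?k = "max k0 k1"
    have "sat P (N ?k <+> L') \<subseteq> sat P (N m <+> L')" if m: "m \<ge> ?k" for m
    proof
      fix r assume r: "r \<in> sat P (N ?k <+> L')"
      have "r \<in> sat P (N m <+> L)"
        using r sat_mono[OF sub] k0[of ?k] k0[of m] m by auto
      then obtain s where s: "s \<in> carrier R - P" "s \<otimes> r \<in> N m <+> L" and rc: "r \<in> carrier R" by (auto simp: sat_def)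
      then obtain n l where n: "n \<in> N m" "l \<in> L" "s \<otimes> r = n \<oplus> l" using LL(4) by blast
      then obtain t where t: "t \<in> carrier R - P" "t \<otimes> l \<in> Idl (insert x L')" using step.hyps(8) by (auto simp: sat_def)
      then obtain q c where q: "q \<in> L'" "c \<in> carrier R" "t \<otimes> l = q \<oplus> c \<otimes> x"
        using ideal_insert_mem[OF step.hyps(3) xc] by blast
      have cc: "n \<in> carrier R" "l \<in> carrier R" "q \<in> carrier R" "t \<in> carrier R" "s \<in> carrier R"
        using n q t s ideal_closed(7)[OF Nk(1)] ideal_closed(7)[OF step.hyps(2)] ideal_closed(7)[OF step.hyps(3)] by auto
      have "(t \<otimes> s) \<otimes> r = t \<otimes> (s \<otimes> r)" using cc rc by (simp add: m_assoc)
      also have "\<dots> = t \<otimes> n \<oplus> t \<otimes> l" unfolding n(3) using cc by algebra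
      finally have eq: "(t \<otimes> s) \<otimes> r = (t \<otimes> n \<oplus> q) \<oplus> c \<otimes> x" unfolding q(3) using cc q xc by algebra
      have tn: "t \<otimes> n \<oplus> q \<in> N m <+> L'"
        using LL'(4) n q ideal_closed(3)[OF Nk(1) n(1)] cc by blast
      \<comment> \<open>A coefficient outside \<open>P\<close> is a unit after localization and
        would put \<open>x\<close> into the term at stage \<open>k1\<close>.\<close>
      have "c \<in> P"
      proof (rule ccontr)
        assume cP: "c \<notin> P"
        note sk = sat_ideal[OF P LL'(1)[of ?k]]
        have a1: "(t \<otimes> s) \<otimes> r \<in> sat P (N ?k <+> L')" using ideal_closed(3)[OF sk(1) r] cc by simp
        have a2: "t \<otimes> n \<oplus> q \<in> sat P (N ?k <+> L')" using sk(2) tn mono[OF m] by blast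
        have "c \<otimes> x \<in> sat P (N ?k <+> L')"
          using ideal_cancel[OF sk(1) a1[unfolded eq] a2] q xc by simp
        then have "x \<in> sat P (sat P (N ?k <+> L'))" using cP q xc by (auto simp: sat_def)
        then show False using k1 sk(3) sat_mono[OF mono[of k1 ?k]] by auto
      qed
      then have cx: "c \<otimes> x \<in> N m <+> L'" using step.hyps(7) LL'(3) by blast
      have "(t \<otimes> s) \<otimes> r \<in> N m <+> L'" unfolding eq by (rule ideal_closed(1)[OF LL'(1) tn cx])
      moreover have "t \<otimes> s \<in> carrier R - P" using primeideal.I_prime[OF P, of t s] s t by auto
      ultimately show "r \<in> sat P (N m <+> L')" using rc unfolding sat_def by blast
    qed
    moreover have "sat P (N m <+> L') \<subseteq> sat P (N ?k <+> L')" if "m \<ge> ?k" for m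
      by (rule sat_mono[OF mono[OF that]])
    ultimately show ?thesis by blast
  qed
qed

section \<open>Symbolic powers and Krull's principal ideal theorem\<close>

fun sym_power :: "'a set \<Rightarrow> 'a set \<Rightarrow> nat \<Rightarrow> 'a set" where
  "sym_power Q Q0 0 = carrier R"
| "sym_power Q Q0 (Suc k) = sat Q (Idl ({q \<otimes> n | q n. q \<in> Q \<and> n \<in> sym_power Q Q0 k} \<union> Q0))"

text \<open>\<open>sym_power Q Q0 k\<close> is the preimage in the ring of the symbolic power
  \<open>k\<close> of \<open>Q\<close> modulo \<open>Q0\<close>. Saturating at every stage gives the
  same ideal as saturating once after forming the power, and makes the recursion fit Nakayama's
  lemma at \<open>Q\<close>.\<close>

lemma sym_power_facts:
  assumes Q: "primeideal Q R" and Q0: "ideal Q0 R" "Q0 \<subseteq> Q"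
  shows "ideal (sym_power Q Q0 k) R" "sat Q (sym_power Q Q0 k) = sym_power Q Q0 k"
    "sym_power Q Q0 (Suc k) \<subseteq> sym_power Q Q0 k" "Q0 \<subseteq> sym_power Q Q0 k"
    "q \<in> Q \<Longrightarrow> q [^] k \<in> sym_power Q Q0 k" "sym_power Q Q0 (Suc 0) \<subseteq> Q"
proof -
  let ?N = "sym_power Q Q0"
  have QI: "ideal Q R" using Q by (rule primeideal.axioms)
  let ?G = "\<lambda>k. {q \<otimes> n | q n. q \<in> Q \<and> n \<in> ?N k} \<union> Q0"
  have id: "ideal (?N k) R" for k
  proof (induction k)
    case (Suc k)
    have "?G k \<subseteq> carrier R" using ideal_closed(7)[OF QI] ideal_closed(7)[OF Suc] ideal_closed(7)[OF Q0(1)] by auto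
    then show ?case using sat_ideal(1)[OF Q genideal_ideal] by simp
  qed (simp add: oneideal)
  then show "ideal (?N k) R" .
  have G: "?G k \<subseteq> carrier R" for k
    using ideal_closed(7)[OF QI] ideal_closed(7)[OF id] ideal_closed(7)[OF Q0(1)] by auto
  note S = sat_ideal[OF Q genideal_ideal[OF G]]
  have st: "sat Q (?N k) = ?N k" for k
  proof (cases k)
    case 0 then show ?thesis using sat_ideal(2)[OF Q oneideal] by (auto simp: sat_def)
  qed (use S(3) in simp)
  then show "sat Q (?N k) = ?N k" .
  have q0: "Q0 \<subseteq> ?N k" for k
  proof (cases k)
    case 0 then show ?thesis using ideal_closed(8)[OF Q0(1)] by simp
  next
    case (Suc m) then show ?thesis using S(2)[of m] genideal_self[OF G[of m]] by auto
  qed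
  then show "Q0 \<subseteq> ?N k" .
  show "?N (Suc k) \<subseteq> ?N k"
  proof -
    have "?G k \<subseteq> ?N k" using q0 ideal_closed(3)[OF id] ideal_closed(7)[OF QI] by auto
    then have "Idl (?G k) \<subseteq> ?N k" by (rule genideal_minimal[OF id])
    then have "sat Q (Idl (?G k)) \<subseteq> sat Q (?N k)" by (rule sat_mono)
    then show ?thesis unfolding st sym_power.simps(2) .
  qed
  show "?N (Suc 0) \<subseteq> Q"
  proof -
    have "?G 0 \<subseteq> Q" using Q0(2) ideal_closed(4)[OF QI] by auto
    then have "Idl (?G 0) \<subseteq> Q" by (rule genideal_minimal[OF QI])
    moreover have "sat Q Q \<subseteq> Q" using primeideal.I_prime[OF Q] by (auto simp: sat_def)
    ultimately show ?thesis using sat_mono[of "Idl (?G 0)" Q Q] by simp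
  qed
  show "q [^] k \<in> ?N k" if q: "q \<in> Q"
  proof (induction k)
    case (Suc k)
    have "q [^] Suc k = q \<otimes> q [^] k" using ideal_closed(7)[OF QI q] by (simp add: m_comm)
    then have "q [^] Suc k \<in> ?G k" using q Suc by blast
    then show ?case using S(2)[of k] genideal_self[OF G[of k]] by auto
  qed simp
qed

text \<open>A form suited to chains: the bottom and top primes stay. If no such \<open>T\<close>
  existed, \<open>P\<close> would be the only prime between the ideal of \<open>Q0\<close> and
  \<open>a\<close> and \<open>P\<close> itself, so the quotient would have finite length at
  \<open>P\<close>, and the symbolic powers of \<open>Q\<close> would become stationary modulo
  \<open>a\<close>. Nakayama's lemma at \<open>P\<close> then removes \<open>a\<close>, and at
  \<open>Q\<close> it collapses a symbolic power into \<open>Q0\<close>, which forces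
  \<open>Q = Q0\<close>.\<close>

lemma principal_ideal_theorem:
  assumes N: "noetherian_ring R" and pr: "primeideal Q0 R" "primeideal Q R" "primeideal P R"
    and sub: "Q0 \<subset> Q" "Q \<subset> P" and a: "a \<in> P"
  shows "\<exists>T. primeideal T R \<and> Q0 \<subseteq> T \<and> T \<subset> P \<and> a \<in> T"
proof (rule ccontr)
  assume no: "\<not> ?thesis"
  have noT: False if "primeideal T R" "Q0 \<subseteq> T" "T \<subset> P" "a \<in> T" for T using no that by blast
  have I0: "ideal Q0 R" and IQ: "ideal Q R" and IP: "ideal P R" using pr by (auto intro: primeideal.axioms)
  have ac: "a \<in> carrier R" using ideal_closed(7)[OF IP a] .
  let ?I = "Idl (insert a Q0)"
  note I = ideal_insert_facts[OF I0 ac]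
  have aQ: "a \<notin> Q" using noT[OF pr(2)] sub by blast
  \<comment> \<open>Otherwise some prime would contain \<open>Q0\<close> and \<open>a\<close> and
    avoid all \<open>s \<otimes> p [^] k\<close>; it would lie in \<open>P\<close> and miss
    \<open>p\<close>.\<close>
  have nil: "\<exists>s\<in>carrier R - P. \<exists>k::nat. s \<otimes> p [^] k \<in> ?I" if p: "p \<in> P" for p
  proof (rule ccontr)
    assume n: "\<not> (\<exists>s\<in>carrier R - P. \<exists>k::nat. s \<otimes> p [^] k \<in> ?I)"
    have pc: "p \<in> carrier R" using ideal_closed(7)[OF IP p] .
    let ?M = "{s \<otimes> p [^] k | s (k::nat). s \<in> carrier R - P}"
    have one: "\<one> \<in> carrier R - P" using primeideal_one[OF pr(3)] by simp
    have inM: "s \<otimes> p [^] (k::nat) \<in> ?M" if "s \<in> carrier R - P" for s k using that by blast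
    obtain T where T: "primeideal T R" "?I \<subseteq> T" "T \<inter> ?M = {}"
    proof (rule prime_avoiding[OF N I(1)])
      show "\<one> \<in> ?M" using inM[OF one, of 0] by simp
      show "?M \<subseteq> carrier R" using pc by auto
      show "?I \<inter> ?M = {}" using n by blast
      fix u v assume "u \<in> ?M" "v \<in> ?M"
      then obtain s t and k m :: nat where uv: "s \<in> carrier R - P" "t \<in> carrier R - P" "u = s \<otimes> p [^] k" "v = t \<otimes> p [^] m"
        by blast
      have "u \<otimes> v = (s \<otimes> t) \<otimes> (p [^] k \<otimes> p [^] m)" using uv pc by (simp add: m_ac)
      also have "p [^] k \<otimes> p [^] m = p [^] (k + m)" using pc by (simp add: nat_pow_mult)
      finally have "u \<otimes> v = (s \<otimes> t) \<otimes> p [^] (k + m)" .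
      moreover have "s \<otimes> t \<in> carrier R - P" using primeideal.I_prime[OF pr(3), of s t] uv by auto
      ultimately show "u \<otimes> v \<in> ?M" using inM by simp
    qed (use that in blast)
    have TI: "ideal T R" using T(1) by (rule primeideal.axioms)
    have "T \<subseteq> P"
    proof
      fix s assume s: "s \<in> T"
      show "s \<in> P"
      proof (rule ccontr)
        assume "s \<notin> P"
        then have "s \<in> ?M" using inM[of s 0] ideal_closed(7)[OF TI s] by simp
        then show False using T(3) s by blast
      qed
    qed
    moreover have "p \<notin> T" using inM[OF one, of 1] T(3) pc by auto
    ultimately have "T \<subset> P" using p by blast
    then show False using noT[OF T(1)] T(2) I by blast
  qed
  let ?N = "sym_power Q Q0"
  note S = sym_power_facts[OF pr(2) I0 psubset_imp_subset[OF sub(1)]]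
  obtain k0 where k0: "\<And>k. k \<ge> k0 \<Longrightarrow> sat P (?N k <+> sat P ?I) = sat P (?N k0 <+> sat P ?I)"
    using fin_len_dcc[OF fin_len_sat[OF N pr(3) I(1) nil] pr(3), of ?N] S(1,3) by blast
  define k where "k = Suc k0"
  have eqk: "sat P (?N k <+> sat P ?I) = sat P (?N (Suc k) <+> sat P ?I)"
    using k0[of k] k0[of "Suc k"] unfolding k_def by simp
  have kQ: "?N k \<subseteq> Q"
  proof -
    have "?N (Suc m) \<subseteq> Q" for m by (induction m) (use S(3,6) in blast)+
    then show ?thesis unfolding k_def by blast
  qed
  note sI = sat_ideal[OF pr(3) I(1)]
  note sum = sum_ideal[OF S(1) sI(1)]
  \<comment> \<open>Up to factors outside \<open>P\<close>, stationarity writes \<open>r\<close> as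
    an element of the next symbolic power plus \<open>b \<otimes> a\<close>. Then
    \<open>b \<otimes> a\<close> lies in the symbolic power \<open>k\<close>, and since
    \<open>a\<close> is outside \<open>Q\<close> and this ideal is saturated at \<open>Q\<close>, so
    does \<open>b\<close>.\<close>
  have key: "\<exists>s\<in>carrier R - P. \<exists>n\<in>?N (Suc k). \<exists>b\<in>?N k. s \<otimes> r = n \<oplus> b \<otimes> a" if r: "r \<in> ?N k" for r
  proof -
    have rc: "r \<in> carrier R" using ideal_closed(7)[OF S(1) r] .
    have "r \<in> sat P (?N k <+> sat P ?I)"
      using sat_ideal(2)[OF pr(3) sum(1)[of k]] sum(2)[of k] r by blast
    then obtain s where s: "s \<in> carrier R - P" "s \<otimes> r \<in> ?N (Suc k) <+> sat P ?I" unfolding eqk by (auto simp: sat_def)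
    then obtain n i where n: "n \<in> ?N (Suc k)" "i \<in> sat P ?I" "s \<otimes> r = n \<oplus> i" using sum(4) by blast
    then obtain t where t: "t \<in> carrier R - P" "t \<otimes> i \<in> ?I" "i \<in> carrier R" by (auto simp: sat_def)
    then obtain q b where q: "q \<in> Q0" "b \<in> carrier R" "t \<otimes> i = q \<oplus> b \<otimes> a" using ideal_insert_mem[OF I0 ac] by blast
    have c: "n \<in> carrier R" "q \<in> carrier R" "s \<in> carrier R" "t \<in> carrier R"
      using ideal_closed(7)[OF S(1) n(1)] ideal_closed(7)[OF I0 q(1)] s t by auto
    have "(t \<otimes> s) \<otimes> r = t \<otimes> (s \<otimes> r)" using c rc by (simp add: m_assoc)
    also have "\<dots> = t \<otimes> n \<oplus> t \<otimes> i" unfolding n(3) using c t(3) by algebra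
    finally have eq: "(t \<otimes> s) \<otimes> r = (t \<otimes> n \<oplus> q) \<oplus> b \<otimes> a" unfolding q(3) using c q(2) ac by algebra
    have n': "t \<otimes> n \<oplus> q \<in> ?N (Suc k)"
      using ideal_closed(1,3)[OF S(1)[of "Suc k"]] n(1) c S(4)[of "Suc k"] q(1) by blast
    have "b \<otimes> a \<in> ?N k"
      using ideal_cancel[OF S(1), of "t \<otimes> n \<oplus> q" "b \<otimes> a" k] eq ideal_closed(3)[OF S(1) r, of "t \<otimes> s"] c n' S(3) q(2) ac
      by (metis m_closed subsetD)
    then have "b \<in> sat Q (?N k)" using aQ ac q(2) by (auto simp: sat_def m_comm)
    then have "b \<in> ?N k" using S(2) by simp
    moreover have "t \<otimes> s \<in> carrier R - P" using primeideal.I_prime[OF pr(3), of t s] s t by auto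
    ultimately show ?thesis using n' eq by blast
  qed
  have "?N k \<subseteq> sat P (?N (Suc k))"
  proof (rule nakayama[OF N pr(3) S(1) ideal_closed(8)[OF S(1)]])
    fix M assume M: "ideal M R" "?N (Suc k) \<subseteq> M" "\<And>p n. p \<in> P \<Longrightarrow> n \<in> ?N k \<Longrightarrow> p \<otimes> n \<in> M"
    show "?N k \<subseteq> sat P M"
    proof
      fix r assume r: "r \<in> ?N k"
      then obtain s n b where s: "s \<in> carrier R - P" "n \<in> ?N (Suc k)" "b \<in> ?N k" "s \<otimes> r = n \<oplus> b \<otimes> a" using key by blast
      have "b \<otimes> a \<in> M" using M(3)[OF a s(3)] m_comm[OF ac, of b] ideal_closed(7)[OF S(1) s(3)] by simp
      then have "s \<otimes> r \<in> M" unfolding s(4) using s(2) M(2) ideal_closed(1)[OF M(1)] by blast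
      then show "r \<in> sat P M" using s(1) ideal_closed(7)[OF S(1) r] by (auto simp: sat_def)
    qed
  qed
  also have "\<dots> \<subseteq> sat Q (?N (Suc k))" using sub(2) by (auto simp: sat_def)
  finally have 1: "?N k \<subseteq> ?N (Suc k)" unfolding S(2) .
  have "?N k \<subseteq> sat Q Q0"
  proof (rule nakayama[OF N pr(2) I0 ideal_closed(8)[OF S(1)]])
    fix M assume M: "ideal M R" "Q0 \<subseteq> M" "\<And>p n. p \<in> Q \<Longrightarrow> n \<in> ?N k \<Longrightarrow> p \<otimes> n \<in> M"
    have "Idl ({q \<otimes> n | q n. q \<in> Q \<and> n \<in> ?N k} \<union> Q0) \<subseteq> M"
      using M by (intro genideal_minimal) auto
    from sat_mono[OF this, of Q] show "?N k \<subseteq> sat Q M" using 1 unfolding sym_power.simps(2) by (rule subset_trans[rotated])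
  qed
  moreover have "sat Q Q0 \<subseteq> Q0"
    using primeideal.I_prime[OF pr(1)] sub(1) by (auto simp: sat_def)
  ultimately have kQ0: "?N k \<subseteq> Q0" by blast
  have "Q \<subseteq> Q0"
  proof
    fix q assume q: "q \<in> Q"
    have qc: "q \<in> carrier R" using ideal_closed(7)[OF IQ q] .
    have "q [^] k \<in> Q0" using S(5)[OF q] kQ0 by blast
    then show "q \<in> Q0"
    proof (induction k)
      case 0 then show ?case using primeideal_one[OF pr(1)] by simp
    next
      case (Suc k) then show ?case using primeideal.I_prime[OF pr(1), of "q [^] k" q] qc by auto
    qed
  qed
  then show False using sub by blast
qed

text \<open>The principal ideal theorem moves \<open>a\<close> down one prime at a time: the prime
  below the top is replaced by one containing \<open>a\<close>, and the shorter chain that ends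
  there is treated by induction.\<close>

lemma chain_through:
  assumes N: "noetherian_ring R"
  shows "prime_chain R n c \<Longrightarrow> 0 < n \<Longrightarrow> a \<in> c n \<Longrightarrow>
    \<exists>c'. prime_chain R n c' \<and> c' 0 = c 0 \<and> c' n = c n \<and> a \<in> c' 1"
proof (induction n arbitrary: c)
  case (Suc n)
  show ?case
  proof (cases n)
    case 0 then show ?thesis using Suc.prems by auto
  next
    case (Suc m)
    have pr: "primeideal (c m) R" "primeideal (c n) R" "primeideal (c (Suc n)) R"
      and sub: "c m \<subset> c n" "c n \<subset> c (Suc n)"
      using Suc.prems(1) Suc unfolding prime_chain_def by auto
    obtain T where T: "primeideal T R" "c m \<subset> T" "T \<subset> c (Suc n)" "a \<in> T"
    proof (cases "a \<in> c n")
      case True then show ?thesis using that pr sub by blast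
    next
      case False
      obtain T where "primeideal T R" "c m \<subseteq> T" "T \<subset> c (Suc n)" "a \<in> T"
        using principal_ideal_theorem[OF N pr sub Suc.prems(3)] by blast
      then show ?thesis using that False sub by blast
    qed
    have "prime_chain R n (c(n := T))"
      using Suc.prems(1) T Suc unfolding prime_chain_def by (auto simp: less_Suc_eq)
    from Suc.IH[OF this] obtain c' where c': "prime_chain R n c'" "c' 0 = c 0" "c' n = T" "a \<in> c' 1"
      using T(4) Suc by (auto simp del: One_nat_def)
    define d where "d = c'(Suc n := c (Suc n))"
    have "prime_chain R (Suc n) d"
      using c' T pr(3) unfolding prime_chain_def d_def by (auto simp: le_Suc_eq less_Suc_eq)
    moreover have "d 0 = c 0" "d (Suc n) = c (Suc n)" "a \<in> d 1" using c' Suc by (auto simp: d_def)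
    ultimately show ?thesis by blast
  qed
qed simp

text \<open>Each element of \<open>F\<close> costs one step of the chain: it is brought into the
  second prime and the bottom one is dropped. As \<open>card F < n\<close>, a proper inclusion
  remains below the top at the end.\<close>

lemma krull_chain:
  assumes N: "noetherian_ring R" and fin: "finite F"
  shows "prime_chain R n c \<Longrightarrow> card F < n \<Longrightarrow> F \<subseteq> c n \<Longrightarrow>
    \<exists>T. primeideal T R \<and> c 0 \<subseteq> T \<and> T \<subset> c n \<and> F \<subseteq> T"
  using fin
proof (induction F arbitrary: n c)
  case empty
  have "c 0 \<subset> c n" using empty.prems(1,2)
  proof (induction n)
    case (Suc n)
    then show ?case by (cases n) (auto simp: prime_chain_def)
  qed simp
  then show ?case using empty.prems(1) unfolding prime_chain_def by auto
next
  case (insert a F)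
  obtain c' where c': "prime_chain R n c'" "c' 0 = c 0" "c' n = c n" "a \<in> c' 1"
    using chain_through[OF N insert.prems(1), of a] insert.prems(2,3) by (metis card.empty gr_zeroI insert_subset not_less_zero)
  obtain m where m: "n = Suc m" using insert.prems(2) by (cases n) auto
  have "prime_chain R m (\<lambda>i. c' (Suc i))" using c'(1) unfolding prime_chain_def m by auto
  then obtain T where T: "primeideal T R" "c' 1 \<subseteq> T" "T \<subset> c' n" "F \<subseteq> T"
    using insert.IH[of m "\<lambda>i. c' (Suc i)"] insert.prems insert.hyps c'(3) m by auto
  have "c' 0 \<subset> c' 1" using c'(1) m unfolding prime_chain_def by auto
  then show ?case using T c' by (intro exI[of _ T]) auto
qed

text \<open>Zorn's lemma is applied to complements, which turns descending chains of primes into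
  ascending chains. The intersection of such a chain is prime because its members are
  comparable.\<close>

lemma minimal_prime:
  assumes N: "noetherian_ring R" and I: "ideal I R" "\<one> \<notin> I"
  obtains P where "primeideal P R" "I \<subseteq> P" "\<And>Q. primeideal Q R \<Longrightarrow> I \<subseteq> Q \<Longrightarrow> Q \<subseteq> P \<Longrightarrow> Q = P"
proof -
  define A where "A = {carrier R - P | P. primeideal P R \<and> I \<subseteq> P}"
  have "\<exists>M\<in>A. \<forall>N\<in>A. M \<subseteq> N \<longrightarrow> N = M"
  proof (rule subset_Zorn_nonempty)
    obtain T where "primeideal T R" "I \<subseteq> T"
      using prime_avoiding[OF N I(1), of "{\<one>}"] I(2) by auto
    then show "A \<noteq> {}" unfolding A_def by blast
    fix C assume C: "C \<noteq> {}" "subset.chain A C"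
    define D where "D = {P. primeideal P R \<and> I \<subseteq> P \<and> carrier R - P \<in> C}"
    have CD: "C = (\<lambda>P. carrier R - P) ` D"
    proof
      show "C \<subseteq> (\<lambda>P. carrier R - P) ` D"
      proof
        fix c assume c: "c \<in> C"
        then have "c \<in> A" using C(2) unfolding subset_chain_def by blast
        then obtain P where "c = carrier R - P" "primeideal P R" "I \<subseteq> P" unfolding A_def by blast
        then show "c \<in> (\<lambda>P. carrier R - P) ` D" using c unfolding D_def by blast
      qed
    qed (auto simp: D_def)
    have D0: "D \<noteq> {}" using C(1) CD by (metis image_empty)
    have DI: "ideal P R" if "P \<in> D" for P
      by (rule primeideal.axioms) (use that in \<open>simp add: D_def\<close>)
    have cmp: "P \<subseteq> Q \<or> Q \<subseteq> P" if PQ: "P \<in> D" "Q \<in> D" for P Q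
    proof -
      have "carrier R - P \<subseteq> carrier R - Q \<or> carrier R - Q \<subseteq> carrier R - P"
        using C(2) PQ unfolding subset_chain_def D_def by simp
      then show ?thesis using ideal_closed(8)[OF DI[OF PQ(1)]] ideal_closed(8)[OF DI[OF PQ(2)]] by blast
    qed
    have "primeideal (\<Inter>D) R"
    proof (rule primeidealI')
      show "ideal (\<Inter>D) R" using DI D0 by (intro i_Intersect) auto
      from D0 obtain P where "P \<in> D" by auto
      then show "\<one> \<notin> \<Inter>D" using primeideal_one[of P] unfolding D_def by auto
      fix a b assume ab: "a \<in> carrier R" "b \<in> carrier R" "a \<otimes> b \<in> \<Inter>D"
      show "a \<in> \<Inter>D \<or> b \<in> \<Inter>D"
      proof (rule ccontr)
        assume "\<not> ?thesis"
        then obtain P Q where PQ: "P \<in> D" "a \<notin> P" "Q \<in> D" "b \<notin> Q" by auto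
        have "primeideal P R" "primeideal Q R" "a \<otimes> b \<in> P" "a \<otimes> b \<in> Q"
          using PQ ab(3) unfolding D_def by auto
        then have "a \<in> P \<or> b \<in> P" "a \<in> Q \<or> b \<in> Q" using primeideal.I_prime ab(1,2) by metis+
        then show False using PQ(2,4) cmp[OF PQ(1,3)] by auto
      qed
    qed
    moreover have "I \<subseteq> \<Inter>D" unfolding D_def by auto
    moreover have "\<Union>C = carrier R - \<Inter>D" by (subst CD) auto
    ultimately show "\<Union>C \<in> A" unfolding A_def by auto
  qed
  then obtain M where M: "M \<in> A" "\<And>N. N \<in> A \<Longrightarrow> M \<subseteq> N \<Longrightarrow> N = M" by auto
  from M(1) obtain P where P: "primeideal P R" "I \<subseteq> P" "M = carrier R - P" unfolding A_def by auto
  have "Q = P" if Q: "primeideal Q R" "I \<subseteq> Q" "Q \<subseteq> P" for Q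
  proof -
    have "carrier R - Q \<in> A" unfolding A_def using Q(1,2) by auto
    then have "carrier R - Q = carrier R - P" using M(2) Q(3) P(3) by auto
    then show ?thesis using Q(3) ideal_closed(8)[OF primeideal.axioms(1)[OF P(1)]] by auto
  qed
  with P(1,2) show ?thesis by (rule that)
qed

text \<open>Over a prime minimal above the ideal of \<open>F\<close>, a chain with more than
  \<open>card F\<close> steps would produce a strictly smaller prime that still contains
  \<open>F\<close>.\<close>

theorem height_le_card:
  assumes N: "noetherian_ring R" and F: "finite F" "F \<subseteq> carrier R" "\<one> \<notin> Idl F" and K: "K \<subseteq> Idl F"
  shows "height R K \<le> enat (card F)"
proof -
  obtain P where P: "primeideal P R" "Idl F \<subseteq> P"
    and mn: "\<And>Q. primeideal Q R \<Longrightarrow> Idl F \<subseteq> Q \<Longrightarrow> Q \<subseteq> P \<Longrightarrow> Q = P"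
    using minimal_prime[OF N genideal_ideal[OF F(2)] F(3)] by blast
  have "prime_height R P \<le> enat (card F)"
    unfolding prime_height_def
  proof (rule SUP_least)
    fix n assume "n \<in> {n. \<exists>c. (\<forall>i\<le>n. primeideal (c i) R) \<and> (\<forall>i<n. c i \<subset> c (Suc i)) \<and> c n = P}"
    then obtain c where c: "prime_chain R n c" "c n = P" unfolding prime_chain_def by blast
    show "enat n \<le> enat (card F)"
    proof (rule ccontr)
      assume "\<not> enat n \<le> enat (card F)"
      then obtain T where T: "primeideal T R" "T \<subset> P" "F \<subseteq> T"
        using krull_chain[OF N F(1) c(1)] c(2) P(2) genideal_self[OF F(2)] by auto
      then have "Idl F \<subseteq> T" by (intro genideal_minimal) (auto intro: primeideal.axioms)
      then show False using mn[OF T(1)] T(2) by blast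
    qed
  qed
  moreover have "height R K \<le> prime_height R P"
    unfolding height_def using P K by (intro INF_lower) auto
  ultimately show ?thesis by (rule order_trans[rotated])
qed

end

context ring
begin

lemma noetherian_maximal_ex:
  assumes "noetherian_ring R" "ideal I R" "P I"
  shows "\<exists>M. ideal M R \<and> P M \<and> (\<forall>N. ideal N R \<longrightarrow> P N \<longrightarrow> M \<subseteq> N \<longrightarrow> N = M)"
  by (rule noetherian_maximal[where P = P, OF assms]) auto

end

section \<open>Noetherian local rings\<close>

context cring
begin

lemma prime_not_contains_Inter:
  assumes P: "primeideal P R" and fin: "finite \<F>"
    and F: "\<And>J. J \<in> \<F> \<Longrightarrow> ideal J R" "\<And>J. J \<in> \<F> \<Longrightarrow> \<not> J \<subseteq> P"
  shows "\<exists>z\<in>carrier R. (\<forall>J\<in>\<F>. z \<in> J) \<and> z \<notin> P"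
  using fin F
proof (induction \<F>)
  case empty
  show ?case using primeideal_one[OF P] by auto
next
  case (insert J \<F>)
  obtain z where z: "z \<in> carrier R" "\<forall>J\<in>\<F>. z \<in> J" "z \<notin> P" using insert by auto
  obtain y where y: "y \<in> J" "y \<notin> P" using insert.prems(2)[of J] by auto
  have yc: "y \<in> carrier R" using ideal_closed(7)[OF insert.prems(1) y(1)] by simp
  have "y \<otimes> z \<notin> P" using primeideal.I_prime[OF P yc z(1)] y z by auto
  moreover have "y \<otimes> z \<in> J" using ideal_closed(4)[OF insert.prems(1) y(1) z(1)] by simp
  moreover have "y \<otimes> z \<in> J'" if "J' \<in> \<F>" for J'
    using ideal_closed(3)[OF insert.prems(1), of J' z y] that z yc by simp
  ultimately show ?case using yc z by (intro bexI[of _ "y \<otimes> z"]) auto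
qed

text \<open>If \<open>y\<close> avoids the earlier primes but lies in \<open>P\<close>, it is
  corrected by some \<open>z\<close> that lies in \<open>I\<close> and in all earlier primes and
  outside \<open>P\<close>. Incomparability of the primes supplies this \<open>z\<close>.\<close>

lemma prime_avoidance:
  assumes I: "ideal I R" and fin: "finite \<P>" and pr: "\<And>P. P \<in> \<P> \<Longrightarrow> primeideal P R"
    and inc: "\<And>P Q. P \<in> \<P> \<Longrightarrow> Q \<in> \<P> \<Longrightarrow> P \<subseteq> Q \<Longrightarrow> P = Q" and nin: "\<And>P. P \<in> \<P> \<Longrightarrow> \<not> I \<subseteq> P"
  shows "\<exists>y\<in>I. \<forall>P\<in>\<P>. y \<notin> P"
  using fin pr inc nin
proof (induction \<P>)
  case empty
  then show ?case using ideal_closed(5)[OF I] by auto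
next
  case (insert P \<P>)
  have "\<exists>y\<in>I. \<forall>Q\<in>\<P>. y \<notin> Q"
    by (rule insert.IH) (use insert.prems in \<open>simp_all\<close>)
  then obtain y where y: "y \<in> I" "\<forall>Q\<in>\<P>. y \<notin> Q" by auto
  show ?case
  proof (cases "y \<in> P")
    case False
    then show ?thesis using y by auto
  next
    case True
    have P: "primeideal P R" using insert.prems(1) by simp
    have PI: "ideal P R" by (rule primeideal.axioms) (rule P)
    have QI: "ideal Q R" if "Q \<in> \<P>" for Q
      by (rule primeideal.axioms) (use insert.prems(1) that in simp)
    have "\<exists>z\<in>carrier R. (\<forall>J\<in>insert I \<P>. z \<in> J) \<and> z \<notin> P"
    proof (rule prime_not_contains_Inter[OF P])
      show "finite (insert I \<P>)" using insert.hyps by simp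
      show "ideal J R" if "J \<in> insert I \<P>" for J using that QI I by auto
      show "\<not> J \<subseteq> P" if "J \<in> insert I \<P>" for J
        using that insert.prems(2)[of J P] insert.prems(3)[of P] insert.hyps by auto
    qed
    then obtain z where z: "z \<in> carrier R" "z \<in> I" "\<forall>Q\<in>\<P>. z \<in> Q" "z \<notin> P" by auto
    have yc: "y \<in> carrier R" using ideal_closed(7)[OF I y(1)] .
    have "y \<oplus> z \<notin> P" using ideal_cancel[OF PI _ True z(1)] z(4) by auto
    moreover have "y \<oplus> z \<notin> Q" if "Q \<in> \<P>" for Q
      using ideal_cancel[OF QI[OF that], of z y] that z y yc by (auto simp: a_comm)
    ultimately show ?thesis using ideal_closed(1)[OF I y(1) z(2)] by auto
  qed
qed

text \<open>The witnesses of the maximal associated primes of the ring modulo \<open>I\<close>.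
  These primes cover all zerodivisors modulo \<open>I\<close>, and being pairwise incomparable they
  suit \<open>prime_avoidance\<close>.\<close>

definition max_colon :: "'a set \<Rightarrow> 'a \<Rightarrow> bool" where
  "max_colon I x \<longleftrightarrow> x \<in> carrier R \<and> x \<notin> I \<and>
    (\<forall>z\<in>carrier R. z \<notin> I \<longrightarrow> colon I x \<subseteq> colon I z \<longrightarrow> colon I z = colon I x)"

lemma max_colon_exists:
  assumes N: "noetherian_ring R" and I: "ideal I R" and y: "y \<in> carrier R" "y \<notin> I"
  obtains x where "max_colon I x" "colon I y \<subseteq> colon I x" "primeideal (colon I x) R"
  using max_colon_prime[OF assms] unfolding max_colon_def by metis

lemma max_colon_is_prime:
  assumes N: "noetherian_ring R" and I: "ideal I R" and x: "max_colon I x"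
  shows "primeideal (colon I x) R"
proof -
  obtain z where z: "max_colon I z" "colon I x \<subseteq> colon I z" "primeideal (colon I z) R"
    using max_colon_exists[OF N I, of x] x unfolding max_colon_def by auto
  then have "colon I z = colon I x" using x unfolding max_colon_def by auto
  then show ?thesis using z(3) by simp
qed

text \<open>Finitely many witnesses \<open>T\<close> generate all others modulo \<open>I\<close>.
  What kills \<open>T\<close> modulo \<open>I\<close> kills every witness \<open>x\<close>, so the
  prime colon at \<open>x\<close> contains the intersection of the colons at \<open>T\<close>, hence
  one of them, and equals it by maximality.\<close>

lemma finite_max_colons:
  assumes N: "noetherian_ring R" and I: "ideal I R"
  shows "finite (colon I ` {x. max_colon I x})"
proof -
  let ?S = "{x. max_colon I x}"
  have Sc: "?S \<subseteq> carrier R" unfolding max_colon_def by auto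
  define Q where "Q = (\<lambda>J. \<exists>T. finite T \<and> T \<subseteq> ?S \<and> J = Idl (I \<union> T))"
  have cI: "I \<union> T \<subseteq> carrier R" if "T \<subseteq> ?S" for T using that Sc ideal_closed(8)[OF I] by auto
  have "Q (Idl (I \<union> {}))" unfolding Q_def by auto
  from noetherian_maximal_ex[where P = Q, OF N genideal_ideal[OF cI] this]
  obtain J where J: "ideal J R" "Q J" and mx: "\<And>L. ideal L R \<Longrightarrow> Q L \<Longrightarrow> J \<subseteq> L \<Longrightarrow> L = J" by auto
  then obtain T where T: "finite T" "T \<subseteq> ?S" "J = Idl (I \<union> T)" unfolding Q_def by auto
  have all: "x \<in> J" if x: "x \<in> ?S" for x
  proof -
    have s: "insert x T \<subseteq> ?S" using T x by auto
    have "Q (Idl (I \<union> insert x T))" unfolding Q_def using T s by (intro exI[of _ "insert x T"]) auto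
    moreover have "J \<subseteq> Idl (I \<union> insert x T)" unfolding T(3) by (rule Idl_mono) (use cI[OF s] in auto)
    ultimately have "Idl (I \<union> insert x T) = J" using mx genideal_ideal[OF cI[OF s]] by auto
    then show ?thesis using genideal_self[OF cI[OF s]] by auto
  qed
  have "colon I ` ?S \<subseteq> colon I ` T"
  proof
    fix P assume "P \<in> colon I ` ?S"
    then obtain x where x: "max_colon I x" "P = colon I x" by auto
    have xc: "x \<in> carrier R" using x unfolding max_colon_def by auto
    have pr: "primeideal P R" using max_colon_is_prime[OF N I x(1)] x(2) by simp
    have "\<exists>t\<in>T. colon I t \<subseteq> P"
    proof (rule ccontr)
      assume no: "\<not> (\<exists>t\<in>T. colon I t \<subseteq> P)"
      have "\<exists>z\<in>carrier R. (\<forall>L\<in>colon I ` T. z \<in> L) \<and> z \<notin> P"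
        by (rule prime_not_contains_Inter[OF pr]) (use T Sc no colon_ideal[OF I] in auto)
      then obtain z where z: "z \<in> carrier R" "\<And>t. t \<in> T \<Longrightarrow> z \<otimes> t \<in> I" "z \<notin> P" by (auto simp: colon_def)
      have "Idl (I \<union> T) \<subseteq> colon I z"
      proof (rule genideal_minimal[OF colon_ideal[OF I z(1)]])
        show "I \<union> T \<subseteq> colon I z"
          using z ideal_closed(4,7)[OF I] T(2) Sc by (auto simp: colon_def m_comm subset_iff)
      qed
      then have "x \<in> colon I z" using all x T(3) by auto
      then show False using z x xc by (auto simp: colon_def m_comm)
    qed
    then obtain t where t: "t \<in> T" "colon I t \<subseteq> P" by auto
    then have "P = colon I t" using T(2) x(2) xc x(1) unfolding max_colon_def by auto
    then show "P \<in> colon I ` T" using t by auto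
  qed
  then show ?thesis by (rule finite_subset) (use T(1) in simp)
qed

end

section \<open>Units, socles and maximal regular sequences\<close>

locale noetherian_local = cring R + noetherian_ring R for R (structure) +
  assumes local: "local_ring R"
begin

lemma noeth: "noetherian_ring R" ..

abbreviation mm :: "'a set" where "mm \<equiv> max_ideal R"

lemma mm_maximal: "maximalideal mm R"
  using local theI'[of "\<lambda>M. maximalideal M R"] unfolding local_ring_def max_ideal_def by simp

lemma mm_unique: "maximalideal M R \<Longrightarrow> M = mm"
  using local mm_maximal unfolding local_ring_def by auto

lemma mm_ideal: "ideal mm R" by (rule maximalideal.axioms(1)[OF mm_maximal])

lemma mm_prime: "primeideal mm R" by (rule maximalideal_prime[OF mm_maximal])

lemma one_notin_mm: "\<one> \<notin> mm" by (rule primeideal_one[OF mm_prime])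

lemma mm_carr: "x \<in> mm \<Longrightarrow> x \<in> carrier R" by (rule ideal_closed(7)[OF mm_ideal])

lemma proper_in_mm:
  assumes I: "ideal I R" "\<one> \<notin> I"
  shows "I \<subseteq> mm"
proof -
  obtain M where M: "ideal M R" "\<one> \<notin> M" "I \<subseteq> M" and mx: "\<And>N. ideal N R \<Longrightarrow> \<one> \<notin> N \<Longrightarrow> M \<subseteq> N \<Longrightarrow> N = M"
    using noetherian_maximal[OF noeth I(1), of "\<lambda>M. \<one> \<notin> M", OF I(2)] by metis
  have "maximalideal M R"
  proof (rule maximalidealI[OF M(1)])
    show "carrier R \<noteq> M" using M(2) by auto
    fix J assume J: "ideal J R" "M \<subseteq> J" "J \<subseteq> carrier R"
    show "J = M \<or> J = carrier R"
    proof (cases "\<one> \<in> J")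
      case True then show ?thesis using ideal.one_imp_carrier[OF J(1)] by auto
    next
      case False then show ?thesis using mx[OF J(1)] J(2) by auto
    qed
  qed
  then show ?thesis using mm_unique M(3) by auto
qed

lemma unit_obtain:
  assumes a: "a \<in> carrier R" "a \<notin> mm"
  obtains b where "b \<in> carrier R" "b \<otimes> a = \<one>"
proof -
  have "\<one> \<in> Idl {a}"
    using proper_in_mm[OF genideal_ideal, of "{a}"] genideal_self[of "{a}"] a by auto
  then obtain q b where q: "q \<in> Idl {}" "b \<in> carrier R" "\<one> = q \<oplus> b \<otimes> a"
    using Idl_insert_mem[of "{}" a \<one>] a by auto
  then have "b \<otimes> a = \<one>" using a by (auto simp: Idl_empty)
  then show ?thesis using that q by auto
qed

text \<open>The zerodivisors modulo \<open>I\<close> lie in finitely many maximal colons. None of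
  these contains \<open>mm\<close>, because its witness would be an element of the socle outside
  \<open>I\<close>; prime avoidance then gives \<open>y\<close>.\<close>

lemma exists_nzd:
  assumes I: "ideal I R" and soc: "\<And>u. u \<in> carrier R \<Longrightarrow> (\<And>r. r \<in> mm \<Longrightarrow> r \<otimes> u \<in> I) \<Longrightarrow> u \<in> I"
  shows "\<exists>y\<in>mm. \<forall>a\<in>carrier R. y \<otimes> a \<in> I \<longrightarrow> a \<in> I"
proof -
  let ?P = "colon I ` {x. max_colon I x}"
  have "\<exists>y\<in>mm. \<forall>P\<in>?P. y \<notin> P"
  proof (rule prime_avoidance[OF mm_ideal finite_max_colons[OF noeth I]])
    show "primeideal P R" if "P \<in> ?P" for P using that max_colon_is_prime[OF noeth I] by auto
    show "P = Q" if "P \<in> ?P" "Q \<in> ?P" "P \<subseteq> Q" for P Q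
      using that unfolding max_colon_def by auto
    show "\<not> mm \<subseteq> P" if P: "P \<in> ?P" for P
    proof
      assume s: "mm \<subseteq> P"
      obtain x where x: "max_colon I x" "P = colon I x" using P by auto
      then have xc: "x \<in> carrier R" "x \<notin> I" unfolding max_colon_def by auto
      have "r \<otimes> x \<in> I" if "r \<in> mm" for r using s that x by (auto simp: colon_def)
      then show False using soc xc by auto
    qed
  qed
  then obtain y where y: "y \<in> mm" "\<And>P. P \<in> ?P \<Longrightarrow> y \<notin> P" by auto
  have "a \<in> I" if a: "a \<in> carrier R" "y \<otimes> a \<in> I" for a
  proof (rule ccontr)
    assume "a \<notin> I"
    then obtain x where x: "max_colon I x" "colon I a \<subseteq> colon I x"
      using max_colon_exists[OF noeth I a(1)] by metis
    have "y \<in> colon I a" using a mm_carr[OF y(1)] by (simp add: colon_def)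
    then show False using y(2)[of "colon I x"] x by auto
  qed
  then show ?thesis using y(1) by auto
qed

text \<open>The preimage of the socle of the ring modulo \<open>I\<close>. That it is not contained
  in \<open>I\<close> expresses depth zero of the quotient.\<close>

definition socle_gen :: "'a set \<Rightarrow> 'a set" where
  "socle_gen I = {u \<in> carrier R. \<forall>r\<in>mm. r \<otimes> u \<in> I}"

text \<open>Noetherianity is applied to the ideals generated by regular extensions of
  \<open>xs\<close>, so no bound on lengths has to be known beforehand. If the socle at a maximal
  such ideal were zero, a further nonzerodivisor would exist and would already lie in the ideal,
  which would then contain the unit element.\<close>

lemma extend_regular:
  assumes xs: "set xs \<subseteq> mm" "reg {} xs"
  obtains ys where "set ys \<subseteq> mm" "reg {} (xs @ ys)" "\<not> socle_gen (Idl (set (xs @ ys))) \<subseteq> Idl (set (xs @ ys))"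
proof -
  define Q where "Q = (\<lambda>J. \<exists>ys. set ys \<subseteq> mm \<and> reg {} (xs @ ys) \<and> J = Idl (set (xs @ ys)))"
  have c: "set (xs @ ys) \<subseteq> carrier R" if "set ys \<subseteq> mm" for ys using that xs mm_carr by auto
  have "Q (Idl (set (xs @ [])))" unfolding Q_def by (intro exI[of _ "[]"]) (use xs in auto)
  from noetherian_maximal_ex[where P = Q, OF noeth genideal_ideal[OF c] this]
  obtain J where J: "ideal J R" "Q J" and mx: "\<And>L. ideal L R \<Longrightarrow> Q L \<Longrightarrow> J \<subseteq> L \<Longrightarrow> L = J" by auto
  then obtain ys where ys: "set ys \<subseteq> mm" "reg {} (xs @ ys)" "J = Idl (set (xs @ ys))" unfolding Q_def by auto
  have "\<not> socle_gen J \<subseteq> J"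
  proof
    assume s: "socle_gen J \<subseteq> J"
    then obtain y where y: "y \<in> mm" "\<And>a. a \<in> carrier R \<Longrightarrow> y \<otimes> a \<in> J \<Longrightarrow> a \<in> J"
      using exists_nzd[OF J(1)] unfolding socle_gen_def by auto
    let ?ys = "ys @ [y]"
    have m: "set ?ys \<subseteq> mm" using ys y by auto
    have "reg {} (xs @ ?ys)"
      using reg_snoc[of "{}" "xs @ ys" y] ys(2,3) y(2) by (auto simp: nzd_def)
    then have "Q (Idl (set (xs @ ?ys)))" unfolding Q_def using m by (intro exI[of _ ?ys] conjI refl)
    moreover have "J \<subseteq> Idl (set (xs @ ?ys))" unfolding ys(3) by (rule Idl_mono) (use c[OF m] in auto)
    ultimately have "Idl (set (xs @ ?ys)) = J" using mx genideal_ideal[OF c[OF m]] by auto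
    then have "y \<in> J" using genideal_self[OF c[OF m]] by auto
    then have "\<one> \<in> J" using y(2)[of \<one>] mm_carr[OF y(1)] by simp
    moreover have "J \<subseteq> mm" unfolding ys(3) by (rule genideal_minimal[OF mm_ideal]) (use ys xs in auto)
    ultimately show False using one_notin_mm by auto
  qed
  then show ?thesis using that ys by auto
qed

end

lemma noetherian_localI: "noetherian_ring R \<Longrightarrow> local_ring R \<Longrightarrow> noetherian_local R"
  unfolding noetherian_local_def noetherian_local_axioms_def local_ring_def by auto

section \<open>Free modules and linear independence\<close>

context cring
begin

abbreviation free :: "nat \<Rightarrow> ('a, nat \<Rightarrow> 'a) module" where "free p \<equiv> free_module R p"

definition unit_vec :: "nat \<Rightarrow> nat \<Rightarrow> nat \<Rightarrow> 'a" where
  "unit_vec p j = (\<lambda>i\<in>{..<p}. if i = j then \<one> else \<zero>)"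

lemma free_simps [simp]:
  "carrier (free p) = {..<p} \<rightarrow>\<^sub>E carrier R"
  "v \<oplus>\<^bsub>free p\<^esub> w = (\<lambda>i\<in>{..<p}. v i \<oplus> w i)"
  "\<zero>\<^bsub>free p\<^esub> = (\<lambda>i\<in>{..<p}. \<zero>)"
  "r \<odot>\<^bsub>free p\<^esub> v = (\<lambda>i\<in>{..<p}. r \<otimes> v i)"
  by (simp_all add: free_module_def)

lemma free_ext: "v \<in> carrier (free p) \<Longrightarrow> w \<in> carrier (free p) \<Longrightarrow> (\<And>i. i < p \<Longrightarrow> v i = w i) \<Longrightarrow> v = w"
  by (auto intro: PiE_ext)

lemma free_coord [simp]: "v \<in> {..<p} \<rightarrow>\<^sub>E carrier R \<Longrightarrow> i < p \<Longrightarrow> v i \<in> carrier R"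
  by auto

lemma free_is_module: "module R (free p)"
proof (rule moduleI)
  show "cring R" by (rule is_cring)
  show "abelian_group (free p)"
  proof (rule abelian_groupI)
    fix x y z assume x: "x \<in> carrier (free p)" "y \<in> carrier (free p)" "z \<in> carrier (free p)"
    then have c: "x i \<in> carrier R" "y i \<in> carrier R" "z i \<in> carrier R" if "i < p" for i using that by auto
    show "x \<oplus>\<^bsub>free p\<^esub> y \<in> carrier (free p)" using c by simp
    show "x \<oplus>\<^bsub>free p\<^esub> y \<oplus>\<^bsub>free p\<^esub> z = x \<oplus>\<^bsub>free p\<^esub> (y \<oplus>\<^bsub>free p\<^esub> z)"
      using c by (intro free_ext[where p = p]) (simp_all add: a_assoc)
    show "x \<oplus>\<^bsub>free p\<^esub> y = y \<oplus>\<^bsub>free p\<^esub> x" using c by (intro free_ext[where p = p]) (simp_all add: a_comm)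
    show "\<zero>\<^bsub>free p\<^esub> \<oplus>\<^bsub>free p\<^esub> x = x" using x c by (intro free_ext[where p = p]) simp_all
    show "\<exists>y\<in>carrier (free p). y \<oplus>\<^bsub>free p\<^esub> x = \<zero>\<^bsub>free p\<^esub>"
      using x c by (intro bexI[of _ "\<lambda>i\<in>{..<p}. \<ominus> x i"] free_ext[where p = p]) (simp_all add: l_neg)
  qed simp
next
  fix a b x y assume a: "a \<in> carrier R" "b \<in> carrier R"
  assume x: "x \<in> carrier (free p)" "y \<in> carrier (free p)"
  then have c: "x i \<in> carrier R" "y i \<in> carrier R" if "i < p" for i using that by auto
  show "(a \<oplus> b) \<odot>\<^bsub>free p\<^esub> x = a \<odot>\<^bsub>free p\<^esub> x \<oplus>\<^bsub>free p\<^esub> b \<odot>\<^bsub>free p\<^esub> x"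
    using a c by (intro free_ext[where p = p]) (simp_all add: l_distr)
  show "a \<odot>\<^bsub>free p\<^esub> (x \<oplus>\<^bsub>free p\<^esub> y) = a \<odot>\<^bsub>free p\<^esub> x \<oplus>\<^bsub>free p\<^esub> a \<odot>\<^bsub>free p\<^esub> y"
    using a c by (intro free_ext[where p = p]) (simp_all add: r_distr)
  show "(a \<otimes> b) \<odot>\<^bsub>free p\<^esub> x = a \<odot>\<^bsub>free p\<^esub> (b \<odot>\<^bsub>free p\<^esub> x)"
    using a c by (intro free_ext[where p = p]) (simp_all add: m_assoc)
next
  fix a x assume a: "a \<in> carrier R" and x: "x \<in> carrier (free p)"
  then have c: "x i \<in> carrier R" if "i < p" for i using that by auto
  show "a \<odot>\<^bsub>free p\<^esub> x \<in> carrier (free p)" using a c by simp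
next
  fix x assume x: "x \<in> carrier (free p)"
  then have c: "x i \<in> carrier R" if "i < p" for i using that by auto
  show "\<one> \<odot>\<^bsub>free p\<^esub> x = x" using x c by (intro free_ext[where p = p]) simp_all
qed

lemma unit_vec_in [simp]: "unit_vec p j \<in> {..<p} \<rightarrow>\<^sub>E carrier R"
  by (auto simp: unit_vec_def)

text \<open>Submodules as plain subsets; negatives come from the scalar minus one.\<close>

definition lsub :: "('a, 'c, 'm) module_scheme \<Rightarrow> 'c set \<Rightarrow> bool" where
  "lsub N S \<longleftrightarrow> S \<subseteq> carrier N \<and> \<zero>\<^bsub>N\<^esub> \<in> S \<and> (\<forall>x\<in>S. \<forall>y\<in>S. x \<oplus>\<^bsub>N\<^esub> y \<in> S) \<and> (\<forall>r\<in>carrier R. \<forall>x\<in>S. r \<odot>\<^bsub>N\<^esub> x \<in> S)"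

text \<open>Serves as an induction principle: an identity whose solutions form a submodule holds on
  the whole free module once it holds at the unit vectors.\<close>

lemma free_span:
  assumes S: "lsub (free p) S" and b: "\<And>j. j < p \<Longrightarrow> unit_vec p j \<in> S" and v: "v \<in> carrier (free p)"
  shows "v \<in> S"
proof -
  have "(\<lambda>i\<in>{..<p}. if i < k then v i else \<zero>) \<in> S" if "k \<le> p" for k
    using that
  proof (induction k)
    case 0
    then show ?case using S by (simp add: lsub_def restrict_def)
  next
    case (Suc k)
    let ?w = "\<lambda>i\<in>{..<p}. if i < k then v i else \<zero>"
    have "?w \<oplus>\<^bsub>free p\<^esub> (v k \<odot>\<^bsub>free p\<^esub> unit_vec p k) \<in> S"
    proof -
      have w: "?w \<in> S" by (rule Suc.IH) (use Suc.prems in simp)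
      have k: "v k \<in> carrier R" "unit_vec p k \<in> S" using Suc.prems v b[of k] by auto
      have "v k \<odot>\<^bsub>free p\<^esub> unit_vec p k \<in> S" using S k unfolding lsub_def by (simp del: free_simps)
      then show ?thesis using S w unfolding lsub_def by (simp del: free_simps)
    qed
    moreover have "?w \<oplus>\<^bsub>free p\<^esub> (v k \<odot>\<^bsub>free p\<^esub> unit_vec p k) = (\<lambda>i\<in>{..<p}. if i < Suc k then v i else \<zero>)"
    proof (rule free_ext[where p = p])
      have c: "v i \<in> carrier R" if "i < p" for i using v that by auto
      fix i assume i: "i < p"
      then show "(?w \<oplus>\<^bsub>free p\<^esub> (v k \<odot>\<^bsub>free p\<^esub> unit_vec p k)) i = (\<lambda>i\<in>{..<p}. if i < Suc k then v i else \<zero>) i"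
        using c[OF i] c[of k] Suc.prems by (simp add: unit_vec_def less_Suc_eq)
    qed (use v Suc.prems in \<open>auto simp: unit_vec_def\<close>)
    ultimately show ?case by (simp only:)
  qed
  from this[of p] have "(\<lambda>i\<in>{..<p}. if i < p then v i else \<zero>) \<in> S" by (simp only: order_refl)
  also have "(\<lambda>i\<in>{..<p}. if i < p then v i else \<zero>) = v" using v by (intro free_ext[where p = p]) auto
  finally show ?thesis .
qed

lemma module_homD:
  assumes "f \<in> module_hom R M N"
  shows "x \<in> carrier M \<Longrightarrow> f x \<in> carrier N"
    "x \<in> carrier M \<Longrightarrow> y \<in> carrier M \<Longrightarrow> f (x \<oplus>\<^bsub>M\<^esub> y) = f x \<oplus>\<^bsub>N\<^esub> f y"
    "r \<in> carrier R \<Longrightarrow> x \<in> carrier M \<Longrightarrow> f (r \<odot>\<^bsub>M\<^esub> x) = r \<odot>\<^bsub>N\<^esub> f x"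
    "f \<in> extensional (carrier M)"
  using assms by (auto simp: module_hom_def PiE_def)

lemma module_homI:
  assumes "\<And>x. x \<in> carrier M \<Longrightarrow> f x \<in> carrier N"
    "\<And>x y. x \<in> carrier M \<Longrightarrow> y \<in> carrier M \<Longrightarrow> x \<oplus>\<^bsub>M\<^esub> y \<in> carrier M \<Longrightarrow> f (x \<oplus>\<^bsub>M\<^esub> y) = f x \<oplus>\<^bsub>N\<^esub> f y"
    "\<And>r x. r \<in> carrier R \<Longrightarrow> x \<in> carrier M \<Longrightarrow> r \<odot>\<^bsub>M\<^esub> x \<in> carrier M \<Longrightarrow> f (r \<odot>\<^bsub>M\<^esub> x) = r \<odot>\<^bsub>N\<^esub> f x"
    and M: "module R M"
  shows "restrict f (carrier M) \<in> module_hom R M N"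
proof -
  interpret M: module R M by (rule M)
  show ?thesis unfolding module_hom_def using assms(1-3) by auto
qed

lemma module_hom_zero:
  assumes "f \<in> module_hom R M N" "module R M" "module R N"
  shows "f \<zero>\<^bsub>M\<^esub> = \<zero>\<^bsub>N\<^esub>"
proof -
  interpret M: module R M by fact
  interpret N: module R N by fact
  have "f (\<zero> \<odot>\<^bsub>M\<^esub> \<zero>\<^bsub>M\<^esub>) = \<zero> \<odot>\<^bsub>N\<^esub> f \<zero>\<^bsub>M\<^esub>" by (rule module_homD(3)[OF assms(1)]) auto
  then show ?thesis using module_homD(1)[OF assms(1)] by simp
qed

lemma free_hom_exists:
  assumes N: "module R N" and w: "\<And>j. j < p \<Longrightarrow> w j \<in> carrier N"
  obtains f where "f \<in> module_hom R (free p) N" "\<And>j. j < p \<Longrightarrow> f (unit_vec p j) = w j"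
    "\<And>v. v \<in> carrier (free p) \<Longrightarrow> f v = (\<Oplus>\<^bsub>N\<^esub>j\<in>{..<p}. v j \<odot>\<^bsub>N\<^esub> w j)"
proof -
  interpret N: module R N by fact
  let ?f = "\<lambda>v. \<Oplus>\<^bsub>N\<^esub>j\<in>{..<p}. v j \<odot>\<^bsub>N\<^esub> w j"
  have "restrict ?f (carrier (free p)) \<in> module_hom R (free p) N"
  proof (rule module_homI)
    fix v u assume vu: "v \<in> carrier (free p)" "u \<in> carrier (free p)"
    have "?f (v \<oplus>\<^bsub>free p\<^esub> u) = (\<Oplus>\<^bsub>N\<^esub>j\<in>{..<p}. v j \<odot>\<^bsub>N\<^esub> w j \<oplus>\<^bsub>N\<^esub> u j \<odot>\<^bsub>N\<^esub> w j)"
      using vu w by (intro N.add.finprod_cong') (simp_all add: N.smult_l_distr Pi_iff del: PiE_iff)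
    also have "\<dots> = ?f v \<oplus>\<^bsub>N\<^esub> ?f u" using vu w by (intro N.finsum_addf) (simp_all add: Pi_iff)
    finally show "?f (v \<oplus>\<^bsub>free p\<^esub> u) = ?f v \<oplus>\<^bsub>N\<^esub> ?f u" .
  next
    fix r v assume rv: "r \<in> carrier R" "v \<in> carrier (free p)"
    have "?f (r \<odot>\<^bsub>free p\<^esub> v) = (\<Oplus>\<^bsub>N\<^esub>j\<in>{..<p}. r \<odot>\<^bsub>N\<^esub> (v j \<odot>\<^bsub>N\<^esub> w j))"
      using rv w by (intro N.add.finprod_cong') (simp_all add: N.smult_assoc1 Pi_iff del: PiE_iff)
    also have "\<dots> = r \<odot>\<^bsub>N\<^esub> ?f v" using rv w by (subst N.finsum_smult_ldistr) (simp_all add: Pi_iff)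
    finally show "?f (r \<odot>\<^bsub>free p\<^esub> v) = r \<odot>\<^bsub>N\<^esub> ?f v" .
  next
    fix v assume "v \<in> carrier (free p)"
    then show "?f v \<in> carrier N" using w by (intro N.finsum_closed) (simp add: Pi_iff)
  qed (rule free_is_module)
  moreover have "restrict ?f (carrier (free p)) (unit_vec p j) = w j" if j: "j < p" for j
  proof -
    have "?f (unit_vec p j) = (\<Oplus>\<^bsub>N\<^esub>i\<in>{..<p}. if j = i then w i else \<zero>\<^bsub>N\<^esub>)"
      using w by (intro N.add.finprod_cong') (auto simp: unit_vec_def)
    also have "\<dots> = w j" using j w by (subst N.add.finprod_singleton) auto
    finally show ?thesis by simp
  qed
  ultimately show ?thesis by (rule that[of "restrict ?f (carrier (free p))"]) (simp_all only: restrict_apply')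
qed

lemma module_hom_eqI:
  assumes "f \<in> module_hom R M N" "g \<in> module_hom R M N" "\<And>x. x \<in> carrier M \<Longrightarrow> f x = g x"
  shows "f = g"
  using assms module_homD(4) extensionalityI by metis

lemma lsub_vimage_eq:
  assumes "f \<in> module_hom R M N" "g \<in> module_hom R M N" "module R M" "module R N"
  shows "lsub M {x \<in> carrier M. f x = g x}"
proof -
  interpret M: module R M by fact
  interpret N: module R N by fact
  show ?thesis unfolding lsub_def
    using module_homD[OF assms(1)] module_homD[OF assms(2)] module_hom_zero[OF assms(1)] module_hom_zero[OF assms(2)] assms(3,4)
    by auto
qed

lemma free_hom_eq:
  assumes "f \<in> module_hom R (free p) N" "g \<in> module_hom R (free p) N" "module R N"
    and "\<And>j. j < p \<Longrightarrow> f (unit_vec p j) = g (unit_vec p j)" and "v \<in> carrier (free p)"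
  shows "f v = g v"
  using free_span[OF lsub_vimage_eq[OF assms(1,2) free_is_module assms(3)] _ assms(5)] assms(4) by auto

lemma lsub_vimage:
  assumes f: "f \<in> module_hom R M N" and MN: "module R M" "module R N" and S: "lsub N S"
  shows "lsub M {x \<in> carrier M. f x \<in> S}"
proof -
  interpret M: module R M by fact
  interpret N: module R N by fact
  show ?thesis using S module_homD[OF f] module_hom_zero[OF f MN] unfolding lsub_def by auto
qed

lemma lsub_image:
  assumes f: "f \<in> module_hom R M N" and MN: "module R M" "module R N"
  shows "lsub N (f ` carrier M)"
proof -
  interpret M: module R M by fact
  interpret N: module R N by fact
  show ?thesis unfolding lsub_def
  proof (intro conjI ballI)
    show "\<zero>\<^bsub>N\<^esub> \<in> f ` carrier M" using module_hom_zero[OF f MN] by (metis M.zero_closed image_eqI)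
    fix x y assume "x \<in> f ` carrier M" "y \<in> f ` carrier M"
    then obtain a b where ab: "a \<in> carrier M" "b \<in> carrier M" "x = f a" "y = f b" by auto
    then have "x \<oplus>\<^bsub>N\<^esub> y = f (a \<oplus>\<^bsub>M\<^esub> b)" using module_homD(2)[OF f] by simp
    then show "x \<oplus>\<^bsub>N\<^esub> y \<in> f ` carrier M" using ab by auto
  next
    fix r x assume "r \<in> carrier R" "x \<in> f ` carrier M"
    then obtain a where a: "a \<in> carrier M" "x = f a" "r \<in> carrier R" by auto
    then have "r \<odot>\<^bsub>N\<^esub> x = f (r \<odot>\<^bsub>M\<^esub> a)" using module_homD(3)[OF f] by simp
    then show "r \<odot>\<^bsub>N\<^esub> x \<in> f ` carrier M" using a by auto
  qed (use module_homD(1)[OF f] in auto)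
qed

text \<open>Projectivity of free modules: preimages are chosen at the unit vectors and extended
  linearly.\<close>

lemma free_lift:
  assumes d: "d \<in> module_hom R M N" and M: "module R M" "module R N"
    and f: "f \<in> module_hom R (free p) N" and im: "\<And>v. v \<in> carrier (free p) \<Longrightarrow> f v \<in> d ` carrier M"
  obtains h where "h \<in> module_hom R (free p) M" "\<And>v. v \<in> carrier (free p) \<Longrightarrow> d (h v) = f v"
proof -
  have "\<exists>x\<in>carrier M. d x = f (unit_vec p j)" for j using im[of "unit_vec p j"] by auto
  then obtain w where w: "\<And>j. w j \<in> carrier M" "\<And>j. d (w j) = f (unit_vec p j)" by metis
  obtain h where h: "h \<in> module_hom R (free p) M" "\<And>j. j < p \<Longrightarrow> h (unit_vec p j) = w j"
    by (rule free_hom_exists[OF M(1), of p w]) (use w(1) in \<open>blast+\<close>)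
  let ?S = "{v \<in> carrier (free p). d (h v) = f v}"
  interpret F: module R "free p" by (rule free_is_module)
  have "lsub (free p) ?S"
    unfolding lsub_def using module_homD[OF h(1)] module_homD[OF f] module_homD[OF d]
      module_hom_zero[OF h(1) free_is_module M(1)] module_hom_zero[OF f free_is_module M(2)] module_hom_zero[OF d M]
      F.a_closed F.smult_closed F.zero_closed
    by (simp del: free_simps)
  then have "d (h v) = f v" if "v \<in> carrier (free p)" for v
    using free_span[of p ?S v] h(2) w(2) that by auto
  then show ?thesis using that h(1) by auto
qed

end

section \<open>Finite generation of submodules of free modules\<close>

context noetherian_ring
begin

text \<open>Induction on the rank: the last coordinates of \<open>U\<close> form a finitely
  generated ideal, and the vectors of \<open>U\<close> whose last coordinate is zero live in rank
  \<open>p\<close>. That \<open>G\<close> generates \<open>U\<close> is expressed by the submodules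
  \<open>S\<close> containing \<open>G\<close>, in place of a span.\<close>

lemma fg_submodule_aux:
  assumes "cring R"
  shows "cring.lsub R (free_module R p) U \<Longrightarrow> \<exists>G. finite G \<and> G \<subseteq> U \<and> (\<forall>S. cring.lsub R (free_module R p) S \<longrightarrow> G \<subseteq> S \<longrightarrow> U \<subseteq> S)"
proof (induction p arbitrary: U)
  case 0
  interpret cring R by fact
  show ?case
  proof (intro exI[of _ "{}"] conjI allI impI)
    fix S assume S: "lsub (free 0) S"
    have "U \<subseteq> {\<lambda>x. undefined}" using 0 unfolding lsub_def by auto
    moreover have "(\<lambda>x. undefined) \<in> S" using S unfolding lsub_def by (auto simp: restrict_def)
    ultimately show "U \<subseteq> S" by auto
  qed auto
next
  case (Suc p)
  interpret cring R by fact
  note U = Suc.prems[unfolded lsub_def free_simps]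
  let ?L = "(\<lambda>u. u p) ` U"
  have "ideal ?L R"
  proof (rule ideal_setI)
    show "?L \<subseteq> carrier R" using U by auto
    show "\<zero> \<in> ?L" using U by (intro image_eqI[of _ _ "\<lambda>i\<in>{..<Suc p}. \<zero>"]) auto
    fix x y assume "x \<in> ?L" "y \<in> ?L"
    then obtain u v where uv: "u \<in> U" "v \<in> U" "x = u p" "y = v p" by auto
    then show "x \<oplus> y \<in> ?L" using U by (intro image_eqI[of _ _ "\<lambda>i\<in>{..<Suc p}. u i \<oplus> v i"]) auto
  next
    fix r x assume r: "r \<in> carrier R" and "x \<in> ?L"
    then obtain u where "u \<in> U" "x = u p" by auto
    then show "r \<otimes> x \<in> ?L" using U r by (intro image_eqI[of _ _ "\<lambda>i\<in>{..<Suc p}. r \<otimes> u i"]) auto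
  qed
  then obtain A where A: "A \<subseteq> carrier R" "finite A" "?L = Idl A" using finetely_gen by metis
  have "A \<subseteq> ?L" using A genideal_self by auto
  then obtain G1 where G1: "finite G1" "G1 \<subseteq> U" "A = (\<lambda>u. u p) ` G1" using A(2) by (metis finite_subset_image)
  define emb where "emb = (\<lambda>v :: nat \<Rightarrow> 'a. \<lambda>i\<in>{..<Suc p}. if i < p then v i else \<zero>)"
  let ?U' = "{v \<in> carrier (free p). emb v \<in> U}"
  have emb_sub: "lsub (free p) {v \<in> carrier (free p). emb v \<in> S}" if S: "lsub (free (Suc p)) S" for S
  proof -
    have "emb (\<lambda>i\<in>{..<p}. \<zero>) = (\<lambda>i\<in>{..<Suc p}. \<zero>)" by (auto simp: emb_def intro!: restrict_ext)
    moreover have "emb (\<lambda>i\<in>{..<p}. v i \<oplus> w i) = (\<lambda>i\<in>{..<Suc p}. emb v i \<oplus> emb w i)" for v w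
      by (auto simp: emb_def intro!: restrict_ext)
    moreover have "emb (\<lambda>i\<in>{..<p}. r \<otimes> v i) = (\<lambda>i\<in>{..<Suc p}. r \<otimes> emb v i)" if "r \<in> carrier R" for r v
      using that by (auto simp: emb_def intro!: restrict_ext)
    ultimately show ?thesis using S unfolding lsub_def by auto
  qed
  obtain G' where G': "finite G'" "G' \<subseteq> ?U'" "\<And>S. lsub (free p) S \<Longrightarrow> G' \<subseteq> S \<Longrightarrow> ?U' \<subseteq> S"
    using Suc.IH[OF emb_sub[OF Suc.prems]] by auto
  show ?case
  proof (intro exI[of _ "G1 \<union> emb ` G'"] conjI allI impI)
    show "finite (G1 \<union> emb ` G')" using G1 G' by auto
    show "G1 \<union> emb ` G' \<subseteq> U" using G1 G' by auto
    fix S assume S: "lsub (free (Suc p)) S" and GS: "G1 \<union> emb ` G' \<subseteq> S"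
    note S' = S[unfolded lsub_def free_simps]
    have "?U' \<subseteq> {v \<in> carrier (free p). emb v \<in> S}"
      using G'(2) GS by (intro G'(3)[OF emb_sub[OF S]]) auto
    then have embS: "emb v \<in> S" if "v \<in> carrier (free p)" "emb v \<in> U" for v using that by auto
    let ?L' = "(\<lambda>u. u p) ` (S \<inter> U)"
    have "ideal ?L' R"
    proof (rule ideal_setI)
      show "?L' \<subseteq> carrier R" using U by auto
      show "\<zero> \<in> ?L'" using U S' by (intro image_eqI[of _ _ "\<lambda>i\<in>{..<Suc p}. \<zero>"]) auto
      fix x y assume "x \<in> ?L'" "y \<in> ?L'"
      then obtain u v where uv: "u \<in> S \<inter> U" "v \<in> S \<inter> U" "x = u p" "y = v p" by auto
      then show "x \<oplus> y \<in> ?L'" using U S' by (intro image_eqI[of _ _ "\<lambda>i\<in>{..<Suc p}. u i \<oplus> v i"]) auto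
    next
      fix r x assume r: "r \<in> carrier R" and "x \<in> ?L'"
      then obtain u where "u \<in> S \<inter> U" "x = u p" by auto
      then show "r \<otimes> x \<in> ?L'" using U S' r by (intro image_eqI[of _ _ "\<lambda>i\<in>{..<Suc p}. r \<otimes> u i"]) auto
    qed
    \<comment> \<open>Every last coordinate on \<open>U\<close> is attained on
      \<open>S \<inter> U\<close>, so each \<open>u\<close> differs from such a vector by one that
      comes from rank \<open>p\<close>.\<close>
    then have LL: "?L \<subseteq> ?L'" unfolding A(3) using G1 GS by (intro genideal_minimal) auto
    show "U \<subseteq> S"
    proof
      fix u assume u: "u \<in> U"
      then obtain y where y: "y \<in> S" "y \<in> U" "u p = y p" using LL by auto
      have uc: "u i \<in> carrier R" "y i \<in> carrier R" if "i < Suc p" for i using U u y that by auto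
      let ?z = "\<lambda>i\<in>{..<p}. u i \<oplus> \<ominus> \<one> \<otimes> y i"
      have z: "(\<lambda>i\<in>{..<Suc p}. \<ominus> \<one> \<otimes> y i) \<in> U" using U y(2) by simp
      have z: "(\<lambda>i\<in>{..<Suc p}. u i \<oplus> (\<lambda>i\<in>{..<Suc p}. \<ominus> \<one> \<otimes> y i) i) \<in> U"
        using U(1) u z by (simp del: restrict_apply)
      also have "(\<lambda>i\<in>{..<Suc p}. u i \<oplus> (\<lambda>i\<in>{..<Suc p}. \<ominus> \<one> \<otimes> y i) i) = emb ?z"
        using uc y(3) by (auto simp: emb_def less_Suc_eq l_minus r_neg intro!: restrict_ext)
      finally have "emb ?z \<in> S" using uc by (intro embS) auto
      then have "(\<lambda>i\<in>{..<Suc p}. emb ?z i \<oplus> y i) \<in> S" using S' y by auto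
      also have "(\<lambda>i\<in>{..<Suc p}. emb ?z i \<oplus> y i) = u"
      proof (rule free_ext[where p = "Suc p"])
        have e: "emb ?z i = (if i < p then u i \<oplus> \<ominus> \<one> \<otimes> y i else \<zero>)" if "i < Suc p" for i
          using that by (auto simp: emb_def)
        then have ec: "emb ?z i \<in> carrier R" if "i < Suc p" for i using uc that by auto
        show "(\<lambda>i\<in>{..<Suc p}. emb ?z i \<oplus> y i) \<in> carrier (free (Suc p))"
          unfolding free_simps(1) by (rule restrict_PiE_iff[THEN iffD2]) (use ec uc in simp)
        show "u \<in> carrier (free (Suc p))" using U u by auto
        show "(\<lambda>i\<in>{..<Suc p}. emb ?z i \<oplus> y i) i = u i" if i: "i < Suc p" for i
          using i e[OF i] uc[OF i] y(3) by (cases "i = p") (simp_all add: l_minus a_assoc l_neg)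
      qed
      finally show "u \<in> S" .
    qed
  qed
qed

end

context cring
begin

lemma fg_submodule:
  assumes N: "noetherian_ring R" and U: "lsub (free p) U"
  obtains q d where "d \<in> module_hom R (free q) (free p)" "d ` carrier (free q) = U"
proof -
  from noetherian_ring.fg_submodule_aux[OF N is_cring U]
  obtain G where G: "finite G" "G \<subseteq> U" "\<forall>S. lsub (free p) S \<longrightarrow> G \<subseteq> S \<longrightarrow> U \<subseteq> S"
    by (elim exE conjE)
  obtain gs where gs: "set gs = G" using finite_list[OF G(1)] by auto
  have gc: "gs ! j \<in> U" if "j < length gs" for j using that gs G(2) by auto
  have Uc: "U \<subseteq> carrier (free p)" using U unfolding lsub_def by auto
  obtain d where d: "d \<in> module_hom R (free (length gs)) (free p)" "\<And>j. j < length gs \<Longrightarrow> d (unit_vec (length gs) j) = gs ! j"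
    by (rule free_hom_exists[OF free_is_module, of "length gs" "\<lambda>j. gs ! j" p]) (use gc Uc in \<open>blast+\<close>)
  have "d ` carrier (free (length gs)) = U"
  proof
    show "d ` carrier (free (length gs)) \<subseteq> U"
      using free_span[OF lsub_vimage[OF d(1) free_is_module free_is_module U]] d(2) gc by auto
    show "U \<subseteq> d ` carrier (free (length gs))"
    proof (rule G(3)[rule_format, OF lsub_image[OF d(1) free_is_module free_is_module]])
      show "G \<subseteq> d ` carrier (free (length gs))"
      proof
        fix g assume "g \<in> G"
        then obtain j where "j < length gs" "g = gs ! j" using gs by (metis in_set_conv_nth)
        then show "g \<in> d ` carrier (free (length gs))" using d(2)[of j]
          by (intro image_eqI[of _ _ "unit_vec (length gs) j"]) simp_all
      qed
    qed
  qed
  then show ?thesis using that d(1) by auto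
qed

lemma module_closed:
  assumes "module R M"
  shows "x \<in> carrier M \<Longrightarrow> y \<in> carrier M \<Longrightarrow> x \<oplus>\<^bsub>M\<^esub> y \<in> carrier M"
    "r \<in> carrier R \<Longrightarrow> x \<in> carrier M \<Longrightarrow> r \<odot>\<^bsub>M\<^esub> x \<in> carrier M"
    "\<zero>\<^bsub>M\<^esub> \<in> carrier M"
proof -
  interpret M: module R M by fact
  show "x \<in> carrier M \<Longrightarrow> y \<in> carrier M \<Longrightarrow> x \<oplus>\<^bsub>M\<^esub> y \<in> carrier M" by simp
  show "r \<in> carrier R \<Longrightarrow> x \<in> carrier M \<Longrightarrow> r \<odot>\<^bsub>M\<^esub> x \<in> carrier M" by simp
  show "\<zero>\<^bsub>M\<^esub> \<in> carrier M" by simp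
qed

lemma module_hom_comp:
  assumes f: "f \<in> module_hom R M N" and g: "g \<in> module_hom R N L" and M: "module R M"
  shows "(\<lambda>x\<in>carrier M. g (f x)) \<in> module_hom R M L"
  by (rule module_homI[OF _ _ _ M]) (simp_all add: module_homD[OF f] module_homD[OF g])

lemma free_hom_sum:
  assumes f: "f \<in> module_hom R (free p) N" and N: "module R N" and v: "v \<in> carrier (free p)"
  shows "f v = (\<Oplus>\<^bsub>N\<^esub>j\<in>{..<p}. v j \<odot>\<^bsub>N\<^esub> f (unit_vec p j))"
proof -
  have w: "f (unit_vec p j) \<in> carrier N" for j using module_homD(1)[OF f] by simp
  obtain g where g: "g \<in> module_hom R (free p) N" "\<And>j. j < p \<Longrightarrow> g (unit_vec p j) = f (unit_vec p j)"
    "\<And>v. v \<in> carrier (free p) \<Longrightarrow> g v = (\<Oplus>\<^bsub>N\<^esub>j\<in>{..<p}. v j \<odot>\<^bsub>N\<^esub> f (unit_vec p j))"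
    by (rule free_hom_exists[OF N, of p "\<lambda>j. f (unit_vec p j)"]) (use w in \<open>blast+\<close>)
  have "f v = g v" by (rule free_hom_eq[OF f g(1) N _ v]) (simp add: g(2))
  then show ?thesis using g(3)[OF v] by simp
qed

lemma lsub_smult: "lsub N S \<Longrightarrow> r \<in> carrier R \<Longrightarrow> x \<in> S \<Longrightarrow> r \<odot>\<^bsub>N\<^esub> x \<in> S"
  by (simp add: lsub_def)

lemma lsub_finsum:
  assumes N: "module R N" and S: "lsub N S" and fin: "finite T" and f: "\<And>t. t \<in> T \<Longrightarrow> f t \<in> S"
  shows "(\<Oplus>\<^bsub>N\<^esub>t\<in>T. f t) \<in> S"
proof -
  interpret N: module R N by fact
  have SN: "S \<subseteq> carrier N" using S unfolding lsub_def by simp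
  show ?thesis using fin f
  proof (induction T)
    case empty then show ?case using S by (simp add: lsub_def)
  next
    case (insert t T)
    have "(\<Oplus>\<^bsub>N\<^esub>t\<in>insert t T. f t) = f t \<oplus>\<^bsub>N\<^esub> (\<Oplus>\<^bsub>N\<^esub>t\<in>T. f t)"
      using insert.hyps insert.prems SN by (intro N.finsum_insert) (simp_all add: Pi_iff subset_iff)
    then show ?case using insert S unfolding lsub_def by simp
  qed
qed

lemma lsub_coord:
  assumes f: "f \<in> module_hom R (free p) (free n)" and k: "k < n" and I: "ideal I R"
  shows "lsub (free p) {v \<in> carrier (free p). f v k \<in> I}"
proof -
  have A: "lsub (free n) {w \<in> carrier (free n). w k \<in> I}"
    unfolding lsub_def
  proof (intro conjI ballI)
    fix x y assume "x \<in> {w \<in> carrier (free n). w k \<in> I}" "y \<in> {w \<in> carrier (free n). w k \<in> I}"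
    then show "x \<oplus>\<^bsub>free n\<^esub> y \<in> {w \<in> carrier (free n). w k \<in> I}"
      using k ideal_closed(1)[OF I] module_closed(1)[OF free_is_module, of x n y] by simp
  next
    fix r x assume "r \<in> carrier R" "x \<in> {w \<in> carrier (free n). w k \<in> I}"
    then show "r \<odot>\<^bsub>free n\<^esub> x \<in> {w \<in> carrier (free n). w k \<in> I}"
      using k ideal_closed(3)[OF I] module_closed(2)[OF free_is_module, of r x n] by simp
  next
    show "\<zero>\<^bsub>free n\<^esub> \<in> {w \<in> carrier (free n). w k \<in> I}" using k ideal_closed(5)[OF I] by simp
  qed simp
  have B: "{x \<in> carrier (free p). f x \<in> {w \<in> carrier (free n). w k \<in> I}} = {v \<in> carrier (free p). f v k \<in> I}"
    using module_homD(1)[OF f] by (intro Collect_cong) (simp del: free_simps cong: conj_cong)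
  show ?thesis using lsub_vimage[OF f free_is_module free_is_module A] unfolding B .
qed

end

section \<open>Linear algebra over the residue field\<close>

context noetherian_local
begin

lemma dependent_mod_mm:
  "f \<in> module_hom R (free p) (free n) \<Longrightarrow> n < p \<Longrightarrow>
    \<exists>c\<in>carrier (free p). (\<exists>j<p. c j \<notin> mm) \<and> (\<forall>i<n. f c i \<in> mm)"
proof (induction n arbitrary: p f)
  case 0
  show ?case using 0(2) one_notin_mm by (intro bexI[of _ "unit_vec p 0"]) (auto simp: unit_vec_def)
next
  case (Suc n)
  define pr where "pr = (\<lambda>w\<in>carrier (free (Suc n)). \<lambda>i\<in>{..<n}. w i)"
  have pr: "pr \<in> module_hom R (free (Suc n)) (free n)"
    unfolding pr_def
  proof (rule module_homI[OF _ _ _ free_is_module])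
    fix u v assume "u \<in> carrier (free (Suc n))" "v \<in> carrier (free (Suc n))"
    show "(\<lambda>i\<in>{..<n}. (u \<oplus>\<^bsub>free (Suc n)\<^esub> v) i) = (\<lambda>i\<in>{..<n}. u i) \<oplus>\<^bsub>free n\<^esub> (\<lambda>i\<in>{..<n}. v i)"
      unfolding free_simps by (rule restrict_ext) simp
  next
    fix r v
    show "(\<lambda>i\<in>{..<n}. (r \<odot>\<^bsub>free (Suc n)\<^esub> v) i) = r \<odot>\<^bsub>free n\<^esub> (\<lambda>i\<in>{..<n}. v i)"
      unfolding free_simps by (rule restrict_ext) simp
  qed simp
  have pra: "pr w i = w i" if "w \<in> carrier (free (Suc n))" "i < n" for w i
    unfolding pr_def using that by simp
  show ?case
  proof (cases "\<forall>j<p. f (unit_vec p j) n \<in> mm")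
    case True
    have all: "f v n \<in> mm" if v: "v \<in> carrier (free p)" for v
      using free_span[OF lsub_coord[OF Suc.prems(1) _ mm_ideal, of n] _ v] True by simp
    obtain c where c: "c \<in> carrier (free p)" "\<exists>j<p. c j \<notin> mm" "\<forall>i<n. (\<lambda>x\<in>carrier (free p). pr (f x)) c i \<in> mm"
      using Suc.IH[OF module_hom_comp[OF Suc.prems(1) pr free_is_module]] Suc.prems(2) by (metis Suc_lessD)
    have "f c i \<in> mm" if "i < Suc n" for i
      using that c all[OF c(1)] pra[OF module_homD(1)[OF Suc.prems(1) c(1)]] by (auto simp: less_Suc_eq simp del: free_simps)
    then show ?thesis using c by auto
  next
    case False
    then obtain j0 where j0: "j0 < p" "f (unit_vec p j0) n \<notin> mm" by auto
    have fc: "f v n \<in> carrier R" if "v \<in> carrier (free p)" for v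
      using module_homD(1)[OF Suc.prems(1) that] by auto
    obtain b where b: "b \<in> carrier R" "b \<otimes> f (unit_vec p j0) n = \<one>"
      using unit_obtain[OF fc j0(2)] by auto
    obtain q where q: "p = Suc q" using j0 by (cases p) auto
    \<comment> \<open>\<open>sk\<close> enumerates the indices other than the pivot
      \<open>j0\<close>.\<close>
    define sk where "sk = (\<lambda>j. if j < j0 then j else Suc j)"
    have sk: "sk j < p" "sk j \<noteq> j0" "sk i = sk j \<longleftrightarrow> i = j" if "j < q" "i < q" for i j
      using that j0 q unfolding sk_def by auto
    define x where "x = (\<lambda>j. \<ominus> (b \<otimes> f (unit_vec p (sk j)) n))"
    have xc: "x j \<in> carrier R" for j unfolding x_def using b fc by simp
    define w where "w = (\<lambda>j. unit_vec p (sk j) \<oplus>\<^bsub>free p\<^esub> (x j \<odot>\<^bsub>free p\<^esub> unit_vec p j0))"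
    have wc: "w j \<in> carrier (free p)" for j
      unfolding w_def using xc by (intro module_closed(1,2)[OF free_is_module]) simp_all
    obtain g where g: "g \<in> module_hom R (free q) (free p)" "\<And>j. j < q \<Longrightarrow> g (unit_vec q j) = w j"
      by (rule free_hom_exists[OF free_is_module, of q w p]) (use wc in \<open>blast+\<close>)
    \<comment> \<open>The vector \<open>w j\<close> has entry one at \<open>sk j\<close> and zero at
      the other values of \<open>sk\<close>. Hence a relation among these vectors with a unit
      coefficient still has a unit coefficient in the original coordinates.\<close>
    have coord: "g v (sk j) = v j" if j: "j < q" and v: "v \<in> carrier (free q)" for v j
    proof -
      have L: "lsub (free q) {v \<in> carrier (free q). g v (sk j) = v j}"
        unfolding lsub_def
      proof (intro conjI ballI)
        show "\<zero>\<^bsub>free q\<^esub> \<in> {v \<in> carrier (free q). g v (sk j) = v j}"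
          using module_hom_zero[OF g(1) free_is_module free_is_module] j sk(1)[OF j j] by simp
      next
        fix u v assume "u \<in> {v \<in> carrier (free q). g v (sk j) = v j}" "v \<in> {v \<in> carrier (free q). g v (sk j) = v j}"
        then show "u \<oplus>\<^bsub>free q\<^esub> v \<in> {v \<in> carrier (free q). g v (sk j) = v j}"
          using module_homD(2)[OF g(1), of u v] j sk(1)[OF j j] module_closed(1)[OF free_is_module, of u q v] by simp
      next
        fix r v assume "r \<in> carrier R" "v \<in> {v \<in> carrier (free q). g v (sk j) = v j}"
        then show "r \<odot>\<^bsub>free q\<^esub> v \<in> {v \<in> carrier (free q). g v (sk j) = v j}"
          using module_homD(3)[OF g(1), of r v] j sk(1)[OF j j] module_closed(2)[OF free_is_module, of r v q] by simp
      qed simp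
      have b: "g (unit_vec q k) (sk j) = unit_vec q k j" if k: "k < q" for k
        using g(2)[OF k] sk[OF j k] xc[of k] k j sk(3)[OF k j] by (simp add: w_def unit_vec_def)
      have "v \<in> {v \<in> carrier (free q). g v (sk j) = v j}" by (rule free_span[OF L _ v]) (simp add: b)
      then show ?thesis by simp
    qed
    let ?h = "\<lambda>v\<in>carrier (free q). f (g v)"
    have h: "?h \<in> module_hom R (free q) (free (Suc n))" by (rule module_hom_comp[OF g(1) Suc.prems(1) free_is_module])
    have h0: "?h v n = \<zero>" if v: "v \<in> carrier (free q)" for v
    proof -
      have "?h (unit_vec q j) n = \<zero>" if j: "j < q" for j
      proof -
        have "?h (unit_vec q j) = f (unit_vec p (sk j)) \<oplus>\<^bsub>free (Suc n)\<^esub> (x j \<odot>\<^bsub>free (Suc n)\<^esub> f (unit_vec p j0))"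
          using g(2)[OF j] module_homD(2,3)[OF Suc.prems(1)] xc module_closed(2)[OF free_is_module, of "x j" "unit_vec p j0" p]
          by (simp add: w_def del: free_simps(2,3,4))
        then have "?h (unit_vec q j) n = f (unit_vec p (sk j)) n \<oplus> x j \<otimes> f (unit_vec p j0) n" by simp
        also have "x j \<otimes> f (unit_vec p j0) n = \<ominus> ((b \<otimes> f (unit_vec p j0) n) \<otimes> f (unit_vec p (sk j)) n)"
          unfolding x_def using b(1) fc[of "unit_vec p j0"] fc[of "unit_vec p (sk j)"] by (simp add: l_minus r_minus m_ac)
        finally show ?thesis using b(2) fc[of "unit_vec p (sk j)"] by (simp add: r_neg)
      qed
      then have "v \<in> {v \<in> carrier (free q). ?h v n \<in> {\<zero>}}"
        by (intro free_span[OF lsub_coord[OF h _ zeroideal, of n] _ v]) (simp_all del: restrict_apply)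
      then show ?thesis by blast
    qed
    obtain c where c: "c \<in> carrier (free q)" "\<exists>j<q. c j \<notin> mm" "\<forall>i<n. (\<lambda>x\<in>carrier (free q). pr (?h x)) c i \<in> mm"
      using Suc.IH[OF module_hom_comp[OF h pr free_is_module]] Suc.prems(2) q by (metis Suc_less_eq)
    have gc: "g c \<in> carrier (free p)" by (rule module_homD(1)[OF g(1) c(1)])
    have "f (g c) i \<in> mm" if i: "i < Suc n" for i
    proof (cases "i = n")
      case True
      then show ?thesis using h0[OF c(1)] c(1) ideal_closed(5)[OF mm_ideal] by simp
    next
      case False
      then have i: "i < n" using i by simp
      from c(3) i have "pr (f (g c)) i \<in> mm" using c(1) by (simp del: free_simps)
      then show ?thesis using pra[OF module_homD(1)[OF h c(1)] i] c(1) by (simp del: free_simps)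
    qed
    moreover obtain j where j: "j < q" "c j \<notin> mm" using c(2) by auto
    ultimately show ?thesis using gc coord[OF j(1) c(1)] sk(1)[OF j(1) j(1)]
      by (intro bexI[of _ "g c"] conjI exI[of _ "sk j"]) simp_all
  qed
qed

text \<open>A \<open>p\<close>-tuple of elements of \<open>M\<close> is encoded as the linear map \<open>f\<close> from the free module of rank \<open>p\<close> that takes
  the unit vectors to it. If \<open>mm\<close> kills \<open>M\<close>, then \<open>indep\<close> is linear independence over the residue field.\<close>

definition indep :: "('a, 'v, 'm) module_scheme \<Rightarrow> nat \<Rightarrow> ((nat \<Rightarrow> 'a) \<Rightarrow> 'v) \<Rightarrow> bool" where
  "indep M p f \<longleftrightarrow> f \<in> module_hom R (free p) M \<and>
    (\<forall>c\<in>carrier (free p). f c = \<zero>\<^bsub>M\<^esub> \<longrightarrow> (\<forall>j<p. c j \<in> mm))"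

lemma hom_mm_zero:
  assumes f: "f \<in> module_hom R (free p) M" and M: "module R M"
    and kill: "\<And>r x. r \<in> mm \<Longrightarrow> x \<in> carrier M \<Longrightarrow> r \<odot>\<^bsub>M\<^esub> x = \<zero>\<^bsub>M\<^esub>"
    and c: "c \<in> carrier (free p)" "\<And>j. j < p \<Longrightarrow> c j \<in> mm"
  shows "f c = \<zero>\<^bsub>M\<^esub>"
proof -
  interpret M: module R M by fact
  have "f c = (\<Oplus>\<^bsub>M\<^esub>j\<in>{..<p}. \<zero>\<^bsub>M\<^esub>)"
    unfolding free_hom_sum[OF f M c(1)]
    using kill[OF c(2) module_homD(1)[OF f]] by (intro M.add.finprod_cong') auto
  then show ?thesis by simp
qed

text \<open>An independent tuple lifts along the surjection \<open>g\<close> to vectors of length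
  \<open>n\<close>. If \<open>p\<close> were larger, these would be dependent modulo
  \<open>mm\<close>, and since \<open>mm\<close> kills \<open>M\<close> the relation would descend
  to \<open>M\<close>.\<close>

lemma indep_le:
  assumes M: "module R M" and kill: "\<And>r x. r \<in> mm \<Longrightarrow> x \<in> carrier M \<Longrightarrow> r \<odot>\<^bsub>M\<^esub> x = \<zero>\<^bsub>M\<^esub>"
    and f: "indep M p f" and g: "g \<in> module_hom R (free n) M" "g ` carrier (free n) = carrier M"
  shows "p \<le> n"
proof (rule ccontr)
  assume "\<not> p \<le> n"
  have fh: "f \<in> module_hom R (free p) M" using f unfolding indep_def by simp
  obtain h where h: "h \<in> module_hom R (free p) (free n)" "\<And>v. v \<in> carrier (free p) \<Longrightarrow> g (h v) = f v"
    by (rule free_lift[OF g(1) free_is_module M fh]) (use g(2) module_homD(1)[OF fh] in auto)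
  obtain c where c: "c \<in> carrier (free p)" "\<exists>j<p. c j \<notin> mm" "\<forall>i<n. h c i \<in> mm"
    using dependent_mod_mm[OF h(1)] \<open>\<not> p \<le> n\<close> by (metis not_le)
  have "g (h c) = \<zero>\<^bsub>M\<^esub>" by (rule hom_mm_zero[OF g(1) M kill module_homD(1)[OF h(1) c(1)]]) (use c(3) in auto)
  then show False using f c h(2)[OF c(1)] unfolding indep_def by auto
qed

lemma residue_field_simps:
  "carrier (residue_field R) = {mm +> a | a. a \<in> carrier R}"
  "\<zero>\<^bsub>residue_field R\<^esub> = mm"
  by (auto simp: residue_field_def FactRing_def A_RCOSETS_defs a_r_coset_def r_coset_def)

lemma mm_coset_eq: "a \<in> carrier R \<Longrightarrow> b \<in> carrier R \<Longrightarrow> mm +> a = mm +> b \<longleftrightarrow> a \<ominus> b \<in> mm"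
  using quotient_eq_iff_same_a_r_cos[OF mm_ideal, of a b] by auto

lemma mm_coset_zero: "a \<in> carrier R \<Longrightarrow> mm +> a = mm \<longleftrightarrow> a \<in> mm"
proof -
  assume a: "a \<in> carrier R"
  have "mm +> \<zero> = mm" using ideal_closed(8)[OF mm_ideal] by (rule a_coset_add_zero)
  then show ?thesis using mm_coset_eq[of a \<zero>] a by (simp add: a_minus_def)
qed

text \<open>The choice of representative made in \<open>residue_space\<close>, given a name so that
  sums over the residue field can be rewritten as sums over the ring.\<close>

definition rep :: "'a set \<Rightarrow> 'a" where "rep \<kappa> = (SOME r. r \<in> \<kappa>)"

lemma rep_coset:
  assumes "\<kappa> \<in> carrier (residue_field R)"
  shows "rep \<kappa> \<in> carrier R" "mm +> rep \<kappa> = \<kappa>"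
proof -
  interpret I: ideal mm R by (rule mm_ideal)
  obtain a where a: "a \<in> carrier R" "\<kappa> = mm +> a" using assms residue_field_simps by auto
  have "a \<in> \<kappa>" using I.a_rcos_self[OF a(1)] a(2) by simp
  then have r: "rep \<kappa> \<in> \<kappa>" unfolding rep_def by (rule someI)
  then show rc: "rep \<kappa> \<in> carrier R" using a I.a_elemrcos_carrier[OF a(1)] by simp
  obtain h where h: "h \<in> mm" "rep \<kappa> = h \<oplus> a" using r unfolding a(2) a_r_coset_def' by auto
  have "rep \<kappa> \<ominus> a = h" unfolding h(2) using mm_carr[OF h(1)] a(1) by algebra
  then show "mm +> rep \<kappa> = \<kappa>" using mm_coset_eq[OF rc a(1)] h(1) a(2) by simp
qed

context
  fixes M :: "('a, 'v, 'm) module_scheme"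
  assumes M: "module R M"
    and kill: "\<And>r x. r \<in> mm \<Longrightarrow> x \<in> carrier M \<Longrightarrow> r \<odot>\<^bsub>M\<^esub> x = \<zero>\<^bsub>M\<^esub>"
begin

interpretation M: module R M by (rule M)

lemma smult_rep:
  assumes a: "a \<in> carrier R" and x: "x \<in> carrier M"
  shows "rep (mm +> a) \<odot>\<^bsub>M\<^esub> x = a \<odot>\<^bsub>M\<^esub> x"
proof -
  have \<kappa>: "mm +> a \<in> carrier (residue_field R)" using a residue_field_simps by auto
  let ?r = "rep (mm +> a)"
  have r: "?r \<in> carrier R" "?r \<ominus> a \<in> mm" using rep_coset[OF \<kappa>] mm_coset_eq[of ?r a] a by auto
  have "?r = (?r \<ominus> a) \<oplus> a" using r(1) a by algebra
  then have "?r \<odot>\<^bsub>M\<^esub> x = ((?r \<ominus> a) \<oplus> a) \<odot>\<^bsub>M\<^esub> x" by simp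
  also have "\<dots> = (?r \<ominus> a) \<odot>\<^bsub>M\<^esub> x \<oplus>\<^bsub>M\<^esub> a \<odot>\<^bsub>M\<^esub> x" using r(1) a x by (intro M.smult_l_distr) auto
  also have "\<dots> = a \<odot>\<^bsub>M\<^esub> x" using kill[OF r(2) x] a x by simp
  finally show ?thesis .
qed

lemma residue_space_sum:
  "(\<Oplus>\<^bsub>residue_space M\<^esub>v\<in>T. c v \<odot>\<^bsub>residue_space M\<^esub> v) = (\<Oplus>\<^bsub>M\<^esub>v\<in>T. rep (c v) \<odot>\<^bsub>M\<^esub> v)"
  by (simp add: residue_space_def finsum_def finprod_def rep_def)

lemma residue_space_simps: "carrier (residue_space M) = carrier M" "\<zero>\<^bsub>residue_space M\<^esub> = \<zero>\<^bsub>M\<^esub>"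
  by (simp_all add: residue_space_def)

text \<open>Translates between two encodings of a linear combination: \<open>is_basis\<close> sums
  over a set of vectors with residue classes as coefficients, whereas a linear map is evaluated at a
  vector of ring elements.\<close>

lemma enumerated_sum:
  assumes f: "f \<in> module_hom R (free n) M" and inj: "inj_on (\<lambda>i. f (unit_vec n i)) {..<n}"
    and a: "a \<in> carrier (free n)"
  shows "(\<Oplus>\<^bsub>M\<^esub>v\<in>(\<lambda>i. f (unit_vec n i)) ` {..<n}. rep (mm +> a (inv_into {..<n} (\<lambda>i. f (unit_vec n i)) v)) \<odot>\<^bsub>M\<^esub> v) = f a"
proof -
  let ?\<sigma> = "\<lambda>i. f (unit_vec n i)"
  have s: "?\<sigma> i \<in> carrier M" for i using module_homD(1)[OF f] by simp
  have ac: "a i \<in> carrier R" if "i < n" for i using a that by simp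
  have k: "mm +> a i \<in> carrier (residue_field R)" if "i < n" for i using ac[OF that] residue_field_simps by auto
  have "(\<Oplus>\<^bsub>M\<^esub>v\<in>?\<sigma> ` {..<n}. rep (mm +> a (inv_into {..<n} ?\<sigma> v)) \<odot>\<^bsub>M\<^esub> v) =
     (\<Oplus>\<^bsub>M\<^esub>i\<in>{..<n}. rep (mm +> a (inv_into {..<n} ?\<sigma> (?\<sigma> i))) \<odot>\<^bsub>M\<^esub> ?\<sigma> i)"
  proof (rule M.finsum_reindex[OF _ inj])
    show "(\<lambda>v. rep (mm +> a (inv_into {..<n} ?\<sigma> v)) \<odot>\<^bsub>M\<^esub> v) \<in> ?\<sigma> ` {..<n} \<rightarrow> carrier M"
    proof
      fix v assume "v \<in> ?\<sigma> ` {..<n}"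
      then obtain i where i: "i < n" "v = ?\<sigma> i" by auto
      then have "inv_into {..<n} ?\<sigma> v = i" using inv_into_f_f[OF inj, of i] by simp
      then show "rep (mm +> a (inv_into {..<n} ?\<sigma> v)) \<odot>\<^bsub>M\<^esub> v \<in> carrier M"
        using rep_coset(1)[OF k[OF i(1)]] s i(2) by simp
    qed
  qed
  also have "\<dots> = (\<Oplus>\<^bsub>M\<^esub>i\<in>{..<n}. a i \<odot>\<^bsub>M\<^esub> ?\<sigma> i)"
    using s ac inv_into_f_f[OF inj] smult_rep by (intro M.add.finprod_cong') (simp_all add: Pi_iff)
  also have "\<dots> = f a" using free_hom_sum[OF f M a] by simp
  finally show ?thesis .
qed

lemma basis_indep:
  assumes S: "is_basis (residue_field R) (residue_space M) S"
    and f: "f \<in> module_hom R (free n) M" and inj: "inj_on (\<lambda>i. f (unit_vec n i)) {..<n}"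
    and sub: "(\<lambda>i. f (unit_vec n i)) ` {..<n} \<subseteq> S"
  shows "indep M n f"
  unfolding indep_def
proof (intro conjI ballI impI allI)
  fix a j assume a: "a \<in> carrier (free n)" "f a = \<zero>\<^bsub>M\<^esub>" and j: "j < n"
  let ?\<sigma> = "\<lambda>i. f (unit_vec n i)"
  let ?c = "\<lambda>v. mm +> a (inv_into {..<n} ?\<sigma> v)"
  have inv: "inv_into {..<n} ?\<sigma> (?\<sigma> i) = i" if "i < n" for i using inv_into_f_f[OF inj, of i] that by simp
  have c: "?c \<in> ?\<sigma> ` {..<n} \<rightarrow> carrier (residue_field R)"
    using inv a(1) by (auto simp: residue_field_simps simp del: free_simps intro!: exI[of _ "a _"]) auto
  have "(\<Oplus>\<^bsub>residue_space M\<^esub>v\<in>?\<sigma> ` {..<n}. ?c v \<odot>\<^bsub>residue_space M\<^esub> v) = \<zero>\<^bsub>residue_space M\<^esub>"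
    using enumerated_sum[OF f inj a(1)] a(2) by (simp only: residue_space_sum residue_space_simps)
  moreover have "finite (?\<sigma> ` {..<n})" by simp
  ultimately have "\<forall>v\<in>?\<sigma> ` {..<n}. ?c v = \<zero>\<^bsub>residue_field R\<^esub>"
    using S c sub unfolding is_basis_def by blast
  then have "?c (?\<sigma> j) = mm" using j residue_field_simps by simp
  then show "a j \<in> mm" using mm_coset_zero[of "a j"] a(1) j inv[OF j] by simp
qed (rule f)

lemma indep_inj:
  assumes f: "indep M n f"
  shows "inj_on (\<lambda>i. f (unit_vec n i)) {..<n}"
proof (rule inj_onI)
  fix i j assume ij: "i \<in> {..<n}" "j \<in> {..<n}" "f (unit_vec n i) = f (unit_vec n j)"
  have fh: "f \<in> module_hom R (free n) M" using f unfolding indep_def by simp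
  let ?v = "unit_vec n i \<oplus>\<^bsub>free n\<^esub> (\<ominus> \<one> \<odot>\<^bsub>free n\<^esub> unit_vec n j)"
  have u: "unit_vec n k \<in> carrier (free n)" for k by simp
  have jc: "\<ominus> \<one> \<odot>\<^bsub>free n\<^esub> unit_vec n j \<in> carrier (free n)" using module_closed(2)[OF free_is_module _ u] by blast
  have "f ?v = f (unit_vec n i) \<oplus>\<^bsub>M\<^esub> (\<ominus> \<one> \<odot>\<^bsub>M\<^esub> f (unit_vec n j))"
    using module_homD(2)[OF fh u jc] module_homD(3)[OF fh _ u] by simp
  also have "\<dots> = \<zero>\<^bsub>M\<^esub>" unfolding ij(3) using module_homD(1)[OF fh u[of j]] by (simp add: M.smult_l_minus M.r_neg)
  finally have "\<forall>k<n. ?v k \<in> mm" using f module_closed(1)[OF free_is_module u jc] unfolding indep_def by blast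
  then have "?v i \<in> mm" using ij by blast
  then show "i = j" using ij one_notin_mm by (auto simp: unit_vec_def split: if_splits)
qed

text \<open>\<open>vdim\<close> depends on an arbitrary choice of basis. For a finitely generated
  module it is shown to be the largest length of an independent tuple: a longest tuple gives a
  basis, so the choice is meaningful, and any chosen basis is finite because its finite subsets are
  independent.\<close>

lemma vdim_characterization:
  assumes g: "g \<in> module_hom R (free p) M" "g ` carrier (free p) = carrier M"
  shows "\<exists>f. indep M (vdim (residue_field R) (residue_space M)) f"
    and "indep M n h \<Longrightarrow> n \<le> vdim (residue_field R) (residue_space M)"
proof -
  let ?K = "residue_field R" let ?V = "residue_space M"
  have "\<exists>S. is_basis ?K ?V S"
  proof -
    let ?P = "\<lambda>n. \<exists>f. indep M n f"
    have "?P 0"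
    proof -
      obtain f where "f \<in> module_hom R (free 0) M"
        by (rule free_hom_exists[OF M, of 0 "\<lambda>_. \<zero>\<^bsub>M\<^esub>"]) auto
      then show ?thesis unfolding indep_def by auto
    qed
    moreover have bound: "\<And>n. ?P n \<Longrightarrow> n \<le> p" using indep_le[OF M kill _ g] by blast
    ultimately obtain n where n: "?P n" "\<And>k. ?P k \<Longrightarrow> k \<le> n" using Nat.ex_has_greatest_nat[of ?P 0 p] by auto
    then obtain f where f: "indep M n f" by auto
    have fh: "f \<in> module_hom R (free n) M" using f unfolding indep_def by simp
    let ?\<sigma> = "\<lambda>i. f (unit_vec n i)"
    have s: "?\<sigma> i \<in> carrier M" for i using module_homD(1)[OF fh] by simp
    note inj = indep_inj[OF f]
    have inv: "inv_into {..<n} ?\<sigma> (?\<sigma> i) = i" if "i < n" for i using inv_into_f_f[OF inj, of i] that by simp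
    \<comment> \<open>Appending \<open>x\<close> to a longest tuple creates a relation. The
      coefficient of \<open>x\<close> is a unit in it, since otherwise that term vanishes and the
      tuple itself would be dependent.\<close>
    have surj: "x \<in> f ` carrier (free n)" if x: "x \<in> carrier M" for x
    proof -
      let ?w = "\<lambda>i. if i < n then ?\<sigma> i else x"
      obtain f' where f': "f' \<in> module_hom R (free (Suc n)) M" "\<And>j. j < Suc n \<Longrightarrow> f' (unit_vec (Suc n) j) = ?w j"
        "\<And>v. v \<in> carrier (free (Suc n)) \<Longrightarrow> f' v = (\<Oplus>\<^bsub>M\<^esub>j\<in>{..<Suc n}. v j \<odot>\<^bsub>M\<^esub> ?w j)"
        by (rule free_hom_exists[OF M, of "Suc n" ?w]) (use s x in \<open>auto split: if_splits\<close>)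
      have "\<not> indep M (Suc n) f'" using n(2)[of "Suc n"] by auto
      then obtain c j where c: "c \<in> carrier (free (Suc n))" "f' c = \<zero>\<^bsub>M\<^esub>" "j < Suc n" "c j \<notin> mm"
        using f'(1) unfolding indep_def by blast
      have cc: "c i \<in> carrier R" if "i < Suc n" for i using c(1) that by auto
      let ?c = "\<lambda>i\<in>{..<n}. c i"
      have c': "?c \<in> carrier (free n)" using cc by simp
      have "f' c = c n \<odot>\<^bsub>M\<^esub> x \<oplus>\<^bsub>M\<^esub> (\<Oplus>\<^bsub>M\<^esub>j\<in>{..<n}. c j \<odot>\<^bsub>M\<^esub> ?w j)"
        unfolding f'(3)[OF c(1)] lessThan_Suc using cc s x by (subst M.finsum_insert) (auto split: if_splits)
      also have "(\<Oplus>\<^bsub>M\<^esub>j\<in>{..<n}. c j \<odot>\<^bsub>M\<^esub> ?w j) = (\<Oplus>\<^bsub>M\<^esub>j\<in>{..<n}. ?c j \<odot>\<^bsub>M\<^esub> ?\<sigma> j)"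
        using cc s by (intro M.add.finprod_cong') (simp_all add: Pi_iff)
      also have "\<dots> = f ?c" using free_hom_sum[OF fh M c'] by simp
      finally have eq: "c n \<odot>\<^bsub>M\<^esub> x \<oplus>\<^bsub>M\<^esub> f ?c = \<zero>\<^bsub>M\<^esub>" using c(2) by simp
      have fc: "f ?c \<in> carrier M" by (rule module_homD(1)[OF fh c'])
      have "c n \<notin> mm"
      proof
        assume cn: "c n \<in> mm"
        have "f ?c = \<zero>\<^bsub>M\<^esub>" using eq kill[OF cn x] fc by simp
        then have "\<forall>j<n. ?c j \<in> mm" using f c' unfolding indep_def by blast
        then show False using c(3,4) cn by (auto simp: less_Suc_eq)
      qed
      then obtain b where b: "b \<in> carrier R" "b \<otimes> c n = \<one>" using unit_obtain[OF cc[of n]] by auto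
      let ?y = "c n \<odot>\<^bsub>M\<^esub> x"
      have yc: "?y \<in> carrier M" using cc[of n] x by simp
      have "?y = \<ominus>\<^bsub>M\<^esub> f ?c" using eq yc fc by (metis M.minus_equality M.a_comm)
      also have "\<dots> = \<ominus> \<one> \<odot>\<^bsub>M\<^esub> f ?c" using fc by (simp add: M.smult_l_minus)
      finally have y: "?y = \<ominus> \<one> \<odot>\<^bsub>M\<^esub> f ?c" .
      have "x = b \<odot>\<^bsub>M\<^esub> ?y" using b cc[of n] x M.smult_assoc1[of b "c n" x] by simp
      also have "\<dots> = f (b \<odot>\<^bsub>free n\<^esub> (\<ominus> \<one> \<odot>\<^bsub>free n\<^esub> ?c))"
        unfolding y using module_homD(3)[OF fh] b(1) c' module_closed(2)[OF free_is_module _ c', of "\<ominus> \<one>"]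
        by (simp del: free_simps)
      finally show ?thesis using b(1) module_closed(2)[OF free_is_module] c' by blast
    qed
    have "is_basis ?K ?V (?\<sigma> ` {..<n})"
      unfolding is_basis_def residue_space_sum residue_space_simps
    proof (intro conjI allI impI ballI)
      show "?\<sigma> ` {..<n} \<subseteq> carrier M" using s by auto
    next
      fix T c v
      assume T: "finite T \<and> T \<subseteq> ?\<sigma> ` {..<n} \<and> c \<in> T \<rightarrow> carrier ?K \<and> (\<Oplus>\<^bsub>M\<^esub>v\<in>T. rep (c v) \<odot>\<^bsub>M\<^esub> v) = \<zero>\<^bsub>M\<^esub>"
        and v: "v \<in> T"
      have rc: "rep (c v) \<in> carrier R" if "v \<in> T" for v using T that rep_coset(1) by auto
      let ?a = "\<lambda>i\<in>{..<n}. if ?\<sigma> i \<in> T then rep (c (?\<sigma> i)) else \<zero>"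
      have a: "?a \<in> carrier (free n)" using rc by simp
      have "f ?a = (\<Oplus>\<^bsub>M\<^esub>i\<in>{..<n}. (if ?\<sigma> i \<in> T then rep (c (?\<sigma> i)) else \<zero>) \<odot>\<^bsub>M\<^esub> ?\<sigma> i)"
        unfolding free_hom_sum[OF fh M a] using rc s by (intro M.add.finprod_cong') (simp_all add: Pi_iff)
      also have "\<dots> = (\<Oplus>\<^bsub>M\<^esub>v\<in>?\<sigma> ` {..<n}. (if v \<in> T then rep (c v) else \<zero>) \<odot>\<^bsub>M\<^esub> v)"
        using rc s by (intro M.finsum_reindex[OF _ inj, symmetric]) auto
      also have "\<dots> = (\<Oplus>\<^bsub>M\<^esub>v\<in>T. rep (c v) \<odot>\<^bsub>M\<^esub> v)"
        using T rc s by (intro M.add.finprod_mono_neutral_cong_right) auto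
      finally have "f ?a = \<zero>\<^bsub>M\<^esub>" using T by simp
      then have "\<forall>i<n. ?a i \<in> mm" using f a unfolding indep_def by blast
      moreover obtain i where i: "i < n" "v = ?\<sigma> i" using T v by auto
      ultimately have "rep (c v) \<in> mm" using v by auto
      then show "c v = \<zero>\<^bsub>?K\<^esub>"
        using mm_coset_zero[OF rc[OF v]] rep_coset(2)[of "c v"] T v residue_field_simps(2) by auto
    next
      fix x assume "x \<in> carrier M"
      then obtain a where a: "a \<in> carrier (free n)" "x = f a" using surj by auto
      show "\<exists>T c. finite T \<and> T \<subseteq> ?\<sigma> ` {..<n} \<and> c \<in> T \<rightarrow> carrier ?K \<and> x = (\<Oplus>\<^bsub>M\<^esub>v\<in>T. rep (c v) \<odot>\<^bsub>M\<^esub> v)"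
      proof (intro exI conjI)
        show "(\<lambda>v. mm +> a (inv_into {..<n} ?\<sigma> v)) \<in> ?\<sigma> ` {..<n} \<rightarrow> carrier ?K"
        proof
          fix v assume "v \<in> ?\<sigma> ` {..<n}"
          then obtain i where "i < n" "v = ?\<sigma> i" by auto
          then show "mm +> a (inv_into {..<n} ?\<sigma> v) \<in> carrier ?K" using inv a(1) residue_field_simps by auto
        qed
        show "x = (\<Oplus>\<^bsub>M\<^esub>v\<in>?\<sigma> ` {..<n}. rep (mm +> a (inv_into {..<n} ?\<sigma> v)) \<odot>\<^bsub>M\<^esub> v)"
          using enumerated_sum[OF fh inj a(1)] a(2) by simp
      qed auto
    qed
    then show ?thesis by blast
  qed
  then have S: "is_basis ?K ?V (SOME S. is_basis ?K ?V S)" by (rule someI_ex)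
  define S where "S = (SOME S. is_basis ?K ?V S)"
  note S = S[folded S_def]
  have SM: "S \<subseteq> carrier M" using S unfolding is_basis_def residue_space_simps by simp
  have enum: "\<exists>f. f \<in> module_hom R (free (card T)) M \<and> inj_on (\<lambda>i. f (unit_vec (card T) i)) {..<card T}
      \<and> (\<lambda>i. f (unit_vec (card T) i)) ` {..<card T} = T" if T: "finite T" "T \<subseteq> S" for T
  proof -
    obtain b where b: "bij_betw b {0..<card T} T" using ex_bij_betw_nat_finite[OF T(1)] by auto
    have bM: "b j \<in> carrier M" if "j < card T" for j
      using bij_betwE[OF b] that T(2) SM by (meson atLeastLessThan_iff le0 subsetD)
    obtain f where f: "f \<in> module_hom R (free (card T)) M" "\<And>j. j < card T \<Longrightarrow> f (unit_vec (card T) j) = b j"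
      by (rule free_hom_exists[OF M, of "card T" b]) (use bM in \<open>blast+\<close>)
    have "inj_on (\<lambda>i. f (unit_vec (card T) i)) {..<card T}"
    proof (rule inj_onI)
      fix i j assume ij: "i \<in> {..<card T}" "j \<in> {..<card T}" "f (unit_vec (card T) i) = f (unit_vec (card T) j)"
      then have "b i = b j" using f(2) by simp
      then show "i = j" using b ij by (auto simp: bij_betw_def dest: inj_onD)
    qed
    moreover have "(\<lambda>i. f (unit_vec (card T) i)) ` {..<card T} = b ` {0..<card T}"
      using f(2) by (intro image_cong) auto
    moreover have "b ` {0..<card T} = T" using b unfolding bij_betw_def by simp
    ultimately show ?thesis using f(1) by (intro exI[of _ f]) simp
  qed
  have small: "card T \<le> p" if T: "finite T" "T \<subseteq> S" for T
  proof -
    obtain f where f: "f \<in> module_hom R (free (card T)) M" "inj_on (\<lambda>i. f (unit_vec (card T) i)) {..<card T}"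
        "(\<lambda>i. f (unit_vec (card T) i)) ` {..<card T} = T" using enum[OF T] by auto
    show ?thesis by (rule indep_le[OF M kill basis_indep[OF S f(1,2)] g]) (use f(3) T(2) in simp_all)
  qed
  have fin: "finite S"
  proof (rule ccontr)
    assume "infinite S"
    then have "\<exists>T. finite T \<and> card T = Suc p \<and> T \<subseteq> S" by (rule infinite_arbitrarily_large)
    then show False
    proof (elim exE conjE)
      fix T assume T: "finite T" "card T = Suc p" "T \<subseteq> S"
      have "card T \<le> p" by (rule small[OF T(1,3)])
      then show False using T(2) by linarith
    qed
  qed
  have dim: "vdim ?K ?V = card S" unfolding vdim_def S_def by simp
  from enum[OF fin subset_refl]
  obtain f where f: "f \<in> module_hom R (free (card S)) M" "inj_on (\<lambda>i. f (unit_vec (card S) i)) {..<card S}"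
      "(\<lambda>i. f (unit_vec (card S) i)) ` {..<card S} = S" by (elim exE conjE)
  have ind: "indep M (card S) f" by (rule basis_indep[OF S f(1,2)]) (use f(3) in simp)
  then show "\<exists>f. indep M (vdim ?K ?V) f" unfolding dim by (rule exI[of "indep M (card S)"])
  have surj: "f ` carrier (free (card S)) = carrier M"
  proof
    show "f ` carrier (free (card S)) \<subseteq> carrier M" using module_homD(1)[OF f(1)] by auto
    show "carrier M \<subseteq> f ` carrier (free (card S))"
    proof
      fix x assume "x \<in> carrier M"
      then have "\<exists>T c. finite T \<and> T \<subseteq> S \<and> c \<in> T \<rightarrow> carrier ?K \<and> x = (\<Oplus>\<^bsub>M\<^esub>v\<in>T. rep (c v) \<odot>\<^bsub>M\<^esub> v)"
        using S unfolding is_basis_def residue_space_sum residue_space_simps by simp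
      then obtain T c where T: "finite T" "T \<subseteq> S" "c \<in> T \<rightarrow> carrier ?K" "x = (\<Oplus>\<^bsub>M\<^esub>v\<in>T. rep (c v) \<odot>\<^bsub>M\<^esub> v)"
        by (elim exE conjE)
      note sub = lsub_image[OF f(1) free_is_module M]
      show "x \<in> f ` carrier (free (card S))" unfolding T(4)
      proof (rule lsub_finsum[OF M sub T(1)])
        fix v assume v: "v \<in> T"
        then have "v \<in> (\<lambda>i. f (unit_vec (card S) i)) ` {..<card S}" using T(2) f(3) by auto
        then obtain i where "v = f (unit_vec (card S) i)" by auto
        then have "v \<in> f ` carrier (free (card S))" by simp
        moreover have "rep (c v) \<in> carrier R" using rep_coset(1) T(3) v by auto
        ultimately show "rep (c v) \<odot>\<^bsub>M\<^esub> v \<in> f ` carrier (free (card S))" using lsub_smult[OF sub] by (simp del: free_simps)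
      qed
    qed
  qed
  show "indep M n h \<Longrightarrow> n \<le> vdim ?K ?V" unfolding dim by (rule indep_le[OF M kill _ f(1) surj])
qed

end

end

section \<open>Modules of homomorphisms, submodules and quotients\<close>

context cring
begin

lemma self_simps [simp]:
  "carrier (self_module R) = carrier R" "\<zero>\<^bsub>self_module R\<^esub> = \<zero>"
  "x \<oplus>\<^bsub>self_module R\<^esub> y = x \<oplus> y" "r \<odot>\<^bsub>self_module R\<^esub> x = r \<otimes> x"
  by (simp_all add: self_module_def)

lemma self_is_module: "module R (self_module R)"
proof (rule moduleI)
  show "abelian_group (self_module R)"
  proof (rule abelian_groupI)
    fix x assume "x \<in> carrier (self_module R)"
    then show "\<exists>y\<in>carrier (self_module R). y \<oplus>\<^bsub>self_module R\<^esub> x = \<zero>\<^bsub>self_module R\<^esub>"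
      by (intro bexI[of _ "\<ominus> x"]) (simp_all add: l_neg)
  qed (simp_all add: a_ac)
qed (simp_all add: is_cring l_distr r_distr m_assoc)

lemma hom_simps [simp]:
  "carrier (hom_module R M N) = module_hom R M N"
  "\<zero>\<^bsub>hom_module R M N\<^esub> = (\<lambda>x\<in>carrier M. \<zero>\<^bsub>N\<^esub>)"
  "f \<oplus>\<^bsub>hom_module R M N\<^esub> g = (\<lambda>x\<in>carrier M. f x \<oplus>\<^bsub>N\<^esub> g x)"
  "r \<odot>\<^bsub>hom_module R M N\<^esub> f = (\<lambda>x\<in>carrier M. r \<odot>\<^bsub>N\<^esub> f x)"
  by (simp_all add: hom_module_def)

lemma hom_closed_ops:
  assumes M: "module R M" and N: "module R N"
  shows "(\<lambda>x\<in>carrier M. \<zero>\<^bsub>N\<^esub>) \<in> module_hom R M N"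
    "f \<in> module_hom R M N \<Longrightarrow> g \<in> module_hom R M N \<Longrightarrow> (\<lambda>x\<in>carrier M. f x \<oplus>\<^bsub>N\<^esub> g x) \<in> module_hom R M N"
    "r \<in> carrier R \<Longrightarrow> f \<in> module_hom R M N \<Longrightarrow> (\<lambda>x\<in>carrier M. r \<odot>\<^bsub>N\<^esub> f x) \<in> module_hom R M N"
proof -
  interpret N: module R N by (rule N)
  show "(\<lambda>x\<in>carrier M. \<zero>\<^bsub>N\<^esub>) \<in> module_hom R M N"
    by (rule module_homI[OF _ _ _ M]) simp_all
  show "(\<lambda>x\<in>carrier M. f x \<oplus>\<^bsub>N\<^esub> g x) \<in> module_hom R M N" if f: "f \<in> module_hom R M N" and g: "g \<in> module_hom R M N"
    by (rule module_homI[OF _ _ _ M])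
      (simp_all add: module_homD[OF f] module_homD[OF g] N.smult_r_distr N.a_assoc N.a_comm N.a_lcomm)
  show "(\<lambda>x\<in>carrier M. r \<odot>\<^bsub>N\<^esub> f x) \<in> module_hom R M N" if r: "r \<in> carrier R" and f: "f \<in> module_hom R M N"
  proof (rule module_homI[OF _ _ _ M])
    fix s x assume s: "s \<in> carrier R" "x \<in> carrier M"
    then show "r \<odot>\<^bsub>N\<^esub> f (s \<odot>\<^bsub>M\<^esub> x) = s \<odot>\<^bsub>N\<^esub> (r \<odot>\<^bsub>N\<^esub> f x)"
      using r module_homD(1)[OF f] by (simp add: module_homD(3)[OF f] N.smult_assoc1[symmetric] m_comm)
  qed (simp_all add: r module_homD[OF f] N.smult_r_distr)
qed

lemma hom_is_module:
  assumes M: "module R M" and N: "module R N"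
  shows "module R (hom_module R M N)"
proof (rule moduleI)
  interpret N: module R N by (rule N)
  note cl = hom_closed_ops[OF M N]
  show "cring R" by (rule is_cring)
  show "abelian_group (hom_module R M N)"
  proof (rule abelian_groupI)
    fix f g h assume "f \<in> carrier (hom_module R M N)" "g \<in> carrier (hom_module R M N)" "h \<in> carrier (hom_module R M N)"
    then have h: "f \<in> module_hom R M N" "g \<in> module_hom R M N" "h \<in> module_hom R M N" by simp_all
    note c = h[THEN module_homD(1)]
    show "f \<oplus>\<^bsub>hom_module R M N\<^esub> g \<in> carrier (hom_module R M N)" using cl(2)[OF h(1,2)] by simp
    show "f \<oplus>\<^bsub>hom_module R M N\<^esub> g \<oplus>\<^bsub>hom_module R M N\<^esub> h = f \<oplus>\<^bsub>hom_module R M N\<^esub> (g \<oplus>\<^bsub>hom_module R M N\<^esub> h)"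
      unfolding hom_simps by (rule restrict_ext) (simp add: c N.a_assoc)
    show "f \<oplus>\<^bsub>hom_module R M N\<^esub> g = g \<oplus>\<^bsub>hom_module R M N\<^esub> f"
      unfolding hom_simps by (rule restrict_ext) (simp add: c N.a_comm)
    show "\<zero>\<^bsub>hom_module R M N\<^esub> \<oplus>\<^bsub>hom_module R M N\<^esub> f = f"
      unfolding hom_simps by (rule module_hom_eqI[OF cl(2)[OF cl(1) h(1)] h(1)]) (simp add: c)
    have "(\<lambda>x\<in>carrier M. (\<lambda>x\<in>carrier M. \<ominus> \<one> \<odot>\<^bsub>N\<^esub> f x) x \<oplus>\<^bsub>N\<^esub> f x) = (\<lambda>x\<in>carrier M. \<zero>\<^bsub>N\<^esub>)"
      by (rule restrict_ext) (simp add: c N.smult_l_minus N.l_neg)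
    then show "\<exists>g\<in>carrier (hom_module R M N). g \<oplus>\<^bsub>hom_module R M N\<^esub> f = \<zero>\<^bsub>hom_module R M N\<^esub>"
      using cl(3)[OF _ h(1), of "\<ominus> \<one>"] by (intro bexI[of _ "\<lambda>x\<in>carrier M. \<ominus> \<one> \<odot>\<^bsub>N\<^esub> f x"]) simp_all
  qed (simp add: cl(1))
next
  interpret N: module R N by (rule N)
  note cl = hom_closed_ops[OF M N]
  fix a b f g assume a: "a \<in> carrier R" "b \<in> carrier R" and "f \<in> carrier (hom_module R M N)" "g \<in> carrier (hom_module R M N)"
  then have h: "f \<in> module_hom R M N" "g \<in> module_hom R M N" by simp_all
  note c = h[THEN module_homD(1)]
  show "(a \<oplus> b) \<odot>\<^bsub>hom_module R M N\<^esub> f = a \<odot>\<^bsub>hom_module R M N\<^esub> f \<oplus>\<^bsub>hom_module R M N\<^esub> b \<odot>\<^bsub>hom_module R M N\<^esub> f"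
    unfolding hom_simps by (rule restrict_ext) (simp add: a c N.smult_l_distr)
  show "a \<odot>\<^bsub>hom_module R M N\<^esub> (f \<oplus>\<^bsub>hom_module R M N\<^esub> g) = a \<odot>\<^bsub>hom_module R M N\<^esub> f \<oplus>\<^bsub>hom_module R M N\<^esub> a \<odot>\<^bsub>hom_module R M N\<^esub> g"
    unfolding hom_simps by (rule restrict_ext) (simp add: a c N.smult_r_distr)
  show "(a \<otimes> b) \<odot>\<^bsub>hom_module R M N\<^esub> f = a \<odot>\<^bsub>hom_module R M N\<^esub> (b \<odot>\<^bsub>hom_module R M N\<^esub> f)"
    unfolding hom_simps by (rule restrict_ext) (simp add: a c N.smult_assoc1)
next
  interpret N: module R N by (rule N)
  note cl = hom_closed_ops[OF M N]
  fix a f assume a: "a \<in> carrier R" and "f \<in> carrier (hom_module R M N)"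
  then have h: "f \<in> module_hom R M N" by simp
  then show "a \<odot>\<^bsub>hom_module R M N\<^esub> f \<in> carrier (hom_module R M N)" using cl(3)[OF a] by simp
next
  interpret N: module R N by (rule N)
  note cl = hom_closed_ops[OF M N]
  fix f assume "f \<in> carrier (hom_module R M N)"
  then have h: "f \<in> module_hom R M N" by simp
  note c = module_homD(1)[OF h]
  show "\<one> \<odot>\<^bsub>hom_module R M N\<^esub> f = f"
    unfolding hom_simps by (rule module_hom_eqI[OF cl(3)[OF one_closed h] h]) (simp add: c)
qed

lemma lsubD:
  assumes "lsub N S"
  shows "x \<in> S \<Longrightarrow> x \<in> carrier N" "\<zero>\<^bsub>N\<^esub> \<in> S" "x \<in> S \<Longrightarrow> y \<in> S \<Longrightarrow> x \<oplus>\<^bsub>N\<^esub> y \<in> S"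
    "r \<in> carrier R \<Longrightarrow> x \<in> S \<Longrightarrow> r \<odot>\<^bsub>N\<^esub> x \<in> S"
  using assms unfolding lsub_def by auto

lemma sub_is_module:
  assumes N: "module R N" and S: "lsub N S"
  shows "module R (N\<lparr>carrier := S\<rparr>)"
proof -
  interpret N: module R N by (rule N)
  note D = lsubD[OF S]
  show ?thesis
  proof (rule moduleI)
    show "abelian_group (N\<lparr>carrier := S\<rparr>)"
    proof (rule abelian_groupI)
      fix x assume "x \<in> carrier (N\<lparr>carrier := S\<rparr>)"
      then have x: "x \<in> S" by simp
      have "\<ominus> \<one> \<odot>\<^bsub>N\<^esub> x \<in> S" by (rule D(4)) (use x in simp_all)
      moreover have "(\<ominus> \<one> \<odot>\<^bsub>N\<^esub> x) \<oplus>\<^bsub>N\<^esub> x = \<zero>\<^bsub>N\<^esub>"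
        using D(1)[OF x] by (simp add: N.smult_l_minus N.l_neg)
      ultimately show "\<exists>y\<in>carrier (N\<lparr>carrier := S\<rparr>). y \<oplus>\<^bsub>N\<lparr>carrier := S\<rparr>\<^esub> x = \<zero>\<^bsub>N\<lparr>carrier := S\<rparr>\<^esub>" by auto
    qed (simp_all add: D N.a_ac)
  qed (simp_all add: is_cring D N.smult_l_distr N.smult_r_distr N.smult_assoc1)
qed

lemma lsub_sub: "lsub N S \<Longrightarrow> lsub N T \<Longrightarrow> T \<subseteq> S \<Longrightarrow> lsub (N\<lparr>carrier := S\<rparr>) T"
  unfolding lsub_def by simp

text \<open>The scalar action on cosets is a union over representatives; all of them give the same
  coset. With this known, the module axioms are transported along the projection.\<close>

lemma quotient_module_facts:
  assumes N: "module R N" and S: "lsub N S"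
  defines "\<pi> \<equiv> \<lambda>x\<in>carrier N. S +>\<^bsub>N\<^esub> x"
  shows "module R (quotient_module N S)" "\<pi> \<in> module_hom R N (quotient_module N S)"
    "\<pi> ` carrier N = carrier (quotient_module N S)"
    "x \<in> carrier N \<Longrightarrow> \<pi> x = \<zero>\<^bsub>quotient_module N S\<^esub> \<longleftrightarrow> x \<in> S"
proof -
  interpret N: module R N by (rule N)
  note D = lsubD[OF S]
  have inv: "\<ominus>\<^bsub>N\<^esub> x \<in> S" if "x \<in> S" for x
  proof -
    have "\<ominus> \<one> \<odot>\<^bsub>N\<^esub> x = \<ominus>\<^bsub>N\<^esub> x" using D(1)[OF that] by (simp add: N.smult_l_minus)
    then show ?thesis using D(4)[of "\<ominus> \<one>" x] that by simp
  qed
  have "additive_subgroup S N"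
    by (rule additive_subgroupI, unfold_locales) (use D inv in \<open>auto simp: a_inv_def\<close>)
  then interpret S: abelian_subgroup S N by (rule abelian_subgroupI3) (rule N.abelian_group_axioms)
  let ?Q = "quotient_module N S"
  have Qs: "carrier ?Q = a_rcosets\<^bsub>N\<^esub> S" "\<zero>\<^bsub>?Q\<^esub> = S" "C \<oplus>\<^bsub>?Q\<^esub> C' = C <+>\<^bsub>N\<^esub> C'"
    "r \<odot>\<^bsub>?Q\<^esub> C = (\<Union>x\<in>C. S +>\<^bsub>N\<^esub> (r \<odot>\<^bsub>N\<^esub> x))" for C C' r
    by (simp_all add: quotient_module_def)
  have \<pi>: "\<pi> x = S +>\<^bsub>N\<^esub> x" if "x \<in> carrier N" for x unfolding \<pi>_def using that by simp
  show im: "\<pi> ` carrier N = carrier ?Q"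
    unfolding Qs using \<pi> by (auto simp: A_RCOSETS_def')
  have add: "\<pi> x \<oplus>\<^bsub>?Q\<^esub> \<pi> y = \<pi> (x \<oplus>\<^bsub>N\<^esub> y)" if "x \<in> carrier N" "y \<in> carrier N" for x y
    unfolding Qs using that S.a_rcos_sum by (simp add: \<pi>)
  have zero: "\<pi> x = \<zero>\<^bsub>?Q\<^esub> \<longleftrightarrow> x \<in> S" if x: "x \<in> carrier N" for x
    unfolding Qs \<pi>[OF x] using S.a_rcos_self[OF x] S.a_rcos_const by auto
  then show "x \<in> carrier N \<Longrightarrow> \<pi> x = \<zero>\<^bsub>?Q\<^esub> \<longleftrightarrow> x \<in> S" .
  have smult: "r \<odot>\<^bsub>?Q\<^esub> \<pi> x = \<pi> (r \<odot>\<^bsub>N\<^esub> x)" if r: "r \<in> carrier R" and x: "x \<in> carrier N" for r x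
  proof -
    have "S +>\<^bsub>N\<^esub> (r \<odot>\<^bsub>N\<^esub> x') = S +>\<^bsub>N\<^esub> (r \<odot>\<^bsub>N\<^esub> x)" if x': "x' \<in> S +>\<^bsub>N\<^esub> x" for x'
    proof -
      obtain s where s: "s \<in> S" "x' = s \<oplus>\<^bsub>N\<^esub> x" using x' by (auto simp: a_r_coset_def r_coset_def)
      have rs: "r \<odot>\<^bsub>N\<^esub> s \<in> S" "r \<odot>\<^bsub>N\<^esub> s \<in> carrier N" using D(1,4) s r by auto
      have "r \<odot>\<^bsub>N\<^esub> x' = r \<odot>\<^bsub>N\<^esub> s \<oplus>\<^bsub>N\<^esub> r \<odot>\<^bsub>N\<^esub> x" using s D(1) r x by (simp add: N.smult_r_distr)
      then have "S +>\<^bsub>N\<^esub> (r \<odot>\<^bsub>N\<^esub> x') = (S +>\<^bsub>N\<^esub> (r \<odot>\<^bsub>N\<^esub> s)) <+>\<^bsub>N\<^esub> (S +>\<^bsub>N\<^esub> (r \<odot>\<^bsub>N\<^esub> x))"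
        using S.a_rcos_sum[OF rs(2), of "r \<odot>\<^bsub>N\<^esub> x"] r x by simp
      also have "S +>\<^bsub>N\<^esub> (r \<odot>\<^bsub>N\<^esub> s) = S" using S.a_rcos_const[OF rs(1)] .
      also have "S <+>\<^bsub>N\<^esub> (S +>\<^bsub>N\<^esub> (r \<odot>\<^bsub>N\<^esub> x)) = S +>\<^bsub>N\<^esub> (r \<odot>\<^bsub>N\<^esub> x)"
        using r x by (intro S.rcosets_add_eq N.a_rcosetsI) (auto simp: S.a_subset)
      finally show ?thesis .
    qed
    then have "(\<Union>x'\<in>S +>\<^bsub>N\<^esub> x. S +>\<^bsub>N\<^esub> (r \<odot>\<^bsub>N\<^esub> x')) = (\<Union>x'\<in>S +>\<^bsub>N\<^esub> x. S +>\<^bsub>N\<^esub> (r \<odot>\<^bsub>N\<^esub> x))"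
      by (intro SUP_cong refl)
    also have "\<dots> = S +>\<^bsub>N\<^esub> (r \<odot>\<^bsub>N\<^esub> x)" using S.a_rcos_self[OF x] by (subst UN_constant) auto
    finally show ?thesis unfolding Qs \<pi>[OF x] \<pi>[OF N.smult_closed[OF r x]] .
  qed
  show "module R ?Q"
  proof (rule moduleI)
    show "abelian_group ?Q"
    proof (rule abelian_groupI)
      fix C C' C'' assume "C \<in> carrier ?Q" "C' \<in> carrier ?Q" "C'' \<in> carrier ?Q"
      then obtain x y z where c: "x \<in> carrier N" "y \<in> carrier N" "z \<in> carrier N"
        and e: "C = \<pi> x" "C' = \<pi> y" "C'' = \<pi> z" unfolding im[symmetric] by auto
      show "C \<oplus>\<^bsub>?Q\<^esub> C' \<in> carrier ?Q" unfolding e im[symmetric] using c by (simp add: add)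
      show "C \<oplus>\<^bsub>?Q\<^esub> C' \<oplus>\<^bsub>?Q\<^esub> C'' = C \<oplus>\<^bsub>?Q\<^esub> (C' \<oplus>\<^bsub>?Q\<^esub> C'')"
        unfolding e using c by (simp add: add N.a_assoc)
      show "C \<oplus>\<^bsub>?Q\<^esub> C' = C' \<oplus>\<^bsub>?Q\<^esub> C" unfolding e using c by (simp add: add N.a_comm)
      have z: "\<zero>\<^bsub>?Q\<^esub> = \<pi> \<zero>\<^bsub>N\<^esub>" using zero[of "\<zero>\<^bsub>N\<^esub>"] D(2) by simp
      show "\<zero>\<^bsub>?Q\<^esub> \<oplus>\<^bsub>?Q\<^esub> C = C" unfolding e z using c by (simp add: add)
      show "\<exists>C'\<in>carrier ?Q. C' \<oplus>\<^bsub>?Q\<^esub> C = \<zero>\<^bsub>?Q\<^esub>"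
        unfolding e z im[symmetric] using c by (intro bexI[of _ "\<pi> (\<ominus>\<^bsub>N\<^esub> x)"]) (simp_all add: add N.l_neg)
    next
      show "\<zero>\<^bsub>?Q\<^esub> \<in> carrier ?Q" using zero[of "\<zero>\<^bsub>N\<^esub>"] D(2) im by (metis N.zero_closed image_eqI)
    qed
  next
    fix a b C C' assume a: "a \<in> carrier R" "b \<in> carrier R" and "C \<in> carrier ?Q" "C' \<in> carrier ?Q"
    then obtain x y where c: "x \<in> carrier N" "y \<in> carrier N" and e: "C = \<pi> x" "C' = \<pi> y"
      unfolding im[symmetric] by auto
    show "(a \<oplus> b) \<odot>\<^bsub>?Q\<^esub> C = a \<odot>\<^bsub>?Q\<^esub> C \<oplus>\<^bsub>?Q\<^esub> b \<odot>\<^bsub>?Q\<^esub> C" unfolding e using a c by (simp add: smult add N.smult_l_distr)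
    show "a \<odot>\<^bsub>?Q\<^esub> (C \<oplus>\<^bsub>?Q\<^esub> C') = a \<odot>\<^bsub>?Q\<^esub> C \<oplus>\<^bsub>?Q\<^esub> a \<odot>\<^bsub>?Q\<^esub> C'" unfolding e using a c by (simp add: smult add N.smult_r_distr)
    show "(a \<otimes> b) \<odot>\<^bsub>?Q\<^esub> C = a \<odot>\<^bsub>?Q\<^esub> (b \<odot>\<^bsub>?Q\<^esub> C)" unfolding e using a c by (simp add: smult N.smult_assoc1)
  next
    fix a C assume a: "a \<in> carrier R" and "C \<in> carrier ?Q"
    then obtain x where c: "x \<in> carrier N" and e: "C = \<pi> x" unfolding im[symmetric] by auto
    show "a \<odot>\<^bsub>?Q\<^esub> C \<in> carrier ?Q" unfolding e im[symmetric] using a c by (simp add: smult)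
  next
    fix C assume "C \<in> carrier ?Q"
    then obtain x where c: "x \<in> carrier N" and e: "C = \<pi> x" unfolding im[symmetric] by auto
    show "\<one> \<odot>\<^bsub>?Q\<^esub> C = C" unfolding e using c by (simp add: smult)
  qed (rule is_cring)
  show "\<pi> \<in> module_hom R N ?Q"
  proof -
    have "restrict \<pi> (carrier N) \<in> module_hom R N ?Q"
      by (rule module_homI[OF _ _ _ N]) (use im add smult in auto)
    then show ?thesis unfolding \<pi>_def by simp
  qed
qed

end

section \<open>Free resolutions of the residue field\<close>

context noetherian_local
begin

lemma lsub_self: "ideal I R \<Longrightarrow> lsub (self_module R) I"
  unfolding lsub_def using ideal_closed by simp

definition proj :: "'a \<Rightarrow> 'a set" where
  "proj = (\<lambda>x\<in>carrier (self_module R). mm +>\<^bsub>self_module R\<^esub> x)"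

lemma residue_module_facts:
  "module R (residue_module R)" "proj \<in> module_hom R (self_module R) (residue_module R)"
  "proj ` carrier R = carrier (residue_module R)"
  "x \<in> carrier R \<Longrightarrow> proj x = \<zero>\<^bsub>residue_module R\<^esub> \<longleftrightarrow> x \<in> mm"
  using quotient_module_facts[OF self_is_module lsub_self[OF mm_ideal]]
  unfolding proj_def residue_module_def by simp_all

lemma lsub_kernel:
  assumes f: "f \<in> module_hom R M N" and MN: "module R M" "module R N"
  shows "lsub M {x \<in> carrier M. f x = \<zero>\<^bsub>N\<^esub>}"
proof -
  interpret N: module R N by (rule MN(2))
  have "lsub N {\<zero>\<^bsub>N\<^esub>}" unfolding lsub_def by simp
  from lsub_vimage[OF f MN this] show ?thesis by simp
qed

text \<open>Kernels of maps between free modules of finite rank are images of such maps, so the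
  differentials can be chosen one after another.\<close>

lemma resolution_exists: "\<exists>n d e. free_resolution R (residue_module R) n d e"
proof -
  have p1: "proj \<one> \<in> carrier (residue_module R)" using module_homD(1)[OF residue_module_facts(2), of \<one>] by simp
  obtain e where e: "e \<in> module_hom R (free 1) (residue_module R)" "\<And>j. j < 1 \<Longrightarrow> e (unit_vec 1 j) = proj \<one>"
    by (rule free_hom_exists[OF residue_module_facts(1), of 1 "\<lambda>_. proj \<one>"]) (use p1 in \<open>blast+\<close>)
  have esurj: "e ` carrier (free 1) = carrier (residue_module R)"
  proof
    show "e ` carrier (free 1) \<subseteq> carrier (residue_module R)" using module_homD(1)[OF e(1)] by auto
    show "carrier (residue_module R) \<subseteq> e ` carrier (free 1)"
    proof
      fix C assume "C \<in> carrier (residue_module R)"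
      then obtain r where r: "r \<in> carrier R" "C = proj r" unfolding residue_module_facts(3)[symmetric] by auto
      have "C = r \<odot>\<^bsub>residue_module R\<^esub> proj \<one>"
        using r module_homD(3)[OF residue_module_facts(2), of r \<one>] by simp
      also have "\<dots> = e (r \<odot>\<^bsub>free 1\<^esub> unit_vec 1 0)"
        using module_homD(3)[OF e(1) r(1), of "unit_vec 1 0"] e(2)[of 0] by (simp del: free_simps(4))
      finally have "C = e (r \<odot>\<^bsub>free 1\<^esub> unit_vec 1 0)" .
      moreover have "r \<odot>\<^bsub>free 1\<^esub> unit_vec 1 0 \<in> carrier (free 1)"
        by (rule module_closed(2)[OF free_is_module r(1)]) (simp only: free_simps(1) unit_vec_in)
      ultimately show "C \<in> e ` carrier (free 1)" by (simp only: imageI)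
    qed
  qed
  let ?U = "{v \<in> carrier (free 1). e v = \<zero>\<^bsub>residue_module R\<^esub>}"
  \<comment> \<open>A state of the dependent choice is a triple of target rank, source rank and
    differential. \<open>P\<close> fixes the start of the resolution and \<open>Q\<close> demands
    exactness between consecutive states.\<close>
  define P where "P k s \<longleftrightarrow> snd (snd s) \<in> module_hom R (free (fst (snd s))) (free (fst s)) \<and>
     (k = 0 \<longrightarrow> fst s = 1 \<and> snd (snd s) ` carrier (free (fst (snd s))) = ?U)" for k :: nat and s
  define Q where "Q s t \<longleftrightarrow> fst t = fst (snd s) \<and>
     snd (snd t) ` carrier (free (fst (snd t))) = {v \<in> carrier (free (fst (snd s))). snd (snd s) v = \<zero>\<^bsub>free (fst s)\<^esub>}"
    for s t :: "nat \<times> nat \<times> ((nat \<Rightarrow> 'a) \<Rightarrow> nat \<Rightarrow> 'a)"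
  have "\<exists>s. \<forall>k. P k (s k) \<and> Q (s k) (s (Suc k))"
  proof (rule dependent_nat_choice[of P "\<lambda>_. Q"])
    obtain q D where "D \<in> module_hom R (free q) (free 1)" "D ` carrier (free q) = ?U"
      by (rule fg_submodule[OF noeth lsub_kernel[OF e(1) free_is_module residue_module_facts(1)]])
    then have "P 0 (1, q, D)" unfolding P_def fst_conv snd_conv by blast
    then show "\<exists>s. P 0 s" by (rule exI[of "P 0"])
  next
    fix s k assume s: "P k s"
    have D: "snd (snd s) \<in> module_hom R (free (fst (snd s))) (free (fst s))" using s unfolding P_def by (rule conjunct1)
    obtain q D where "D \<in> module_hom R (free q) (free (fst (snd s)))"
      "D ` carrier (free q) = {v \<in> carrier (free (fst (snd s))). snd (snd s) v = \<zero>\<^bsub>free (fst s)\<^esub>}"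
      by (rule fg_submodule[OF noeth lsub_kernel[OF D free_is_module free_is_module]])
    then have "P (Suc k) (fst (snd s), q, D) \<and> Q s (fst (snd s), q, D)"
      unfolding P_def Q_def fst_conv snd_conv by (intro conjI impI refl) simp_all
    then show "\<exists>t. P (Suc k) t \<and> Q s t" by (rule exI[of "\<lambda>t. P (Suc k) t \<and> Q s t"])
  qed
  then obtain s where s: "\<And>k. P k (s k)" "\<And>k. Q (s k) (s (Suc k))" by auto
  define n where "n = (\<lambda>k. fst (s k))"
  define d where "d = (\<lambda>k. snd (snd (s k)))"
  have q: "fst (snd (s k)) = n (Suc k)" for k
    using s(2)[of k] unfolding Q_def n_def by (rule conjunct1[THEN sym])
  have fs: "fst (s k) = n k" and ds: "snd (snd (s k)) = d k" for k by (simp_all only: n_def d_def)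
  have dh: "d k \<in> module_hom R (free (n (Suc k))) (free (n k))" for k
    using s(1)[of k] unfolding P_def q fs ds by (rule conjunct1)
  have *: "0 = (0::nat) \<longrightarrow> n 0 = 1 \<and> d 0 ` carrier (free (n (Suc 0))) = ?U"
    using s(1)[of 0] unfolding P_def q fs ds by (rule conjunct2)
  have n0: "n 0 = 1" and im0: "d 0 ` carrier (free (n (Suc 0))) = ?U" using *[THEN mp, OF refl] by (rule conjunct1, rule conjunct2)
  have ex: "d (Suc k) ` carrier (free (n (Suc (Suc k)))) = {v \<in> carrier (free (n (Suc k))). d k v = \<zero>\<^bsub>free (n k)\<^esub>}" for k
    using s(2)[of k] unfolding Q_def q fs ds by (rule conjunct2)
  have "free_resolution R (residue_module R) n d e"
    unfolding free_resolution_def One_nat_def using e(1) esurj dh im0 ex n0 by (simp only: simp_thms One_nat_def)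
  then show ?thesis by (intro exI)
qed

end

text \<open>The augmentation to the residue field is replaced by a lift \<open>\<rho>\<close> into
  the ring itself. Exactness at the end becomes a condition modulo the maximal ideal, surjectivity
  becomes the vector \<open>v1\<close>, and cosets no longer occur.\<close>

locale resolution = noetherian_local R for R (structure) +
  fixes n :: "nat \<Rightarrow> nat" and d :: "nat \<Rightarrow> (nat \<Rightarrow> 'a) \<Rightarrow> (nat \<Rightarrow> 'a)" and \<rho> :: "(nat \<Rightarrow> 'a) \<Rightarrow> 'a" and v1 :: "nat \<Rightarrow> 'a"
  assumes \<rho>: "\<rho> \<in> module_hom R (free_module R (n 0)) (self_module R)"
    and d: "\<And>i. d i \<in> module_hom R (free_module R (n (Suc i))) (free_module R (n i))"
    and exact0: "d 0 ` carrier (free_module R (n 1)) = {v \<in> carrier (free_module R (n 0)). \<rho> v \<in> max_ideal R}"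
    and exact: "\<And>i. d (Suc i) ` carrier (free_module R (n (Suc (Suc i)))) =
       {v \<in> carrier (free_module R (n (Suc i))). d i v = \<zero>\<^bsub>free_module R (n i)\<^esub>}"
    and v1: "v1 \<in> carrier (free_module R (n 0))" "\<rho> v1 = \<one>"

lemma (in noetherian_local) resolution_of_free_resolution:
  assumes "free_resolution R (residue_module R) n d e"
  shows "\<exists>\<rho> v1. resolution R n d \<rho> v1"
proof -
  note A = assms[unfolded free_resolution_def]
  have e: "e \<in> module_hom R (free (n 0)) (residue_module R)" using A by simp
  have esurj: "e ` carrier (free (n 0)) = carrier (residue_module R)" using A by simp
  obtain \<rho> where \<rho>: "\<rho> \<in> module_hom R (free (n 0)) (self_module R)" "\<And>v. v \<in> carrier (free (n 0)) \<Longrightarrow> proj (\<rho> v) = e v"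
  proof (rule free_lift[OF residue_module_facts(2) self_is_module residue_module_facts(1) e])
    fix v assume "v \<in> carrier (free (n 0))"
    then show "e v \<in> proj ` carrier (self_module R)"
      using module_homD(1)[OF e] residue_module_facts(3) by simp
  qed (use that in blast)
  have \<rho>c: "\<rho> v \<in> carrier R" if "v \<in> carrier (free (n 0))" for v using module_homD(1)[OF \<rho>(1) that] by simp
  have ker: "e v = \<zero>\<^bsub>residue_module R\<^esub> \<longleftrightarrow> \<rho> v \<in> mm" if "v \<in> carrier (free (n 0))" for v
    using \<rho>(2)[OF that] residue_module_facts(4)[OF \<rho>c[OF that]] by simp
  have "proj \<one> \<in> e ` carrier (free (n 0))" using esurj module_homD(1)[OF residue_module_facts(2), of \<one>] by simp
  then obtain w where w: "w \<in> carrier (free (n 0))" "e w = proj \<one>" by (metis imageE)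
  have "\<rho> w \<notin> mm"
  proof
    assume "\<rho> w \<in> mm"
    then have "proj \<one> = \<zero>\<^bsub>residue_module R\<^esub>" using ker[OF w(1)] w(2) by simp
    then show False using residue_module_facts(4)[of \<one>] one_notin_mm by simp
  qed
  then obtain b where b: "b \<in> carrier R" "b \<otimes> \<rho> w = \<one>" using unit_obtain[OF \<rho>c[OF w(1)]] by metis
  have "resolution R n d \<rho> (b \<odot>\<^bsub>free (n 0)\<^esub> w)"
  proof (unfold_locales)
    show "d 0 ` carrier (free (n 1)) = {v \<in> carrier (free (n 0)). \<rho> v \<in> mm}"
      using A ker by (simp del: free_simps cong: conj_cong)
    show "b \<odot>\<^bsub>free (n 0)\<^esub> w \<in> carrier (free (n 0))" by (rule module_closed(2)[OF free_is_module b(1) w(1)])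
    show "\<rho> (b \<odot>\<^bsub>free (n 0)\<^esub> w) = \<one>" using module_homD(3)[OF \<rho>(1) b(1) w(1)] b(2) by simp
  qed (use A \<rho>(1) in \<open>simp_all del: free_simps\<close>)
  then show ?thesis by (intro exI)
qed

context resolution
begin

abbreviation "F i \<equiv> free_module R (n i)"
abbreviation "H i \<equiv> module_hom R (F i) (self_module R)"
abbreviation "HM i \<equiv> hom_module R (F i) (self_module R)"

lemma FM: "module R (F i)" by (rule free_is_module)

lemma HMM: "module R (HM i)" by (rule hom_is_module[OF FM self_is_module])

lemma H_facts:
  assumes f: "f \<in> H i"
  shows "v \<in> carrier (F i) \<Longrightarrow> f v \<in> carrier R"
    "v \<in> carrier (F i) \<Longrightarrow> w \<in> carrier (F i) \<Longrightarrow> f (v \<oplus>\<^bsub>F i\<^esub> w) = f v \<oplus> f w"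
    "r \<in> carrier R \<Longrightarrow> v \<in> carrier (F i) \<Longrightarrow> f (r \<odot>\<^bsub>F i\<^esub> v) = r \<otimes> f v"
    "f \<zero>\<^bsub>F i\<^esub> = \<zero>"
  using module_homD[OF f] module_hom_zero[OF f FM self_is_module] by simp_all

lemma d_closed: "v \<in> carrier (F (Suc i)) \<Longrightarrow> d i v \<in> carrier (F i)"
  by (rule module_homD(1)[OF d])

lemma dd: "v \<in> carrier (F (Suc (Suc i))) \<Longrightarrow> d i (d (Suc i) v) = \<zero>\<^bsub>F i\<^esub>"
  using exact[of i] by (metis (mono_tags, lifting) imageI mem_Collect_eq)

lemma \<rho>d: "v \<in> carrier (F 1) \<Longrightarrow> \<rho> (d 0 v) \<in> mm"
  using exact0 by (metis (mono_tags, lifting) imageI mem_Collect_eq)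

text \<open>Cocycles and coboundaries of \<open>Hom(F, R / Q)\<close>, represented by homomorphisms into \<open>R\<close>. The coboundaries in degree
  0 are zero modulo \<open>Q\<close>.\<close>

definition Zc :: "nat \<Rightarrow> 'a set \<Rightarrow> ((nat \<Rightarrow> 'a) \<Rightarrow> 'a) set" where
  "Zc i Q = {f \<in> H i. \<forall>v\<in>carrier (F (Suc i)). f (d i v) \<in> Q}"

fun cob :: "nat \<Rightarrow> 'a set \<Rightarrow> ((nat \<Rightarrow> 'a) \<Rightarrow> 'a) \<Rightarrow> bool" where
  "cob 0 Q f = (\<forall>v\<in>carrier (F 0). f v \<in> Q)"
| "cob (Suc j) Q f = (\<exists>g\<in>H j. \<forall>v\<in>carrier (F (Suc j)). f v \<ominus> g (d j v) \<in> Q)"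

lemma Hop:
  fixes f g :: "(nat \<Rightarrow> 'a) \<Rightarrow> 'a" and r :: 'a and i :: nat
  shows "f \<in> H i \<Longrightarrow> g \<in> H i \<Longrightarrow> (\<lambda>v\<in>carrier (F i). f v \<oplus> g v) \<in> H i"
  "r \<in> carrier R \<Longrightarrow> f \<in> H i \<Longrightarrow> (\<lambda>v\<in>carrier (F i). r \<otimes> f v) \<in> H i"
  "(\<lambda>v\<in>carrier (F i). \<zero>) \<in> H i"
  using hom_closed_ops[OF FM[of i] self_is_module] by (simp_all del: free_simps)

lemma Hdiff: "f \<in> H i \<Longrightarrow> g \<in> H i \<Longrightarrow> (\<lambda>v\<in>carrier (F i). f v \<ominus> g v) \<in> H i"
proof -
  assume f: "f \<in> H i" and g: "g \<in> H i"
  have "(\<lambda>v\<in>carrier (F i). f v \<ominus> g v) = (\<lambda>v\<in>carrier (F i). f v \<oplus> (\<lambda>v\<in>carrier (F i). \<ominus> \<one> \<otimes> g v) v)"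
    by (rule restrict_ext) (simp add: H_facts(1)[OF g] l_minus a_minus_def del: free_simps)
  then show ?thesis using Hop(1)[OF f Hop(2)[OF _ g, of "\<ominus> \<one>"]] by simp
qed

lemma Hd: "g \<in> H j \<Longrightarrow> (\<lambda>v\<in>carrier (F (Suc j)). g (d j v)) \<in> H (Suc j)"
  by (rule module_hom_comp[OF d _ FM])

lemma Zc_lsub:
  assumes Q: "ideal Q R"
  shows "lsub (HM i) (Zc i Q)"
  unfolding lsub_def
proof (intro conjI ballI)
  show "Zc i Q \<subseteq> carrier (HM i)" unfolding Zc_def by auto
  show "\<zero>\<^bsub>HM i\<^esub> \<in> Zc i Q"
    unfolding Zc_def using Hop(3) d_closed ideal_closed(5)[OF Q] by (simp del: free_simps)
  show "f \<oplus>\<^bsub>HM i\<^esub> g \<in> Zc i Q" if "f \<in> Zc i Q" "g \<in> Zc i Q" for f g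
    using that Hop(1) d_closed ideal_closed(1)[OF Q] unfolding Zc_def by (simp del: free_simps)
  show "r \<odot>\<^bsub>HM i\<^esub> f \<in> Zc i Q" if "r \<in> carrier R" "f \<in> Zc i Q" for r f
    using that Hop(2) d_closed ideal_closed(3)[OF Q] unfolding Zc_def by (simp del: free_simps)
qed

lemma cob_lsub:
  assumes Q: "ideal Q R"
  shows "lsub (HM i) {f \<in> H i. cob i Q f}"
proof (cases i)
  case 0
  show ?thesis unfolding lsub_def
  proof (intro conjI ballI)
    show "\<zero>\<^bsub>HM i\<^esub> \<in> {f \<in> H i. cob i Q f}" using Hop(3)[where i = i] ideal_closed(5)[OF Q] 0 by (simp del: free_simps)
    show "f \<oplus>\<^bsub>HM i\<^esub> g \<in> {f \<in> H i. cob i Q f}" if "f \<in> {f \<in> H i. cob i Q f}" "g \<in> {f \<in> H i. cob i Q f}" for f g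
      using that Hop(1)[of f i g] ideal_closed(1)[OF Q] 0 by (simp del: free_simps)
    show "r \<odot>\<^bsub>HM i\<^esub> f \<in> {f \<in> H i. cob i Q f}" if "r \<in> carrier R" "f \<in> {f \<in> H i. cob i Q f}" for r f
      using that Hop(2)[of r f i] ideal_closed(3)[OF Q] 0 by (simp del: free_simps)
  qed auto
next
  case (Suc j)
  show ?thesis unfolding lsub_def Suc
  proof (intro conjI ballI)
    have "cob (Suc j) Q \<zero>\<^bsub>HM (Suc j)\<^esub>"
      unfolding cob.simps using Hop(3)[where i = j] d_closed ideal_closed(5)[OF Q]
      by (intro bexI[of _ "\<lambda>v\<in>carrier (F j). \<zero>"]) (simp_all add: a_minus_def del: free_simps)
    then show "\<zero>\<^bsub>HM (Suc j)\<^esub> \<in> {f \<in> H (Suc j). cob (Suc j) Q f}" using Hop(3)[where i = "Suc j"] by (simp del: free_simps cob.simps)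
  next
    fix f g assume "f \<in> {f \<in> H (Suc j). cob (Suc j) Q f}" "g \<in> {f \<in> H (Suc j). cob (Suc j) Q f}"
    then obtain h k where fg: "f \<in> H (Suc j)" "g \<in> H (Suc j)" and h: "h \<in> H j" "\<And>v. v \<in> carrier (F (Suc j)) \<Longrightarrow> f v \<ominus> h (d j v) \<in> Q"
      and k: "k \<in> H j" "\<And>v. v \<in> carrier (F (Suc j)) \<Longrightarrow> g v \<ominus> k (d j v) \<in> Q" by auto
    have "(f v \<oplus> g v) \<ominus> (h (d j v) \<oplus> k (d j v)) \<in> Q" if v: "v \<in> carrier (F (Suc j))" for v
    proof -
      have "(f v \<oplus> g v) \<ominus> (h (d j v) \<oplus> k (d j v)) = (f v \<ominus> h (d j v)) \<oplus> (g v \<ominus> k (d j v))"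
        using H_facts(1)[OF fg(1) v] H_facts(1)[OF fg(2) v] H_facts(1)[OF h(1) d_closed[OF v]] H_facts(1)[OF k(1) d_closed[OF v]] by algebra
      then show ?thesis using ideal_closed(1)[OF Q h(2)[OF v] k(2)[OF v]] by simp
    qed
    then have "cob (Suc j) Q (f \<oplus>\<^bsub>HM (Suc j)\<^esub> g)"
      unfolding cob.simps using Hop(1)[OF h(1) k(1)] d_closed
      by (intro bexI[of _ "\<lambda>v\<in>carrier (F j). h v \<oplus> k v"]) (simp_all del: free_simps)
    then show "f \<oplus>\<^bsub>HM (Suc j)\<^esub> g \<in> {f \<in> H (Suc j). cob (Suc j) Q f}" using Hop(1)[OF fg] by (simp del: free_simps cob.simps)
  next
    fix r f assume r: "r \<in> carrier R" and "f \<in> {f \<in> H (Suc j). cob (Suc j) Q f}"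
    then obtain h where f: "f \<in> H (Suc j)" and h: "h \<in> H j" "\<And>v. v \<in> carrier (F (Suc j)) \<Longrightarrow> f v \<ominus> h (d j v) \<in> Q" by auto
    have "r \<otimes> f v \<ominus> r \<otimes> h (d j v) \<in> Q" if v: "v \<in> carrier (F (Suc j))" for v
    proof -
      have "r \<otimes> f v \<ominus> r \<otimes> h (d j v) = r \<otimes> (f v \<ominus> h (d j v))"
        using r H_facts(1)[OF f v] H_facts(1)[OF h(1) d_closed[OF v]] by algebra
      then show ?thesis using ideal_closed(3)[OF Q h(2)[OF v] r] by simp
    qed
    then have "cob (Suc j) Q (r \<odot>\<^bsub>HM (Suc j)\<^esub> f)"
      unfolding cob.simps using Hop(2)[OF r h(1)] d_closed
      by (intro bexI[of _ "\<lambda>v\<in>carrier (F j). r \<otimes> h v"]) (simp_all del: free_simps)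
    then show "r \<odot>\<^bsub>HM (Suc j)\<^esub> f \<in> {f \<in> H (Suc j). cob (Suc j) Q f}" using Hop(2)[OF r f] by (simp del: free_simps cob.simps)
  qed auto
qed

lemma cob_Zc:
  assumes Q: "ideal Q R" and f: "f \<in> H i" "cob i Q f"
  shows "f \<in> Zc i Q"
proof (cases i)
  case 0
  then show ?thesis using f d_closed unfolding Zc_def by auto
next
  case (Suc j)
  then obtain g where g: "g \<in> H j" "\<And>v. v \<in> carrier (F (Suc j)) \<Longrightarrow> f v \<ominus> g (d j v) \<in> Q" using f(2) by auto
  have "f (d i v) \<in> Q" if v: "v \<in> carrier (F (Suc i))" for v
  proof -
    have v': "v \<in> carrier (F (Suc (Suc j)))" using v unfolding Suc .
    have "f (d (Suc j) v) \<ominus> g (d j (d (Suc j) v)) \<in> Q" by (rule g(2)[OF d_closed[OF v']])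
    then show ?thesis
      using H_facts(1)[OF f(1) d_closed[OF v]] unfolding dd[OF v'] H_facts(4)[OF g(1)] Suc by (simp add: a_minus_def)
  qed
  then show ?thesis using f(1) unfolding Zc_def by simp
qed

text \<open>By \<open>E\<close>, multiplication by \<open>y\<close> minus \<open>h\<close> after
  \<open>d i\<close> takes values in the kernel of \<open>d i\<close>, which is the image of the
  next differential; lifting it gives the next homotopy.\<close>

lemma homotopy_step:
  assumes y: "y \<in> carrier R" and h: "h \<in> module_hom R (F i) (F (Suc i))"
    and E: "\<And>v. v \<in> carrier (F (Suc i)) \<Longrightarrow> d i (h (d i v)) = y \<odot>\<^bsub>F i\<^esub> d i v"
  shows "\<exists>k\<in>module_hom R (F (Suc i)) (F (Suc (Suc i))). \<forall>w\<in>carrier (F (Suc i)).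
    d (Suc i) (k w) \<oplus>\<^bsub>F (Suc i)\<^esub> h (d i w) = y \<odot>\<^bsub>F (Suc i)\<^esub> w"
proof -
  interpret M: module R "F (Suc i)" by (rule FM)
  interpret M0: module R "F i" by (rule FM)
  define \<phi> where "\<phi> = (\<lambda>w\<in>carrier (F (Suc i)). y \<odot>\<^bsub>F (Suc i)\<^esub> w \<oplus>\<^bsub>F (Suc i)\<^esub> (\<ominus> \<one> \<odot>\<^bsub>F (Suc i)\<^esub> h (d i w)))"
  have hc: "h (d i w) \<in> carrier (F (Suc i))" if "w \<in> carrier (F (Suc i))" for w
    by (rule module_homD(1)[OF h d_closed[OF that]])
  have \<phi>: "\<phi> \<in> module_hom R (F (Suc i)) (F (Suc i))"
    unfolding \<phi>_def
  proof (rule module_homI[OF _ _ _ FM])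
    fix u w assume uw: "u \<in> carrier (F (Suc i))" "w \<in> carrier (F (Suc i))"
    have "h (d i (u \<oplus>\<^bsub>F (Suc i)\<^esub> w)) = h (d i u) \<oplus>\<^bsub>F (Suc i)\<^esub> h (d i w)"
      using uw module_homD(2)[OF d] module_homD(2)[OF h] d_closed by (simp del: free_simps)
    then show "y \<odot>\<^bsub>F (Suc i)\<^esub> (u \<oplus>\<^bsub>F (Suc i)\<^esub> w) \<oplus>\<^bsub>F (Suc i)\<^esub> (\<ominus> \<one> \<odot>\<^bsub>F (Suc i)\<^esub> h (d i (u \<oplus>\<^bsub>F (Suc i)\<^esub> w))) =
       y \<odot>\<^bsub>F (Suc i)\<^esub> u \<oplus>\<^bsub>F (Suc i)\<^esub> (\<ominus> \<one> \<odot>\<^bsub>F (Suc i)\<^esub> h (d i u)) \<oplus>\<^bsub>F (Suc i)\<^esub>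
      (y \<odot>\<^bsub>F (Suc i)\<^esub> w \<oplus>\<^bsub>F (Suc i)\<^esub> (\<ominus> \<one> \<odot>\<^bsub>F (Suc i)\<^esub> h (d i w)))"
      using uw hc y by (simp add: M.smult_r_distr M.a_ac del: free_simps)
  next
    fix r w assume r: "r \<in> carrier R" "w \<in> carrier (F (Suc i))"
    have "h (d i (r \<odot>\<^bsub>F (Suc i)\<^esub> w)) = r \<odot>\<^bsub>F (Suc i)\<^esub> h (d i w)"
      using r module_homD(3)[OF d] module_homD(3)[OF h] d_closed by (simp del: free_simps)
    then show "y \<odot>\<^bsub>F (Suc i)\<^esub> (r \<odot>\<^bsub>F (Suc i)\<^esub> w) \<oplus>\<^bsub>F (Suc i)\<^esub> (\<ominus> \<one> \<odot>\<^bsub>F (Suc i)\<^esub> h (d i (r \<odot>\<^bsub>F (Suc i)\<^esub> w))) =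
       r \<odot>\<^bsub>F (Suc i)\<^esub> (y \<odot>\<^bsub>F (Suc i)\<^esub> w \<oplus>\<^bsub>F (Suc i)\<^esub> (\<ominus> \<one> \<odot>\<^bsub>F (Suc i)\<^esub> h (d i w)))"
      using r hc y by (simp add: M.smult_r_distr M.smult_assoc1[symmetric] m_comm del: free_simps)
  qed (use hc y in \<open>simp del: free_simps\<close>)
  have \<phi>v: "\<phi> w = y \<odot>\<^bsub>F (Suc i)\<^esub> w \<oplus>\<^bsub>F (Suc i)\<^esub> (\<ominus> \<one> \<odot>\<^bsub>F (Suc i)\<^esub> h (d i w))" if "w \<in> carrier (F (Suc i))" for w
    unfolding \<phi>_def using that by (simp del: free_simps)
  have d\<phi>: "d i (\<phi> w) = \<zero>\<^bsub>F i\<^esub>" if w: "w \<in> carrier (F (Suc i))" for w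
  proof -
    have "d i (\<phi> w) = y \<odot>\<^bsub>F i\<^esub> d i w \<oplus>\<^bsub>F i\<^esub> (\<ominus> \<one> \<odot>\<^bsub>F i\<^esub> d i (h (d i w)))"
      unfolding \<phi>v[OF w] using w hc[OF w] y module_homD(2)[OF d] module_homD(3)[OF d] by (simp del: free_simps)
    then show ?thesis unfolding E[OF w] using d_closed[OF w] y by (simp add: M0.smult_l_minus M0.r_neg del: free_simps)
  qed
  obtain k where k: "k \<in> module_hom R (F (Suc i)) (F (Suc (Suc i)))" "\<And>w. w \<in> carrier (F (Suc i)) \<Longrightarrow> d (Suc i) (k w) = \<phi> w"
  proof (rule free_lift[OF d FM FM \<phi>])
    fix w assume w: "w \<in> carrier (F (Suc i))"
    show "\<phi> w \<in> d (Suc i) ` carrier (F (Suc (Suc i)))"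
      unfolding exact using d\<phi>[OF w] module_homD(1)[OF \<phi> w] by simp
  qed (use that in blast)
  have "d (Suc i) (k w) \<oplus>\<^bsub>F (Suc i)\<^esub> h (d i w) = y \<odot>\<^bsub>F (Suc i)\<^esub> w" if w: "w \<in> carrier (F (Suc i))" for w
    unfolding k(2)[OF w] \<phi>v[OF w] using hc[OF w] w y by (simp add: M.smult_l_minus M.a_assoc M.l_neg del: free_simps)
  then show ?thesis using k(1) by (intro bexI[of _ k] ballI)
qed

text \<open>Multiplication by \<open>y\<close> is zero on the residue field, hence null-homotopic on
  its resolution. The invariant is the homotopy identity composed with \<open>d i\<close>: the
  previous homotopy drops out of it, and it is just what \<open>homotopy_step\<close>
  consumes.\<close>

lemma homotopy:
  assumes y: "y \<in> mm"
  shows "\<exists>h\<in>module_hom R (F i) (F (Suc i)). \<forall>v\<in>carrier (F (Suc i)). d i (h (d i v)) = y \<odot>\<^bsub>F i\<^esub> d i v"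
    and "\<exists>h\<in>module_hom R (F 0) (F 1). \<forall>v\<in>carrier (F 0). d 0 (h v) = y \<odot>\<^bsub>F 0\<^esub> v"
proof -
  note yc = mm_carr[OF y]
  interpret M: module R "F 0" by (rule FM)
  let ?\<phi> = "\<lambda>v\<in>carrier (F 0). y \<odot>\<^bsub>F 0\<^esub> v"
  have \<phi>: "?\<phi> \<in> module_hom R (F 0) (F 0)"
    by (rule module_homI[OF _ _ _ FM])
      (use yc in \<open>simp_all add: M.smult_r_distr M.smult_assoc1[symmetric] m_comm del: free_simps\<close>)
  obtain h where h: "h \<in> module_hom R (F 0) (F 1)" "\<And>v. v \<in> carrier (F 0) \<Longrightarrow> d 0 (h v) = ?\<phi> v"
  proof (rule free_lift[OF _ FM FM \<phi>])
    show "d 0 \<in> module_hom R (F 1) (F 0)" using d[of 0] by simp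
    fix v assume v: "v \<in> carrier (F 0)"
    have "\<rho> (y \<odot>\<^bsub>F 0\<^esub> v) \<in> mm"
      using H_facts(3)[OF \<rho> yc v] H_facts(1)[OF \<rho> v] ideal_closed(4)[OF mm_ideal y] by simp
    then show "?\<phi> v \<in> d 0 ` carrier (F 1)" unfolding exact0 using v yc M.smult_closed[OF yc v] by (simp del: free_simps)
  qed (use that in blast)
  then show B: "\<exists>h\<in>module_hom R (F 0) (F 1). \<forall>v\<in>carrier (F 0). d 0 (h v) = y \<odot>\<^bsub>F 0\<^esub> v"
    by (intro bexI[of _ h]) (simp_all del: free_simps)
  show "\<exists>h\<in>module_hom R (F i) (F (Suc i)). \<forall>v\<in>carrier (F (Suc i)). d i (h (d i v)) = y \<odot>\<^bsub>F i\<^esub> d i v"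
  proof (induction i)
    case 0
    then show ?case using B d_closed[of _ 0] by (metis One_nat_def)
  next
    case (Suc i)
    then obtain h where h: "h \<in> module_hom R (F i) (F (Suc i))"
      and h': "\<forall>v\<in>carrier (F (Suc i)). d i (h (d i v)) = y \<odot>\<^bsub>F i\<^esub> d i v" by (rule bexE)
    from homotopy_step[OF yc h h'[rule_format]]
    obtain k where k: "k \<in> module_hom R (F (Suc i)) (F (Suc (Suc i)))"
      and k': "\<forall>w\<in>carrier (F (Suc i)). d (Suc i) (k w) \<oplus>\<^bsub>F (Suc i)\<^esub> h (d i w) = y \<odot>\<^bsub>F (Suc i)\<^esub> w"
      by (rule bexE)
    interpret M': module R "F (Suc i)" by (rule FM)
    have "d (Suc i) (k (d (Suc i) v)) = y \<odot>\<^bsub>F (Suc i)\<^esub> d (Suc i) v" if v: "v \<in> carrier (F (Suc (Suc i)))" for v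
    proof -
      have "h (d i (d (Suc i) v)) = \<zero>\<^bsub>F (Suc i)\<^esub>" unfolding dd[OF v] by (rule module_hom_zero[OF h FM FM])
      then show ?thesis using k'[rule_format, OF d_closed[OF v]] d_closed[OF module_homD(1)[OF k d_closed[OF v]]]
        by (simp del: free_simps)
    qed
    then show ?case using k by (intro bexI[of _ k] ballI)
  qed
qed

text \<open>Applying \<open>f\<close> to the homotopy identity splits \<open>y \<otimes> f\<close>
  into a term that lies in \<open>Q\<close> because \<open>f\<close> is a cocycle and the coboundary
  of \<open>f\<close> after \<open>h\<close>. So the maximal ideal kills the cohomology.\<close>

lemma null_homotopic:
  assumes Q: "ideal Q R" and y: "y \<in> mm" and f: "f \<in> Zc i Q"
  shows "cob i Q (\<lambda>v\<in>carrier (F i). y \<otimes> f v)"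
proof (cases i)
  case 0
  from homotopy(2)[OF y] obtain h where h: "h \<in> module_hom R (F 0) (F 1)"
    and h': "\<forall>v\<in>carrier (F 0). d 0 (h v) = y \<odot>\<^bsub>F 0\<^esub> v" by (rule bexE)
  have fH: "f \<in> H 0" using f 0 unfolding Zc_def by simp
  have "y \<otimes> f v \<in> Q" if v: "v \<in> carrier (F 0)" for v
  proof -
    have "f (d 0 (h v)) \<in> Q" using f 0 module_homD(1)[OF h v] unfolding Zc_def by simp
    then show ?thesis unfolding h'[rule_format, OF v] using H_facts(3)[OF fH mm_carr[OF y] v] by simp
  qed
  then show ?thesis unfolding 0 by (simp del: free_simps)
next
  case (Suc j)
  note yc = mm_carr[OF y]
  from homotopy(1)[OF y, of j] obtain h where h: "h \<in> module_hom R (F j) (F (Suc j))"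
    and h': "\<forall>v\<in>carrier (F (Suc j)). d j (h (d j v)) = y \<odot>\<^bsub>F j\<^esub> d j v" by (rule bexE)
  from homotopy_step[OF yc h h'[rule_format]] obtain k where k: "k \<in> module_hom R (F (Suc j)) (F (Suc (Suc j)))"
    and k': "\<forall>w\<in>carrier (F (Suc j)). d (Suc j) (k w) \<oplus>\<^bsub>F (Suc j)\<^esub> h (d j w) = y \<odot>\<^bsub>F (Suc j)\<^esub> w"
    by (rule bexE)
  have fH: "f \<in> H (Suc j)" and fZ: "\<And>v. v \<in> carrier (F (Suc (Suc j))) \<Longrightarrow> f (d (Suc j) v) \<in> Q"
    using f Suc unfolding Zc_def by simp_all
  let ?g = "\<lambda>v\<in>carrier (F j). f (h v)"
  have g: "?g \<in> H j" by (rule module_hom_comp[OF h fH FM])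
  have "y \<otimes> f w \<ominus> ?g (d j w) \<in> Q" if w: "w \<in> carrier (F (Suc j))" for w
  proof -
    have c: "d (Suc j) (k w) \<in> carrier (F (Suc j))" "h (d j w) \<in> carrier (F (Suc j))"
      using d_closed[OF module_homD(1)[OF k w]] module_homD(1)[OF h d_closed[OF w]] .
    have "y \<otimes> f w = f (d (Suc j) (k w)) \<oplus> f (h (d j w))"
      using H_facts(2)[OF fH c] H_facts(3)[OF fH yc w] k'[rule_format, OF w] by simp
    then have "y \<otimes> f w \<ominus> ?g (d j w) = f (d (Suc j) (k w))"
      using H_facts(1)[OF fH c(1)] H_facts(1)[OF fH c(2)] d_closed[OF w] by (simp add: a_minus_def a_assoc r_neg del: free_simps)
    then show ?thesis using fZ[OF module_homD(1)[OF k w]] by simp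
  qed
  then show ?thesis unfolding Suc cob.simps using g by (intro bexI[of _ ?g]) (simp_all del: free_simps)
qed

end

section \<open>The type as the dimension of a socle\<close>

context cring
begin

lemma free_hom_ex:
  assumes N: "module R N" and w: "\<And>j. w j \<in> carrier N"
  shows "\<exists>f\<in>module_hom R (free p) N. \<forall>j<p. f (unit_vec p j) = w j"
proof -
  obtain f where f: "f \<in> module_hom R (free p) N" "\<And>j. j < p \<Longrightarrow> f (unit_vec p j) = w j"
    by (rule free_hom_exists[OF N, of p w]) (use w in \<open>blast+\<close>)
  then show ?thesis by (intro bexI[of _ f] allI impI)
qed

text \<open>Linearity concerns the first argument; the second is a parameter at which cochains are
  evaluated. \<open>span_cong\<close> then reduces congruences modulo \<open>Q\<close> to unit
  vectors.\<close>

definition bil :: "nat \<Rightarrow> 'v set \<Rightarrow> ((nat \<Rightarrow> 'a) \<Rightarrow> 'v \<Rightarrow> 'a) \<Rightarrow> bool" where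
  "bil p V A \<longleftrightarrow> (\<forall>v\<in>V. (\<forall>c\<in>carrier (free p). A c v \<in> carrier R) \<and>
     (\<forall>c\<in>carrier (free p). \<forall>c'\<in>carrier (free p). A (c \<oplus>\<^bsub>free p\<^esub> c') v = A c v \<oplus> A c' v) \<and>
     (\<forall>r\<in>carrier R. \<forall>c\<in>carrier (free p). A (r \<odot>\<^bsub>free p\<^esub> c) v = r \<otimes> A c v))"

lemma bilD:
  assumes "bil p V A" "v \<in> V"
  shows "c \<in> carrier (free p) \<Longrightarrow> A c v \<in> carrier R"
    "c \<in> carrier (free p) \<Longrightarrow> c' \<in> carrier (free p) \<Longrightarrow> A (c \<oplus>\<^bsub>free p\<^esub> c') v = A c v \<oplus> A c' v"
    "r \<in> carrier R \<Longrightarrow> c \<in> carrier (free p) \<Longrightarrow> A (r \<odot>\<^bsub>free p\<^esub> c) v = r \<otimes> A c v"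
  using assms unfolding bil_def by (simp_all del: free_simps)

lemma bil_zero:
  assumes "bil p V A" "v \<in> V"
  shows "A \<zero>\<^bsub>free p\<^esub> v = \<zero>"
proof -
  interpret M: module R "free p" by (rule free_is_module)
  have "A (\<zero> \<odot>\<^bsub>free p\<^esub> \<zero>\<^bsub>free p\<^esub>) v = \<zero> \<otimes> A \<zero>\<^bsub>free p\<^esub> v" by (rule bilD(3)[OF assms]) (simp_all del: free_simps)
  then show ?thesis using bilD(1)[OF assms M.zero_closed] by (simp del: free_simps)
qed

lemma span_cong:
  assumes A: "bil p V A" and B: "bil p V B" and Q: "ideal Q R"
    and basis: "\<And>k. k < p \<Longrightarrow> A (unit_vec p k) v \<ominus> B (unit_vec p k) v \<in> Q"
    and c: "c \<in> carrier (free p)" and v: "v \<in> V"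
  shows "A c v \<ominus> B c v \<in> Q"
proof -
  have "lsub (free p) {c \<in> carrier (free p). A c v \<ominus> B c v \<in> Q}"
    unfolding lsub_def
  proof (intro conjI ballI)
    show "\<zero>\<^bsub>free p\<^esub> \<in> {c \<in> carrier (free p). A c v \<ominus> B c v \<in> Q}"
      using bil_zero[OF A v] bil_zero[OF B v] module_closed(3)[OF free_is_module] ideal_closed(5)[OF Q]
      by (simp add: a_minus_def del: free_simps)
  next
    fix x y assume "x \<in> {c \<in> carrier (free p). A c v \<ominus> B c v \<in> Q}" "y \<in> {c \<in> carrier (free p). A c v \<ominus> B c v \<in> Q}"
    then have x: "x \<in> carrier (free p)" "A x v \<ominus> B x v \<in> Q" and y: "y \<in> carrier (free p)" "A y v \<ominus> B y v \<in> Q"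
      by (simp_all del: free_simps)
    have "(A x v \<oplus> A y v) \<ominus> (B x v \<oplus> B y v) = (A x v \<ominus> B x v) \<oplus> (A y v \<ominus> B y v)"
      using bilD(1)[OF A v x(1)] bilD(1)[OF A v y(1)] bilD(1)[OF B v x(1)] bilD(1)[OF B v y(1)] by algebra
    then show "x \<oplus>\<^bsub>free p\<^esub> y \<in> {c \<in> carrier (free p). A c v \<ominus> B c v \<in> Q}"
      using x y bilD(2)[OF A v x(1) y(1)] bilD(2)[OF B v x(1) y(1)] module_closed(1)[OF free_is_module x(1) y(1)]
        ideal_closed(1)[OF Q x(2) y(2)] by (simp del: free_simps)
  next
    fix r x assume r: "r \<in> carrier R" and "x \<in> {c \<in> carrier (free p). A c v \<ominus> B c v \<in> Q}"
    then have x: "x \<in> carrier (free p)" "A x v \<ominus> B x v \<in> Q" by (simp_all del: free_simps)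
    have "r \<otimes> A x v \<ominus> r \<otimes> B x v = r \<otimes> (A x v \<ominus> B x v)"
      using r bilD(1)[OF A v x(1)] bilD(1)[OF B v x(1)] by algebra
    then show "r \<odot>\<^bsub>free p\<^esub> x \<in> {c \<in> carrier (free p). A c v \<ominus> B c v \<in> Q}"
      using x r bilD(3)[OF A v r x(1)] bilD(3)[OF B v r x(1)] module_closed(2)[OF free_is_module r x(1)]
        ideal_closed(3)[OF Q x(2) r] by (simp del: free_simps)
  qed (simp del: free_simps)
  from free_span[OF this _ c] show ?thesis using basis by (simp only: mem_Collect_eq free_simps(1) unit_vec_in simp_thms)
qed

lemma bil_hom:
  assumes f: "f \<in> module_hom R (free p) (self_module R)"
  shows "bil p V (\<lambda>c v. f c)"
  unfolding bil_def using module_homD[OF f] by (simp del: free_simps)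

lemma bil_eval:
  assumes g: "g \<in> module_hom R (free p) (hom_module R M (self_module R))"
    and t: "\<And>v. v \<in> V \<Longrightarrow> t v \<in> carrier M"
  shows "bil p V (\<lambda>c v. g c (t v))"
  unfolding bil_def
proof (intro ballI conjI)
  fix v c assume v: "v \<in> V" and c: "c \<in> carrier (free p)"
  have "g c \<in> module_hom R M (self_module R)" using module_homD(1)[OF g c] by simp
  from module_homD(1)[OF this t[OF v]] show "g c (t v) \<in> carrier R" by simp
next
  fix v c c' assume v: "v \<in> V" and c: "c \<in> carrier (free p)" "c' \<in> carrier (free p)"
  show "g (c \<oplus>\<^bsub>free p\<^esub> c') (t v) = g c (t v) \<oplus> g c' (t v)"
    using module_homD(2)[OF g c] t[OF v] by (simp del: free_simps)
next
  fix v r c assume v: "v \<in> V" and r: "r \<in> carrier R" "c \<in> carrier (free p)"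
  show "g (r \<odot>\<^bsub>free p\<^esub> c) (t v) = r \<otimes> g c (t v)"
    using module_homD(3)[OF g r] t[OF v] by (simp del: free_simps)
qed

lemma bil_scale:
  assumes A: "bil p V A" and y: "\<And>v. v \<in> V \<Longrightarrow> y v \<in> carrier R"
  shows "bil p V (\<lambda>c v. A c v \<otimes> y v)"
  unfolding bil_def
proof (intro ballI conjI)
  fix v c c' assume v: "v \<in> V" and c: "c \<in> carrier (free p)" "c' \<in> carrier (free p)"
  show "A (c \<oplus>\<^bsub>free p\<^esub> c') v \<otimes> y v = A c v \<otimes> y v \<oplus> A c' v \<otimes> y v"
    using bilD[OF A v] c y[OF v] by (simp add: l_distr del: free_simps)
next
  fix v r c assume v: "v \<in> V" and r: "r \<in> carrier R" "c \<in> carrier (free p)"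
  show "A (r \<odot>\<^bsub>free p\<^esub> c) v \<otimes> y v = r \<otimes> (A c v \<otimes> y v)"
    using bilD[OF A v] r y[OF v] by (simp add: m_assoc del: free_simps)
qed (use bilD(1)[OF A] y in \<open>simp del: free_simps\<close>)

lemma divide_hom:
  assumes Q: "ideal Q R" and y: "y \<in> carrier R" and f: "f \<in> module_hom R (free p) (self_module R)"
    and Q': "\<And>v. v \<in> carrier (free p) \<Longrightarrow> f v \<in> Idl (insert y Q)"
  shows "\<exists>g\<in>module_hom R (free p) (self_module R). \<forall>v\<in>carrier (free p). f v \<ominus> g v \<otimes> y \<in> Q"
proof -
  have "\<exists>r\<in>carrier R. f (unit_vec p j) \<ominus> r \<otimes> y \<in> Q" for j
  proof -
    have "f (unit_vec p j) \<in> Idl (insert y Q)" by (rule Q') simp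
    then obtain q r where q: "q \<in> Q" "r \<in> carrier R" "f (unit_vec p j) = q \<oplus> r \<otimes> y"
      unfolding ideal_insert_mem[OF Q y] by auto
    have "(q \<oplus> r \<otimes> y) \<ominus> r \<otimes> y = q" using q(2) y ideal_closed(7)[OF Q q(1)] by algebra
    then show ?thesis unfolding q(3) using q(1,2) by (intro bexI[of _ r]) simp_all
  qed
  then obtain r where r: "\<And>j. r j \<in> carrier R" "\<And>j. f (unit_vec p j) \<ominus> r j \<otimes> y \<in> Q" by metis
  obtain g where g: "g \<in> module_hom R (free p) (self_module R)" "\<And>j. j < p \<Longrightarrow> g (unit_vec p j) = r j"
    by (rule free_hom_exists[OF self_is_module, of p r]) (use r(1) in \<open>simp_all\<close>)
  have "f v \<ominus> g v \<otimes> y \<in> Q" if v: "v \<in> carrier (free p)" for v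
    by (rule span_cong[where A = "\<lambda>c _. f c" and B = "\<lambda>c _. g c \<otimes> y" and V = "UNIV :: unit set" and v = "()",
          OF bil_hom[OF f] bil_scale[OF bil_hom[OF g(1)]] Q _ v])
      (use g(2) r(2) y in simp_all)
  then show ?thesis using g(1) by (intro bexI[of _ g] ballI)
qed

end

context noetherian_local
begin

text \<open>The socle of \<open>R / Q\<close> has dimension at least \<open>p\<close>; \<open>coh\<close> below says the same of the cohomology of
  \<open>Hom(F, R / Q)\<close> in degree \<open>i\<close>.\<close>

definition socle_family :: "'a set \<Rightarrow> nat \<Rightarrow> bool" where
  "socle_family Q p \<longleftrightarrow> (\<exists>a\<in>module_hom R (free p) (self_module R).
     \<forall>c\<in>carrier (free p). a c \<in> socle_gen Q \<and> (a c \<in> Q \<longrightarrow> (\<forall>j<p. c j \<in> mm)))"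

end

context resolution
begin

definition coh :: "nat \<Rightarrow> 'a set \<Rightarrow> nat \<Rightarrow> bool" where
  "coh i Q p \<longleftrightarrow> (\<exists>g\<in>module_hom R (free p) (HM i).
     \<forall>c\<in>carrier (free p). g c \<in> Zc i Q \<and> (cob i Q (g c) \<longrightarrow> (\<forall>j<p. c j \<in> mm)))"

definition vanish :: "nat \<Rightarrow> 'a set \<Rightarrow> bool" where
  "vanish i Q \<longleftrightarrow> (\<forall>f\<in>Zc i Q. cob i Q f)"

lemma coh_not_vanish:
  assumes "coh i Q (Suc p)" shows "\<not> vanish i Q"
proof
  assume v: "vanish i Q"
  from assms obtain g where g: "g \<in> module_hom R (free (Suc p)) (HM i)"
    and g': "\<forall>c\<in>carrier (free (Suc p)). g c \<in> Zc i Q \<and> (cob i Q (g c) \<longrightarrow> (\<forall>j<Suc p. c j \<in> mm))"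
    unfolding coh_def by (rule bexE)
  let ?c = "unit_vec (Suc p) 0"
  have c: "?c \<in> carrier (free (Suc p))" by (simp only: free_simps(1) unit_vec_in)
  have "g ?c \<in> Zc i Q" by (rule conjunct1[OF bspec[OF g' c]])
  then have "cob i Q (g ?c)" using v unfolding vanish_def by (rule bspec[rotated])
  then have "\<forall>j<Suc p. ?c j \<in> mm" by (rule mp[OF conjunct2[OF bspec[OF g' c]]])
  then have "?c 0 \<in> mm" by simp
  then show False using one_notin_mm by (simp add: unit_vec_def)
qed

lemma not_vanish_coh:
  assumes Q: "ideal Q R" and v: "\<not> vanish i Q" shows "coh i Q 1"
proof -
  interpret HM: module R "HM i" by (rule HMM)
  obtain f where f: "f \<in> Zc i Q" "\<not> cob i Q f" using v unfolding vanish_def by auto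
  have fH: "f \<in> H i" using f(1) unfolding Zc_def by simp
  obtain g where g: "g \<in> module_hom R (free 1) (HM i)" "\<And>j. j < 1 \<Longrightarrow> g (unit_vec 1 j) = f"
    by (rule free_hom_exists[OF HMM, of 1 "\<lambda>_. f"]) (use fH in \<open>simp_all del: free_simps\<close>)
  have "g c \<in> Zc i Q \<and> (cob i Q (g c) \<longrightarrow> (\<forall>j<1. c j \<in> mm))" if c: "c \<in> carrier (free 1)" for c
  proof -
    have c0: "c 0 \<in> carrier R" using c by (simp only: free_simps(1)) (rule free_coord[of _ 1], simp_all)
    have u: "unit_vec 1 0 \<in> carrier (free 1)" by (simp only: free_simps(1) unit_vec_in)
    have "c = c 0 \<odot>\<^bsub>free 1\<^esub> unit_vec 1 0"
      by (rule free_ext[OF c module_closed(2)[OF free_is_module c0 u]]) (use c0 in \<open>simp add: unit_vec_def\<close>)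
    then have "g c = g (c 0 \<odot>\<^bsub>free 1\<^esub> unit_vec 1 0)" by (rule arg_cong)
    also have "\<dots> = c 0 \<odot>\<^bsub>HM i\<^esub> f" using module_homD(3)[OF g(1) c0 u] g(2)[of 0] by (simp only: zero_less_one)
    finally have gc: "g c = c 0 \<odot>\<^bsub>HM i\<^esub> f" .
    have "g c \<in> Zc i Q" unfolding gc by (rule lsubD(4)[OF Zc_lsub[OF Q] c0 f(1)])
    moreover have "c 0 \<in> mm" if cb: "cob i Q (g c)"
    proof (rule ccontr)
      assume "c 0 \<notin> mm"
      then obtain b where b: "b \<in> carrier R" "b \<otimes> c 0 = \<one>" by (rule unit_obtain[OF c0])
      have gH: "g c \<in> H i" using module_homD(1)[OF g(1) c] by (simp only: hom_simps(1))
      have "b \<odot>\<^bsub>HM i\<^esub> g c \<in> {f \<in> H i. cob i Q f}"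
        by (rule lsubD(4)[OF cob_lsub[OF Q] b(1)]) (use cb gH in simp)
      moreover have "b \<odot>\<^bsub>HM i\<^esub> g c = f"
        unfolding gc using HM.smult_assoc1[OF b(1) c0, of f] HM.smult_one[of f] fH b(2) by (simp only: hom_simps(1))
      ultimately show False using f(2) by simp
    qed
    ultimately show ?thesis by simp
  qed
  then show ?thesis unfolding coh_def using g(1) by (intro bexI[of _ g] ballI)
qed

text \<open>A coboundary modulo \<open>y\<close> and \<open>Q\<close> is, modulo \<open>Q\<close>,
  the sum of a coboundary defined over the ring and of \<open>y\<close> times a cochain
  \<open>h\<close>. Composition with \<open>d i\<close> removes the first summand.\<close>

lemma cob_divide:
  assumes Q: "ideal Q R" and y: "y \<in> carrier R" and f: "f \<in> H i" and c: "cob i (Idl (insert y Q)) f"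
  shows "\<exists>h\<in>H i. \<forall>w\<in>carrier (F (Suc i)). f (d i w) \<ominus> h (d i w) \<otimes> y \<in> Q"
proof (cases i)
  case 0
  have fQ: "\<And>v. v \<in> carrier (F 0) \<Longrightarrow> f v \<in> Idl (insert y Q)" using c unfolding 0 cob.simps by (rule bspec)
  from divide_hom[OF Q y f[unfolded 0] fQ] obtain h where h: "h \<in> H 0"
    and h': "\<forall>v\<in>carrier (F 0). f v \<ominus> h v \<otimes> y \<in> Q" by (rule bexE)
  show ?thesis unfolding 0 using h bspec[OF h' d_closed] by (intro bexI[of _ h] ballI)
next
  case (Suc j)
  from c obtain k where k: "k \<in> H j" and k': "\<forall>v\<in>carrier (F (Suc j)). f v \<ominus> k (d j v) \<in> Idl (insert y Q)"
    unfolding Suc cob.simps by (rule bexE)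
  let ?f = "\<lambda>v\<in>carrier (F (Suc j)). f v \<ominus> (\<lambda>v\<in>carrier (F (Suc j)). k (d j v)) v"
  have f': "?f \<in> H (Suc j)" by (rule Hdiff[OF f[unfolded Suc] Hd[OF k]])
  have fv: "?f v = f v \<ominus> k (d j v)" if "v \<in> carrier (F (Suc j))" for v using that by (simp del: free_simps)
  have fQ: "?f v \<in> Idl (insert y Q)" if v: "v \<in> carrier (F (Suc j))" for v
    unfolding fv[OF v] by (rule bspec[OF k' v])
  from divide_hom[OF Q y f' fQ] obtain h where h: "h \<in> H (Suc j)"
    and h': "\<forall>v\<in>carrier (F (Suc j)). ?f v \<ominus> h v \<otimes> y \<in> Q" by (rule bexE)
  have "f (d (Suc j) w) \<ominus> h (d (Suc j) w) \<otimes> y \<in> Q" if w: "w \<in> carrier (F (Suc (Suc j)))" for w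
  proof -
    have "?f (d (Suc j) w) \<ominus> h (d (Suc j) w) \<otimes> y \<in> Q" by (rule bspec[OF h' d_closed[OF w]])
    moreover have "?f (d (Suc j) w) = f (d (Suc j) w)"
      unfolding fv[OF d_closed[OF w]] dd[OF w] H_facts(4)[OF k]
      using H_facts(1)[OF f[unfolded Suc] d_closed[OF w]] by (simp add: a_minus_def)
    ultimately show ?thesis by (simp only:)
  qed
  then show ?thesis unfolding Suc using h by (intro bexI[of _ h] ballI)
qed

lemma cob_add_multiple:
  assumes Q: "ideal Q R" and y: "y \<in> carrier R" and f: "f \<in> H i" and h: "h \<in> H i"
    and c: "cob i Q (\<lambda>v\<in>carrier (F i). f v \<ominus> h v \<otimes> y)"
  shows "cob i (Idl (insert y Q)) f"
proof -
  note Q' = ideal_insert_facts[OF Q y]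
  have key: "a \<in> Idl (insert y Q)" if a: "a \<ominus> b \<otimes> y \<in> Q" "a \<in> carrier R" "b \<in> carrier R" for a b
  proof -
    have "a = (a \<ominus> b \<otimes> y) \<oplus> b \<otimes> y" using a(2,3) y by algebra
    then show ?thesis unfolding ideal_insert_mem[OF Q y] using a(1,3) by auto
  qed
  show ?thesis
  proof (cases i)
    case 0
    show ?thesis unfolding 0 cob.simps
    proof
      fix v assume v: "v \<in> carrier (F 0)"
      have "f v \<ominus> h v \<otimes> y \<in> Q" using c v unfolding 0 by (simp del: free_simps)
      then show "f v \<in> Idl (insert y Q)"
        by (rule key) (use H_facts(1)[OF f] H_facts(1)[OF h] v 0 in \<open>simp_all del: free_simps\<close>)
    qed
  next
    case (Suc j)
    from c obtain k where k: "k \<in> H j"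
      and k': "\<forall>v\<in>carrier (F (Suc j)). (\<lambda>v\<in>carrier (F i). f v \<ominus> h v \<otimes> y) v \<ominus> k (d j v) \<in> Q"
      unfolding Suc cob.simps by (rule bexE)
    have "f v \<ominus> k (d j v) \<in> Idl (insert y Q)" if v: "v \<in> carrier (F (Suc j))" for v
    proof (rule key)
      have c: "f v \<in> carrier R" "h v \<in> carrier R" "k (d j v) \<in> carrier R"
        using H_facts(1)[OF f[unfolded Suc] v] H_facts(1)[OF h[unfolded Suc] v] H_facts(1)[OF k d_closed[OF v]] .
      then show "f v \<ominus> k (d j v) \<in> carrier R" "h v \<in> carrier R" by simp_all
      have "(f v \<ominus> h v \<otimes> y) \<ominus> k (d j v) \<in> Q" using bspec[OF k' v] v unfolding Suc by (simp del: free_simps)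
      moreover have "(f v \<ominus> h v \<otimes> y) \<ominus> k (d j v) = f v \<ominus> k (d j v) \<ominus> h v \<otimes> y" using c y by algebra
      ultimately show "f v \<ominus> k (d j v) \<ominus> h v \<otimes> y \<in> Q" by (simp only:)
    qed
    then show ?thesis unfolding Suc cob.simps using k by (intro bexI[of _ k] ballI)
  qed
qed

lemma hom_HM: "g \<in> module_hom R (free p) (HM i) \<Longrightarrow> c \<in> carrier (free p) \<Longrightarrow> g c \<in> H i"
  using module_homD(1)[of g "free p" "HM i" c] by (simp only: hom_simps(1))

text \<open>The connecting map for multiplication by \<open>y\<close> on the ring modulo
  \<open>Q\<close>: a cocycle \<open>u\<close> modulo \<open>y\<close> goes to the \<open>g\<close>
  with \<open>u\<close> after \<open>d i\<close> equal to \<open>g\<close> times \<open>y\<close>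
  modulo \<open>Q\<close>. It is injective because the cohomology modulo \<open>Q\<close> vanishes
  in degree \<open>i\<close>.\<close>

lemma shift_up:
  assumes Q: "ideal Q R" and y: "y \<in> carrier R"
    and nz: "\<And>a. a \<in> carrier R \<Longrightarrow> y \<otimes> a \<in> Q \<Longrightarrow> a \<in> Q" and van: "vanish i Q"
    and D: "coh i (Idl (insert y Q)) p"
  shows "coh (Suc i) Q p"
proof -
  let ?Q = "Idl (insert y Q)"
  from D obtain u where u: "u \<in> module_hom R (free p) (HM i)"
    and u': "\<forall>c\<in>carrier (free p). u c \<in> Zc i ?Q \<and> (cob i ?Q (u c) \<longrightarrow> (\<forall>j<p. c j \<in> mm))"
    unfolding coh_def by (rule bexE)
  have uH: "u c \<in> H i" if "c \<in> carrier (free p)" for c by (rule hom_HM[OF u that])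
  have uQ: "u c (d i v) \<in> ?Q" if "c \<in> carrier (free p)" "v \<in> carrier (F (Suc i))" for c v
    using bspec[OF u' that(1)] that(2) unfolding Zc_def by simp
  have e: "unit_vec p k \<in> carrier (free p)" for k by simp
  \<comment> \<open>The connecting image is chosen at unit vectors only and then extended linearly,
    so that it depends linearly on the coefficients.\<close>
  have "\<exists>g\<in>H (Suc i). \<forall>v\<in>carrier (F (Suc i)). u (unit_vec p k) (d i v) \<ominus> g v \<otimes> y \<in> Q" for k
  proof -
    let ?f = "\<lambda>v\<in>carrier (F (Suc i)). u (unit_vec p k) (d i v)"
    have "?f v \<in> ?Q" if "v \<in> carrier (F (Suc i))" for v using uQ[OF e that] that by (simp del: free_simps)
    from divide_hom[OF Q y Hd[OF uH[OF e]] this] show ?thesis by (simp del: free_simps)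
  qed
  then obtain gk where gk: "\<And>k. gk k \<in> H (Suc i)" "\<And>k. \<forall>v\<in>carrier (F (Suc i)). u (unit_vec p k) (d i v) \<ominus> gk k v \<otimes> y \<in> Q"
    by metis
  have "gk k \<in> carrier (HM (Suc i))" for k using gk(1) by (simp only: hom_simps(1))
  from free_hom_ex[OF HMM this, of p] obtain g where g: "g \<in> module_hom R (free p) (HM (Suc i))"
    and g2: "\<forall>j<p. g (unit_vec p j) = gk j" by (rule bexE)
  have gH: "g c \<in> H (Suc i)" if "c \<in> carrier (free p)" for c by (rule hom_HM[OF g that])
  have key: "u c (d i v) \<ominus> g c v \<otimes> y \<in> Q" if c: "c \<in> carrier (free p)" and v: "v \<in> carrier (F (Suc i))" for c v
  proof (rule span_cong[OF bil_eval[OF u] bil_scale[OF bil_eval[OF g]] Q _ c v])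
    fix k assume "k < p"
    then show "u (unit_vec p k) (d i v) \<ominus> g (unit_vec p k) v \<otimes> y \<in> Q" using bspec[OF gk(2) v] g2 by simp
  qed (use d_closed y in simp_all)
  have "g c \<in> Zc (Suc i) Q \<and> (cob (Suc i) Q (g c) \<longrightarrow> (\<forall>j<p. c j \<in> mm))" if c: "c \<in> carrier (free p)" for c
  proof
    have "g c (d (Suc i) v) \<in> Q" if v: "v \<in> carrier (F (Suc (Suc i)))" for v
    proof -
      let ?w = "d (Suc i) v"
      have gw: "g c ?w \<in> carrier R" by (rule H_facts(1)[OF gH[OF c] d_closed[OF v]])
      have "\<zero> \<ominus> g c ?w \<otimes> y \<in> Q" using key[OF c d_closed[OF v]] unfolding dd[OF v] H_facts(4)[OF uH[OF c]] .
      from ideal_closed(6)[OF Q this] have "y \<otimes> g c ?w \<in> Q" using gw y by (simp add: a_minus_def m_comm)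
      then show ?thesis by (rule nz[OF gw])
    qed
    then show "g c \<in> Zc (Suc i) Q" unfolding Zc_def using gH[OF c] by simp
    show "cob (Suc i) Q (g c) \<longrightarrow> (\<forall>j<p. c j \<in> mm)"
    proof
      assume "cob (Suc i) Q (g c)"
      then obtain h where h: "h \<in> H i" and h': "\<forall>v\<in>carrier (F (Suc i)). g c v \<ominus> h (d i v) \<in> Q"
        unfolding cob.simps by (rule bexE)
      let ?h = "\<lambda>v\<in>carrier (F i). y \<otimes> h v"
      let ?f = "\<lambda>v\<in>carrier (F i). u c v \<ominus> ?h v"
      have eq: "?f = (\<lambda>v\<in>carrier (F i). u c v \<ominus> h v \<otimes> y)"
        by (rule restrict_ext) (use H_facts(1)[OF h] y in \<open>simp add: m_comm del: free_simps\<close>)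
      have fH: "?f \<in> H i" by (rule Hdiff[OF uH[OF c] Hop(2)[OF y h]])
      have fQ: "?f (d i w) \<in> Q" if w: "w \<in> carrier (F (Suc i))" for w
      proof -
        have cc: "u c (d i w) \<in> carrier R" "g c w \<in> carrier R" "h (d i w) \<in> carrier R"
          using H_facts(1)[OF uH[OF c] d_closed[OF w]] H_facts(1)[OF gH[OF c] w] H_facts(1)[OF h d_closed[OF w]] .
        have "(u c (d i w) \<ominus> g c w \<otimes> y) \<oplus> (g c w \<ominus> h (d i w)) \<otimes> y \<in> Q"
          by (rule ideal_closed(1)[OF Q key[OF c w] ideal_closed(4)[OF Q bspec[OF h' w] y]])
        moreover have "(u c (d i w) \<ominus> g c w \<otimes> y) \<oplus> (g c w \<ominus> h (d i w)) \<otimes> y = u c (d i w) \<ominus> h (d i w) \<otimes> y"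
          using cc y by algebra
        ultimately show ?thesis unfolding eq using d_closed[OF w] by (simp del: free_simps)
      qed
      \<comment> \<open>After subtracting \<open>y\<close> times \<open>h\<close>, the class is a
        cocycle modulo \<open>Q\<close> and so a coboundary there; modulo \<open>y\<close> this
        makes \<open>u c\<close> a coboundary.\<close>
      have "?f \<in> Zc i Q" unfolding Zc_def by (rule CollectI, rule conjI, rule fH, rule ballI, rule fQ)
      then have "cob i Q ?f" using van unfolding vanish_def by (rule bspec[rotated])
      then have "cob i ?Q (u c)" unfolding eq by (rule cob_add_multiple[OF Q y uH[OF c] h])
      then show "\<forall>j<p. c j \<in> mm" using bspec[OF u' c] by simp
    qed
  qed
  then show ?thesis unfolding coh_def using g by (intro bexI[of _ g] ballI)
qed

text \<open>Surjectivity of the connecting map: \<open>y\<close> kills the cohomology in degree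
  \<open>i + 1\<close>, so \<open>y\<close> times \<open>g\<close> is modulo \<open>Q\<close> the
  coboundary of some \<open>u\<close>, and this \<open>u\<close> is a cocycle modulo
  \<open>y\<close> lying over \<open>g\<close>.\<close>

lemma shift_down:
  assumes Q: "ideal Q R" and y: "y \<in> mm"
    and nz: "\<And>a. a \<in> carrier R \<Longrightarrow> y \<otimes> a \<in> Q \<Longrightarrow> a \<in> Q"
    and D: "coh (Suc i) Q p"
  shows "coh i (Idl (insert y Q)) p"
proof -
  let ?Q = "Idl (insert y Q)"
  note yc = mm_carr[OF y]
  from D obtain g where g: "g \<in> module_hom R (free p) (HM (Suc i))"
    and g': "\<forall>c\<in>carrier (free p). g c \<in> Zc (Suc i) Q \<and> (cob (Suc i) Q (g c) \<longrightarrow> (\<forall>j<p. c j \<in> mm))"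
    unfolding coh_def by (rule bexE)
  have gH: "g c \<in> H (Suc i)" if "c \<in> carrier (free p)" for c by (rule hom_HM[OF g that])
  have e: "unit_vec p k \<in> carrier (free p)" for k by simp
  have "\<exists>u\<in>H i. \<forall>v\<in>carrier (F (Suc i)). g (unit_vec p k) v \<otimes> y \<ominus> u (d i v) \<in> Q" for k
  proof -
    have "cob (Suc i) Q (\<lambda>v\<in>carrier (F (Suc i)). y \<otimes> g (unit_vec p k) v)"
      by (rule null_homotopic[OF Q y conjunct1[OF bspec[OF g' e]]])
    then show ?thesis using H_facts(1)[OF gH[OF e]] yc by (simp add: m_comm del: free_simps)
  qed
  then obtain uk where uk: "\<And>k. uk k \<in> H i" "\<And>k. \<forall>v\<in>carrier (F (Suc i)). g (unit_vec p k) v \<otimes> y \<ominus> uk k (d i v) \<in> Q"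
    by metis
  have "uk k \<in> carrier (HM i)" for k using uk(1) by (simp only: hom_simps(1))
  from free_hom_ex[OF HMM this, of p] obtain u where u: "u \<in> module_hom R (free p) (HM i)"
    and u2: "\<forall>j<p. u (unit_vec p j) = uk j" by (rule bexE)
  have uH: "u c \<in> H i" if "c \<in> carrier (free p)" for c by (rule hom_HM[OF u that])
  have key: "g c v \<otimes> y \<ominus> u c (d i v) \<in> Q" if c: "c \<in> carrier (free p)" and v: "v \<in> carrier (F (Suc i))" for c v
  proof (rule span_cong[OF bil_scale[OF bil_eval[OF g]] bil_eval[OF u] Q _ c v])
    fix k assume "k < p"
    then show "g (unit_vec p k) v \<otimes> y \<ominus> u (unit_vec p k) (d i v) \<in> Q" using bspec[OF uk(2) v] u2 by simp
  qed (use d_closed yc in simp_all)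
  have "u c \<in> Zc i ?Q \<and> (cob i ?Q (u c) \<longrightarrow> (\<forall>j<p. c j \<in> mm))" if c: "c \<in> carrier (free p)" for c
  proof
    have "u c (d i v) \<in> ?Q" if v: "v \<in> carrier (F (Suc i))" for v
    proof -
      have cc: "g c v \<in> carrier R" "u c (d i v) \<in> carrier R"
        using H_facts(1)[OF gH[OF c] v] H_facts(1)[OF uH[OF c] d_closed[OF v]] .
      have "u c (d i v) = \<ominus> (g c v \<otimes> y \<ominus> u c (d i v)) \<oplus> g c v \<otimes> y" using cc yc by algebra
      then show ?thesis unfolding ideal_insert_mem[OF Q yc] using ideal_closed(6)[OF Q key[OF c v]] cc(1) by auto
    qed
    then show "u c \<in> Zc i ?Q" unfolding Zc_def using uH[OF c] by simp
    show "cob i ?Q (u c) \<longrightarrow> (\<forall>j<p. c j \<in> mm)"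
    proof
      assume "cob i ?Q (u c)"
      from cob_divide[OF Q yc uH[OF c] this] obtain h where h: "h \<in> H i"
        and h': "\<forall>w\<in>carrier (F (Suc i)). u c (d i w) \<ominus> h (d i w) \<otimes> y \<in> Q" by (rule bexE)
      \<comment> \<open>Multiplied by \<open>y\<close>, the difference is a sum of two known
        elements of \<open>Q\<close>; then \<open>y\<close> cancels.\<close>
      have "g c v \<ominus> h (d i v) \<in> Q" if v: "v \<in> carrier (F (Suc i))" for v
      proof (rule nz)
        have cc: "g c v \<in> carrier R" "u c (d i v) \<in> carrier R" "h (d i v) \<in> carrier R"
          using H_facts(1)[OF gH[OF c] v] H_facts(1)[OF uH[OF c] d_closed[OF v]] H_facts(1)[OF h d_closed[OF v]] .
        show "g c v \<ominus> h (d i v) \<in> carrier R" using cc by simp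
        have "y \<otimes> (g c v \<ominus> h (d i v)) = (g c v \<otimes> y \<ominus> u c (d i v)) \<oplus> (u c (d i v) \<ominus> h (d i v) \<otimes> y)"
          using cc yc by algebra
        then show "y \<otimes> (g c v \<ominus> h (d i v)) \<in> Q" using ideal_closed(1)[OF Q key[OF c v] bspec[OF h' v]] by simp
      qed
      then have "cob (Suc i) Q (g c)" unfolding cob.simps using h by (intro bexI[of _ h] ballI)
      then show "\<forall>j<p. c j \<in> mm" using bspec[OF g' c] by simp
    qed
  qed
  then show ?thesis unfolding coh_def using u by (intro bexI[of _ u] ballI)
qed

lemma \<rho>_kernel:
  assumes "v \<in> carrier (F 0)" "\<rho> v \<in> mm"
  obtains w where "w \<in> carrier (F (Suc 0))" "v = d 0 w"
proof -
  have "v \<in> d 0 ` carrier (F 1)" unfolding exact0 using assms by (simp del: free_simps)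
  then show ?thesis using that by auto
qed

text \<open>Degree zero is Hom out of the residue field. A cocycle is determined modulo
  \<open>Q\<close> by its value at \<open>v1\<close>, because subtracting \<open>\<rho> v\<close>
  times \<open>v1\<close> from \<open>v\<close> gives a vector in the image of \<open>d 0\<close>.
  Conversely, an element of the socle times \<open>\<rho>\<close> is a cocycle.\<close>

lemma coh_0_iff:
  assumes Q: "ideal Q R"
  shows "coh 0 Q p \<longleftrightarrow> socle_family Q p"
proof
  interpret M: module R "F 0" by (rule FM)
  assume "coh 0 Q p"
  then obtain g where g: "g \<in> module_hom R (free p) (HM 0)"
    and g': "\<forall>c\<in>carrier (free p). g c \<in> Zc 0 Q \<and> (cob 0 Q (g c) \<longrightarrow> (\<forall>j<p. c j \<in> mm))"
    unfolding coh_def by (rule bexE)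
  have gH: "g c \<in> H 0" if "c \<in> carrier (free p)" for c by (rule hom_HM[OF g that])
  have gQ: "g c v \<in> Q" if c: "c \<in> carrier (free p)" and v: "v \<in> carrier (F 0)" "\<rho> v \<in> mm" for c v
  proof -
    obtain w where w: "w \<in> carrier (F (Suc 0))" "v = d 0 w" by (rule \<rho>_kernel[OF v])
    show ?thesis using bspec[OF g' c] w(1) unfolding Zc_def w(2) by simp
  qed
  let ?a = "\<lambda>c\<in>carrier (free p). g c v1"
  have b: "bil p {v1} (\<lambda>c v. g c v)" by (rule bil_eval[OF g, of "{v1}" "\<lambda>v. v"]) (use v1(1) in simp)
  have a: "?a \<in> module_hom R (free p) (self_module R)"
    by (rule module_homI[OF _ _ _ free_is_module]) (use bilD[OF b, of v1] in \<open>simp_all del: free_simps\<close>)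
  have "?a c \<in> socle_gen Q \<and> (?a c \<in> Q \<longrightarrow> (\<forall>j<p. c j \<in> mm))" if c: "c \<in> carrier (free p)" for c
  proof
    have av: "?a c = g c v1" using c by (simp del: free_simps)
    have "r \<otimes> g c v1 \<in> Q" if r: "r \<in> mm" for r
    proof -
      have rv: "r \<odot>\<^bsub>F 0\<^esub> v1 \<in> carrier (F 0)" by (rule M.smult_closed[OF mm_carr[OF r] v1(1)])
      have "\<rho> (r \<odot>\<^bsub>F 0\<^esub> v1) \<in> mm" using H_facts(3)[OF \<rho> mm_carr[OF r] v1(1)] v1(2) r mm_carr[OF r] by simp
      from gQ[OF c rv this] show ?thesis using H_facts(3)[OF gH[OF c] mm_carr[OF r] v1(1)] by simp
    qed
    then show "?a c \<in> socle_gen Q" unfolding av socle_gen_def using H_facts(1)[OF gH[OF c] v1(1)] by simp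
    show "?a c \<in> Q \<longrightarrow> (\<forall>j<p. c j \<in> mm)"
    proof
      assume "?a c \<in> Q"
      then have aQ: "g c v1 \<in> Q" unfolding av .
      have "g c v \<in> Q" if v: "v \<in> carrier (F 0)" for v
      proof -
        have x: "\<rho> v \<in> carrier R" by (rule H_facts(1)[OF \<rho> v])
        let ?s = "\<ominus> \<rho> v \<odot>\<^bsub>F 0\<^esub> v1"
        have s: "?s \<in> carrier (F 0)" using x by (intro M.smult_closed v1(1)) simp
        have "\<rho> (v \<oplus>\<^bsub>F 0\<^esub> ?s) = \<rho> v \<oplus> \<ominus> \<rho> v \<otimes> \<one>"
          using H_facts(2)[OF \<rho> v s] H_facts(3)[OF \<rho> _ v1(1), of "\<ominus> \<rho> v"] v1(2) x by simp
        then have "\<rho> (v \<oplus>\<^bsub>F 0\<^esub> ?s) \<in> mm" using x ideal_closed(5)[OF mm_ideal] by (simp add: r_neg)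
        from gQ[OF c M.a_closed[OF v s] this] have q: "g c v \<oplus> \<ominus> \<rho> v \<otimes> g c v1 \<in> Q"
          using H_facts(2)[OF gH[OF c] v s] H_facts(3)[OF gH[OF c] _ v1(1), of "\<ominus> \<rho> v"] x by simp
        have cc: "g c v \<in> carrier R" "g c v1 \<in> carrier R" using H_facts(1)[OF gH[OF c] v] H_facts(1)[OF gH[OF c] v1(1)] .
        have "(g c v \<oplus> \<ominus> \<rho> v \<otimes> g c v1) \<oplus> \<rho> v \<otimes> g c v1 \<in> Q" by (rule ideal_closed(1)[OF Q q ideal_closed(3)[OF Q aQ x]])
        moreover have "(g c v \<oplus> \<ominus> \<rho> v \<otimes> g c v1) \<oplus> \<rho> v \<otimes> g c v1 = g c v" using cc x by algebra
        ultimately show ?thesis by (simp only:)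
      qed
      then have "cob 0 Q (g c)" unfolding cob.simps by (rule ballI)
      then show "\<forall>j<p. c j \<in> mm" using bspec[OF g' c] by simp
    qed
  qed
  then show "socle_family Q p" unfolding socle_family_def using a by (intro bexI[of _ ?a] ballI)
next
  assume "socle_family Q p"
  then obtain a where a: "a \<in> module_hom R (free p) (self_module R)"
    and a': "\<forall>c\<in>carrier (free p). a c \<in> socle_gen Q \<and> (a c \<in> Q \<longrightarrow> (\<forall>j<p. c j \<in> mm))"
    unfolding socle_family_def by (rule bexE)
  have ac: "a c \<in> carrier R" if "c \<in> carrier (free p)" for c using module_homD(1)[OF a that] by simp
  have e: "unit_vec p k \<in> carrier (free p)" for k by simp
  let ?w = "\<lambda>k. \<lambda>v\<in>carrier (F 0). a (unit_vec p k) \<otimes> \<rho> v"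
  have w: "?w k \<in> H 0" for k by (rule Hop(2)[OF ac[OF e] \<rho>])
  have "?w k \<in> carrier (HM 0)" for k using w by (simp only: hom_simps(1))
  from free_hom_ex[OF HMM this, of p] obtain g where g: "g \<in> module_hom R (free p) (HM 0)"
    and g2: "\<forall>j<p. g (unit_vec p j) = ?w j" by (rule bexE)
  have gv: "g c v = a c \<otimes> \<rho> v" if c: "c \<in> carrier (free p)" and v: "v \<in> carrier (F 0)" for c v
  proof -
    have "g c v \<ominus> a c \<otimes> \<rho> v \<in> {\<zero>}"
    proof (rule span_cong[OF bil_eval[OF g] bil_scale[OF bil_hom[OF a]] zeroideal _ c v])
      fix k assume k: "k < p"
      show "g (unit_vec p k) v \<ominus> a (unit_vec p k) \<otimes> \<rho> v \<in> {\<zero>}"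
        unfolding g2[rule_format, OF k] using v ac[OF e] H_facts(1)[OF \<rho> v] by (simp add: a_minus_def r_neg del: free_simps)
    qed (use H_facts(1)[OF \<rho>] in simp_all)
    then show ?thesis using H_facts(1)[OF hom_HM[OF g c] v] ac[OF c] H_facts(1)[OF \<rho> v] by simp
  qed
  have "g c \<in> Zc 0 Q \<and> (cob 0 Q (g c) \<longrightarrow> (\<forall>j<p. c j \<in> mm))" if c: "c \<in> carrier (free p)" for c
  proof
    have "g c (d 0 v) \<in> Q" if v: "v \<in> carrier (F (Suc 0))" for v
    proof -
      have r: "\<rho> (d 0 v) \<in> mm" using \<rho>d v by simp
      then have "\<rho> (d 0 v) \<otimes> a c \<in> Q" using bspec[OF a' c] unfolding socle_gen_def by simp
      then show ?thesis unfolding gv[OF c d_closed[OF v]] using ac[OF c] mm_carr[OF r] by (simp add: m_comm)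
    qed
    then show "g c \<in> Zc 0 Q" unfolding Zc_def using hom_HM[OF g c] by simp
    show "cob 0 Q (g c) \<longrightarrow> (\<forall>j<p. c j \<in> mm)"
    proof
      assume "cob 0 Q (g c)"
      then have "g c v1 \<in> Q" unfolding cob.simps using v1(1) by (rule bspec)
      then have "a c \<in> Q" unfolding gv[OF c v1(1)] v1(2) using ac[OF c] by simp
      then show "\<forall>j<p. c j \<in> mm" using bspec[OF a' c] by simp
    qed
  qed
  then show "coh 0 Q p" unfolding coh_def using g by (intro bexI[of _ g] ballI)
qed

text \<open>Dimension shifting along \<open>ys\<close>. In degree zero vanishing holds because
  \<open>y\<close> both kills the cohomology and is regular modulo \<open>S\<close>; in a higher
  degree a nonzero class would shift down to one modulo \<open>y\<close>.\<close>

lemma coh_regular: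
  assumes "set ys \<subseteq> mm" "S \<subseteq> carrier R" "reg S ys"
  shows "(\<forall>i<length ys. vanish i (Idl S)) \<and> (coh (length ys) (Idl S) p \<longleftrightarrow> socle_family (Idl (S \<union> set ys)) p)"
  using assms
proof (induction ys arbitrary: S)
  case Nil
  then show ?case using coh_0_iff[OF genideal_ideal] by simp
next
  case (Cons y ys)
  have y: "y \<in> mm" and yc: "y \<in> carrier R" using Cons.prems(1) mm_carr by simp_all
  have SC: "insert y S \<subseteq> carrier R" using Cons.prems(2) yc by simp
  have r: "reg S [y]" "reg (insert y S) ys" using Cons.prems(3) reg_append[of S "[y]" ys] by simp_all
  then have nz: "\<And>a. a \<in> carrier R \<Longrightarrow> y \<otimes> a \<in> Idl S \<Longrightarrow> a \<in> Idl S" unfolding reg_def nzd_def by simp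
  have Q: "ideal (Idl S) R" by (rule genideal_ideal[OF Cons.prems(2)])
  have eq: "Idl (insert y (Idl S)) = Idl (insert y S)"
    using Idl_Un_Idl[OF Cons.prems(2), of "{y}"] yc by simp
  have Q': "ideal (Idl (insert y S)) R" by (rule genideal_ideal[OF SC])
  have IH: "\<And>i. i < length ys \<Longrightarrow> vanish i (Idl (insert y S))"
    "coh (length ys) (Idl (insert y S)) p \<longleftrightarrow> socle_family (Idl (insert y S \<union> set ys)) p"
    using Cons.IH[OF _ SC r(2)] Cons.prems(1) by simp_all
  have van: "vanish i (Idl S)" if i: "i < Suc (length ys)" for i
  proof (cases i)
    case 0
    have "cob 0 (Idl S) f" if f: "f \<in> Zc 0 (Idl S)" for f
    proof -
      have fH: "f \<in> H 0" using f unfolding Zc_def by simp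
      have "cob 0 (Idl S) (\<lambda>v\<in>carrier (F 0). y \<otimes> f v)" by (rule null_homotopic[OF Q y f])
      then have yf: "y \<otimes> f v \<in> Idl S" if "v \<in> carrier (F 0)" for v using that by (simp del: free_simps)
      show ?thesis unfolding cob.simps
      proof
        fix v assume v: "v \<in> carrier (F 0)"
        show "f v \<in> Idl S" by (rule nz[OF H_facts(1)[OF fH v] yf[OF v]])
      qed
    qed
    then show ?thesis unfolding 0 vanish_def by (rule ballI)
  next
    case (Suc j)
    show ?thesis
    proof (rule ccontr)
      assume "\<not> vanish i (Idl S)"
      then have "coh (Suc j) (Idl S) 1" unfolding Suc by (rule not_vanish_coh[OF Q])
      from shift_down[OF Q y nz this] have "coh j (Idl (insert y S)) (Suc 0)" unfolding eq by simp
      then have "\<not> vanish j (Idl (insert y S))" by (rule coh_not_vanish)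
      then show False using IH(1)[of j] i Suc by simp
    qed
  qed
  have "coh (Suc (length ys)) (Idl S) p \<longleftrightarrow> coh (length ys) (Idl (insert y S)) p"
    using shift_down[OF Q y nz, of "length ys" p] shift_up[OF Q yc nz van, of "length ys" p] unfolding eq by blast
  then show ?case using van IH(2) by simp
qed

section \<open>Ext with values in the ring, as cohomology modulo the zero ideal\<close>

abbreviation "Ext_module i \<equiv> cohomology R (self_module R) n d i"

lemma cocycles_eq: "cocycles R (self_module R) n d i = Zc i {\<zero>}"
  unfolding cocycles_def Zc_def by (simp del: free_simps)

lemma coboundaries_eq: "coboundaries R (self_module R) n d i = {f \<in> H i. cob i {\<zero>} f}"
proof (cases i)
  case 0
  have z: "\<zero>\<^bsub>HM 0\<^esub> = (\<lambda>v\<in>carrier (F 0). \<zero>)" by (simp only: hom_simps self_simps)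
  show ?thesis unfolding 0 coboundaries.simps z
  proof (intro equalityI subsetI)
    fix f assume "f \<in> {\<lambda>v\<in>carrier (F 0). \<zero>}"
    then have f: "f = (\<lambda>v\<in>carrier (F 0). \<zero>)" by (rule singletonD)
    show "f \<in> {f \<in> H 0. cob 0 {\<zero>} f}" unfolding f using Hop(3)[of 0] by (simp del: free_simps)
  next
    fix f assume "f \<in> {f \<in> H 0. cob 0 {\<zero>} f}"
    then have f: "f \<in> H 0" "cob 0 {\<zero>} f" by simp_all
    have "f = (\<lambda>v\<in>carrier (F 0). \<zero>)"
    proof (rule module_hom_eqI[OF f(1) Hop(3)])
      fix v assume v: "v \<in> carrier (F 0)"
      have "f v = \<zero>" using f(2) v by (simp del: free_simps)
      then show "f v = (\<lambda>v\<in>carrier (F 0). \<zero>) v" using v by (simp only: restrict_apply')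
    qed
    then show "f \<in> {\<lambda>v\<in>carrier (F 0). \<zero>}" by (simp only: singleton_iff)
  qed
next
  case (Suc j)
  show ?thesis unfolding Suc coboundaries.simps
  proof (intro equalityI subsetI)
    fix f assume "f \<in> (\<lambda>g. \<lambda>v\<in>carrier (F (Suc j)). g (d j v)) ` H j"
    then obtain g where g: "g \<in> H j" "f = (\<lambda>v\<in>carrier (F (Suc j)). g (d j v))" by auto
    have "f v \<ominus> g (d j v) \<in> {\<zero>}" if v: "v \<in> carrier (F (Suc j))" for v
      unfolding g(2) using v H_facts(1)[OF g(1) d_closed[OF v]] by (simp add: a_minus_def r_neg del: free_simps)
    then have "cob (Suc j) {\<zero>} f" unfolding cob.simps using g(1) by (intro bexI[of _ g] ballI)
    then show "f \<in> {f \<in> H (Suc j). cob (Suc j) {\<zero>} f}" using Hd[OF g(1)] unfolding g(2) by (simp only: mem_Collect_eq simp_thms)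
  next
    fix f assume "f \<in> {f \<in> H (Suc j). cob (Suc j) {\<zero>} f}"
    then have f: "f \<in> H (Suc j)" and "cob (Suc j) {\<zero>} f" by simp_all
    then obtain g where g: "g \<in> H j" "\<forall>v\<in>carrier (F (Suc j)). f v \<ominus> g (d j v) \<in> {\<zero>}" unfolding cob.simps by (elim bexE)
    have "f = (\<lambda>v\<in>carrier (F (Suc j)). g (d j v))"
    proof (rule module_hom_eqI[OF f Hd[OF g(1)]])
      fix v assume v: "v \<in> carrier (F (Suc j))"
      have "f v \<ominus> g (d j v) = \<zero>" using g(2) v by simp
      then show "f v = (\<lambda>v\<in>carrier (F (Suc j)). g (d j v)) v"
        using v H_facts(1)[OF f v] H_facts(1)[OF g(1) d_closed[OF v]] by (simp del: free_simps)
    qed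
    then show "f \<in> (\<lambda>g. \<lambda>v\<in>carrier (F (Suc j)). g (d j v)) ` H j" using g(1) by (rule image_eqI)
  qed
qed

abbreviation "ZM i \<equiv> (HM i)\<lparr>carrier := Zc i {\<zero>}\<rparr>"
abbreviation "cobs i \<equiv> {f \<in> H i. cob i {\<zero>} f}"

lemma Ext_module_eq: "Ext_module i = quotient_module (ZM i) (cobs i)"
  unfolding cohomology_def cocycles_eq coboundaries_eq by simp

lemma ZM_module: "module R (ZM i)"
  by (rule sub_is_module[OF HMM Zc_lsub[OF zeroideal]])

lemma cobs_lsub: "lsub (ZM i) (cobs i)"
  by (rule lsub_sub[OF Zc_lsub[OF zeroideal] cob_lsub[OF zeroideal]]) (use cob_Zc[OF zeroideal] in blast)

definition cls :: "nat \<Rightarrow> ((nat \<Rightarrow> 'a) \<Rightarrow> 'a) \<Rightarrow> ((nat \<Rightarrow> 'a) \<Rightarrow> 'a) set" where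
  "cls i = (\<lambda>x\<in>carrier (ZM i). cobs i +>\<^bsub>ZM i\<^esub> x)"

lemma Ext_facts:
  "module R (Ext_module i)" "cls i \<in> module_hom R (ZM i) (Ext_module i)"
  "cls i ` carrier (ZM i) = carrier (Ext_module i)"
  "f \<in> carrier (ZM i) \<Longrightarrow> cls i f = \<zero>\<^bsub>Ext_module i\<^esub> \<longleftrightarrow> f \<in> cobs i"
  unfolding Ext_module_eq cls_def by (rule quotient_module_facts[OF ZM_module cobs_lsub])+

lemma ZM_hom_iff:
  "g \<in> module_hom R (free p) (ZM i) \<longleftrightarrow> g \<in> module_hom R (free p) (HM i) \<and> (\<forall>c\<in>carrier (free p). g c \<in> Zc i {\<zero>})"
proof -
  have Z: "Zc i {\<zero>} \<subseteq> H i" unfolding Zc_def by auto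
  show ?thesis unfolding module_hom_def using Z by (auto simp del: free_simps simp: PiE_iff)
qed

lemma coh_iff_indep: "coh i {\<zero>} p \<longleftrightarrow> (\<exists>f. indep (Ext_module i) p f)"
proof
  assume "coh i {\<zero>} p"
  then obtain g where g: "g \<in> module_hom R (free p) (HM i)"
    and g': "\<forall>c\<in>carrier (free p). g c \<in> Zc i {\<zero>} \<and> (cob i {\<zero>} (g c) \<longrightarrow> (\<forall>j<p. c j \<in> mm))"
    unfolding coh_def by (rule bexE)
  have gZ: "g \<in> module_hom R (free p) (ZM i)" unfolding ZM_hom_iff using g g' by simp
  let ?f = "\<lambda>c\<in>carrier (free p). cls i (g c)"
  have "indep (Ext_module i) p ?f" unfolding indep_def
  proof (intro conjI ballI impI)
    show "?f \<in> module_hom R (free p) (Ext_module i)" by (rule module_hom_comp[OF gZ Ext_facts(2) free_is_module])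
    fix c assume c: "c \<in> carrier (free p)" and "?f c = \<zero>\<^bsub>Ext_module i\<^esub>"
    then have "cls i (g c) = \<zero>\<^bsub>Ext_module i\<^esub>" by (simp del: free_simps)
    then have "g c \<in> cobs i" using Ext_facts(4)[OF module_homD(1)[OF gZ c]] by (rule iffD1[rotated])
    then show "\<forall>j<p. c j \<in> mm" using bspec[OF g' c] by simp
  qed
  then show "\<exists>f. indep (Ext_module i) p f" by (rule exI[of "indep (Ext_module i) p"])
next
  assume "\<exists>f. indep (Ext_module i) p f"
  then obtain f where f: "f \<in> module_hom R (free p) (Ext_module i)"
    and f': "\<forall>c\<in>carrier (free p). f c = \<zero>\<^bsub>Ext_module i\<^esub> \<longrightarrow> (\<forall>j<p. c j \<in> mm)" unfolding indep_def by (elim exE conjE)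
  obtain g where g: "g \<in> module_hom R (free p) (ZM i)" "\<And>c. c \<in> carrier (free p) \<Longrightarrow> cls i (g c) = f c"
  proof (rule free_lift[OF Ext_facts(2) ZM_module Ext_facts(1) f])
    fix v assume "v \<in> carrier (free p)"
    from module_homD(1)[OF f this] show "f v \<in> cls i ` carrier (ZM i)" unfolding Ext_facts(3) .
  qed (use that in blast)
  have "g c \<in> Zc i {\<zero>} \<and> (cob i {\<zero>} (g c) \<longrightarrow> (\<forall>j<p. c j \<in> mm))" if c: "c \<in> carrier (free p)" for c
  proof
    show Z: "g c \<in> Zc i {\<zero>}" using module_homD(1)[OF g(1) c] by simp
    show "cob i {\<zero>} (g c) \<longrightarrow> (\<forall>j<p. c j \<in> mm)"
    proof
      assume "cob i {\<zero>} (g c)"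
      then have "g c \<in> cobs i" using Z unfolding Zc_def by simp
      then have "cls i (g c) = \<zero>\<^bsub>Ext_module i\<^esub>" using Ext_facts(4)[OF module_homD(1)[OF g(1) c]] by (rule iffD2[rotated])
      then have "f c = \<zero>\<^bsub>Ext_module i\<^esub>" unfolding g(2)[OF c] .
      then show "\<forall>j<p. c j \<in> mm" using bspec[OF f' c] by simp
    qed
  qed
  then show "coh i {\<zero>} p" unfolding coh_def using g(1)[unfolded ZM_hom_iff] by (intro bexI[of _ g] ballI) simp_all
qed

lemma Ext_kill:
  assumes r: "r \<in> mm" and x: "x \<in> carrier (Ext_module i)"
  shows "r \<odot>\<^bsub>Ext_module i\<^esub> x = \<zero>\<^bsub>Ext_module i\<^esub>"
proof -
  obtain f where f: "f \<in> carrier (ZM i)" "x = cls i f" using x unfolding Ext_facts(3)[symmetric] by auto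
  then have fZ: "f \<in> Zc i {\<zero>}" by simp
  have fH: "f \<in> H i" using fZ unfolding Zc_def by simp
  have eq: "r \<odot>\<^bsub>ZM i\<^esub> f = (\<lambda>v\<in>carrier (F i). r \<otimes> f v)" by (simp del: free_simps)
  have "r \<odot>\<^bsub>ZM i\<^esub> f \<in> cobs i"
    unfolding eq using null_homotopic[OF zeroideal r fZ] Hop(2)[OF mm_carr[OF r] fH] by (simp only: mem_Collect_eq simp_thms)
  then have "cls i (r \<odot>\<^bsub>ZM i\<^esub> f) = \<zero>\<^bsub>Ext_module i\<^esub>"
    using Ext_facts(4)[OF module_closed(2)[OF ZM_module mm_carr[OF r] f(1)]] by (rule iffD2[rotated])
  then show ?thesis unfolding f(2) module_homD(3)[OF Ext_facts(2) mm_carr[OF r] f(1)] .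
qed

text \<open>A cocycle is determined by its values at the unit vectors, so the cocycles embed into a
  free module of finite rank, whose submodules are finitely generated.\<close>

lemma Ext_fg: "\<exists>p g. g \<in> module_hom R (free p) (Ext_module i) \<and> g ` carrier (free p) = carrier (Ext_module i)"
proof -
  define ev where "ev = (\<lambda>f\<in>carrier (ZM i). \<lambda>j\<in>{..<n i}. f (unit_vec (n i) j))"
  have e: "unit_vec (n i) j \<in> carrier (F i)" for j by simp
  have ZH: "f \<in> carrier (ZM i) \<Longrightarrow> f \<in> H i" for f unfolding Zc_def by simp
  have ev: "ev \<in> module_hom R (ZM i) (F i)"
    unfolding ev_def
  proof (rule module_homI[OF _ _ _ ZM_module])
    fix f assume f: "f \<in> carrier (ZM i)"
    show "(\<lambda>j\<in>{..<n i}. f (unit_vec (n i) j)) \<in> carrier (F i)"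
      unfolding free_simps(1) by (rule restrict_PiE_iff[THEN iffD2]) (use H_facts(1)[OF ZH[OF f] e] in simp)
  next
    fix f g assume "f \<in> carrier (ZM i)" "g \<in> carrier (ZM i)"
    show "(\<lambda>j\<in>{..<n i}. (f \<oplus>\<^bsub>ZM i\<^esub> g) (unit_vec (n i) j)) =
      (\<lambda>j\<in>{..<n i}. f (unit_vec (n i) j)) \<oplus>\<^bsub>F i\<^esub> (\<lambda>j\<in>{..<n i}. g (unit_vec (n i) j))"
      unfolding free_simps(2) by (rule restrict_ext) simp
  next
    fix r f
    show "(\<lambda>j\<in>{..<n i}. (r \<odot>\<^bsub>ZM i\<^esub> f) (unit_vec (n i) j)) = r \<odot>\<^bsub>F i\<^esub> (\<lambda>j\<in>{..<n i}. f (unit_vec (n i) j))"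
      unfolding free_simps(4) by (rule restrict_ext) simp
  qed
  obtain q D where D: "D \<in> module_hom R (free q) (F i)" "D ` carrier (free q) = ev ` carrier (ZM i)"
    by (rule fg_submodule[OF noeth lsub_image[OF ev ZM_module FM]])
  obtain g where g: "g \<in> module_hom R (free q) (ZM i)" "\<And>v. v \<in> carrier (free q) \<Longrightarrow> ev (g v) = D v"
    by (rule free_lift[OF ev ZM_module FM D(1)]) (use D(2) in blast)+
  have inj: "f = g" if f: "f \<in> carrier (ZM i)" and g: "g \<in> carrier (ZM i)" and eq: "ev f = ev g" for f g
  proof (rule module_hom_eqI[OF ZH[OF f] ZH[OF g]])
    fix v assume v: "v \<in> carrier (F i)"
    show "f v = g v"
    proof (rule free_hom_eq[OF ZH[OF f] ZH[OF g] self_is_module _ v])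
      fix j assume j: "j < n i"
      have "ev f j = ev g j" using eq by simp
      then show "f (unit_vec (n i) j) = g (unit_vec (n i) j)" unfolding ev_def using f g j by simp
    qed
  qed
  let ?g = "\<lambda>v\<in>carrier (free q). cls i (g v)"
  have "?g ` carrier (free q) = carrier (Ext_module i)"
  proof
    note h = module_hom_comp[OF g(1) Ext_facts(2) free_is_module]
    show "?g ` carrier (free q) \<subseteq> carrier (Ext_module i)" using module_homD(1)[OF h] by (rule image_subsetI)
    show "carrier (Ext_module i) \<subseteq> ?g ` carrier (free q)"
    proof
      fix x assume "x \<in> carrier (Ext_module i)"
      then obtain f where f: "f \<in> carrier (ZM i)" "x = cls i f" unfolding Ext_facts(3)[symmetric] by auto
      have "ev f \<in> D ` carrier (free q)" unfolding D(2) using f(1) by (rule imageI)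
      then obtain v where v: "v \<in> carrier (free q)" "ev f = D v" by auto
      have "f = g v" by (rule inj[OF f(1) module_homD(1)[OF g(1) v(1)]]) (simp only: v(2) g(2)[OF v(1)])
      then have "x = ?g v" unfolding f(2) using v(1) by (simp del: free_simps)
      then show "x \<in> ?g ` carrier (free q)" using v(1) by (rule image_eqI)
    qed
  qed
  then show ?thesis using module_hom_comp[OF g(1) Ext_facts(2) free_is_module] by (intro exI conjI)
qed

lemma vdim_Ext:
  "coh i {\<zero>} (vdim (residue_field R) (residue_space (Ext_module i)))"
  "coh i {\<zero>} p \<Longrightarrow> p \<le> vdim (residue_field R) (residue_space (Ext_module i))"
proof -
  obtain q g where g: "g \<in> module_hom R (free q) (Ext_module i)" "g ` carrier (free q) = carrier (Ext_module i)"
    using Ext_fg[of i] by blast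
  note V = vdim_characterization[OF Ext_facts(1) Ext_kill g]
  show "coh i {\<zero>} (vdim (residue_field R) (residue_space (Ext_module i)))" unfolding coh_iff_indep by (rule V(1))
  assume "coh i {\<zero>} p"
  then obtain h where "indep (Ext_module i) p h" unfolding coh_iff_indep by (elim exE)
  then show "p \<le> vdim (residue_field R) (residue_space (Ext_module i))" by (rule V(2)[rotated 2])
qed

end

context noetherian_local
begin

lemma regular_sequence_iff_reg:
  "regular_sequence R xs \<longleftrightarrow> set xs \<subseteq> mm \<and> reg {} xs"
proof
  assume r: "regular_sequence R xs"
  then have c: "set xs \<subseteq> carrier R" and n: "Idl (set xs) \<noteq> carrier R" unfolding regular_sequence_def by auto
  have "\<one> \<notin> Idl (set xs)" using n ideal.one_imp_carrier[OF genideal_ideal[OF c]] by auto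
  then have "set xs \<subseteq> mm" using proper_in_mm[OF genideal_ideal[OF c]] genideal_self[OF c] by auto
  then show "set xs \<subseteq> mm \<and> reg {} xs" using r unfolding regular_sequence_def reg_def nzd_def by simp
next
  assume a: "set xs \<subseteq> mm \<and> reg {} xs"
  then have c: "set xs \<subseteq> carrier R" using mm_carr by auto
  have "Idl (set xs) \<subseteq> mm" by (rule genideal_minimal[OF mm_ideal]) (use a in simp)
  then have "Idl (set xs) \<noteq> carrier R" using one_notin_mm by auto
  then show "regular_sequence R xs" using a c unfolding regular_sequence_def reg_def nzd_def by simp
qed

text \<open>Since the socle modulo \<open>ys\<close> is nonzero, Ext is nonzero in degree
  \<open>length ys\<close>, whereas it vanishes in every degree below the length of a regular
  sequence. Hence \<open>length ys\<close> is the depth, and the type can be read off from the socle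
  in both directions.\<close>

theorem cm_type_eq_socle:
  assumes ys: "set ys \<subseteq> mm" "reg {} ys" and soc: "\<not> socle_gen (Idl (set ys)) \<subseteq> Idl (set ys)"
  shows "socle_family (Idl (set ys)) (cm_type R)"
    and "socle_family (Idl (set ys)) p \<Longrightarrow> p \<le> cm_type R"
proof -
  \<comment> \<open>This is the resolution that \<open>Ext\<close> selects; the locale
    \<open>resolution\<close> is instantiated with it.\<close>
  obtain n d where nd: "(n, d) = (SOME (n, d). \<exists>e. free_resolution R (residue_module R) n d e)"
    by (cases "SOME (n, d). \<exists>e. free_resolution R (residue_module R) n d e") auto
  have "\<exists>e. free_resolution R (residue_module R) n d e"
  proof -
    obtain n' d' e' where "free_resolution R (residue_module R) n' d' e'" using resolution_exists by blast
    then have "case (n', d') of (n, d) \<Rightarrow> \<exists>e. free_resolution R (residue_module R) n d e" by auto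
    then have "case (SOME (n, d). \<exists>e. free_resolution R (residue_module R) n d e) of
      (n, d) \<Rightarrow> \<exists>e. free_resolution R (residue_module R) n d e" by (rule someI)
    then show ?thesis unfolding nd[symmetric] by simp
  qed
  then obtain \<rho> v1 where "resolution R n d \<rho> v1" using resolution_of_free_resolution by (elim exE) blast
  then interpret resolution R n d \<rho> v1 .
  have Q0: "Idl {} = {\<zero>}" by (rule Idl_empty)
  have reg: "(\<forall>i<length zs. vanish i {\<zero>}) \<and> (coh (length zs) {\<zero>} q \<longleftrightarrow> socle_family (Idl (set zs)) q)"
    if "set zs \<subseteq> mm" "reg {} zs" for zs q
    using coh_regular[of zs "{}" q] that Q0 by simp
  let ?Q = "Idl (set ys)"
  have yc: "set ys \<subseteq> carrier R" using ys(1) mm_carr by auto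
  have QI: "ideal ?Q R" by (rule genideal_ideal[OF yc])
  have "\<not> vanish (length ys) {\<zero>}"
  proof -
    obtain u where u: "u \<in> socle_gen ?Q" "u \<notin> ?Q" using soc by auto
    have uc: "u \<in> carrier R" using u(1) unfolding socle_gen_def by simp
    from free_hom_ex[OF self_is_module, of "\<lambda>_. u" 1] uc
    obtain a where a: "a \<in> module_hom R (free 1) (self_module R)" and a': "a (unit_vec 1 0) = u" by auto
    have "a c \<in> socle_gen ?Q \<and> (a c \<in> ?Q \<longrightarrow> (\<forall>j<1. c j \<in> mm))" if c: "c \<in> carrier (free 1)" for c
    proof -
      have c0: "c 0 \<in> carrier R" using c by (simp only: free_simps(1)) (rule free_coord[of _ 1], simp_all)
      have e: "unit_vec 1 0 \<in> carrier (free 1)" by (simp only: free_simps(1) unit_vec_in)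
      have "c = c 0 \<odot>\<^bsub>free 1\<^esub> unit_vec 1 0"
        by (rule free_ext[OF c module_closed(2)[OF free_is_module c0 e]]) (use c0 in \<open>simp add: unit_vec_def\<close>)
      then have "a c = a (c 0 \<odot>\<^bsub>free 1\<^esub> unit_vec 1 0)" by (rule arg_cong)
      also have "\<dots> = c 0 \<otimes> u" using module_homD(3)[OF a c0 e] a' by (simp del: free_simps)
      finally have ac: "a c = c 0 \<otimes> u" .
      have "r \<otimes> (c 0 \<otimes> u) \<in> ?Q" if r: "r \<in> mm" for r
      proof -
        have "r \<otimes> u \<in> ?Q" using u(1) r unfolding socle_gen_def by simp
        then have "c 0 \<otimes> (r \<otimes> u) \<in> ?Q" by (rule ideal_closed(3)[OF QI _ c0])
        then show ?thesis using c0 uc mm_carr[OF r] by (simp add: m_lcomm)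
      qed
      then have "a c \<in> socle_gen ?Q" unfolding ac socle_gen_def using c0 uc by simp
      moreover have "c 0 \<in> mm" if aQ: "a c \<in> ?Q"
      proof (rule ccontr)
        assume "c 0 \<notin> mm"
        then obtain b where b: "b \<in> carrier R" "b \<otimes> c 0 = \<one>" by (rule unit_obtain[OF c0])
        have "b \<otimes> (c 0 \<otimes> u) \<in> ?Q" using ideal_closed(3)[OF QI aQ b(1)] unfolding ac .
        moreover have "b \<otimes> (c 0 \<otimes> u) = u" using m_assoc[OF b(1) c0 uc] b(2) uc by simp
        ultimately show False using u(2) by simp
      qed
      ultimately show ?thesis by simp
    qed
    then have "socle_family ?Q (Suc 0)" unfolding socle_family_def using a by (intro bexI[of _ a] ballI) simp_all
    then have "coh (length ys) {\<zero>} (Suc 0)" using reg[OF ys] by simp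
    then show ?thesis by (rule coh_not_vanish)
  qed
  \<comment> \<open>A longer regular sequence would make Ext vanish in degree
    \<open>length ys\<close>.\<close>
  then have max: "length zs \<le> length ys" if "regular_sequence R zs" for zs
    using reg[of zs 0] that unfolding regular_sequence_iff_reg by (metis not_le)
  have "depth R = length ys"
    unfolding depth_def
  proof (rule cSup_eq_maximum)
    show "length ys \<in> {length xs |xs. regular_sequence R xs}" using ys unfolding regular_sequence_iff_reg by blast
    show "\<And>k. k \<in> {length xs |xs. regular_sequence R xs} \<Longrightarrow> k \<le> length ys" using max by auto
  qed
  then have cm: "cm_type R = vdim (residue_field R) (residue_space (Ext_module (length ys)))"
    unfolding cm_type_def Ext_def nd[symmetric] by simp
  show "socle_family ?Q (cm_type R)" using vdim_Ext(1)[of "length ys"] reg[OF ys] unfolding cm by simp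
  show "socle_family ?Q p \<Longrightarrow> p \<le> cm_type R" using vdim_Ext(2)[of "length ys" p] reg[OF ys] unfolding cm by simp
qed

end

section \<open>Rings of finite self-injective dimension\<close>

context cring
begin

text \<open>The test modules in the definition of injectivity have carriers in \<open>(nat \<Rightarrow> 'a) set\<close>, so ideals are copied there.\<close>

definition emb :: "'a \<Rightarrow> (nat \<Rightarrow> 'a) set" where "emb r = {\<lambda>_. r}"

definition unemb :: "(nat \<Rightarrow> 'a) set \<Rightarrow> 'a" where "unemb S = the_elem S 0"

lemma unemb_emb [simp]: "unemb (emb r) = r"
  by (simp add: unemb_def emb_def)

definition emb_module :: "'a set \<Rightarrow> ('a, (nat \<Rightarrow> 'a) set) module" where
  "emb_module I = \<lparr>carrier = emb ` I, monoid.mult = undefined, one = undefined, ring.zero = emb \<zero>,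
     ring.add = (\<lambda>S T. emb (unemb S \<oplus> unemb T)), smult = (\<lambda>r S. emb (r \<otimes> unemb S))\<rparr>"

lemma emb_simps [simp]:
  "carrier (emb_module I) = emb ` I" "\<zero>\<^bsub>emb_module I\<^esub> = emb \<zero>"
  "S \<oplus>\<^bsub>emb_module I\<^esub> T = emb (unemb S \<oplus> unemb T)" "r \<odot>\<^bsub>emb_module I\<^esub> S = emb (r \<otimes> unemb S)"
  by (simp_all add: emb_module_def)

lemma emb_is_module:
  assumes I: "ideal I R"
  shows "module R (emb_module I)"
proof (rule moduleI)
  note c = ideal_closed[OF I]
  show "cring R" by (rule is_cring)
  show "abelian_group (emb_module I)"
  proof (rule abelian_groupI)
    fix x y z assume "x \<in> carrier (emb_module I)" "y \<in> carrier (emb_module I)" "z \<in> carrier (emb_module I)"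
    then obtain a b d where a: "a \<in> I" "b \<in> I" "d \<in> I" "x = emb a" "y = emb b" "z = emb d" by auto
    note ac = c(7)[OF a(1)] c(7)[OF a(2)] c(7)[OF a(3)]
    show "x \<oplus>\<^bsub>emb_module I\<^esub> y \<in> carrier (emb_module I)" using c(1)[OF a(1,2)] a by simp
    show "x \<oplus>\<^bsub>emb_module I\<^esub> y \<oplus>\<^bsub>emb_module I\<^esub> z = x \<oplus>\<^bsub>emb_module I\<^esub> (y \<oplus>\<^bsub>emb_module I\<^esub> z)"
      using a ac by (simp add: a_assoc)
    show "x \<oplus>\<^bsub>emb_module I\<^esub> y = y \<oplus>\<^bsub>emb_module I\<^esub> x" using a ac by (simp add: a_comm)
    show "\<zero>\<^bsub>emb_module I\<^esub> \<oplus>\<^bsub>emb_module I\<^esub> x = x" using a ac by simp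
    show "\<exists>y\<in>carrier (emb_module I). y \<oplus>\<^bsub>emb_module I\<^esub> x = \<zero>\<^bsub>emb_module I\<^esub>"
      using c(6)[OF a(1)] a ac by (intro bexI[of _ "emb (\<ominus> a)"]) (simp_all add: l_neg)
  qed (use c(5) in simp)
next
  note c = ideal_closed[OF I]
  fix r s x y assume r: "r \<in> carrier R" "s \<in> carrier R" and "x \<in> carrier (emb_module I)" "y \<in> carrier (emb_module I)"
  then obtain a b where a: "a \<in> I" "b \<in> I" "x = emb a" "y = emb b" by auto
  note ac = c(7)[OF a(1)] c(7)[OF a(2)]
  show "(r \<oplus> s) \<odot>\<^bsub>emb_module I\<^esub> x = r \<odot>\<^bsub>emb_module I\<^esub> x \<oplus>\<^bsub>emb_module I\<^esub> s \<odot>\<^bsub>emb_module I\<^esub> x"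
    using a ac r by (simp add: l_distr)
  show "r \<odot>\<^bsub>emb_module I\<^esub> (x \<oplus>\<^bsub>emb_module I\<^esub> y) = r \<odot>\<^bsub>emb_module I\<^esub> x \<oplus>\<^bsub>emb_module I\<^esub> r \<odot>\<^bsub>emb_module I\<^esub> y"
    using a ac r by (simp add: r_distr)
  show "(r \<otimes> s) \<odot>\<^bsub>emb_module I\<^esub> x = r \<odot>\<^bsub>emb_module I\<^esub> (s \<odot>\<^bsub>emb_module I\<^esub> x)"
    using a ac r by (simp add: m_assoc)
next
  note c = ideal_closed[OF I]
  fix r x assume r: "r \<in> carrier R" and "x \<in> carrier (emb_module I)"
  then obtain a where a: "a \<in> I" "x = emb a" by auto
  show "r \<odot>\<^bsub>emb_module I\<^esub> x \<in> carrier (emb_module I)" using c(3)[OF a(1) r] a by simp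
next
  note c = ideal_closed[OF I]
  fix x assume "x \<in> carrier (emb_module I)"
  then obtain a where a: "a \<in> I" "x = emb a" by auto
  show "\<one> \<odot>\<^bsub>emb_module I\<^esub> x = x" using c(7)[OF a(1)] a by simp
qed

definition ideal_hom :: "'a set \<Rightarrow> ('a, 'v, 'm) module_scheme \<Rightarrow> ('a \<Rightarrow> 'v) \<Rightarrow> bool" where
  "ideal_hom I M f \<longleftrightarrow> (\<forall>x\<in>I. f x \<in> carrier M) \<and> (\<forall>x\<in>I. \<forall>y\<in>I. f (x \<oplus> y) = f x \<oplus>\<^bsub>M\<^esub> f y) \<and>
     (\<forall>r\<in>carrier R. \<forall>x\<in>I. f (r \<otimes> x) = r \<odot>\<^bsub>M\<^esub> f x)"

text \<open>A homomorphism from an ideal to an injective module extends to the ring and is therefore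
  given by the image of the unit element.\<close>

lemma baer:
  assumes inj: "injective_module R M" and I: "ideal I R" and f: "ideal_hom I M f"
  shows "\<exists>w\<in>carrier M. \<forall>x\<in>I. f x = x \<odot>\<^bsub>M\<^esub> w"
proof -
  note c = ideal_closed[OF I]
  let ?j = "\<lambda>S\<in>carrier (emb_module I). S" and ?f = "\<lambda>S\<in>carrier (emb_module I). f (unemb S)"
  let ?N = "emb_module (carrier R)"
  have j: "?j \<in> module_hom R (emb_module I) ?N"
    by (rule module_homI[OF _ _ _ emb_is_module[OF I]]) (use c(7) in \<open>auto simp del: emb_simps(3,4) simp: emb_simps(3,4)\<close>)
  have f': "?f \<in> module_hom R (emb_module I) M"
    by (rule module_homI[OF _ _ _ emb_is_module[OF I]]) (use f in \<open>auto simp: ideal_hom_def\<close>)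
  have "inj_on ?j (carrier (emb_module I))" by (rule inj_onI) simp
  then have "\<exists>g\<in>module_hom R ?N M. \<forall>x\<in>carrier (emb_module I). g (?j x) = ?f x"
    using inj emb_is_module[OF I] emb_is_module[OF oneideal] j f' unfolding injective_module_def by blast
  then obtain g where g: "g \<in> module_hom R ?N M" and g': "\<forall>x\<in>carrier (emb_module I). g (?j x) = ?f x" by (rule bexE)
  have o: "emb \<one> \<in> carrier ?N" by simp
  have "f x = x \<odot>\<^bsub>M\<^esub> g (emb \<one>)" if x: "x \<in> I" for x
  proof -
    have "f x = g (emb x)" using bspec[OF g', of "emb x"] x by simp
    also have "emb x = x \<odot>\<^bsub>?N\<^esub> emb \<one>" using c(7)[OF x] by simp
    also have "g (x \<odot>\<^bsub>?N\<^esub> emb \<one>) = x \<odot>\<^bsub>M\<^esub> g (emb \<one>)" by (rule module_homD(3)[OF g c(7)[OF x] o])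
    finally show ?thesis .
  qed
  then show ?thesis using module_homD(1)[OF g o] by (intro bexI[of _ "g (emb \<one>)"] ballI)
qed

text \<open>These \<open>w\<close> stand for the homomorphisms from the ring modulo \<open>I\<close>
  to \<open>M\<close>, each given by its value at the class of one.\<close>

definition killed :: "('a, 'v, 'm) module_scheme \<Rightarrow> 'a set \<Rightarrow> 'v \<Rightarrow> bool" where
  "killed M I w \<longleftrightarrow> w \<in> carrier M \<and> (\<forall>r\<in>I. r \<odot>\<^bsub>M\<^esub> w = \<zero>\<^bsub>M\<^esub>)"

text \<open>Multiplication by \<open>a\<close> embeds the ring modulo the colon at \<open>a\<close>
  into the ring modulo \<open>I\<close>, and a homomorphism on the smaller module extends.
  Concretely \<open>baer\<close> is applied to the map that sends
  \<open>q \<oplus> r \<otimes> a\<close> to \<open>r\<close> times \<open>z\<close>.\<close>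

lemma injective_lift:
  assumes inj: "injective_module R M" and I: "ideal I R" and a: "a \<in> carrier R" and z: "killed M (colon I a) z"
  shows "\<exists>w. killed M I w \<and> a \<odot>\<^bsub>M\<^esub> w = z"
proof -
  have M: "module R M" using inj unfolding injective_module_def by simp
  interpret M: module R M by (rule M)
  note c = ideal_closed[OF I]
  have zc: "z \<in> carrier M" using z unfolding killed_def by simp
  define f where "f x = (SOME r. r \<in> carrier R \<and> (\<exists>q\<in>I. x = q \<oplus> r \<otimes> a)) \<odot>\<^bsub>M\<^esub> z" for x
  \<comment> \<open>Two coefficients of \<open>a\<close> representing the same element differ by a
    member of the colon, which kills \<open>z\<close>.\<close>
  have fv: "f (q \<oplus> r \<otimes> a) = r \<odot>\<^bsub>M\<^esub> z" if q: "q \<in> I" and r: "r \<in> carrier R" for q r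
  proof -
    let ?s = "SOME s. s \<in> carrier R \<and> (\<exists>p\<in>I. q \<oplus> r \<otimes> a = p \<oplus> s \<otimes> a)"
    have "?s \<in> carrier R \<and> (\<exists>p\<in>I. q \<oplus> r \<otimes> a = p \<oplus> ?s \<otimes> a)"
      by (rule someI[of _ r]) (use q r in auto)
    then obtain p where s: "?s \<in> carrier R" and p: "p \<in> I" "q \<oplus> r \<otimes> a = p \<oplus> ?s \<otimes> a" by auto
    define s where "s = ?s"
    note s = s[folded s_def] and p = p[folded s_def]
    have "(s \<ominus> r) \<otimes> a = (p \<oplus> s \<otimes> a) \<ominus> p \<ominus> r \<otimes> a" using s r a c(7)[OF p(1)] by algebra
    also have "\<dots> = q \<ominus> p" unfolding p(2)[symmetric] using r a c(7)[OF p(1)] c(7)[OF q] by algebra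
    also have "\<dots> \<in> I" by (rule c(2)[OF q p(1)])
    finally have "s \<ominus> r \<in> colon I a" using s r unfolding colon_def by simp
    then have k: "(s \<ominus> r) \<odot>\<^bsub>M\<^esub> z = \<zero>\<^bsub>M\<^esub>" using z unfolding killed_def by simp
    have "s = (s \<ominus> r) \<oplus> r" using s r by algebra
    then have "s \<odot>\<^bsub>M\<^esub> z = ((s \<ominus> r) \<oplus> r) \<odot>\<^bsub>M\<^esub> z" by simp
    also have "\<dots> = r \<odot>\<^bsub>M\<^esub> z" using M.smult_l_distr[of "s \<ominus> r" r z] s r zc k by simp
    finally show ?thesis unfolding f_def s_def .
  qed
  note J = ideal_insert_mem[OF I a]
  have "ideal_hom (Idl (insert a I)) M f"
    unfolding ideal_hom_def
  proof (intro conjI ballI)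
    fix x assume "x \<in> Idl (insert a I)"
    then obtain q r where x: "q \<in> I" "r \<in> carrier R" "x = q \<oplus> r \<otimes> a" unfolding J by auto
    show "f x \<in> carrier M" unfolding x(3) fv[OF x(1,2)] using x(2) zc by simp
  next
    fix x y assume "x \<in> Idl (insert a I)" "y \<in> Idl (insert a I)"
    then obtain q r p s where x: "q \<in> I" "r \<in> carrier R" "x = q \<oplus> r \<otimes> a"
      and y: "p \<in> I" "s \<in> carrier R" "y = p \<oplus> s \<otimes> a" unfolding J by auto
    have "x \<oplus> y = (q \<oplus> p) \<oplus> (r \<oplus> s) \<otimes> a" unfolding x(3) y(3) using c(7)[OF x(1)] c(7)[OF y(1)] x(2) y(2) a by algebra
    then have "f (x \<oplus> y) = (r \<oplus> s) \<odot>\<^bsub>M\<^esub> z" using fv[OF c(1)[OF x(1) y(1)], of "r \<oplus> s"] x(2) y(2) by simp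
    then show "f (x \<oplus> y) = f x \<oplus>\<^bsub>M\<^esub> f y"
      unfolding x(3) y(3) fv[OF x(1,2)] fv[OF y(1,2)] using M.smult_l_distr[OF x(2) y(2) zc] by simp
  next
    fix s x assume s: "s \<in> carrier R" and "x \<in> Idl (insert a I)"
    then obtain q r where x: "q \<in> I" "r \<in> carrier R" "x = q \<oplus> r \<otimes> a" unfolding J by auto
    have "s \<otimes> x = s \<otimes> q \<oplus> (s \<otimes> r) \<otimes> a" unfolding x(3) using c(7)[OF x(1)] x(2) s a by algebra
    then have "f (s \<otimes> x) = (s \<otimes> r) \<odot>\<^bsub>M\<^esub> z" using fv[OF c(3)[OF x(1) s], of "s \<otimes> r"] x(2) s by simp
    then show "f (s \<otimes> x) = s \<odot>\<^bsub>M\<^esub> f x" unfolding x(3) fv[OF x(1,2)] using M.smult_assoc1[OF s x(2) zc] by simp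
  qed
  from baer[OF inj ideal_insert_facts(1)[OF I a] this]
  obtain w where w: "w \<in> carrier M" and w': "\<forall>x\<in>Idl (insert a I). f x = x \<odot>\<^bsub>M\<^esub> w" by (rule bexE)
  have "r \<odot>\<^bsub>M\<^esub> w = \<zero>\<^bsub>M\<^esub>" if r: "r \<in> I" for r
  proof -
    have "r = r \<oplus> \<zero> \<otimes> a" using c(7)[OF r] a by simp
    then have "f r = \<zero>\<^bsub>M\<^esub>" using fv[OF r zero_closed] zc by simp
    then show ?thesis using bspec[OF w', of r] ideal_insert_facts(2)[OF I a] r by auto
  qed
  moreover have "a \<odot>\<^bsub>M\<^esub> w = z"
  proof -
    have "a = \<zero> \<oplus> \<one> \<otimes> a" using a by simp
    then have "f a = z" using fv[OF c(5) one_closed] zc by simp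
    then show ?thesis using bspec[OF w' ideal_insert_facts(3)[OF I a]] by simp
  qed
  ultimately show ?thesis using w unfolding killed_def by auto
qed

text \<open>Ideals \<open>J\<close> such that \<open>R / J\<close> has a finite filtration with all quotients isomorphic to \<open>R / C\<close>.\<close>

inductive filtered :: "'a set \<Rightarrow> 'a set \<Rightarrow> bool" for C where
  full: "filtered C (carrier R)"
| step: "filtered C (Idl (insert a J)) \<Longrightarrow> ideal J R \<Longrightarrow> a \<in> carrier R \<Longrightarrow> colon J a = C \<Longrightarrow> filtered C J"

lemma killed_insert:
  assumes M: "module R M" and I: "ideal I R" and a: "a \<in> carrier R"
    and w: "killed M I w" and aw: "a \<odot>\<^bsub>M\<^esub> w = \<zero>\<^bsub>M\<^esub>"
  shows "killed M (Idl (insert a I)) w"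
proof -
  interpret M: module R M by (rule M)
  have wc: "w \<in> carrier M" using w unfolding killed_def by simp
  have "x \<odot>\<^bsub>M\<^esub> w = \<zero>\<^bsub>M\<^esub>" if "x \<in> Idl (insert a I)" for x
  proof -
    from that obtain q r where x: "q \<in> I" "r \<in> carrier R" "x = q \<oplus> r \<otimes> a" unfolding ideal_insert_mem[OF I a] by auto
    have "q \<odot>\<^bsub>M\<^esub> w = \<zero>\<^bsub>M\<^esub>" using w x(1) unfolding killed_def by simp
    then show ?thesis unfolding x(3) using x(2) ideal_closed(7)[OF I x(1)] a wc aw
      by (simp add: M.smult_l_distr M.smult_assoc1)
  qed
  then show ?thesis using wc unfolding killed_def by simp
qed

lemma killed_mono: "killed M J w \<Longrightarrow> I \<subseteq> J \<Longrightarrow> killed M I w"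
  unfolding killed_def by auto

lemma killed_diff:
  assumes M: "module R M" and v: "killed M I v" and w: "killed M I w" and I: "I \<subseteq> carrier R"
  shows "killed M I (v \<ominus>\<^bsub>M\<^esub> w)"
proof -
  interpret M: module R M by (rule M)
  show ?thesis using v w I unfolding killed_def
    by (auto simp: M.smult_r_distr M.smult_r_minus M.minus_eq subset_iff)
qed

end

section \<open>Vanishing of Ext computed from an injective resolution\<close>

locale inj_resolution = cring R for R (structure) +
  fixes I :: "nat \<Rightarrow> ('a, 'c) module" and \<delta> :: "nat \<Rightarrow> 'c \<Rightarrow> 'c" and h :: "'a \<Rightarrow> 'c"
  assumes res: "injective_resolution R (self_module R) I \<delta> h"
begin

lemma inj: "injective_module R (I i)" using res unfolding injective_resolution_def by simp

lemma IM: "module R (I i)" using inj unfolding injective_module_def by simp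

lemma h: "h \<in> module_hom R (self_module R) (I 0)" "inj_on h (carrier (self_module R))"
  "h ` carrier (self_module R) = {x \<in> carrier (I 0). \<delta> 0 x = \<zero>\<^bsub>I 1\<^esub>}"
  using res unfolding injective_resolution_def by blast+

lemma \<delta>: "\<delta> i \<in> module_hom R (I i) (I (Suc i))" using res unfolding injective_resolution_def by blast

lemma exact: "\<delta> i ` carrier (I i) = {x \<in> carrier (I (Suc i)). \<delta> (Suc i) x = \<zero>\<^bsub>I (Suc (Suc i))\<^esub>}"
  using res unfolding injective_resolution_def by blast

lemma \<delta>\<delta>: "x \<in> carrier (I i) \<Longrightarrow> \<delta> (Suc i) (\<delta> i x) = \<zero>\<^bsub>I (Suc (Suc i))\<^esub>"
proof -
  assume "x \<in> carrier (I i)"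
  then have "\<delta> i x \<in> \<delta> i ` carrier (I i)" by (rule imageI)
  then show ?thesis unfolding exact by simp
qed

lemma \<delta>_diff: "x \<in> carrier (I i) \<Longrightarrow> y \<in> carrier (I i) \<Longrightarrow> \<delta> i (x \<ominus>\<^bsub>I i\<^esub> y) = \<delta> i x \<ominus>\<^bsub>I (Suc i)\<^esub> \<delta> i y"
proof -
  interpret M: module R "I i" by (rule IM)
  interpret M': module R "I (Suc i)" by (rule IM)
  assume x: "x \<in> carrier (I i)" and y: "y \<in> carrier (I i)"
  have m: "\<ominus>\<^bsub>I i\<^esub> y = \<ominus> \<one> \<odot>\<^bsub>I i\<^esub> y" using y by (simp add: M.smult_l_minus)
  have "\<delta> i (x \<ominus>\<^bsub>I i\<^esub> y) = \<delta> i x \<oplus>\<^bsub>I (Suc i)\<^esub> \<ominus> \<one> \<odot>\<^bsub>I (Suc i)\<^esub> \<delta> i y"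
    unfolding M.minus_eq m using x y module_homD(2)[OF \<delta>] module_homD(3)[OF \<delta>, of "\<ominus> \<one>" y] M.smult_closed[of "\<ominus> \<one>" y] by simp
  then show ?thesis using module_homD(1)[OF \<delta> y] by (simp add: M'.smult_l_minus M'.minus_eq)
qed

lemma killed_\<delta>:
  assumes w: "killed (I i) J w" and J: "J \<subseteq> carrier R"
  shows "killed (I (Suc i)) J (\<delta> i w)"
proof -
  have wc: "w \<in> carrier (I i)" using w unfolding killed_def by simp
  have "r \<odot>\<^bsub>I (Suc i)\<^esub> \<delta> i w = \<zero>\<^bsub>I (Suc i)\<^esub>" if r: "r \<in> J" for r
  proof -
    have rc: "r \<in> carrier R" using J r by auto
    have "r \<odot>\<^bsub>I (Suc i)\<^esub> \<delta> i w = \<delta> i (r \<odot>\<^bsub>I i\<^esub> w)" using module_homD(3)[OF \<delta> rc wc] by simp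
    also have "r \<odot>\<^bsub>I i\<^esub> w = \<zero>\<^bsub>I i\<^esub>" using w r unfolding killed_def by simp
    also have "\<delta> i \<zero>\<^bsub>I i\<^esub> = \<zero>\<^bsub>I (Suc i)\<^esub>" by (rule module_hom_zero[OF \<delta> IM IM])
    finally show ?thesis .
  qed
  then show ?thesis unfolding killed_def using module_homD(1)[OF \<delta> wc] by simp
qed

text \<open>\<open>acyclic k J\<close> says that \<open>Ext\<^sup>k\<^sup>+\<^sup>1(R / J, R) = 0\<close>: \<open>Hom(R / J, I i)\<close> consists of the elements of \<open>I i\<close>
  killed by \<open>J\<close>.\<close>

definition acyclic :: "nat \<Rightarrow> 'a set \<Rightarrow> bool" where
  "acyclic k J \<longleftrightarrow> (\<forall>w. killed (I (Suc k)) J w \<longrightarrow> \<delta> (Suc k) w = \<zero>\<^bsub>I (Suc (Suc k))\<^esub> \<longrightarrow>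
     (\<exists>v. killed (I k) J v \<and> \<delta> k v = w))"

lemma acyclicD: "acyclic k J \<Longrightarrow> killed (I (Suc k)) J w \<Longrightarrow> \<delta> (Suc k) w = \<zero>\<^bsub>I (Suc (Suc k))\<^esub> \<Longrightarrow>
     \<exists>v. killed (I k) J v \<and> \<delta> k v = w"
  unfolding acyclic_def by simp

text \<open>From the exact sequence \<open>0 \<rightarrow> R/(J:a) \<rightarrow> R/J \<rightarrow>
  R/(J,a) \<rightarrow> 0\<close>: vanishing at both ends gives it in the middle. On elements,
  \<open>a\<close> times \<open>w\<close> is a boundary from the first term; lifting its preimage to
  \<open>z'\<close> leaves a cocycle killed by \<open>a\<close>.\<close>

lemma acyclic_extension:
  assumes J: "ideal J R" and a: "a \<in> carrier R"
    and quot: "acyclic k (Idl (insert a J))" and sub: "acyclic k (colon J a)"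
  shows "acyclic k J"
  unfolding acyclic_def
proof (intro allI impI)
  interpret M: module R "I (Suc k)" by (rule IM)
  interpret M0: module R "I k" by (rule IM)
  fix w assume w: "killed (I (Suc k)) J w" "\<delta> (Suc k) w = \<zero>\<^bsub>I (Suc (Suc k))\<^esub>"
  have wc: "w \<in> carrier (I (Suc k))" using w unfolding killed_def by simp
  note JC = ideal_closed(8)[OF J]
  have "r \<odot>\<^bsub>I (Suc k)\<^esub> (a \<odot>\<^bsub>I (Suc k)\<^esub> w) = \<zero>\<^bsub>I (Suc k)\<^esub>" if "r \<in> colon J a" for r
    using that w(1) a M.smult_assoc1[of r a w] wc unfolding colon_def killed_def by simp
  then have "killed (I (Suc k)) (colon J a) (a \<odot>\<^bsub>I (Suc k)\<^esub> w)" unfolding killed_def using a wc by simp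
  moreover have "\<delta> (Suc k) (a \<odot>\<^bsub>I (Suc k)\<^esub> w) = \<zero>\<^bsub>I (Suc (Suc k))\<^esub>"
  proof -
    interpret M2: module R "I (Suc (Suc k))" by (rule IM)
    show ?thesis using module_homD(3)[OF \<delta> a wc] w(2) a by simp
  qed
  ultimately obtain z where z: "killed (I k) (colon J a) z" "\<delta> k z = a \<odot>\<^bsub>I (Suc k)\<^esub> w"
    using acyclicD[OF sub] by blast
  obtain z' where z': "killed (I k) J z'" "a \<odot>\<^bsub>I k\<^esub> z' = z" using injective_lift[OF inj J a z(1)] by blast
  have z'c: "z' \<in> carrier (I k)" using z'(1) unfolding killed_def by simp
  let ?u = "w \<ominus>\<^bsub>I (Suc k)\<^esub> \<delta> k z'"
  have dz: "killed (I (Suc k)) J (\<delta> k z')" by (rule killed_\<delta>[OF z'(1) JC])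
  have dzc: "\<delta> k z' \<in> carrier (I (Suc k))" by (rule module_homD(1)[OF \<delta> z'c])
  have uJ: "killed (I (Suc k)) J ?u" by (rule killed_diff[OF IM w(1) dz JC])
  have "a \<odot>\<^bsub>I (Suc k)\<^esub> \<delta> k z' = a \<odot>\<^bsub>I (Suc k)\<^esub> w" using module_homD(3)[OF \<delta> a z'c] z'(2) z(2) by simp
  then have "a \<odot>\<^bsub>I (Suc k)\<^esub> ?u = \<zero>\<^bsub>I (Suc k)\<^esub>"
    using a wc dzc by (simp add: M.smult_r_distr M.smult_r_minus M.minus_eq M.r_neg)
  then have "killed (I (Suc k)) (Idl (insert a J)) ?u" by (rule killed_insert[OF IM J a uJ])
  moreover have "\<delta> (Suc k) ?u = \<zero>\<^bsub>I (Suc (Suc k))\<^esub>"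
  proof -
    interpret M2: module R "I (Suc (Suc k))" by (rule IM)
    show ?thesis unfolding \<delta>_diff[OF wc dzc] w(2) \<delta>\<delta>[OF z'c] by (simp add: M2.minus_eq)
  qed
  ultimately obtain y where y: "killed (I k) (Idl (insert a J)) y" "\<delta> k y = ?u" using acyclicD[OF quot] by blast
  have yJ: "killed (I k) J y" by (rule killed_mono[OF y(1) ideal_insert_facts(2)[OF J a]])
  have yc: "y \<in> carrier (I k)" using yJ unfolding killed_def by simp
  have "killed (I k) J (z' \<oplus>\<^bsub>I k\<^esub> y)"
    using z'(1) yJ JC unfolding killed_def by (auto simp: M0.smult_r_distr subset_iff)
  moreover have "\<delta> k (z' \<oplus>\<^bsub>I k\<^esub> y) = w"
    unfolding module_homD(2)[OF \<delta> z'c yc] y(2) using wc dzc by (simp add: M.minus_eq M.a_ac M.r_neg1 M.r_neg)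
  ultimately show "\<exists>v. killed (I k) J v \<and> \<delta> k v = w" by blast
qed

text \<open>The same exact sequence, one place further along in the long sequence: Ext of
  \<open>R/(J:a)\<close> in degree \<open>k + 1\<close> sits between Ext of \<open>R/J\<close> in
  that degree and Ext of \<open>R/(J,a)\<close> in degree \<open>k + 2\<close>.\<close>

lemma acyclic_colon:
  assumes J: "ideal J R" and a: "a \<in> carrier R"
    and A: "acyclic k J" and B: "acyclic (Suc k) (Idl (insert a J))"
  shows "acyclic k (colon J a)"
  unfolding acyclic_def
proof (intro allI impI)
  interpret M: module R "I (Suc k)" by (rule IM)
  interpret M0: module R "I k" by (rule IM)
  interpret M2: module R "I (Suc (Suc k))" by (rule IM)
  note JC = ideal_closed(8)[OF J]
  fix z assume z: "killed (I (Suc k)) (colon J a) z" "\<delta> (Suc k) z = \<zero>\<^bsub>I (Suc (Suc k))\<^esub>"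
  obtain w where w: "killed (I (Suc k)) J w" "a \<odot>\<^bsub>I (Suc k)\<^esub> w = z" using injective_lift[OF inj J a z(1)] by blast
  have wc: "w \<in> carrier (I (Suc k))" using w unfolding killed_def by simp
  have "a \<odot>\<^bsub>I (Suc (Suc k))\<^esub> \<delta> (Suc k) w = \<zero>\<^bsub>I (Suc (Suc k))\<^esub>" using module_homD(3)[OF \<delta> a wc] w(2) z(2) by simp
  then have "killed (I (Suc (Suc k))) (Idl (insert a J)) (\<delta> (Suc k) w)"
    by (rule killed_insert[OF IM J a killed_\<delta>[OF w(1) JC]])
  from acyclicD[OF B this \<delta>\<delta>[OF wc]] obtain w' where
    w': "killed (I (Suc k)) (Idl (insert a J)) w'" "\<delta> (Suc k) w' = \<delta> (Suc k) w" by blast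
  have w'J: "killed (I (Suc k)) J w'" by (rule killed_mono[OF w'(1) ideal_insert_facts(2)[OF J a]])
  have w'c: "w' \<in> carrier (I (Suc k))" using w'J unfolding killed_def by simp
  have aw': "a \<odot>\<^bsub>I (Suc k)\<^esub> w' = \<zero>\<^bsub>I (Suc k)\<^esub>" using w'(1) ideal_insert_facts(3)[OF J a] unfolding killed_def by simp
  let ?u = "w \<ominus>\<^bsub>I (Suc k)\<^esub> w'"
  have "\<delta> (Suc k) ?u = \<zero>\<^bsub>I (Suc (Suc k))\<^esub>"
    unfolding \<delta>_diff[OF wc w'c] w'(2) using module_homD(1)[OF \<delta> wc] by (simp add: M2.minus_eq M2.r_neg)
  from acyclicD[OF A killed_diff[OF IM w(1) w'J JC] this] obtain v where v: "killed (I k) J v" "\<delta> k v = ?u" by blast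
  have vc: "v \<in> carrier (I k)" using v unfolding killed_def by simp
  have "r \<odot>\<^bsub>I k\<^esub> (a \<odot>\<^bsub>I k\<^esub> v) = \<zero>\<^bsub>I k\<^esub>" if "r \<in> colon J a" for r
    using that v(1) a M0.smult_assoc1[of r a v] vc unfolding colon_def killed_def by simp
  then have "killed (I k) (colon J a) (a \<odot>\<^bsub>I k\<^esub> v)" unfolding killed_def using a vc by simp
  moreover have "\<delta> k (a \<odot>\<^bsub>I k\<^esub> v) = z"
    unfolding module_homD(3)[OF \<delta> a vc] v(2)
    using a wc w'c aw' w(2) M.r_neg[OF M.zero_closed] M.smult_closed[OF a wc]
    by (simp add: M.minus_eq M.smult_r_distr M.smult_r_minus)
  ultimately show "\<exists>v. killed (I k) (colon J a) v \<and> \<delta> k v = z" by (intro exI conjI)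
qed

lemma acyclic_zero: "acyclic k {\<zero>}"
  unfolding acyclic_def
proof (intro allI impI)
  interpret M0: module R "I k" by (rule IM)
  fix w assume w: "killed (I (Suc k)) {\<zero>} w" "\<delta> (Suc k) w = \<zero>\<^bsub>I (Suc (Suc k))\<^esub>"
  then have "w \<in> \<delta> k ` carrier (I k)" unfolding exact killed_def by simp
  then obtain v where "v \<in> carrier (I k)" "\<delta> k v = w" by auto
  then show "\<exists>v. killed (I k) {\<zero>} v \<and> \<delta> k v = w" unfolding killed_def by (intro exI[of _ v]) simp
qed

lemma acyclic_full: "acyclic k (carrier R)"
  unfolding acyclic_def
proof (intro allI impI)
  interpret M: module R "I (Suc k)" by (rule IM)
  interpret M0: module R "I k" by (rule IM)
  fix w assume w: "killed (I (Suc k)) (carrier R) w"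
  then have "\<one> \<odot>\<^bsub>I (Suc k)\<^esub> w = \<zero>\<^bsub>I (Suc k)\<^esub>" "w \<in> carrier (I (Suc k))" unfolding killed_def by simp_all
  then have "w = \<zero>\<^bsub>I (Suc k)\<^esub>" by simp
  then show "\<exists>v. killed (I k) (carrier R) v \<and> \<delta> k v = w"
    using module_hom_zero[OF \<delta> IM IM, of k] unfolding killed_def by (intro exI[of _ "\<zero>\<^bsub>I k\<^esub>"]) simp
qed

lemma acyclic_filtered:
  assumes "filtered C J" "acyclic k C"
  shows "acyclic k J"
  using assms
proof (induction rule: filtered.induct)
  case full
  show ?case by (rule acyclic_full)
next
  case (step a J)
  then show ?case using acyclic_extension[OF step.hyps(2,3)] by simp
qed

lemma filtered_subset: "filtered C J \<Longrightarrow> J \<subseteq> carrier R"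
  by (induction rule: filtered.induct) (simp_all add: ideal_closed(8))

text \<open>Induction on \<open>N - k\<close>; for \<open>k \<ge> N\<close> the module
  \<open>I (Suc k)\<close> is zero. In the step, multiplication by \<open>w\<close> embeds the ring
  modulo \<open>C\<close> into the ring, with cokernel the ring modulo \<open>w\<close>. This
  cokernel is filtered, so the induction hypothesis one degree higher covers it, and
  \<open>acyclic_colon\<close> with the zero ideal gives the claim for \<open>C\<close>.\<close>

lemma acyclic_all:
  assumes fin: "\<And>i. i > N \<Longrightarrow> carrier (I i) = {\<zero>\<^bsub>I i\<^esub>}"
    and w: "w \<in> carrier R" "colon {\<zero>} w = C" "filtered C (Idl {w})"
  shows "filtered C J \<Longrightarrow> acyclic k J"
proof (induction "N - k" arbitrary: k J)
  case 0
  interpret M: module R "I k" by (rule IM)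
  note JC = filtered_subset[OF "0.prems"]
  show ?case unfolding acyclic_def
  proof (intro allI impI)
    fix v assume "killed (I (Suc k)) J v"
    then have "v \<in> carrier (I (Suc k))" unfolding killed_def by (rule conjunct1)
    then have v: "\<delta> k \<zero>\<^bsub>I k\<^esub> = v" using fin[of "Suc k"] "0.hyps" module_hom_zero[OF \<delta> IM IM, of k] by simp
    have "killed (I k) J \<zero>\<^bsub>I k\<^esub>" unfolding killed_def using JC by (simp add: subset_iff)
    then show "\<exists>u. killed (I k) J u \<and> \<delta> k u = v" using v by (intro exI conjI)
  qed
next
  case (Suc m)
  have "Idl (insert w {\<zero>}) = Idl {w}"
    using w(1) genideal_self[of "{w}"] Idl_zero[of "{w}"] genideal_ideal[of "{w}"]
    by (intro equalityI genideal_minimal Idl_mono) auto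
  moreover have "acyclic (Suc k) (Idl {w})" by (rule Suc.hyps(1)[OF _ w(3)]) (use Suc.hyps(2) in simp)
  ultimately have "acyclic k C" using acyclic_colon[OF zeroideal w(1) acyclic_zero] w(2) by simp
  then show ?case by (rule acyclic_filtered[OF Suc.prems])
qed

text \<open>Vanishing of the first Ext of the ring modulo \<open>J\<close> makes every homomorphism
  from \<open>J\<close> to the ring a multiplication. In \<open>I 0\<close> it is multiplication by
  some \<open>w0\<close>; its differential is killed by \<open>J\<close> and so is the differential
  of some \<open>w1\<close> killed by \<open>J\<close>, and \<open>w0 \<ominus> w1\<close> comes
  from the ring.\<close>

lemma hom_extends:
  assumes J: "ideal J R" and A: "acyclic 0 J" and f: "ideal_hom J (self_module R) f"
  shows "\<exists>r0\<in>carrier R. \<forall>x\<in>J. f x = x \<otimes> r0"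
proof -
  interpret M: module R "I 0" by (rule IM)
  interpret M1: module R "I (Suc 0)" by (rule IM)
  note JC = ideal_closed(8)[OF J]
  have fc: "f x \<in> carrier R" if "x \<in> J" for x using f that unfolding ideal_hom_def by simp
  have hc: "h x \<in> carrier (I 0)" if "x \<in> carrier R" for x using module_homD(1)[OF h(1)] that by simp
  have ker: "\<delta> 0 (h x) = \<zero>\<^bsub>I (Suc 0)\<^esub>" if "x \<in> carrier R" for x
  proof -
    have "h x \<in> h ` carrier (self_module R)" using that by simp
    then show ?thesis unfolding h(3) by simp
  qed
  have "ideal_hom J (I 0) (\<lambda>x. h (f x))"
    using f module_homD(2)[OF h(1)] module_homD(3)[OF h(1)] hc unfolding ideal_hom_def by simp
  from baer[OF inj J this] obtain w0 where w0: "w0 \<in> carrier (I 0)" and w0': "\<forall>x\<in>J. h (f x) = x \<odot>\<^bsub>I 0\<^esub> w0" by (rule bexE)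
  have "x \<odot>\<^bsub>I (Suc 0)\<^esub> \<delta> 0 w0 = \<zero>\<^bsub>I (Suc 0)\<^esub>" if x: "x \<in> J" for x
    using module_homD(3)[OF \<delta>, of x w0 0] JC x w0 bspec[OF w0' x] ker[OF fc[OF x]] by auto
  then have "killed (I (Suc 0)) J (\<delta> 0 w0)" unfolding killed_def using module_homD(1)[OF \<delta> w0] by simp
  from acyclicD[OF A this \<delta>\<delta>[OF w0]] obtain w1 where w1: "killed (I 0) J w1" "\<delta> 0 w1 = \<delta> 0 w0" by blast
  have w1c: "w1 \<in> carrier (I 0)" using w1 unfolding killed_def by simp
  have "\<delta> 0 (w0 \<ominus>\<^bsub>I 0\<^esub> w1) = \<zero>\<^bsub>I (Suc 0)\<^esub>"
    unfolding \<delta>_diff[OF w0 w1c] w1(2) using module_homD(1)[OF \<delta> w0] by (simp add: M1.minus_eq M1.r_neg)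
  then have "w0 \<ominus>\<^bsub>I 0\<^esub> w1 \<in> h ` carrier (self_module R)" unfolding h(3) using w0 w1c by simp
  then obtain r0 where r0: "r0 \<in> carrier R" "w0 \<ominus>\<^bsub>I 0\<^esub> w1 = h r0" by auto
  have "f x = x \<otimes> r0" if x: "x \<in> J" for x
  proof -
    have xc: "x \<in> carrier R" using JC x by auto
    have "x \<odot>\<^bsub>I 0\<^esub> w1 = \<zero>\<^bsub>I 0\<^esub>" using w1(1) x unfolding killed_def by simp
    then have "x \<odot>\<^bsub>I 0\<^esub> (w0 \<ominus>\<^bsub>I 0\<^esub> w1) = x \<odot>\<^bsub>I 0\<^esub> w0"
      using xc w0 w1c by (simp add: M.minus_eq M.smult_r_distr M.smult_r_minus)
    then have "h (x \<otimes> r0) = h (f x)"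
      using module_homD(3)[OF h(1) xc, of r0] r0 bspec[OF w0' x] by simp
    then show ?thesis using inj_onD[OF h(2), of "x \<otimes> r0" "f x"] xc r0(1) fc[OF x] by simp
  qed
  then show ?thesis using r0(1) by (intro bexI[of _ r0] ballI)
qed

end

context cring
begin

text \<open>Annihilators, independence and filtrations are the data here, so that monomials can be
  left behind. Condition \<open>ind\<close> is what makes the map from
  \<open>a \<otimes> w \<oplus> b \<otimes> w'\<close> to \<open>a \<otimes> w\<close> well
  defined.\<close>

theorem not_gorensteinI:
  assumes w: "w \<in> carrier R" "w' \<in> carrier R" "w \<noteq> \<zero>"
    and C: "colon {\<zero>} w = C" "colon {\<zero>} w' = C"
    and ind: "\<And>a b. a \<in> carrier R \<Longrightarrow> b \<in> carrier R \<Longrightarrow> a \<otimes> w \<oplus> b \<otimes> w' = \<zero> \<Longrightarrow> a \<otimes> w = \<zero>"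
    and fil: "filtered C (Idl {w})" "filtered C (Idl {w, w'})"
  shows "\<not> gorenstein TYPE('c) R"
proof
  assume "gorenstein TYPE('c) R"
  then obtain I :: "nat \<Rightarrow> ('a, 'c) module" and \<delta> h N where res: "injective_resolution R (self_module R) I \<delta> h"
    and fin': "\<forall>i>N. carrier (I i) = {\<zero>\<^bsub>I i\<^esub>}"
    unfolding gorenstein_def by (elim conjE exE)
  have fin: "\<And>i. i > N \<Longrightarrow> carrier (I i) = {\<zero>\<^bsub>I i\<^esub>}" using fin' by simp
  interpret inj_resolution R I \<delta> h
    by (intro inj_resolution.intro inj_resolution_axioms.intro cring_axioms res)
  let ?J = "Idl {w, w'}"
  have J: "ideal ?J R" using w by (intro genideal_ideal) simp
  have mem: "x \<in> ?J \<longleftrightarrow> (\<exists>a\<in>carrier R. \<exists>b\<in>carrier R. x = a \<otimes> w \<oplus> b \<otimes> w')" for x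
  proof -
    have "x \<in> ?J \<longleftrightarrow> (\<exists>q\<in>Idl {w'}. \<exists>a\<in>carrier R. x = q \<oplus> a \<otimes> w)" using Idl_insert_mem[of "{w'}" w x] w by simp
    moreover have "Idl {w'} = (\<lambda>b. b \<otimes> w') ` carrier R"
      using Idl_insert_mem[of "{}" w'] w by (auto simp: Idl_empty)
    ultimately have "x \<in> ?J \<longleftrightarrow> (\<exists>b\<in>carrier R. \<exists>a\<in>carrier R. x = b \<otimes> w' \<oplus> a \<otimes> w)" by simp
    also have "\<dots> \<longleftrightarrow> (\<exists>b\<in>carrier R. \<exists>a\<in>carrier R. x = a \<otimes> w \<oplus> b \<otimes> w')" by (intro bex_cong refl) (simp add: a_comm w)
    finally show ?thesis by blast
  qed
  define f where "f x = (SOME y. \<exists>a\<in>carrier R. \<exists>b\<in>carrier R. x = a \<otimes> w \<oplus> b \<otimes> w' \<and> y = a \<otimes> w)" for x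
  have fv: "f (a \<otimes> w \<oplus> b \<otimes> w') = a \<otimes> w" if a: "a \<in> carrier R" and b: "b \<in> carrier R" for a b
  proof -
    have "\<exists>a'\<in>carrier R. \<exists>b'\<in>carrier R. a \<otimes> w \<oplus> b \<otimes> w' = a' \<otimes> w \<oplus> b' \<otimes> w' \<and> f (a \<otimes> w \<oplus> b \<otimes> w') = a' \<otimes> w"
      unfolding f_def by (rule someI[of _ "a \<otimes> w"]) (use a b in blast)
    then obtain a' b' where ab: "a' \<in> carrier R" "b' \<in> carrier R" "a \<otimes> w \<oplus> b \<otimes> w' = a' \<otimes> w \<oplus> b' \<otimes> w'"
      and f: "f (a \<otimes> w \<oplus> b \<otimes> w') = a' \<otimes> w" by blast
    have "(a' \<ominus> a) \<otimes> w \<oplus> (b' \<ominus> b) \<otimes> w' = (a' \<otimes> w \<oplus> b' \<otimes> w') \<ominus> (a \<otimes> w \<oplus> b \<otimes> w')"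
      using a b ab(1,2) w by algebra
    also have "\<dots> = \<zero>" unfolding ab(3) using ab(1,2) w by (simp add: a_minus_def r_neg)
    finally have z: "(a' \<ominus> a) \<otimes> w = \<zero>" using a b ab(1,2) by (intro ind) auto
    have "a' \<otimes> w = (a' \<ominus> a) \<otimes> w \<oplus> a \<otimes> w" using a ab(1) w by algebra
    then show ?thesis unfolding f z using a w by simp
  qed
  have "ideal_hom ?J (self_module R) f" unfolding ideal_hom_def
  proof (intro conjI ballI)
    fix x assume "x \<in> ?J"
    then obtain a b where x: "a \<in> carrier R" "b \<in> carrier R" "x = a \<otimes> w \<oplus> b \<otimes> w'" unfolding mem by blast
    show "f x \<in> carrier (self_module R)" unfolding x(3) fv[OF x(1,2)] using x(1) w by simp
  next
    fix x y assume "x \<in> ?J" "y \<in> ?J"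
    then obtain a b a' b' where x: "a \<in> carrier R" "b \<in> carrier R" "x = a \<otimes> w \<oplus> b \<otimes> w'"
      and y: "a' \<in> carrier R" "b' \<in> carrier R" "y = a' \<otimes> w \<oplus> b' \<otimes> w'" unfolding mem by blast
    have "x \<oplus> y = (a \<oplus> a') \<otimes> w \<oplus> (b \<oplus> b') \<otimes> w'" unfolding x(3) y(3) using x(1,2) y(1,2) w by algebra
    then have "f (x \<oplus> y) = (a \<oplus> a') \<otimes> w" using fv x(1,2) y(1,2) by simp
    then show "f (x \<oplus> y) = f x \<oplus>\<^bsub>self_module R\<^esub> f y"
      unfolding x(3) y(3) fv[OF x(1,2)] fv[OF y(1,2)] using x(1) y(1) w by (simp add: l_distr)
  next
    fix r x assume r: "r \<in> carrier R" and "x \<in> ?J"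
    then obtain a b where x: "a \<in> carrier R" "b \<in> carrier R" "x = a \<otimes> w \<oplus> b \<otimes> w'" unfolding mem by blast
    have "r \<otimes> x = (r \<otimes> a) \<otimes> w \<oplus> (r \<otimes> b) \<otimes> w'" unfolding x(3) using x(1,2) r w by algebra
    then have "f (r \<otimes> x) = (r \<otimes> a) \<otimes> w" using fv x(1,2) r by simp
    then show "f (r \<otimes> x) = r \<odot>\<^bsub>self_module R\<^esub> f x" unfolding x(3) fv[OF x(1,2)] using x(1) r w by (simp add: m_assoc)
  qed
  from hom_extends[OF J acyclic_all[OF fin w(1) C(1) fil] this]
  obtain r0 where r0: "r0 \<in> carrier R" and r0': "\<forall>x\<in>?J. f x = x \<otimes> r0" by (rule bexE)
  have "w \<in> ?J" "w' \<in> ?J" using genideal_self[of "{w, w'}"] w by auto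
  moreover have "f w = w" using fv[of \<one> \<zero>] w by simp
  moreover have "f w' = \<zero>" using fv[of \<zero> \<one>] w by simp
  ultimately have e: "w = w \<otimes> r0" "\<zero> = w' \<otimes> r0" using r0' by metis+
  have "(\<one> \<ominus> r0) \<otimes> w = w \<ominus> w \<otimes> r0" using r0 w by algebra
  also have "\<dots> = \<zero>" unfolding e(1)[symmetric] using w by (simp add: a_minus_def r_neg)
  finally have "\<one> \<ominus> r0 \<in> C" using r0 unfolding C(1)[symmetric] colon_def by simp
  moreover have "r0 \<in> C" using r0 e(2) w unfolding C(2)[symmetric] colon_def by (simp add: m_comm)
  moreover have "ideal C R" unfolding C(1)[symmetric] by (rule colon_ideal[OF zeroideal w(1)])
  ultimately have "(\<one> \<ominus> r0) \<oplus> r0 \<in> C" by (intro ideal_closed(1))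
  moreover have "(\<one> \<ominus> r0) \<oplus> r0 = \<one>" using r0 by algebra
  ultimately have "\<one> \<in> C" by simp
  then show False using w unfolding C(1)[symmetric] colon_def by simp
qed

end

section \<open>Quotients by monomial ideals\<close>

text \<open>A surjection with kernel \<open>Q\<close> onto an arbitrary ring stands for the quotient
  map; arithmetic with cosets is confined to \<open>ring_epi_rcos\<close>.\<close>

locale ring_epi = cring R + S: cring S
  for R :: "('a, 'b) ring_scheme" (structure) and S :: "('c, 'd) ring_scheme" +
  fixes h :: "'a \<Rightarrow> 'c" and Q :: "'a set"
  assumes hom: "h \<in> ring_hom R S" and surj: "h ` carrier R = carrier S"
    and Q: "ideal Q R" and ker: "\<And>a. a \<in> carrier R \<Longrightarrow> h a = \<zero>\<^bsub>S\<^esub> \<longleftrightarrow> a \<in> Q"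
begin

lemmas h_closed [simp] = ring_hom_closed[OF hom]
lemmas h_mult [simp] = ring_hom_mult[OF hom]
lemmas h_add [simp] = ring_hom_add[OF hom]
lemmas h_one [simp] = ring_hom_one[OF hom]

lemma h_cring: "ring_hom_cring R S h"
  by (intro ring_hom_cring.intro ring_hom_cring_axioms.intro hom is_cring S.is_cring)

lemmas h_zero [simp] = ring_hom_cring.hom_zero[OF h_cring]

lemma h_eq: "a \<in> carrier R \<Longrightarrow> b \<in> carrier R \<Longrightarrow> h a = h b \<longleftrightarrow> a \<ominus> b \<in> Q"
  using ker[of "a \<ominus> b"] ring_hom_cring.hom_sub[OF h_cring, of a b] by simp

lemma h_obtain:
  assumes "x \<in> carrier S"
  obtains a where "a \<in> carrier R" "x = h a"
  using assms surj by auto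

lemma h_image: "T \<subseteq> carrier R \<Longrightarrow> h ` T \<subseteq> carrier S"
  by auto

lemma ideal_image:
  assumes I: "ideal I R"
  shows "ideal (h ` I) S"
proof (rule S.ideal_setI)
  note c = ideal_closed[OF I]
  show "h ` I \<subseteq> carrier S" using c(7) by auto
  show "\<zero>\<^bsub>S\<^esub> \<in> h ` I" using c(5) h_zero by (metis imageI)
  show "x \<oplus>\<^bsub>S\<^esub> y \<in> h ` I" if "x \<in> h ` I" "y \<in> h ` I" for x y
  proof -
    obtain a b where "a \<in> I" "b \<in> I" "x = h a" "y = h b" using \<open>x \<in> h ` I\<close> \<open>y \<in> h ` I\<close> by auto
    then show ?thesis using c(1)[of a b] c(7) h_add[of a b] by (metis imageI)
  qed
  show "r \<otimes>\<^bsub>S\<^esub> x \<in> h ` I" if r: "r \<in> carrier S" and x: "x \<in> h ` I" for r x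
  proof -
    obtain a where "a \<in> carrier R" "r = h a" using h_obtain[OF r] .
    moreover obtain b where "b \<in> I" "x = h b" using x by auto
    ultimately show ?thesis using c(3)[of b a] c(7)[of b] h_mult[of a b] by (metis imageI)
  qed
qed

lemma ideal_preimage: "ideal N S \<Longrightarrow> ideal {r \<in> carrier R. h r \<in> N} R"
  by (rule ring_hom_ring.ideal_vimage[OF ring_hom_ringI2[OF ring_axioms S.ring_axioms hom]])

lemma image_mem:
  assumes I: "ideal I R" "Q \<subseteq> I" and a: "a \<in> carrier R"
  shows "h a \<in> h ` I \<longleftrightarrow> a \<in> I"
proof
  assume "h a \<in> h ` I"
  then obtain b where b: "b \<in> I" "h a = h b" by auto
  have bc: "b \<in> carrier R" by (rule ideal_closed(7)[OF I(1) b(1)])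
  have "a \<ominus> b \<in> I" using b(2) h_eq[OF a bc] I(2) by auto
  then have "(a \<ominus> b) \<oplus> b \<in> I" using ideal_closed(1)[OF I(1)] b(1) by simp
  moreover have "(a \<ominus> b) \<oplus> b = a" using a bc by algebra
  ultimately show "a \<in> I" by simp
qed simp

lemma Idl_image:
  assumes T: "T \<subseteq> carrier R"
  shows "Idl\<^bsub>S\<^esub> (h ` T) = h ` (Idl (Q \<union> T))"
proof
  have QT: "Q \<union> T \<subseteq> carrier R" using T ideal_closed(8)[OF Q] by simp
  show "Idl\<^bsub>S\<^esub> (h ` T) \<subseteq> h ` (Idl (Q \<union> T))"
    using genideal_self[OF QT] by (intro S.genideal_minimal ideal_image genideal_ideal[OF QT]) auto
  let ?N = "Idl\<^bsub>S\<^esub> (h ` T)"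
  have N: "ideal ?N S" using T by (intro S.genideal_ideal) auto
  have "h x \<in> ?N" if x: "x \<in> Q" for x
    using x ker[of x] ideal_closed(7)[OF Q x] S.ideal_closed(5)[OF N] by simp
  moreover have "h x \<in> ?N" if "x \<in> T" for x using S.genideal_self[OF h_image[OF T]] that by auto
  ultimately have "Idl (Q \<union> T) \<subseteq> {r \<in> carrier R. h r \<in> ?N}"
    using QT by (intro genideal_minimal ideal_preimage N) auto
  then show "h ` (Idl (Q \<union> T)) \<subseteq> ?N" by auto
qed

lemma Idl_image_mem:
  assumes T: "T \<subseteq> carrier R" and a: "a \<in> carrier R"
  shows "h a \<in> Idl\<^bsub>S\<^esub> (h ` T) \<longleftrightarrow> a \<in> Idl (Q \<union> T)"
proof -
  have QT: "Q \<union> T \<subseteq> carrier R" using T ideal_closed(8)[OF Q] by simp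
  show ?thesis unfolding Idl_image[OF T]
    using genideal_self[OF QT] by (intro image_mem a genideal_ideal[OF QT]) auto
qed

lemma nzd_image:
  assumes T: "T \<subseteq> carrier R" and y: "y \<in> carrier R" and n: "nzd (Q \<union> T) y"
  shows "S.nzd (h ` T) (h y)"
  unfolding S.nzd_def
proof (intro ballI impI)
  fix b assume b: "b \<in> carrier S" and m: "h y \<otimes>\<^bsub>S\<^esub> b \<in> Idl\<^bsub>S\<^esub> (h ` T)"
  obtain a where a: "a \<in> carrier R" "b = h a" using h_obtain[OF b] .
  have "h (y \<otimes> a) \<in> Idl\<^bsub>S\<^esub> (h ` T)" using m y a by simp
  then have "y \<otimes> a \<in> Idl (Q \<union> T)" using Idl_image_mem[OF T m_closed[OF y a(1)]] by simp
  then have "a \<in> Idl (Q \<union> T)" using n a unfolding nzd_def by simp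
  then show "b \<in> Idl\<^bsub>S\<^esub> (h ` T)" using Idl_image_mem[OF T] a by simp
qed

lemma reg_image:
  assumes "set ys \<subseteq> carrier R" "reg Q ys"
  shows "S.reg {} (map h ys)"
  unfolding S.reg_def
proof (intro allI impI)
  fix i assume i: "i < length (map h ys)"
  have "S.nzd (h ` set (take i ys)) (h (ys ! i))"
  proof (rule nzd_image)
    show "set (take i ys) \<subseteq> carrier R" using assms(1) set_take_subset[of i ys] by blast
    show "ys ! i \<in> carrier R" using assms(1) i by (auto simp: subset_iff)
    show "nzd (Q \<union> set (take i ys)) (ys ! i)" using assms(2) i unfolding reg_def by simp
  qed
  then show "S.nzd ({} \<union> set (take i (map h ys))) (map h ys ! i)" using i by (simp add: take_map)
qed

lemma hom_descends:
  assumes f: "f \<in> module_hom R (free p) (self_module R)"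
  shows "\<exists>g\<in>module_hom S (free_module S p) (self_module S).
    \<forall>c\<in>carrier (free p). g (\<lambda>j\<in>{..<p}. h (c j)) = h (f c)"
proof -
  have fc: "f (unit_vec p j) \<in> carrier R" for j using module_homD(1)[OF f, of "unit_vec p j"] by simp
  have "\<And>j. h (f (unit_vec p j)) \<in> carrier (self_module S)" using fc by simp
  from S.free_hom_ex[OF S.self_is_module this, of p] obtain g where
    g: "g \<in> module_hom S (free_module S p) (self_module S)" and gu: "\<forall>j<p. g (S.unit_vec p j) = h (f (unit_vec p j))"
    by (rule bexE)
  have fs: "finsum (self_module S) = finsum S" "finsum (self_module R) = finsum R"
    by (intro ext; simp add: finsum_def finprod_def self_module_def)+
  have "g (\<lambda>j\<in>{..<p}. h (c j)) = h (f c)" if c: "c \<in> carrier (free p)" for c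
  proof -
    have cc: "c j \<in> carrier R" if "j < p" for j using c that by simp
    have hc: "(\<lambda>j\<in>{..<p}. h (c j)) \<in> carrier (free_module S p)" using cc by (simp add: S.free_simps(1))
    have "g (\<lambda>j\<in>{..<p}. h (c j)) = (\<Oplus>\<^bsub>S\<^esub>j\<in>{..<p}. (\<lambda>j\<in>{..<p}. h (c j)) j \<otimes>\<^bsub>S\<^esub> g (S.unit_vec p j))"
      unfolding S.free_hom_sum[OF g S.self_is_module hc] fs by simp
    also have "\<dots> = (\<Oplus>\<^bsub>S\<^esub>j\<in>{..<p}. (h \<circ> (\<lambda>j. c j \<otimes> f (unit_vec p j))) j)"
      using gu cc fc by (intro S.finsum_cong') auto
    also have "\<dots> = h (\<Oplus>j\<in>{..<p}. c j \<otimes> f (unit_vec p j))"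
      by (rule ring_hom_cring.hom_finsum[OF h_cring, symmetric]) (use cc fc in auto)
    also have "(\<Oplus>j\<in>{..<p}. c j \<otimes> f (unit_vec p j)) = f c"
      unfolding free_hom_sum[OF f self_is_module c] fs by simp
    finally show ?thesis .
  qed
  then show ?thesis using g by blast
qed

text \<open>Proper ideals of \<open>S\<close> have proper preimages, which lie in the maximal ideal,
  so its image is the only maximal ideal of \<open>S\<close>. Finite generation passes to
  \<open>S\<close> from preimages.\<close>

lemma quotient_local:
  assumes N: "noetherian_local R" and one: "\<one> \<notin> Q"
  shows "noetherian_local S \<and> (\<forall>a\<in>carrier R. h a \<in> max_ideal S \<longleftrightarrow> a \<in> max_ideal R)"
proof -
  interpret N: noetherian_local R by (rule N)
  let ?M = "h ` N.mm"
  have Qm: "Q \<subseteq> N.mm" by (rule N.proper_in_mm[OF Q one])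
  have mem: "h a \<in> ?M \<longleftrightarrow> a \<in> N.mm" if "a \<in> carrier R" for a by (rule image_mem[OF N.mm_ideal Qm that])
  have M: "ideal ?M S" by (rule ideal_image[OF N.mm_ideal])
  have sub: "I \<subseteq> ?M" if I: "ideal I S" "\<one>\<^bsub>S\<^esub> \<notin> I" for I
  proof
    fix x assume x: "x \<in> I"
    obtain a where a: "a \<in> carrier R" "x = h a" using h_obtain[OF S.ideal_closed(7)[OF I(1) x]] .
    have "{r \<in> carrier R. h r \<in> I} \<subseteq> N.mm" using I(2) by (intro N.proper_in_mm ideal_preimage I(1)) simp
    then show "x \<in> ?M" using a x by auto
  qed
  have one': "\<one>\<^bsub>S\<^esub> \<notin> ?M" using mem[of \<one>] N.one_notin_mm by simp
  have full: "I = carrier S" if "ideal I S" "\<one>\<^bsub>S\<^esub> \<in> I" for I by (rule ideal.one_imp_carrier[OF that])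
  have mx: "maximalideal ?M S"
  proof (rule maximalidealI[OF M])
    show "carrier S \<noteq> ?M" using one' S.one_closed by blast
    fix I assume I: "ideal I S" "?M \<subseteq> I" "I \<subseteq> carrier S"
    show "I = ?M \<or> I = carrier S" using sub[OF I(1)] full[OF I(1)] I(2) by blast
  qed
  have uniq: "I = ?M" if I: "maximalideal I S" for I
  proof -
    have i: "ideal I S" by (rule maximalideal.axioms(1)[OF I])
    have "\<one>\<^bsub>S\<^esub> \<notin> I" using full[OF i] maximalideal.I_notcarr[OF I] by blast
    from maximalideal.I_maximal[OF I M sub[OF i this]] show ?thesis
      using one' S.one_closed S.ideal_closed(8)[OF M] by auto
  qed
  have loc: "local_ring S" unfolding local_ring_def using S.is_cring mx uniq by blast
  have mS: "max_ideal S = ?M" unfolding max_ideal_def[of S] using mx uniq by (rule the_equality)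
  have "noetherian_ring S"
  proof (intro noetherian_ring.intro noetherian_ring_axioms.intro S.ring_axioms)
    fix I assume I: "ideal I S"
    have P: "ideal {r \<in> carrier R. h r \<in> I} R" by (rule ideal_preimage[OF I])
    from N.finetely_gen[OF this] obtain F where F: "F \<subseteq> carrier R" "finite F" "{r \<in> carrier R. h r \<in> I} = Idl F" by blast
    have QF: "Q \<union> F \<subseteq> carrier R" using F(1) ideal_closed(8)[OF Q] by simp
    have "I = Idl\<^bsub>S\<^esub> (h ` F)"
    proof
      show "I \<subseteq> Idl\<^bsub>S\<^esub> (h ` F)"
      proof
        fix x assume x: "x \<in> I"
        obtain a where a: "a \<in> carrier R" "x = h a" using h_obtain[OF S.ideal_closed(7)[OF I x]] .
        then have "a \<in> Idl F" using x F(3) by auto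
        then have "a \<in> Idl (Q \<union> F)" using Idl_mono[of F "Q \<union> F"] QF by auto
        then show "x \<in> Idl\<^bsub>S\<^esub> (h ` F)" using Idl_image_mem[OF F(1)] a by simp
      qed
      have "F \<subseteq> {r \<in> carrier R. h r \<in> I}" unfolding F(3) by (rule genideal_self[OF F(1)])
      then show "Idl\<^bsub>S\<^esub> (h ` F) \<subseteq> I" by (intro S.genideal_minimal I) auto
    qed
    then show "\<exists>A\<subseteq>carrier S. finite A \<and> I = Idl\<^bsub>S\<^esub> A" using F by (intro exI[of _ "h ` F"]) auto
  qed
  then have "noetherian_local S"
    unfolding noetherian_local_def noetherian_local_axioms_def using loc S.is_cring by simp
  then show ?thesis unfolding mS using mem by blast
qed

end

lemma (in ideal) ring_epi_rcos: "cring R \<Longrightarrow> ring_epi R (R Quot I) ((+>) I) I"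
proof (intro ring_epi.intro ring_epi_axioms.intro quotient_is_cring rcos_ring_hom ideal_axioms)
  show "(+>) I ` carrier R = carrier (R Quot I)"
    by (auto simp: FactRing_def A_RCOSETS_def RCOSETS_def a_r_coset_def)
  show "I +> a = \<zero>\<^bsub>R Quot I\<^esub> \<longleftrightarrow> a \<in> I" if a: "a \<in> carrier R" for a
  proof -
    have "\<zero>\<^bsub>R Quot I\<^esub> = I" by (simp add: FactRing_def)
    moreover have "I +> a = I \<Longrightarrow> a \<in> I" using a_rcos_self[OF a] by simp
    ultimately show ?thesis using a_rcos_const[of a] by argo
  qed
qed

section \<open>Maximal exponents and the two conclusions for a monomial quotient\<close>

definition maxexp :: "nat \<Rightarrow> (nat \<Rightarrow> nat) set \<Rightarrow> (nat \<Rightarrow> nat) set" where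
  "maxexp l E = {w \<in> below l E. \<forall>i<l. w(i := Suc (w i)) \<notin> below l E}"

lemma maxexpD:
  "w \<in> maxexp l E \<Longrightarrow> w \<in> below l E"
  "w \<in> maxexp l E \<Longrightarrow> i < l \<Longrightarrow> w(i := Suc (w i)) \<notin> below l E"
  unfolding maxexp_def by simp_all

text \<open>If \<open>w\<close> dominated \<open>w'\<close> without being equal to it, it would
  dominate \<open>w'\<close> raised by one in some coordinate, which belongs to the up-set.\<close>

lemma below_separated:
  assumes w: "w \<in> below l E" and w': "w' \<in> maxexp l E" and ne: "w \<noteq> w'"
  shows "\<exists>i<l. w i < w' i"
proof (rule ccontr)
  assume "\<not> (\<exists>i<l. w i < w' i)"
  then have le: "w' i \<le> w i" if "i < l" for i using that not_less by blast
  obtain i where "w i \<noteq> w' i" using ne by auto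
  moreover from this have i: "i < l" using w maxexpD(1)[OF w'] unfolding below_def by (metis (mono_tags, lifting) mem_Collect_eq not_less)
  ultimately have lt: "w' i < w i" using le[OF i] by simp
  have z: "\<forall>j\<ge>l. (w'(i := Suc (w' i))) j = 0" using maxexpD(1)[OF w'] i unfolding below_def by simp
  then obtain e where e: "e \<in> E" "\<forall>j<l. e j \<le> (w'(i := Suc (w' i))) j" using maxexpD(2)[OF w' i] unfolding below_def by blast
  have "e j \<le> w j" if "j < l" for j using e(2) le[OF that] lt that by (auto split: if_splits)
  then show False using w e(1) unfolding below_def by blast
qed

lemma below_lt: "w \<in> below l E \<Longrightarrow> e \<in> E \<Longrightarrow> \<exists>i<l. w i < e i"
  unfolding below_def by (auto simp: not_le)

text \<open>\<open>x^v'\<close> is adjoined to the ideal as one more generator, which removes the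
  second term. By maximality of \<open>v'\<close> no exponent of the enlarged set is below
  \<open>v\<close>, so the colon formula at \<open>x^v\<close> still applies.\<close>

lemma (in cring) mon_pair_mem:
  assumes col: "col S xs" and S: "S \<subseteq> carrier R" and xs: "set xs \<subseteq> carrier R"
    and v: "v \<in> maxexp (length xs) E" "v' \<in> maxexp (length xs) E" "v \<noteq> v'"
    and u: "u \<in> carrier R" "u' \<in> carrier R"
    and mem: "monomial R xs v \<otimes> u \<oplus> monomial R xs v' \<otimes> u' \<in> Idl (S \<union> monomial R xs ` E)"
  shows "u \<in> Idl (S \<union> set xs)"
proof -
  let ?l = "length xs" and ?m = "monomial R xs"
  let ?W = "S \<union> ?m ` insert v' E"
  have Wc: "?W \<subseteq> carrier R" using S mon_image_carr[OF xs, of "insert v' E"] by (rule Un_least)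
  have mc: "?m v \<in> carrier R" for v by (rule monomial_closed[OF xs])
  have "?m v' \<otimes> u' \<in> Idl ?W"
    using Idl_lmult[OF Wc Idl_memI[OF Wc, of "?m v'"] u(2)] m_comm[OF u(2) mc] by simp
  moreover have "Idl (S \<union> ?m ` E) \<subseteq> Idl ?W" using Wc by (intro Idl_mono) auto
  ultimately have "(?m v \<otimes> u \<oplus> ?m v' \<otimes> u') \<ominus> ?m v' \<otimes> u' \<in> Idl ?W" using mem by (intro Idl_minus[OF Wc]) auto
  moreover have "(?m v \<otimes> u \<oplus> ?m v' \<otimes> u') \<ominus> ?m v' \<otimes> u' = ?m v \<otimes> u"
  proof -
    have "?m v \<otimes> u \<in> carrier R" "?m v' \<otimes> u' \<in> carrier R" using mc u by auto
    then show ?thesis by algebra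
  qed
  ultimately have "?m v \<otimes> u \<in> Idl ?W" by simp
  moreover have "\<exists>i<?l. v i < e i" if "e \<in> insert v' E" for e
    using that below_lt[OF maxexpD(1)[OF v(1)]] below_separated[OF maxexpD(1)[OF v(1)] v(2,3)] by auto
  ultimately show ?thesis by (intro col_ideal[OF col S xs u(1), where E = "insert v' E" and w = v])
qed

context noetherian_local
begin

text \<open>Two copies of the tuple encoded by \<open>a\<close>, scaled by \<open>x\<close> and
  \<open>x'\<close>, act on the two halves of a coefficient vector.\<close>

lemma pair_hom:
  assumes a: "a \<in> module_hom R (free N) (self_module R)" and x: "x \<in> carrier R" "x' \<in> carrier R"
  shows "(\<lambda>c\<in>carrier (free (N + N)). x \<otimes> a (\<lambda>j\<in>{..<N}. c j) \<oplus> x' \<otimes> a (\<lambda>j\<in>{..<N}. c (N + j)))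
    \<in> module_hom R (free (N + N)) (self_module R)"
proof -
  let ?p = "\<lambda>k c. \<lambda>j\<in>{..<N}. c (k + j)"
  have p: "?p k c \<in> carrier (free N)" if "c \<in> carrier (free (N + N))" "k \<le> N" for c k
  proof -
    have "c (k + j) \<in> carrier R" if "j < N" for j
      using PiE_mem[of c "{..<N + N}" "\<lambda>_. carrier R" "k + j"] \<open>c \<in> carrier (free (N + N))\<close> \<open>k \<le> N\<close> that by simp
    then show ?thesis by simp
  qed
  have ac: "a (?p k c) \<in> carrier R" if "c \<in> carrier (free (N + N))" "k \<le> N" for c k
    using module_homD(1)[OF a p[OF that]] by simp
  have add: "a (?p k (c \<oplus>\<^bsub>free (N + N)\<^esub> d)) = a (?p k c) \<oplus> a (?p k d)"
    if c: "c \<in> carrier (free (N + N))" and d: "d \<in> carrier (free (N + N))" and k: "k \<le> N" for c d k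
  proof -
    have "?p k (c \<oplus>\<^bsub>free (N + N)\<^esub> d) = ?p k c \<oplus>\<^bsub>free N\<^esub> ?p k d" using k by (auto simp: fun_eq_iff)
    then show ?thesis using module_homD(2)[OF a p[OF c k] p[OF d k]] by (simp del: free_simps)
  qed
  have smult: "a (?p k (r \<odot>\<^bsub>free (N + N)\<^esub> c)) = r \<otimes> a (?p k c)"
    if r: "r \<in> carrier R" and c: "c \<in> carrier (free (N + N))" and k: "k \<le> N" for r c k
  proof -
    have "?p k (r \<odot>\<^bsub>free (N + N)\<^esub> c) = r \<odot>\<^bsub>free N\<^esub> ?p k c" using k by (auto simp: fun_eq_iff)
    then show ?thesis using module_homD(3)[OF a r p[OF c k]] by (simp del: free_simps)
  qed
  have "(\<lambda>c\<in>carrier (free (N + N)). x \<otimes> a (?p 0 c) \<oplus> x' \<otimes> a (?p N c)) \<in> module_hom R (free (N + N)) (self_module R)"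
  proof (rule module_homI[OF _ _ _ free_is_module])
    fix c assume c: "c \<in> carrier (free (N + N))"
    show "x \<otimes> a (?p 0 c) \<oplus> x' \<otimes> a (?p N c) \<in> carrier (self_module R)"
      using ac[OF c, of 0] ac[OF c, of N] x by simp
    fix d assume d: "d \<in> carrier (free (N + N))"
    have "x \<otimes> (a (?p 0 c) \<oplus> a (?p 0 d)) \<oplus> x' \<otimes> (a (?p N c) \<oplus> a (?p N d))
      = (x \<otimes> a (?p 0 c) \<oplus> x' \<otimes> a (?p N c)) \<oplus> (x \<otimes> a (?p 0 d) \<oplus> x' \<otimes> a (?p N d))"
      using ac[OF c, of 0] ac[OF c, of N] ac[OF d, of 0] ac[OF d, of N] x by (simp add: r_distr a_ac)
    then show "x \<otimes> a (?p 0 (c \<oplus>\<^bsub>free (N + N)\<^esub> d)) \<oplus> x' \<otimes> a (?p N (c \<oplus>\<^bsub>free (N + N)\<^esub> d))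
      = (x \<otimes> a (?p 0 c) \<oplus> x' \<otimes> a (?p N c)) \<oplus>\<^bsub>self_module R\<^esub> (x \<otimes> a (?p 0 d) \<oplus> x' \<otimes> a (?p N d))"
      unfolding add[OF c d le0] add[OF c d le_refl] self_simps .
  next
    fix r c assume r: "r \<in> carrier R" and c: "c \<in> carrier (free (N + N))"
    have "x \<otimes> (r \<otimes> a (?p 0 c)) \<oplus> x' \<otimes> (r \<otimes> a (?p N c)) = r \<otimes> (x \<otimes> a (?p 0 c) \<oplus> x' \<otimes> a (?p N c))"
      using ac[OF c, of 0] ac[OF c, of N] r x by (simp add: r_distr m_lcomm)
    then show "x \<otimes> a (?p 0 (r \<odot>\<^bsub>free (N + N)\<^esub> c)) \<oplus> x' \<otimes> a (?p N (r \<odot>\<^bsub>free (N + N)\<^esub> c))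
      = r \<odot>\<^bsub>self_module R\<^esub> (x \<otimes> a (?p 0 c) \<oplus> x' \<otimes> a (?p N c))"
      unfolding smult[OF r c le0] smult[OF r c le_refl] self_simps .
  qed
  then show ?thesis by simp
qed

text \<open>\<open>up\<close> places the multiples of a socle element in the larger socle, and
  \<open>down\<close> recovers each coefficient from a relation, once for each order of the pair.
  The images of \<open>ys\<close> are a maximal regular sequence on \<open>S\<close> for the same
  reason: a socle element outside the ideal stays outside after multiplication by
  \<open>x^w\<close>.\<close>

theorem cm_type_monomial_quotient:
  fixes S :: "('c, 'd) ring_scheme"
  assumes xs: "set xs \<subseteq> mm" "reg {} xs" and fin: "finite (below (length xs) E)"
    and w: "w \<in> maxexp (length xs) E" and w': "w' \<in> maxexp (length xs) E"
    and ne: "w \<noteq> w'"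
    and epi: "ring_epi R S h (Idl (monomial R xs ` E))" and S: "noetherian_local S"
    and mmS: "\<And>a. a \<in> carrier R \<Longrightarrow> h a \<in> max_ideal S \<longleftrightarrow> a \<in> mm"
  shows "2 * cm_type R \<le> cm_type S"
proof -
  let ?l = "length xs" and ?m = "monomial R xs"
  let ?Q = "Idl (?m ` E)"
  interpret H: ring_epi R S h ?Q by (rule epi)
  interpret S: noetherian_local S by (rule S)
  obtain ys where ys: "set ys \<subseteq> mm" "reg {} (xs @ ys)"
    and soc: "\<not> socle_gen (Idl (set (xs @ ys))) \<subseteq> Idl (set (xs @ ys))" using extend_regular[OF xs] .
  let ?U = "Idl (set (xs @ ys))"
  let ?V = "Idl (set ys \<union> ?m ` E)"
  have xc: "set xs \<subseteq> carrier R" and yc: "set ys \<subseteq> carrier R" using xs ys mm_carr by auto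
  have Ec: "?m ` F \<subseteq> carrier R" for F by (rule mon_image_carr[OF xc])
  have U: "?U = Idl (set ys \<union> set xs)" by (simp add: Un_commute)
  have cr: "col (set ys) xs" "reg (?m ` E) ys" using reg_mod_mon[OF ys(2) _ xc yc fin] by simp_all
  have V: "Idl (?Q \<union> set ys) = ?V" using Idl_Un_Idl[OF Ec yc] by (simp add: Un_commute)
  have mc: "?m v \<in> carrier R" for v by (rule monomial_closed[OF xc])
  have up: "?m v \<otimes> u \<in> socle_gen ?V"
    if v: "v \<in> maxexp ?l E" and u: "u \<in> socle_gen ?U" for v u
  proof -
    have uc: "u \<in> carrier R" using u unfolding socle_gen_def by simp
    have "r \<otimes> (?m v \<otimes> u) \<in> ?V" if r: "r \<in> mm" for r
    proof -
      have "r \<otimes> u \<in> Idl (set ys \<union> set xs)" using u r unfolding socle_gen_def U by simp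
      then have "?m v \<otimes> (r \<otimes> u) \<in> ?V" by (intro mon_times_var_mem[OF xc yc _ maxexpD(1)[OF v]] maxexpD(2)[OF v])
      then show ?thesis using m_lcomm[OF mm_carr[OF r] mc uc] by simp
    qed
    then show ?thesis unfolding socle_gen_def using mc uc by simp
  qed
  have down: "u \<in> ?U" if v: "v \<in> maxexp ?l E" "v' \<in> maxexp ?l E" "v \<noteq> v'"
    and u: "u \<in> carrier R" "u' \<in> carrier R" and mem: "?m v \<otimes> u \<oplus> ?m v' \<otimes> u' \<in> ?V" for v v' u u'
    unfolding U by (rule mon_pair_mem[OF cr(1) yc xc v u mem])
  have socS: "h u \<in> S.socle_gen (Idl\<^bsub>S\<^esub> (h ` set ys))" if u: "u \<in> socle_gen ?V" for u
  proof -
    have uc: "u \<in> carrier R" using u unfolding socle_gen_def by simp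
    have "r \<otimes>\<^bsub>S\<^esub> h u \<in> Idl\<^bsub>S\<^esub> (h ` set ys)" if r: "r \<in> max_ideal S" for r
    proof -
      obtain b where b: "b \<in> carrier R" "r = h b" using H.h_obtain[OF S.mm_carr[OF r]] .
      then have "b \<otimes> u \<in> ?V" using mmS r u unfolding socle_gen_def by simp
      then have "h (b \<otimes> u) \<in> Idl\<^bsub>S\<^esub> (h ` set ys)" using H.Idl_image_mem[OF yc m_closed[OF b(1) uc]] V by simp
      then show ?thesis using b uc by simp
    qed
    then show ?thesis unfolding S.socle_gen_def using uc by simp
  qed
  have zero: "u \<in> ?U" if u: "u \<in> carrier R" "h (?m w \<otimes> u) \<in> Idl\<^bsub>S\<^esub> (h ` set ys)" for u
  proof -
    have "?m w \<otimes> u \<in> ?V" using H.Idl_image_mem[OF yc m_closed[OF mc u(1)]] u(2) V by simp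
    then have "?m w \<otimes> u \<oplus> ?m w' \<otimes> \<zero> \<in> ?V" using mc u(1) by simp
    then show ?thesis by (rule down[OF w w' ne u(1) zero_closed])
  qed
  let ?N = "cm_type R"
  have zs: "set (xs @ ys) \<subseteq> mm" using xs ys by simp
  from cm_type_eq_socle(1)[OF zs ys(2) soc] obtain a where
    a: "a \<in> module_hom R (free ?N) (self_module R)"
    and a': "\<forall>c\<in>carrier (free ?N). a c \<in> socle_gen ?U \<and> (a c \<in> ?U \<longrightarrow> (\<forall>j<?N. c j \<in> mm))"
    unfolding socle_family_def by (rule bexE)
  let ?f = "\<lambda>c\<in>carrier (free (?N + ?N)). ?m w \<otimes> a (\<lambda>j\<in>{..<?N}. c j) \<oplus> ?m w' \<otimes> a (\<lambda>j\<in>{..<?N}. c (?N + j))"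
  obtain g where g: "g \<in> module_hom S (free_module S (?N + ?N)) (self_module S)"
    and gh: "\<forall>c\<in>carrier (free (?N + ?N)). g (\<lambda>j\<in>{..<?N + ?N}. h (c j)) = h (?f c)"
    using H.hom_descends[OF pair_hom[OF a mc mc, of w w']] by (rule bexE)
  have "S.socle_family (Idl\<^bsub>S\<^esub> (h ` set ys)) (?N + ?N)"
    unfolding S.socle_family_def
  proof (rule bexI[OF _ g], rule ballI)
    fix v assume v: "v \<in> carrier (free_module S (?N + ?N))"
    have "\<forall>j\<in>{..<?N + ?N}. \<exists>b. b \<in> carrier R \<and> h b = v j"
    proof
      fix j assume "j \<in> {..<?N + ?N}"
      then have "v j \<in> carrier S" using v by (auto simp: H.S.free_simps)
      then show "\<exists>b. b \<in> carrier R \<and> h b = v j" by (rule H.h_obtain) auto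
    qed
    \<comment> \<open>Coefficients over \<open>S\<close> are lifted to the ring, where the value of
      \<open>g\<close> is computed.\<close>
    from bchoice[OF this] obtain c0 where c0: "\<forall>j\<in>{..<?N + ?N}. c0 j \<in> carrier R \<and> h (c0 j) = v j" by (rule exE)
    define c where "c = (\<lambda>j\<in>{..<?N + ?N}. c0 j)"
    have c: "c \<in> carrier (free (?N + ?N))" unfolding c_def using c0 by auto
    have "(\<lambda>j\<in>{..<?N + ?N}. h (c j)) = v"
      using v c0 unfolding c_def by (intro ext) (auto simp: H.S.free_simps PiE_def extensional_def)
    then have gv: "g v = h (?f c)" using bspec[OF gh c] by simp
    let ?c = "\<lambda>j\<in>{..<?N}. c j" and ?c' = "\<lambda>j\<in>{..<?N}. c (?N + j)"
    have cj: "c j \<in> carrier R" if "j < ?N + ?N" for j using c0 that unfolding c_def by simp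
    have cc: "?c \<in> carrier (free ?N)" "?c' \<in> carrier (free ?N)" using cj by simp_all
    note a1 = bspec[OF a' cc(1)] and a2 = bspec[OF a' cc(2)]
    have ac: "a ?c \<in> carrier R" "a ?c' \<in> carrier R" using a1 a2 unfolding socle_gen_def by auto
    have fc: "?f c = ?m w \<otimes> a ?c \<oplus> ?m w' \<otimes> a ?c'" using c by (simp del: free_simps)
    have "?m w \<otimes> a ?c \<in> socle_gen ?V" "?m w' \<otimes> a ?c' \<in> socle_gen ?V"
      using up[OF w] up[OF w'] a1 a2 by auto
    then have "?m w \<otimes> a ?c \<oplus> ?m w' \<otimes> a ?c' \<in> socle_gen ?V"
      unfolding socle_gen_def using yc Ec mm_carr by (auto simp: r_distr intro!: Idl_add)
    then have soc1: "g v \<in> S.socle_gen (Idl\<^bsub>S\<^esub> (h ` set ys))" unfolding gv fc by (rule socS)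
    have "v j \<in> max_ideal S" if m: "g v \<in> Idl\<^bsub>S\<^esub> (h ` set ys)" and j: "j < ?N + ?N" for j
    proof -
      have e: "?m w \<otimes> a ?c \<oplus> ?m w' \<otimes> a ?c' \<in> carrier R" using mc ac by simp
      have V1: "?m w \<otimes> a ?c \<oplus> ?m w' \<otimes> a ?c' \<in> ?V" using m H.Idl_image_mem[OF yc e] V unfolding gv fc by simp
      then have V2: "?m w' \<otimes> a ?c' \<oplus> ?m w \<otimes> a ?c \<in> ?V" using a_comm[of "?m w \<otimes> a ?c" "?m w' \<otimes> a ?c'"] mc ac by simp
      have "a ?c \<in> ?U" by (rule down[OF w w' ne ac V1])
      then have m1: "c i \<in> mm" if "i < ?N" for i using a1 that by auto
      have "a ?c' \<in> ?U" by (rule down[OF w' w ne[symmetric] ac(2,1) V2])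
      then have m2: "c (?N + i) \<in> mm" if "i < ?N" for i using a2 that by auto
      have "c j \<in> mm" using m1[of j] m2[of "j - ?N"] j by (cases "j < ?N") auto
      then have "c0 j \<in> mm" using j unfolding c_def by simp
      moreover have "v j = h (c0 j)" "c0 j \<in> carrier R" using c0 j by auto
      ultimately show ?thesis using mmS by simp
    qed
    then show "g v \<in> S.socle_gen (Idl\<^bsub>S\<^esub> (h ` set ys)) \<and>
        (g v \<in> Idl\<^bsub>S\<^esub> (h ` set ys) \<longrightarrow> (\<forall>j<?N + ?N. v j \<in> max_ideal S))" using soc1 by blast
  qed
  moreover have "S.socle_family (Idl\<^bsub>S\<^esub> (set (map h ys))) p \<Longrightarrow> p \<le> cm_type S" for p
  proof (rule S.cm_type_eq_socle(2))
    show "set (map h ys) \<subseteq> S.mm" using ys(1) mmS yc by auto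
    have "reg ?Q ys" unfolding reg_def nzd_def
    proof (intro allI impI)
      fix i assume i: "i < length ys"
      have t: "set (take i ys) \<subseteq> carrier R" using yc set_take_subset[of i ys] by blast
      show "\<forall>a\<in>carrier R. ys ! i \<otimes> a \<in> Idl (?Q \<union> set (take i ys)) \<longrightarrow> a \<in> Idl (?Q \<union> set (take i ys))"
        using cr(2) i unfolding Idl_Un_Idl[OF Ec t] reg_def nzd_def by simp
    qed
    then show "H.S.reg {} (map h ys)" by (rule H.reg_image[OF yc])
    show "\<not> S.socle_gen (Idl\<^bsub>S\<^esub> (set (map h ys))) \<subseteq> Idl\<^bsub>S\<^esub> (set (map h ys))"
    proof
      assume sub: "S.socle_gen (Idl\<^bsub>S\<^esub> (set (map h ys))) \<subseteq> Idl\<^bsub>S\<^esub> (set (map h ys))"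
      have "socle_gen ?U \<subseteq> ?U"
      proof
        fix u assume u: "u \<in> socle_gen ?U"
        have "h (?m w \<otimes> u) \<in> Idl\<^bsub>S\<^esub> (h ` set ys)" using socS[OF up[OF w u]] sub by auto
        moreover have "u \<in> carrier R" using u unfolding socle_gen_def by simp
        ultimately show "u \<in> ?U" using zero by simp
      qed
      then show False using soc by simp
    qed
  qed
  ultimately have "?N + ?N \<le> cm_type S" by simp
  then show ?thesis by simp
qed

end

text \<open>\<open>G F\<close> is the ideal of \<open>S\<close> generated by the monomials with
  exponents in \<open>F\<close>. For \<open>F\<close> containing \<open>E\<close>, its colon at each
  maximal exponent of \<open>F\<close> is the image of the ideal of the variables, so adjoining
  maximal exponents one at a time as in \<open>below_induct\<close> is a filtration in the sense of
  \<open>filtered\<close>.\<close>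

lemma (in cring) not_gorenstein_monomial_quotient:
  fixes S :: "('c, 'd) ring_scheme"
  assumes xs: "set xs \<subseteq> carrier R" "reg {} xs" "\<one> \<notin> Idl (set xs)"
    and fin: "finite (below (length xs) E)"
    and w: "w \<in> maxexp (length xs) E" and w': "w' \<in> maxexp (length xs) E" and ne: "w \<noteq> w'"
    and epi: "ring_epi R S h (Idl (monomial R xs ` E))"
  shows "\<not> gorenstein TYPE('e) S"
proof -
  let ?l = "length xs" and ?m = "monomial R xs" and ?D = "Idl (set xs)"
  let ?Q = "Idl (?m ` E)"
  interpret H: ring_epi R S h ?Q by (rule epi)
  have mc: "?m v \<in> carrier R" for v by (rule monomial_closed[OF xs(1)])
  have Ec: "?m ` F \<subseteq> carrier R" for F by (rule mon_image_carr[OF xs(1)])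
  have cl: "col {} xs" using reg_imp_col[OF xs(2) _ xs(1)] by simp
  define G where "G = (\<lambda>F. Idl\<^bsub>S\<^esub> (h ` ?m ` F))"
  have Gi: "ideal (G F) S" for F unfolding G_def by (rule H.S.genideal_ideal[OF H.h_image[OF Ec]])
  have QF: "Idl (?Q \<union> ?m ` F) = Idl (?m ` (E \<union> F))" for F
    using Idl_Un_Idl[OF Ec Ec, of E F] by (simp add: image_Un)
  have G: "G F = h ` (Idl (?m ` (E \<union> F)))" for F unfolding G_def H.Idl_image[OF Ec] QF ..
  have Gmem: "h a \<in> G F \<longleftrightarrow> a \<in> Idl (?m ` (E \<union> F))" if "a \<in> carrier R" for a F
    unfolding G_def H.Idl_image_mem[OF Ec that] QF ..
  \<comment> \<open>The monomials of \<open>E\<close> vanish in \<open>S\<close>, so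
    \<open>F\<close> may be enlarged by \<open>E\<close>, as the colon and filtration statements
    require.\<close>
  have GE: "G (E \<union> F) = G F" for F unfolding G by (simp add: Un_assoc[symmetric])
  have G0: "G E = {\<zero>\<^bsub>S\<^esub>}"
  proof
    show "G E \<subseteq> {\<zero>\<^bsub>S\<^esub>}"
    proof
      fix x assume "x \<in> G E"
      then obtain a where a: "a \<in> ?Q" "x = h a" unfolding G by auto
      then show "x \<in> {\<zero>\<^bsub>S\<^esub>}" using H.ker[of a] Idl_carr[OF Ec] by auto
    qed
    show "{\<zero>\<^bsub>S\<^esub>} \<subseteq> G E" using H.S.ideal_closed(5)[OF Gi] by simp
  qed
  have memD: "r \<in> ?D \<longleftrightarrow> r \<otimes> ?m v \<in> Idl (?m ` F)" if v: "v \<in> maxexp ?l F" and r: "r \<in> carrier R" for v F r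
  proof
    assume "r \<in> ?D"
    then have "?m v \<otimes> r \<in> Idl ({} \<union> ?m ` F)"
      using mon_times_var_mem[OF xs(1) _ _ maxexpD(1)[OF v], of "{}" r] maxexpD(2)[OF v] by simp
    then show "r \<otimes> ?m v \<in> Idl (?m ` F)" using m_comm[OF r mc] by simp
  next
    assume "r \<otimes> ?m v \<in> Idl (?m ` F)"
    then have "?m v \<otimes> r \<in> Idl ({} \<union> ?m ` F)" using m_comm[OF r mc] by simp
    from col_ideal[OF cl _ xs(1) r below_lt[OF maxexpD(1)[OF v]] this] show "r \<in> ?D" by simp
  qed
  have colon: "H.S.colon (G F) (h (?m v)) = h ` ?D" if F: "E \<subseteq> F" and v: "v \<in> maxexp ?l F" for F v
  proof -
    have iff: "h r \<otimes>\<^bsub>S\<^esub> h (?m v) \<in> G F \<longleftrightarrow> r \<in> ?D" if r: "r \<in> carrier R" for r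
      using Gmem[OF m_closed[OF r mc], of v F] memD[OF v r] r mc[of v] F by (simp add: Un_absorb1)
    show ?thesis
    proof
      show "H.S.colon (G F) (h (?m v)) \<subseteq> h ` ?D"
      proof
        fix b assume b: "b \<in> H.S.colon (G F) (h (?m v))"
        obtain r where r: "r \<in> carrier R" "b = h r" using b H.h_obtain[of b] unfolding H.S.colon_def by blast
        have "r \<in> ?D" using b iff[OF r(1)] unfolding H.S.colon_def r(2) by simp
        then show "b \<in> h ` ?D" using r(2) by simp
      qed
      show "h ` ?D \<subseteq> H.S.colon (G F) (h (?m v))"
        using iff Idl_carr[OF xs(1)] unfolding H.S.colon_def by auto
    qed
  qed
  have fil: "H.S.filtered (h ` ?D) (G F)" if "finite (below ?l F)" "E \<subseteq> F" for F
    using that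
  proof (induction rule: below_induct)
    case (full F)
    have "Idl (?m ` F) = carrier R" using mon_ideal_full[OF xs(1) _ full(1), of "{}"] by simp
    then have "G F = carrier S" unfolding G using full(2) H.surj by (simp add: Un_absorb1)
    then show ?case by (simp add: H.S.filtered.full)
  next
    case (step F v)
    have v: "v \<in> maxexp ?l F" unfolding maxexp_def using step.hyps by simp
    have hv: "h (?m v) \<in> carrier S" using mc by simp
    have "Idl\<^bsub>S\<^esub> (insert (h (?m v)) (G F)) = G (insert v F)"
      using H.S.Idl_Un_Idl[OF H.h_image[OF Ec], of "{h (?m v)}" F] hv unfolding G_def by simp
    moreover have "H.S.filtered (h ` ?D) (G (insert v F))" using step.IH step.prems by blast
    ultimately show ?case by (intro H.S.filtered.step[OF _ Gi hv colon[OF step.prems v]]) simp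
  qed
  have one: "?m w \<notin> ?Q"
  proof
    assume "?m w \<in> ?Q"
    then have "\<one> \<otimes> ?m w \<in> ?Q" using mc by simp
    then show False using memD[OF w one_closed] xs(3) by simp
  qed
  have ind: "a \<otimes>\<^bsub>S\<^esub> h (?m w) = \<zero>\<^bsub>S\<^esub>"
    if a: "a \<in> carrier S" and b: "b \<in> carrier S" and ab: "a \<otimes>\<^bsub>S\<^esub> h (?m w) \<oplus>\<^bsub>S\<^esub> b \<otimes>\<^bsub>S\<^esub> h (?m w') = \<zero>\<^bsub>S\<^esub>" for a b
  proof -
    obtain r where r: "r \<in> carrier R" "a = h r" using H.h_obtain[OF a] .
    obtain s where s: "s \<in> carrier R" "b = h s" using H.h_obtain[OF b] .
    have z: "h (?m w \<otimes> r \<oplus> ?m w' \<otimes> s) = \<zero>\<^bsub>S\<^esub>"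
      using ab r s mc H.S.m_comm[of "h r" "h (?m w)"] H.S.m_comm[of "h s" "h (?m w')"] by simp
    have "?m w \<otimes> r \<oplus> ?m w' \<otimes> s \<in> carrier R" using r(1) s(1) mc by simp
    from iffD1[OF H.ker[OF this] z] have "?m w \<otimes> r \<oplus> ?m w' \<otimes> s \<in> Idl ({} \<union> ?m ` E)" by simp
    then have "r \<in> ?D" using mon_pair_mem[OF cl _ xs(1) w w' ne r(1) s(1)] by simp
    then have "r \<otimes> ?m w \<in> ?Q" using memD[OF w r(1)] by simp
    then have "h (r \<otimes> ?m w) = \<zero>\<^bsub>S\<^esub>" by (rule iffD2[OF H.ker[OF m_closed[OF r(1) mc]]])
    then show ?thesis using r mc by simp
  qed
  have fG: "H.S.filtered (h ` ?D) (G F)" for F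
    using fil[of "E \<union> F"] finite_below_mono[OF fin, of "E \<union> F"] unfolding GE by simp
  show ?thesis
  proof (rule H.S.not_gorensteinI)
    show "h (?m w) \<in> carrier S" "h (?m w') \<in> carrier S" using mc by simp_all
    show "h (?m w) \<noteq> \<zero>\<^bsub>S\<^esub>" using one H.ker[OF mc] by simp
    show "H.S.colon {\<zero>\<^bsub>S\<^esub>} (h (?m w)) = h ` ?D" "H.S.colon {\<zero>\<^bsub>S\<^esub>} (h (?m w')) = h ` ?D"
      using colon[OF order_refl w] colon[OF order_refl w'] unfolding G0 by simp_all
    show "H.S.filtered (h ` ?D) (Idl\<^bsub>S\<^esub> {h (?m w)})" using fG[of "{w}"] unfolding G_def by simp
    show "H.S.filtered (h ` ?D) (Idl\<^bsub>S\<^esub> {h (?m w), h (?m w')})" using fG[of "{w, w'}"] unfolding G_def by simp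
  qed (rule ind)
qed

section \<open>Exponents of the product ideal, and the use of the height\<close>

lemma below_le_maxexp:
  assumes fin: "finite (below l E)" and v: "v \<in> below l E"
  shows "\<exists>w\<in>maxexp l E. v \<le> w"
proof -
  obtain w where w: "w \<in> below l E" "v \<le> w" and mx: "\<forall>u\<in>below l E. w \<le> u \<longrightarrow> w = u"
    using finite_has_maximal2[OF fin v] by blast
  have "w(i := Suc (w i)) \<notin> below l E" for i
  proof
    assume "w(i := Suc (w i)) \<in> below l E"
    moreover have "w \<le> w(i := Suc (w i))" by (simp add: le_fun_def)
    ultimately have "w = w(i := Suc (w i))" using mx by blast
    then have "w i = (w(i := Suc (w i))) i" by (rule fun_cong)
    then show False by simp
  qed
  then show ?thesis using w unfolding maxexp_def by blast
qed

text \<open>Let \<open>b\<close> and \<open>c\<close> be the least exponents of pure powers of the variables in the two ideals. A single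
  maximal exponent \<open>w\<close> would satisfy \<open>w i \<ge> b i + c i - 1 \<ge> max (b i) (c i)\<close>, so that
  \<open>x 0 ^ b 0 * x 1 ^ c 1\<close>, an element of the product ideal, would divide \<open>x ^ w\<close>.\<close>

lemma two_maxexp:
  assumes l: "l > 1"
    and P: "\<And>i. i < l \<Longrightarrow> \<exists>e\<in>P. \<forall>j<l. j \<noteq> i \<longrightarrow> e j = 0" "\<And>e. e \<in> P \<Longrightarrow> \<exists>i<l. e i \<noteq> 0"
    and Q: "\<And>i. i < l \<Longrightarrow> \<exists>e\<in>Q. \<forall>j<l. j \<noteq> i \<longrightarrow> e j = 0" "\<And>e. e \<in> Q \<Longrightarrow> \<exists>i<l. e i \<noteq> 0"
    and E: "E = {\<lambda>i. e i + f i | e f. e \<in> P \<and> f \<in> Q}"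
  shows "finite (below l E) \<and> (\<exists>w\<in>maxexp l E. \<exists>w'\<in>maxexp l E. w \<noteq> w')"
proof -
  have fin: "finite (below l E)"
  proof (rule finite_below)
    fix i assume i: "i < l"
    obtain e f where "e \<in> P" "\<forall>j<l. j \<noteq> i \<longrightarrow> e j = 0" "f \<in> Q" "\<forall>j<l. j \<noteq> i \<longrightarrow> f j = 0"
      using P(1)[OF i] Q(1)[OF i] by blast
    then show "\<exists>e\<in>E. \<forall>j<l. j \<noteq> i \<longrightarrow> e j = 0"
      unfolding E by (intro bexI[of _ "\<lambda>j. e j + f j"]) auto
  qed
  define pure where "pure = (\<lambda>(M :: (nat \<Rightarrow> nat) set) i n. \<exists>e\<in>M. (\<forall>j<l. j \<noteq> i \<longrightarrow> e j = 0) \<and> e i = n)"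
  define b where "b i = (LEAST n. pure P i n)" for i
  define c where "c i = (LEAST n. pure Q i n)" for i
  have b: "pure P i (b i)" if "i < l" for i
    unfolding b_def using P(1)[OF that] LeastI_ex[of "pure P i"] unfolding pure_def by blast
  have c: "pure Q i (c i)" if "i < l" for i
    unfolding c_def using Q(1)[OF that] LeastI_ex[of "pure Q i"] unfolding pure_def by blast
  have b_le: "b i \<le> n" if "pure P i n" for i n unfolding b_def using that by (rule Least_le)
  have c_le: "c i \<le> n" if "pure Q i n" for i n unfolding c_def using that by (rule Least_le)
  have bc: "b i \<noteq> 0" "c i \<noteq> 0" if i: "i < l" for i
    using b[OF i] c[OF i] P(2) Q(2) unfolding pure_def by metis+
  \<comment> \<open>An exponent \<open>e + f\<close> below this pure one would have both parts pure
    in coordinate \<open>i\<close>, with entries at least \<open>b i\<close> and \<open>c i\<close>,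
    one too many in total. By \<open>bc\<close> both are positive, so the subtraction is
    exact.\<close>
  have v: "(\<lambda>j. if j = i then b i + c i - 1 else 0) \<in> below l E" (is "?v \<in> _") if i: "i < l" for i
  proof -
    have False if e: "e \<in> P" and f: "f \<in> Q" and le: "\<forall>j<l. e j + f j \<le> ?v j" for e f
    proof -
      have "\<forall>j<l. j \<noteq> i \<longrightarrow> e j = 0" "\<forall>j<l. j \<noteq> i \<longrightarrow> f j = 0" using le by fastforce+
      then have "b i \<le> e i" "c i \<le> f i" by (intro b_le c_le; use e f in \<open>unfold pure_def, blast\<close>)+
      moreover have "e i + f i \<le> b i + c i - 1" using le i by auto
      ultimately show False using bc[OF i] by simp
    qed
    then show ?thesis unfolding below_def E using i by fastforce
  qed
  have l0: "0 < l" using l by simp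
  obtain w where w: "w \<in> maxexp l E" using below_le_maxexp[OF fin v[OF l0]] by blast
  have "\<exists>w'\<in>maxexp l E. w \<noteq> w'"
  proof (rule ccontr)
    assume "\<not> ?thesis"
    then have le: "b i + c i - 1 \<le> w i" if "i < l" for i
      using below_le_maxexp[OF fin v[OF that]] le_funD[of _ w i] by fastforce
    obtain e where e: "e \<in> P" "\<forall>j<l. j \<noteq> 0 \<longrightarrow> e j = 0" "e 0 = b 0" using b[OF l0] unfolding pure_def by blast
    obtain f where f: "f \<in> Q" "\<forall>j<l. j \<noteq> 1 \<longrightarrow> f j = 0" "f 1 = c 1" using c[OF l] unfolding pure_def by blast
    have "e i + f i \<le> w i" if i: "i < l" for i
      using le[OF i] bc[OF i] e(2,3) f(2,3) i by (cases "i = 0"; cases "i = 1") auto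
    moreover have "(\<lambda>i. e i + f i) \<in> E" using e(1) f(1) unfolding E by blast
    ultimately have "\<exists>e\<in>E. \<forall>i<l. e i \<le> w i" by (intro bexI[of _ "\<lambda>i. e i + f i"]) simp_all
    moreover have "\<not> (\<exists>e\<in>E. \<forall>i<l. e i \<le> w i)"
      using maxexpD(1)[OF w] unfolding below_def mem_Collect_eq by (rule conjunct2)
    ultimately show False by (rule notE[rotated])
  qed
  then show ?thesis using fin w by blast
qed

text \<open>The product is bounded by two colon ideals in turn: one factor is first restricted to
  monomials while the other runs through \<open>K\<close>, and then an arbitrary element of
  \<open>K\<close> is fixed while the other factor runs through \<open>J\<close>.\<close>

lemma (in cring) monomial_ideal_prod:
  assumes xs: "set xs \<subseteq> carrier R"
  shows "(Idl (monomial R xs ` P)) \<cdot> (Idl (monomial R xs ` Q)) = Idl (monomial R xs ` {\<lambda>i. e i + f i | e f. e \<in> P \<and> f \<in> Q})"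
    (is "?K \<cdot> ?J = ?I")
proof
  let ?m = "monomial R xs" and ?E = "{\<lambda>i. e i + f i | e f. e \<in> P \<and> f \<in> Q}"
  have Ec: "?m ` F \<subseteq> carrier R" for F by (rule mon_image_carr[OF xs])
  have mc: "?m v \<in> carrier R" for v by (rule monomial_closed[OF xs])
  have KJI: "ideal ?K R" "ideal ?J R" "ideal ?I R" by (rule genideal_ideal[OF Ec])+
  have "?m ` ?E \<subseteq> ?K \<cdot> ?J"
  proof
    fix x assume "x \<in> ?m ` ?E"
    then obtain e f where "e \<in> P" "f \<in> Q" "x = ?m e \<otimes> ?m f" using monomial_add[OF xs] by auto
    then show "x \<in> ?K \<cdot> ?J" using genideal_self[OF Ec[of P]] genideal_self[OF Ec[of Q]] by (auto intro!: ideal_prod.prod)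
  qed
  then show "?I \<subseteq> ?K \<cdot> ?J" by (rule genideal_minimal[OF ideal_prod_is_ideal[OF KJI(1,2)]])
  have 1: "?K \<subseteq> colon ?I (?m f)" if f: "f \<in> Q" for f
  proof (rule genideal_minimal[OF colon_ideal[OF KJI(3) mc]], rule subsetI)
    fix x assume "x \<in> ?m ` P"
    then obtain e where e: "e \<in> P" "x = ?m e" by auto
    have "(\<lambda>i. e i + f i) \<in> ?E" using e(1) f by blast
    then have "x \<otimes> ?m f \<in> ?m ` ?E" unfolding e(2) monomial_add[OF xs, symmetric] by (rule imageI)
    then have "x \<otimes> ?m f \<in> ?I" by (rule subsetD[OF genideal_self[OF Ec]])
    then show "x \<in> colon ?I (?m f)" unfolding colon_def using e(2) mc by simp
  qed
  have 2: "?J \<subseteq> colon ?I x" if x: "x \<in> ?K" for x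
  proof -
    have xc: "x \<in> carrier R" by (rule ideal_closed(7)[OF KJI(1) x])
    show ?thesis
    proof (rule genideal_minimal[OF colon_ideal[OF KJI(3) xc]], rule subsetI)
      fix y assume "y \<in> ?m ` Q"
      then obtain f where f: "f \<in> Q" "y = ?m f" by auto
      then have "x \<otimes> y \<in> ?I" using subsetD[OF 1[OF f(1)] x] unfolding colon_def by simp
      then show "y \<in> colon ?I x" unfolding colon_def using f(2) mc[of f] m_comm[OF xc mc[of f]] by simp
    qed
  qed
  show "?K \<cdot> ?J \<subseteq> ?I"
  proof
    fix z assume "z \<in> ?K \<cdot> ?J"
    then show "z \<in> ?I"
    proof (induction rule: ideal_prod.induct)
      case (prod x y)
      have "y \<otimes> x \<in> ?I" using subsetD[OF 2[OF prod(1)] prod(2)] unfolding colon_def by simp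
      then show ?case using m_comm[of x y] ideal_closed(7)[OF KJI(1) prod(1)] ideal_closed(7)[OF KJI(2) prod(2)] by simp
    next
      case (sum x y)
      then show ?case by (intro ideal_closed(1)[OF KJI(3)])
    qed
  qed
qed

context noetherian_local
begin

text \<open>If no generator were pure in the variable \<open>i\<close>, each would involve another
  variable. The ideal would then lie in the proper ideal generated by the remaining variables, fewer
  than \<open>length xs\<close> in number, and Krull's theorem would bound its height
  accordingly.\<close>

lemma pure_powers:
  assumes xs: "set xs \<subseteq> mm" and K: "height R (Idl (monomial R xs ` P)) = enat (length xs)"
    and i: "i < length xs"
  shows "\<exists>e\<in>P. \<forall>j<length xs. j \<noteq> i \<longrightarrow> e j = 0"
proof (rule ccontr)
  assume "\<not> ?thesis"
  then have n: "\<exists>j<length xs. j \<noteq> i \<and> e j \<noteq> 0" if "e \<in> P" for e using that by blast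
  let ?F = "(!) xs ` ({..<length xs} - {i})"
  have xc: "set xs \<subseteq> carrier R" using xs mm_carr by auto
  have Fm: "?F \<subseteq> mm" using xs nth_mem by blast
  have Fc: "?F \<subseteq> carrier R" using Fm mm_carr by auto
  have one: "\<one> \<notin> Idl ?F" using genideal_minimal[OF mm_ideal Fm] one_notin_mm by auto
  have "monomial R xs e \<in> Idl ?F" if e: "e \<in> P" for e
  proof -
    obtain j where j: "j < length xs" "j \<noteq> i" "e j \<noteq> 0" using n[OF e] by blast
    let ?d = "\<lambda>k. if k = j then 1 else 0 :: nat"
    have "monomial R xs e = monomial R xs (\<lambda>k. e k - ?d k) \<otimes> monomial R xs ?d"
      using j(3) by (intro monomial_le[OF xc]) auto
    also have "monomial R xs ?d = xs ! j" using monomial_single[OF xc j(1), of ?d] xc j(1) by (simp add: nth_carr)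
    finally have e': "monomial R xs e = monomial R xs (\<lambda>k. e k - ?d k) \<otimes> xs ! j" .
    have "xs ! j \<in> Idl ?F" using j by (intro Idl_memI[OF Fc]) auto
    then show ?thesis unfolding e' by (intro Idl_lmult[OF Fc] monomial_closed[OF xc])
  qed
  then have "Idl (monomial R xs ` P) \<subseteq> Idl ?F" using xc Fc by (intro Idl_leI) auto
  from height_le_card[OF noeth _ Fc one this] have "length xs \<le> card ?F" unfolding K by simp
  also have "\<dots> \<le> card ({..<length xs} - {i})" by (rule card_image_le) simp
  also have "\<dots> < length xs" using i by simp
  finally show False by simp
qed

lemma proper_monomial_exp:
  assumes xs: "set xs \<subseteq> carrier R" and K: "Idl (monomial R xs ` P) \<noteq> carrier R" and e: "e \<in> P"
  shows "\<exists>i<length xs. e i \<noteq> 0"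
proof (rule ccontr)
  assume "\<not> ?thesis"
  then have "monomial R xs e = \<one>" by (intro monomial_zero[OF xs]) simp
  then have "\<one> \<in> Idl (monomial R xs ` P)" using genideal_self[OF mon_image_carr[OF xs, of P]] e by force
  then show False using K ideal.one_imp_carrier[OF genideal_ideal[OF mon_image_carr[OF xs]]] by blast
qed

end

theorem proposition6p1:
  fixes A :: "('a, 'b) ring_scheme" and K J :: "'a set" and xs :: "'a list" and l :: nat
  assumes "noetherian_ring A" and "local_ring A" and "contains_residue_field A"
    and "regular_sequence A xs" and "length xs = l" and "l > 1"
    and "monomial_ideal A xs K" and "height A K = enat l"
    and "monomial_ideal A xs J" and "height A J = enat l"
  shows "cm_type (A Quot (K \<cdot>\<^bsub>A\<^esub> J)) \<ge> 2 * cm_type A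
    \<and> \<not> gorenstein TYPE('c) (A Quot (K \<cdot>\<^bsub>A\<^esub> J))"
proof -
  interpret A: noetherian_local A by (rule noetherian_localI[OF assms(1,2)])
  have xs: "set xs \<subseteq> A.mm" "A.reg {} xs" using assms(4) unfolding A.regular_sequence_iff_reg by simp_all
  have xc: "set xs \<subseteq> carrier A" using xs(1) A.mm_carr by auto
  obtain P where P: "K = Idl\<^bsub>A\<^esub> (monomial A xs ` P)" "K \<noteq> carrier A"
    using assms(7) unfolding monomial_ideal_def by blast
  obtain Q where Q: "J = Idl\<^bsub>A\<^esub> (monomial A xs ` Q)" "J \<noteq> carrier A"
    using assms(9) unfolding monomial_ideal_def by blast
  define E where "E = {\<lambda>i. e i + f i | e f. e \<in> P \<and> f \<in> Q}"
  have KJ: "K \<cdot>\<^bsub>A\<^esub> J = Idl\<^bsub>A\<^esub> (monomial A xs ` E)"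
    unfolding P(1) Q(1) E_def by (rule A.monomial_ideal_prod[OF xc])
  have "finite (below l E) \<and> (\<exists>w\<in>maxexp l E. \<exists>w'\<in>maxexp l E. w \<noteq> w')"
  proof (rule two_maxexp[OF assms(6) _ _ _ _ E_def])
    show "\<exists>e\<in>P. \<forall>j<l. j \<noteq> i \<longrightarrow> e j = 0" if "i < l" for i
      using A.pure_powers[OF xs(1), of P i] assms(5,8) that unfolding P(1) by simp
    show "\<exists>e\<in>Q. \<forall>j<l. j \<noteq> i \<longrightarrow> e j = 0" if "i < l" for i
      using A.pure_powers[OF xs(1), of Q i] assms(5,10) that unfolding Q(1) by simp
    show "\<exists>i<l. e i \<noteq> 0" if "e \<in> P" for e
      using A.proper_monomial_exp[OF xc P(2)[unfolded P(1)] that] assms(5) by simp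
    show "\<exists>i<l. e i \<noteq> 0" if "e \<in> Q" for e
      using A.proper_monomial_exp[OF xc Q(2)[unfolded Q(1)] that] assms(5) by simp
  qed
  then obtain w w' where fin: "finite (below (length xs) E)"
    and w: "w \<in> maxexp (length xs) E" "w' \<in> maxexp (length xs) E" "w \<noteq> w'" unfolding assms(5) by blast
  let ?I = "Idl\<^bsub>A\<^esub> (monomial A xs ` E)"
  have I: "ideal ?I A" by (rule A.genideal_ideal[OF A.mon_image_carr[OF xc]])
  have epi: "ring_epi A (A Quot ?I) ((+>\<^bsub>A\<^esub>) ?I) ?I" by (rule ideal.ring_epi_rcos[OF I A.is_cring])
  have one: "\<one>\<^bsub>A\<^esub> \<notin> Idl\<^bsub>A\<^esub> (set xs)" using A.genideal_minimal[OF A.mm_ideal xs(1)] A.one_notin_mm by auto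
  \<comment> \<open>Otherwise the colon at \<open>x^w\<close> would be the whole ring, whereas it is
    contained in the ideal of the variables.\<close>
  have "\<one>\<^bsub>A\<^esub> \<notin> ?I"
  proof
    assume "\<one>\<^bsub>A\<^esub> \<in> ?I"
    then have "monomial A xs w \<otimes>\<^bsub>A\<^esub> \<one>\<^bsub>A\<^esub> \<in> Idl\<^bsub>A\<^esub> ({} \<union> monomial A xs ` E)"
      using A.ideal_closed(3)[OF I _ A.monomial_closed[OF xc]] by simp
    from A.col_ideal[OF A.reg_imp_col[OF xs(2) _ xc] _ xc A.one_closed below_lt[OF maxexpD(1)[OF w(1)]] this]
    show False using one by simp
  qed
  from ring_epi.quotient_local[OF epi A.noetherian_local_axioms this]
  have S: "noetherian_local (A Quot ?I)"
    and mmS: "\<And>a. a \<in> carrier A \<Longrightarrow> ?I +>\<^bsub>A\<^esub> a \<in> max_ideal (A Quot ?I) \<longleftrightarrow> a \<in> A.mm" by simp_all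
  show ?thesis unfolding KJ
  proof (rule conjI)
    show "2 * cm_type A \<le> cm_type (A Quot ?I)"
      by (rule A.cm_type_monomial_quotient[OF xs fin w epi S mmS])
    show "\<not> gorenstein TYPE('c) (A Quot ?I)"
      by (rule A.not_gorenstein_monomial_quotient[OF xc xs(2) one fin w epi])
  qed
qed

end
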